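(* Let $\overline W$ be a conformal vector field on a Riemannian manifold $(N,\bar g)$ and let $\bar\varphi:N\times(-\varepsilon,\varepsilon)\to N$ be the one-parameter family of diffeomorphisms induced by $-\overline W$. Let $M$ be a compact manifold of dimension $m$, let $\phi\in C^\infty[0,T_0)$, and put $\bar t(t)=\int_0^t\phi(s)\,ds$. Suppose that, for some $T>0$, $F:M\times[0,T)\to N$ is a solution of $$\frac{\partial F}{\partial t}=H_F+\phi(t)\,\overline W\circ F,\quad F(\cdot,0)=F_0,\qquad\text{or of}\qquad \frac{\partial F}{\partial t}=H_F+\phi(t)\,(\overline W\circ F)^\bot,\quad F(\cdot,0)=F_0,$$ and that $\bar t(t)\in(-\varepsilon,\varepsilon)$ for all $t\in[0,T)$. Then, up to a (time-dependent) diffeomorphism on $M$, the map $\hat F:M\times[0,T)\to N$ defined by $$\hat F(p,t):=\bar\varphi(F(p,t),\bar t(t)),\qquad (p,t)\in M\times[0,T),$$ is a solution of the curvature flow with external force $$\frac{\partial \hat F}{\partial t}=\rho^2(F,t)\,H_{\hat F}+m\,\bar\varphi_{\bar t*}\big((\bar\nabla\log\rho)^\bot\big),$$ where $\rho>0$ is given by $\bar\varphi_{\bar t}^*\bar g=\rho^2\bar g$. In particular, $\hat F$ and $F$ have the same initial submanifold $\hat F_0=F_0$ and, for each time $t$, the images of the immersions $F_t$ and $\hat F_t$ are globally conformal to each other.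
   Context: $\bar\varphi_s=\bar\varphi(\cdot,s)$ satisfies $\partial\bar\varphi_s(q)/\partial s=-\overline W(\bar\varphi_s(q))$, $\bar\varphi_0=\mathrm{id}$. Solutions consist of smooth immersions $F_t=F(\cdot,t):M\to N$; $H_F$ and $H_{\hat F}$ are the mean curvature vectors (traces of the second fundamental forms with respect to the induced metrics) of $F_t$ and $\hat F_t$ in $(N,\bar g)$. $\bar\nabla$ is the gradient on $(N,\bar g)$ of $\rho(\cdot,t)$, which together with its normal part $(\cdot)^\bot$ (normal to $F_t$) is evaluated along $F_t$. "Up to a diffeomorphism on $M$" means that the flow equation holds after a time-dependent reparametrization of $M$ (equivalently, modulo tangential components of the velocity). *)

theory Defs
  imports "HOL-Analysis.Analysis"
begin

section \<open>Smooth functions between Euclidean spaces\<close>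

text \<open>On an open set, C^k in finite dimension is: continuous, differentiable, and all directional
  derivatives are C^(k-1).\<close>

primrec Ck_on :: "nat \<Rightarrow> 'e::euclidean_space set \<Rightarrow> ('e \<Rightarrow> 'f::real_normed_vector) \<Rightarrow> bool" where
  "Ck_on 0 S f \<longleftrightarrow> continuous_on S f"
| "Ck_on (Suc n) S f \<longleftrightarrow> (\<forall>x\<in>S. f differentiable (at x)) \<and>
     (\<forall>v. Ck_on n S (\<lambda>x. frechet_derivative f (at x) v))"

text \<open>On an arbitrary set, smooth means: locally the restriction of a smooth function defined on an
  open set. For open sets this is the usual notion; for sets such as [0,T) or U x [0,T) it gives
  smoothness up to the boundary t = 0.\<close>

definition smooth_on :: "'e::euclidean_space set \<Rightarrow> ('e \<Rightarrow> 'f::real_normed_vector) \<Rightarrow> bool" where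
  "smooth_on S f \<longleftrightarrow> (\<forall>x\<in>S. \<exists>U h. open U \<and> x \<in> U \<and> (\<forall>n. Ck_on n U h) \<and> (\<forall>y\<in>S \<inter> U. h y = f y))"


section \<open>Smooth manifolds\<close>

text \<open>A manifold is a whole type, Hausdorff and second countable by its type class, together with a
  smooth atlas modelled on a Euclidean space; its dimension is that of the model space.
  Manifolds have no boundary and need not be connected. A chart is a pair of an open set and
  a coordinate map, whose values outside of that set are irrelevant.\<close>

type_synonym ('a, 'e) chart = "'a set \<times> ('a \<Rightarrow> 'e)"

abbreviation dom_chart :: "('a, 'e) chart \<Rightarrow> 'a set" where
  "dom_chart \<xi> \<equiv> fst \<xi>"

abbreviation coord :: "('a, 'e) chart \<Rightarrow> 'a \<Rightarrow> 'e" where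
  "coord \<xi> \<equiv> snd \<xi>"

abbreviation coord_inv :: "('a, 'e) chart \<Rightarrow> 'e \<Rightarrow> 'a" where
  "coord_inv \<xi> \<equiv> inv_into (fst \<xi>) (snd \<xi>)"

definition smooth_atlas ::
    "('a::{t2_space,second_countable_topology}, 'e::euclidean_space) chart set \<Rightarrow> bool" where
  "smooth_atlas A \<longleftrightarrow>
     (\<Union>\<xi>\<in>A. dom_chart \<xi>) = UNIV \<and>
     (\<forall>\<xi>\<in>A. open (dom_chart \<xi>) \<and> open (coord \<xi> ` dom_chart \<xi>) \<and>
        homeomorphism (dom_chart \<xi>) (coord \<xi> ` dom_chart \<xi>) (coord \<xi>) (coord_inv \<xi>)) \<and>
     (\<forall>\<xi>\<in>A. \<forall>\<eta>\<in>A. smooth_on (coord \<xi> ` (dom_chart \<xi> \<inter> dom_chart \<eta>)) (coord \<eta> \<circ> coord_inv \<xi>))"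

definition chart_at :: "('a, 'e) chart set \<Rightarrow> 'a \<Rightarrow> ('a, 'e) chart" where
  "chart_at A p = (SOME \<xi>. \<xi> \<in> A \<and> p \<in> dom_chart \<xi>)"

definition smooth_map ::
    "('a::topological_space, 'e::euclidean_space) chart set \<Rightarrow>
     ('b::topological_space, 'f::euclidean_space) chart set \<Rightarrow> ('a \<Rightarrow> 'b) \<Rightarrow> bool" where
  "smooth_map A B F \<longleftrightarrow> continuous_on UNIV F \<and>
     (\<forall>\<xi>\<in>A. \<forall>\<kappa>\<in>B. smooth_on (coord \<xi> ` (dom_chart \<xi> \<inter> F -` dom_chart \<kappa>)) (coord \<kappa> \<circ> F \<circ> coord_inv \<xi>))"

text \<open>Joint smoothness of a one-parameter family of maps, as a map on the product with I.\<close>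

definition smooth_family ::
    "('a::topological_space, 'e::euclidean_space) chart set \<Rightarrow>
     ('b::topological_space, 'f::euclidean_space) chart set \<Rightarrow> real set \<Rightarrow> ('a \<Rightarrow> real \<Rightarrow> 'b) \<Rightarrow> bool" where
  "smooth_family A B I F \<longleftrightarrow> continuous_on (UNIV \<times> I) (\<lambda>(p, t). F p t) \<and>
     (\<forall>\<xi>\<in>A. \<forall>\<kappa>\<in>B.
        smooth_on {(coord \<xi> p, t) | p t. p \<in> dom_chart \<xi> \<and> t \<in> I \<and> F p t \<in> dom_chart \<kappa>}
          (\<lambda>(z, t). coord \<kappa> (F (coord_inv \<xi> z) t)))"

definition diffeomorphism ::
    "('a::topological_space, 'e::euclidean_space) chart set \<Rightarrow>
     ('b::topological_space, 'f::euclidean_space) chart set \<Rightarrow> ('a \<Rightarrow> 'b) \<Rightarrow> bool" where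
  "diffeomorphism A B \<Phi> \<longleftrightarrow> bij \<Phi> \<and> smooth_map A B \<Phi> \<and> smooth_map B A (inv \<Phi>)"


section \<open>Tangent vectors and tensor fields\<close>

text \<open>A tangent vector at q is given by its components in each of the charts around q, i.e. it is
  a function from charts to the model space; components in different charts are related by the
  differential of the change of coordinates. Tensor fields are treated likewise. An auxiliary
  chart at a point, on which the result does not depend, is fixed by chart_at.\<close>

definition differential ::
    "('a, 'e::euclidean_space) chart \<Rightarrow> ('b, 'f::euclidean_space) chart \<Rightarrow> ('a \<Rightarrow> 'b) \<Rightarrow> 'a \<Rightarrow> 'e \<Rightarrow> 'f" where
  "differential \<xi> \<kappa> F p = frechet_derivative (coord \<kappa> \<circ> F \<circ> coord_inv \<xi>) (at (coord \<xi> p))"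

definition immersion ::
    "('a::topological_space, 'e::euclidean_space) chart set \<Rightarrow>
     ('b::topological_space, 'f::euclidean_space) chart set \<Rightarrow> ('a \<Rightarrow> 'b) \<Rightarrow> bool" where
  "immersion A B F \<longleftrightarrow> smooth_map A B F \<and>
     (\<forall>\<xi>\<in>A. \<forall>\<kappa>\<in>B. \<forall>p\<in>dom_chart \<xi>. F p \<in> dom_chart \<kappa> \<longrightarrow> inj (differential \<xi> \<kappa> F p))"

definition pushforward ::
    "('b, 'f::euclidean_space) chart set \<Rightarrow> ('b \<Rightarrow> 'b) \<Rightarrow> 'b \<Rightarrow> (('b, 'f) chart \<Rightarrow> 'f) \<Rightarrow> ('b, 'f) chart \<Rightarrow> 'f" where
  "pushforward B \<Phi> q v \<kappa> = (let \<eta> = chart_at B q in differential \<eta> \<kappa> \<Phi> q (v \<eta>))"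

definition smooth_vector_field ::
    "('b, 'f::euclidean_space) chart set \<Rightarrow> (('b, 'f) chart \<Rightarrow> 'b \<Rightarrow> 'f) \<Rightarrow> bool" where
  "smooth_vector_field B W \<longleftrightarrow>
     (\<forall>\<kappa>\<in>B. smooth_on (coord \<kappa> ` dom_chart \<kappa>) (W \<kappa> \<circ> coord_inv \<kappa>)) \<and>
     (\<forall>\<kappa>\<in>B. \<forall>\<eta>\<in>B. \<forall>q\<in>dom_chart \<kappa> \<inter> dom_chart \<eta>. W \<eta> q = differential \<kappa> \<eta> id q (W \<kappa> q))"


section \<open>Riemannian metrics\<close>

type_synonym ('b, 'f) metric = "('b, 'f) chart \<Rightarrow> 'b \<Rightarrow> 'f \<Rightarrow> 'f \<Rightarrow> real"

definition riemannian_metric :: "('b, 'f::euclidean_space) chart set \<Rightarrow> ('b, 'f) metric \<Rightarrow> bool" where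
  "riemannian_metric B g \<longleftrightarrow>
     (\<forall>\<kappa>\<in>B. \<forall>q\<in>dom_chart \<kappa>. bilinear (g \<kappa> q) \<and> (\<forall>u v. g \<kappa> q u v = g \<kappa> q v u) \<and> (\<forall>u. u \<noteq> 0 \<longrightarrow> 0 < g \<kappa> q u u)) \<and>
     (\<forall>\<kappa>\<in>B. \<forall>u v. smooth_on (coord \<kappa> ` dom_chart \<kappa>) (\<lambda>z. g \<kappa> (coord_inv \<kappa> z) u v)) \<and>
     (\<forall>\<kappa>\<in>B. \<forall>\<eta>\<in>B. \<forall>q\<in>dom_chart \<kappa> \<inter> dom_chart \<eta>. \<forall>u v.
        g \<kappa> q u v = g \<eta> q (differential \<kappa> \<eta> id q u) (differential \<kappa> \<eta> id q v))"

definition pullback_metric ::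
    "('b, 'f::euclidean_space) chart set \<Rightarrow> ('b, 'f) metric \<Rightarrow> ('a \<Rightarrow> 'b) \<Rightarrow> ('a, 'e::euclidean_space) metric" where
  "pullback_metric B g F \<xi> p u v =
     (let \<kappa> = chart_at B (F p) in g \<kappa> (F p) (differential \<xi> \<kappa> F p u) (differential \<xi> \<kappa> F p v))"

definition conformal_factor ::
    "('b, 'f::euclidean_space) chart set \<Rightarrow> ('b, 'f) metric \<Rightarrow> ('b \<Rightarrow> 'b) \<Rightarrow> ('b \<Rightarrow> real) \<Rightarrow> bool" where
  "conformal_factor B g \<Phi> \<sigma> \<longleftrightarrow> (\<forall>q. 0 < \<sigma> q) \<and>
     (\<forall>\<kappa>\<in>B. \<forall>q\<in>dom_chart \<kappa>. \<forall>u v. pullback_metric B g \<Phi> \<kappa> q u v = (\<sigma> q)\<^sup>2 * g \<kappa> q u v)"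

definition globally_conformal ::
    "('b::topological_space, 'f::euclidean_space) chart set \<Rightarrow> ('b, 'f) metric \<Rightarrow> 'b set \<Rightarrow> 'b set \<Rightarrow> bool" where
  "globally_conformal B g X Y \<longleftrightarrow>
     (\<exists>\<Phi> \<sigma>. diffeomorphism B B \<Phi> \<and> conformal_factor B g \<Phi> \<sigma> \<and> \<Phi> ` X = Y)"

text \<open>For an inner product b: the vector dual to a linear form, the trace of a bilinear map, and the
  orthogonal projection onto the complement of a subspace.\<close>

definition dual_vector :: "('e \<Rightarrow> 'e \<Rightarrow> real) \<Rightarrow> ('e \<Rightarrow> real) \<Rightarrow> 'e" where
  "dual_vector b l = (THE w. \<forall>z. b w z = l z)"

text \<open>The dual vector of the i-th coordinate form is the sum over j of b^(ij) e_j, so this is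
  the sum over i and j of b^(ij) S(e_i, e_j).\<close>

definition trace_wrt :: "('e::euclidean_space \<Rightarrow> 'e \<Rightarrow> real) \<Rightarrow> ('e \<Rightarrow> 'e \<Rightarrow> 'f::real_vector) \<Rightarrow> 'f" where
  "trace_wrt b S = (\<Sum>i\<in>Basis. S i (dual_vector b (\<lambda>z. z \<bullet> i)))"

definition orth_part :: "('f \<Rightarrow> 'f \<Rightarrow> real) \<Rightarrow> 'f set \<Rightarrow> 'f \<Rightarrow> 'f::real_vector" where
  "orth_part b S v = (THE w. v - w \<in> S \<and> (\<forall>s\<in>S. b w s = 0))"

definition gradient :: "('b, 'f::euclidean_space) metric \<Rightarrow> ('b \<Rightarrow> real) \<Rightarrow> 'b \<Rightarrow> ('b, 'f) chart \<Rightarrow> 'f" where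
  "gradient g f q \<kappa> = dual_vector (g \<kappa> q) (frechet_derivative (f \<circ> coord_inv \<kappa>) (at (coord \<kappa> q)))"

text \<open>The directional derivative, in the direction w, of the component g(u,v) of the metric, where
  u and v are constant in the coordinates.\<close>

definition metric_deriv :: "('b, 'f::euclidean_space) metric \<Rightarrow> ('b, 'f) chart \<Rightarrow> 'b \<Rightarrow> 'f \<Rightarrow> 'f \<Rightarrow> 'f \<Rightarrow> real" where
  "metric_deriv g \<kappa> q w u v =
     frechet_derivative (\<lambda>z. g \<kappa> (coord_inv \<kappa> z) u v) (at (coord \<kappa> q)) w"

text \<open>In coordinates, L_W g (u,v) = (D_W g)(u,v) + g(D_u W, v) + g(u, D_v W).\<close>

definition lie_metric ::
    "(('b, 'f) chart \<Rightarrow> 'b \<Rightarrow> 'f) \<Rightarrow> ('b, 'f::euclidean_space) metric \<Rightarrow> ('b, 'f) metric" where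
  "lie_metric W g \<kappa> q u v =
     (let DW = frechet_derivative (W \<kappa> \<circ> coord_inv \<kappa>) (at (coord \<kappa> q))
      in metric_deriv g \<kappa> q (W \<kappa> q) u v + g \<kappa> q (DW u) v + g \<kappa> q u (DW v))"

definition conformal_vector_field ::
    "('b, 'f::euclidean_space) chart set \<Rightarrow> ('b, 'f) metric \<Rightarrow> (('b, 'f) chart \<Rightarrow> 'b \<Rightarrow> 'f) \<Rightarrow> bool" where
  "conformal_vector_field B g W \<longleftrightarrow> smooth_vector_field B W \<and>
     (\<exists>\<mu>. \<forall>\<kappa>\<in>B. \<forall>q\<in>dom_chart \<kappa>. \<forall>u v. lie_metric W g \<kappa> q u v = \<mu> q * g \<kappa> q u v)"


section \<open>Mean curvature of immersions\<close>

text \<open>Christoffel symbols of the Levi-Civita connection, from the Koszul formula for coordinate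
  fields.\<close>

definition christoffel :: "('b, 'f::euclidean_space) metric \<Rightarrow> ('b, 'f) chart \<Rightarrow> 'b \<Rightarrow> 'f \<Rightarrow> 'f \<Rightarrow> 'f" where
  "christoffel g \<kappa> q u v = dual_vector (g \<kappa> q)
     (\<lambda>w. (metric_deriv g \<kappa> q u v w + metric_deriv g \<kappa> q v u w - metric_deriv g \<kappa> q w u v) / 2)"

text \<open>The covariant derivative along F of the field F_*(v) in the direction u, for u and v
  constant in the coordinates of the chart on the source.\<close>

definition cov_deriv ::
    "('b, 'f::euclidean_space) metric \<Rightarrow> ('a, 'e::euclidean_space) chart \<Rightarrow> ('b, 'f) chart \<Rightarrow>
     ('a \<Rightarrow> 'b) \<Rightarrow> 'a \<Rightarrow> 'e \<Rightarrow> 'e \<Rightarrow> 'f" where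
  "cov_deriv g \<xi> \<kappa> F p u v =
     frechet_derivative (\<lambda>z. frechet_derivative (coord \<kappa> \<circ> F \<circ> coord_inv \<xi>) (at z) v) (at (coord \<xi> p)) u
     + christoffel g \<kappa> (F p) (differential \<xi> \<kappa> F p u) (differential \<xi> \<kappa> F p v)"

definition normal_part ::
    "('a, 'e::euclidean_space) chart set \<Rightarrow> ('b, 'f::euclidean_space) metric \<Rightarrow> ('a \<Rightarrow> 'b) \<Rightarrow> 'a \<Rightarrow>
     (('b, 'f) chart \<Rightarrow> 'f) \<Rightarrow> ('b, 'f) chart \<Rightarrow> 'f" where
  "normal_part A g F p v \<kappa> = orth_part (g \<kappa> (F p)) (range (differential (chart_at A p) \<kappa> F p)) (v \<kappa>)"

definition second_fundamental_form ::
    "('b, 'f::euclidean_space) metric \<Rightarrow> ('a, 'e::euclidean_space) chart \<Rightarrow> ('b, 'f) chart \<Rightarrow>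
     ('a \<Rightarrow> 'b) \<Rightarrow> 'a \<Rightarrow> 'e \<Rightarrow> 'e \<Rightarrow> 'f" where
  "second_fundamental_form g \<xi> \<kappa> F p u v =
     orth_part (g \<kappa> (F p)) (range (differential \<xi> \<kappa> F p)) (cov_deriv g \<xi> \<kappa> F p u v)"

definition mean_curvature ::
    "('a, 'e::euclidean_space) chart set \<Rightarrow> ('b, 'f::euclidean_space) chart set \<Rightarrow> ('b, 'f) metric \<Rightarrow>
     ('a \<Rightarrow> 'b) \<Rightarrow> 'a \<Rightarrow> ('b, 'f) chart \<Rightarrow> 'f" where
  "mean_curvature A B g F p \<kappa> =
     (let \<xi> = chart_at A p
      in trace_wrt (pullback_metric B g F \<xi> p) (second_fundamental_form g \<xi> \<kappa> F p))"


section \<open>Flows\<close>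

text \<open>The velocity of t \<mapsto> G p t at time t is the tangent vector V; at an endpoint of I
  the derivative is one-sided.\<close>

definition has_velocity ::
    "('b, 'f::euclidean_space) chart set \<Rightarrow> real set \<Rightarrow> (real \<Rightarrow> 'b) \<Rightarrow> real \<Rightarrow> (('b, 'f) chart \<Rightarrow> 'f) \<Rightarrow> bool" where
  "has_velocity B I \<gamma> t V \<longleftrightarrow>
     (\<forall>\<kappa>\<in>B. \<gamma> t \<in> dom_chart \<kappa> \<longrightarrow> ((\<lambda>s. coord \<kappa> (\<gamma> s)) has_vector_derivative V \<kappa>) (at t within I))"

definition flow_solution ::
    "('a::topological_space, 'e::euclidean_space) chart set \<Rightarrow>
     ('b::topological_space, 'f::euclidean_space) chart set \<Rightarrow> real set \<Rightarrow> ('a \<Rightarrow> real \<Rightarrow> 'b) \<Rightarrow>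
     ('a \<Rightarrow> real \<Rightarrow> ('b, 'f) chart \<Rightarrow> 'f) \<Rightarrow> bool" where
  "flow_solution A B I G V \<longleftrightarrow> smooth_family A B I G \<and>
     (\<forall>t\<in>I. immersion A B (\<lambda>p. G p t)) \<and>
     (\<forall>t\<in>I. \<forall>p. has_velocity B I (G p) t (V p t))"

definition one_parameter_family ::
    "('b::topological_space, 'f::euclidean_space) chart set \<Rightarrow> real set \<Rightarrow>
     (('b, 'f) chart \<Rightarrow> 'b \<Rightarrow> 'f) \<Rightarrow> ('b \<Rightarrow> real \<Rightarrow> 'b) \<Rightarrow> bool" where
  "one_parameter_family B J X \<Phi> \<longleftrightarrow> smooth_family B B J \<Phi> \<and>
     (\<forall>s\<in>J. diffeomorphism B B (\<lambda>q. \<Phi> q s)) \<and>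
     (\<forall>q. \<Phi> q 0 = q) \<and>
     (\<forall>s\<in>J. \<forall>q. has_velocity B J (\<Phi> q) s (\<lambda>\<kappa>. X \<kappa> (\<Phi> q s)))"

text \<open>Time-dependent reparametrizations, normalised to be the identity at time 0.\<close>

definition time_dependent_diffeo ::
    "('a::topological_space, 'e::euclidean_space) chart set \<Rightarrow> real set \<Rightarrow> ('a \<Rightarrow> real \<Rightarrow> 'a) \<Rightarrow> bool" where
  "time_dependent_diffeo A I \<psi> \<longleftrightarrow> smooth_family A A I \<psi> \<and>
     (\<forall>t\<in>I. diffeomorphism A A (\<lambda>p. \<psi> p t)) \<and> (\<forall>p. \<psi> p 0 = p)"

text \<open>F and G are linked by G p t = \<Phi> (F p t) t, and the external force at G p t is the
  pushforward by \<Phi>(\<cdot>,t) of a vector at F p t.\<close>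

definition external_force_velocity ::
    "('a, 'e::euclidean_space) chart set \<Rightarrow> ('b, 'f::euclidean_space) chart set \<Rightarrow> ('b, 'f) metric \<Rightarrow>
     ('b \<Rightarrow> real \<Rightarrow> 'b) \<Rightarrow> ('b \<Rightarrow> real \<Rightarrow> real) \<Rightarrow> ('a \<Rightarrow> real \<Rightarrow> 'b) \<Rightarrow>
     'a \<Rightarrow> real \<Rightarrow> ('b, 'f) chart \<Rightarrow> 'f" where
  "external_force_velocity A B g \<Phi> \<rho> F p t \<kappa> =
     (\<rho> (F p t) t)\<^sup>2 *\<^sub>R mean_curvature A B g (\<lambda>p. \<Phi> (F p t) t) p \<kappa>
     + real DIM('e) *\<^sub>R pushforward B (\<lambda>q. \<Phi> q t) (F p t)
         (normal_part A g (\<lambda>p. F p t) p (gradient g (\<lambda>q. ln (\<rho> q t)) (F p t))) \<kappa>"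

end

theory Submission
  imports Defs
begin

text \<open>Write \<open>\<Phi>\<^sub>t\<close> for the flow of \<open>-W\<close> at time \<open>\<integral>\<phi>\<close>. Differentiating \<open>\<Phi>\<^sub>t(F(p,t))\<close> gives
  \<open>d\<Phi>\<^sub>t(\<partial>\<^sub>tF) - \<phi> W\<close>, and \<open>W\<close> is invariant under its own flow, so if \<open>\<partial>\<^sub>tF = H + \<phi> W\<close> only \<open>d\<Phi>\<^sub>t(H)\<close>
  remains; the transformation of the Christoffel symbols under a conformal map turns it into
  the curvature and gradient terms. If instead \<open>\<partial>\<^sub>tF = H + \<phi> W\<^sup>\<bottom>\<close>, composing \<open>F\<close> with the flow on
  the compact manifold \<open>M\<close> of the time-dependent tangential field \<open>\<phi> F\<^sup>*(W\<^sup>T)\<close> restores the missing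
  tangential component and leads back to the first equation.

  Both the conformality of \<open>\<Phi>\<^sub>t\<close> and the invariance of \<open>W\<close> come from one observation:
  \<open>g(c, c)\<close> solves the same scalar linear equation for every vector \<open>c\<close> carried along by the flow, so
  quotients of such functions are constant.\<close>

section \<open>Calculus of continuously differentiable functions\<close>

text \<open>Three things shape the proof. First, the time interval contains its endpoint 0, where
  smoothness means that a local smooth extension exists. Extensions are not unique and keep no
  geometric property: an extended Gram matrix need not be definite. Differential and linear
  equations are therefore solved for an extension, and conclusions are drawn only at times of the
  interval. Secondly, the function \<mu> with L_W g = \<mu> g comes without any regularity, so exp
  of its integral cannot be formed; this is why quotients are used. Their denominators come from a
  nonzero vector moved by the flow, and the numerators may vanish, which is how the invariance of W
  is obtained. Likewise \<rho> comes without regularity although its logarithm has to be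
  differentiated; its square is recovered as a quotient of metric coefficients. Thirdly, the
  tangential field contains the inverse of the Gram matrix of dF, so linear systems have to be
  solved smoothly in parameters up to t = 0, and its flow has to exist on all of [0,T), where T may
  be infinite: compactness of M yields a common lifetime near each single time only.\<close>

lemma Ck_on_imp_continuous_on: "Ck_on n S f \<Longrightarrow> continuous_on S f"
  by (cases n) (auto intro!: continuous_at_imp_continuous_on differentiable_imp_continuous_within)

lemma Ck_on_subset: "Ck_on n S f \<Longrightarrow> T \<subseteq> S \<Longrightarrow> Ck_on n T f"
  by (induction n arbitrary: f) (auto intro: continuous_on_subset)

lemma Ck_on_SucD: "Ck_on (Suc n) S f \<Longrightarrow> Ck_on n S f"
proof (induction n arbitrary: f)
  case 0
  then show ?case using Ck_on_imp_continuous_on[OF 0] by simp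
next
  case (Suc n)
  then show ?case by (metis Ck_on.simps(2))
qed

lemma Ck_on_mono: "Ck_on n S f \<Longrightarrow> m \<le> n \<Longrightarrow> Ck_on m S f"
  by (induction n) (metis le_zero_eq, metis Ck_on_SucD le_Suc_eq)

lemma Ck_on_has_derivative:
  "Ck_on (Suc n) S f \<Longrightarrow> x \<in> S \<Longrightarrow> (f has_derivative frechet_derivative f (at x)) (at x)"
  by (simp add: frechet_derivative_works)

lemma Ck_on_SucD_deriv: "Ck_on (Suc n) S f \<Longrightarrow> Ck_on n S (\<lambda>x. frechet_derivative f (at x) v)"
  by simp

text \<open>\<open>S\<close> must be open: a Frechet derivative at \<open>x\<close> sees a whole
  neighbourhood of \<open>x\<close>, so agreement on an arbitrary set would not transfer it. The
  functions may differ outside \<open>S\<close>.\<close>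

lemma Ck_on_cong:
  assumes "open S" "Ck_on n S f" "\<And>x. x \<in> S \<Longrightarrow> f x = g x"
  shows "Ck_on n S g"
  using assms(2,3)
proof (induction n arbitrary: f g)
  case 0
  then show ?case by (simp cong: continuous_on_cong_simp)
next
  case (Suc n)
  have d: "f differentiable (at x)" if "x \<in> S" for x
    using Suc.prems(1) that by simp
  have "(g has_derivative frechet_derivative f (at x)) (at x)" if "x \<in> S" for x
    using d[OF that] has_derivative_transform_within_open[OF _ assms(1) that, of f]
      Suc.prems(2) frechet_derivative_works by blast
  then have gd: "(g has_derivative frechet_derivative f (at x)) (at x)" if "x \<in> S" for x
    using that .
  have "g differentiable (at x)" if "x \<in> S" for x
    using differentiableI[OF gd[OF that]] .
  moreover have eq: "frechet_derivative g (at x) = frechet_derivative f (at x)" if "x \<in> S" for x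
    using frechet_derivative_at[OF gd[OF that]] by (rule sym)
  moreover have "Ck_on n S (\<lambda>x. frechet_derivative g (at x) v)" for v
    by (rule Suc.IH[of "\<lambda>x. frechet_derivative f (at x) v"]) (use Suc.prems(1) eq in auto)
  ultimately show ?case by simp
qed

text \<open>Allows any explicit derivative \<open>f'\<close> in place of
  \<open>frechet_derivative\<close>, which is a Hilbert choice; most regularity claims below enter
  through this rule.\<close>

lemma Ck_on_SucI:
  assumes "open S" "\<And>x. x \<in> S \<Longrightarrow> (f has_derivative f' x) (at x)"
    and "\<And>v. Ck_on n S (\<lambda>x. f' x v)"
  shows "Ck_on (Suc n) S f"
proof -
  have "frechet_derivative f (at x) = f' x" if "x \<in> S" for x
    using frechet_derivative_at[OF assms(2)[OF that]] by (rule sym)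
  then have "Ck_on n S (\<lambda>x. frechet_derivative f (at x) v)" for v
    by (intro Ck_on_cong[OF assms(1) assms(3)[of v]]) simp
  then show ?thesis
    using differentiableI[OF assms(2)] unfolding Ck_on.simps by blast
qed

lemma Ck_on_local:
  assumes "\<And>x. x \<in> S \<Longrightarrow> \<exists>U. open U \<and> x \<in> U \<and> Ck_on n U f"
  shows "Ck_on n S f"
  using assms
proof (induction n arbitrary: f)
  case 0
  have "continuous (at x) f" if "x \<in> S" for x
    using 0[OF that] by (auto simp: continuous_on_eq_continuous_at)
  then show ?case by (simp add: continuous_at_imp_continuous_on)
next
  case (Suc n)
  have "f differentiable (at x)" if "x \<in> S" for x
    using Suc.prems[OF that] by auto
  moreover have "Ck_on n S (\<lambda>x. frechet_derivative f (at x) v)" for v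
    by (rule Suc.IH) (use Suc.prems in \<open>unfold Ck_on.simps, blast\<close>)
  ultimately show ?case by simp
qed

lemma Ck_on_const: "Ck_on n S (\<lambda>x. c)"
  by (induction n arbitrary: c) auto

lemma Ck_on_bounded_linear:
  assumes "bounded_linear L" "open S" "Ck_on n S f"
  shows "Ck_on n S (\<lambda>x. L (f x))"
  using assms(3)
proof (induction n arbitrary: f)
  case 0
  then show ?case by (simp add: bounded_linear.continuous_on[OF assms(1)])
next
  case (Suc n)
  show ?case
    by (rule Ck_on_SucI[OF assms(2) bounded_linear.has_derivative[OF assms(1)
          Ck_on_has_derivative[OF Suc.prems]]]) (use Suc in auto)
qed

lemma Ck_on_ident: "open S \<Longrightarrow> Ck_on n S (\<lambda>x. x)"
  by (cases n) (auto intro!: Ck_on_SucI derivative_eq_intros Ck_on_const simp del: Ck_on.simps(2))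

lemma Ck_on_linear: "bounded_linear L \<Longrightarrow> open S \<Longrightarrow> Ck_on n S L"
  using Ck_on_bounded_linear[OF _ _ Ck_on_ident] by blast

lemma Ck_on_add:
  assumes "open S" "Ck_on n S f" "Ck_on n S g"
  shows "Ck_on n S (\<lambda>x. f x + g x)"
  using assms(2,3)
proof (induction n arbitrary: f g)
  case 0
  then show ?case by (simp add: continuous_on_add)
next
  case (Suc n)
  show ?case
    by (rule Ck_on_SucI[OF assms(1) has_derivative_add[OF Ck_on_has_derivative[OF Suc.prems(1)]
          Ck_on_has_derivative[OF Suc.prems(2)]]]) (use Suc in auto)
qed

lemma Ck_on_minus: "open S \<Longrightarrow> Ck_on n S f \<Longrightarrow> Ck_on n S (\<lambda>x. - f x)"
  using Ck_on_bounded_linear[OF bounded_linear_minus[OF bounded_linear_ident]] by blast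

lemma Ck_on_diff: "open S \<Longrightarrow> Ck_on n S f \<Longrightarrow> Ck_on n S g \<Longrightarrow> Ck_on n S (\<lambda>x. f x - g x)"
  using Ck_on_add[of S n f "\<lambda>x. - g x"] Ck_on_minus by auto

lemma Ck_on_sum:
  "open S \<Longrightarrow> (\<And>i. i \<in> X \<Longrightarrow> Ck_on n S (f i)) \<Longrightarrow> Ck_on n S (\<lambda>x. \<Sum>i\<in>X. f i x)"
  by (induction X rule: infinite_finite_induct) (auto intro: Ck_on_const Ck_on_add)

text \<open>The derivative b(f, Dg) + b(Df, g) consists of two expressions of the same shape with
  factors one order lower, so a single induction covers scaling, inner products and all other
  products.\<close>

lemma Ck_on_bilinear:
  assumes "bounded_bilinear b" "open S" "Ck_on n S f" "Ck_on n S g"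
  shows "Ck_on n S (\<lambda>x. b (f x) (g x))"
  using assms(3,4)
proof (induction n arbitrary: f g)
  case 0
  then show ?case by (simp add: bounded_bilinear.continuous_on[OF assms(1)])
next
  case (Suc n)
  show ?case
  proof (rule Ck_on_SucI[OF assms(2) bounded_bilinear.FDERIV[OF assms(1)
          Ck_on_has_derivative[OF Suc.prems(1)] Ck_on_has_derivative[OF Suc.prems(2)]]])
    show "Ck_on n S (\<lambda>x. b (f x) (frechet_derivative g (at x) v) + b (frechet_derivative f (at x) v) (g x))" for v
      using Suc.prems by (intro Ck_on_add Suc.IH assms(2)) (simp_all add: Ck_on_SucD Ck_on_SucD_deriv del: Ck_on.simps)
  qed auto
qed

lemmas Ck_on_scaleR = Ck_on_bilinear[OF bounded_bilinear_scaleR]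
  and Ck_on_inner = Ck_on_bilinear[OF bounded_bilinear_inner]

lemma Ck_on_Pair:
  assumes "open S" "Ck_on n S f" "Ck_on n S g"
  shows "Ck_on n S (\<lambda>x. (f x, g x))"
proof -
  have "bounded_linear (\<lambda>x. (x, 0::'c))" "bounded_linear (\<lambda>x. (0::'b, x))"
    by (intro bounded_linear_Pair bounded_linear_ident bounded_linear_zero)+
  then have "Ck_on n S (\<lambda>x. (f x, 0) + (0, g x))"
    by (intro Ck_on_add assms Ck_on_bounded_linear[of "\<lambda>x. (x, 0)"] Ck_on_bounded_linear[of "\<lambda>x. (0, x)"])
  then show ?thesis by simp
qed

text \<open>\<open>Ck_on\<close> speaks about derivatives in fixed directions only. This expansion
  reduces a derivative in a direction that varies with the point to finitely many fixed
  ones.\<close>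

lemma linear_basis_expand:
  fixes L :: "'a::euclidean_space \<Rightarrow> 'b::real_vector"
  assumes "linear L" shows "L v = (\<Sum>i\<in>Basis. (v \<bullet> i) *\<^sub>R L i)"
proof -
  have "L v = L (\<Sum>i\<in>Basis. (v \<bullet> i) *\<^sub>R i)" by (simp add: euclidean_representation)
  then show ?thesis using assms by (simp add: linear_sum linear_scale)
qed

text \<open>In the chain rule the direction Df(x) v varies with x. Expanded over
  \<open>Basis\<close> it leaves the derivatives of \<open>g\<close> in fixed directions, composed
  with \<open>f\<close>, to which the induction hypothesis for arbitrary \<open>g\<close>
  applies.\<close>

lemma Ck_on_compose:
  fixes f :: "'a::euclidean_space \<Rightarrow> 'b::euclidean_space" and g :: "'b \<Rightarrow> 'c::real_normed_vector"
  assumes "open S" "open T" "Ck_on n S f" "Ck_on n T g" "f ` S \<subseteq> T"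
  shows "Ck_on n S (\<lambda>x. g (f x))"
  using assms(3,4)
proof (induction n arbitrary: g)
  case 0
  then show ?case using assms(5) by (auto intro: continuous_on_compose2)
next
  case (Suc n)
  let ?D = "\<lambda>x v. \<Sum>i\<in>Basis. (frechet_derivative f (at x) v \<bullet> i) *\<^sub>R frechet_derivative g (at (f x)) i"
  have "((\<lambda>x. g (f x)) has_derivative ?D x) (at x)" if "x \<in> S" for x
  proof -
    have fx: "f x \<in> T" using that assms(5) by auto
    have 1: "(g has_derivative frechet_derivative g (at (f x))) (at (f x))"
      using Ck_on_has_derivative[OF Suc.prems(2) fx] .
    have "((\<lambda>x. g (f x)) has_derivative (\<lambda>v. frechet_derivative g (at (f x)) (frechet_derivative f (at x) v))) (at x)"
      using has_derivative_compose[OF Ck_on_has_derivative[OF Suc.prems(1) that] 1] by simp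
    then show ?thesis
      by (subst linear_basis_expand[OF has_derivative_linear[OF 1], symmetric])
  qed
  moreover have "Ck_on n S (\<lambda>x. ?D x v)" for v
    using Suc.prems by (intro Ck_on_sum Ck_on_scaleR assms(1) Ck_on_inner Ck_on_const Suc.IH)
      (simp_all add: Ck_on_SucD Ck_on_SucD_deriv del: Ck_on.simps)
  ultimately show ?case
    by (intro Ck_on_SucI[OF assms(1)])
qed

lemma Ck_on_fst: "open S \<Longrightarrow> Ck_on n S f \<Longrightarrow> Ck_on n S (\<lambda>x. fst (f x))"
  and Ck_on_snd: "open S \<Longrightarrow> Ck_on n S f \<Longrightarrow> Ck_on n S (\<lambda>x. snd (f x))"
  by (auto intro: Ck_on_bounded_linear bounded_linear_fst bounded_linear_snd)

text \<open>Covers derivatives taken at a moving point in a moving direction, as in the variational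
  equation; one order is lost.\<close>

lemma Ck_on_deriv_apply:
  fixes f :: "'a::euclidean_space \<Rightarrow> 'b::euclidean_space" and g :: "'c::euclidean_space \<Rightarrow> 'a"
  assumes "open S" "open T" "Ck_on (Suc n) T f" "Ck_on n S g" "g ` S \<subseteq> T" "Ck_on n S h"
  shows "Ck_on n S (\<lambda>x. frechet_derivative f (at (g x)) (h x))"
proof -
  have "Ck_on n S (\<lambda>x. \<Sum>i\<in>Basis. (h x \<bullet> i) *\<^sub>R frechet_derivative f (at (g x)) i)"
    by (intro Ck_on_sum Ck_on_scaleR assms(1) Ck_on_inner Ck_on_const Ck_on_compose[OF assms(1,2,4)] assms(6,5))
       (use assms(3) in auto)
  moreover have "frechet_derivative f (at (g x)) (h x)
      = (\<Sum>i\<in>Basis. (h x \<bullet> i) *\<^sub>R frechet_derivative f (at (g x)) i)" if "x \<in> S" for x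
    by (rule linear_basis_expand[OF has_derivative_linear[OF Ck_on_has_derivative[OF assms(3)]]]) (use that assms(5) in blast)
  ultimately show ?thesis
    using Ck_on_cong[OF assms(1), of n _ "\<lambda>x. frechet_derivative f (at (g x)) (h x)"] by simp
qed

lemma Ck_on_antiderivative:
  fixes f H :: "real \<Rightarrow> 'b::real_normed_vector"
  assumes "open S" "Ck_on n S f" "\<And>x. x \<in> S \<Longrightarrow> (H has_vector_derivative f x) (at x)"
  shows "Ck_on (Suc n) S H"
proof (rule Ck_on_SucI[OF assms(1)])
  show "(H has_derivative (\<lambda>h. h *\<^sub>R f x)) (at x)" if "x \<in> S" for x
    using assms(3)[OF that] by (simp add: has_vector_derivative_def)
qed (intro Ck_on_scaleR Ck_on_const assms)

subsection \<open>Symmetry of second derivatives\<close>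

text \<open>The mean value theorem is applied in the direction \<open>u\<close> to the difference of
  \<open>f\<close> over the step h v, and then once more in the direction \<open>v\<close>. The left
  side is symmetric in \<open>u\<close> and \<open>v\<close>, which is how both mixed derivatives
  come to be compared.\<close>

lemma second_difference_mvt:
  fixes f :: "'a::real_normed_vector \<Rightarrow> real"
  assumes h: "0 < h" and d: "\<And>s t. 0 \<le> s \<Longrightarrow> s \<le> h \<Longrightarrow> 0 \<le> t \<Longrightarrow> t \<le> h \<Longrightarrow>
      (f has_derivative f' (x + s *\<^sub>R u + t *\<^sub>R v)) (at (x + s *\<^sub>R u + t *\<^sub>R v)) \<and>
      ((\<lambda>y. f' y u) has_derivative f'' (x + s *\<^sub>R u + t *\<^sub>R v)) (at (x + s *\<^sub>R u + t *\<^sub>R v))"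
  shows "\<exists>s t. 0 \<le> s \<and> s \<le> h \<and> 0 \<le> t \<and> t \<le> h \<and>
    f (x + h *\<^sub>R u + h *\<^sub>R v) - f (x + h *\<^sub>R u) - f (x + h *\<^sub>R v) + f x
      = h * h * f'' (x + s *\<^sub>R u + t *\<^sub>R v) v"
proof -
  define p where "p s = f (x + s *\<^sub>R u + h *\<^sub>R v) - f (x + s *\<^sub>R u)" for s
  have "(p has_derivative (\<lambda>k. k * (f' (x + s *\<^sub>R u + h *\<^sub>R v) u - f' (x + s *\<^sub>R u) u))) (at s within X)"
    if "0 \<le> s" "s \<le> h" for s X
  proof -
    have 1: "((\<lambda>s. f (x + s *\<^sub>R u + t *\<^sub>R v)) has_derivative (\<lambda>k. k * f' (x + s *\<^sub>R u + t *\<^sub>R v) u)) (at s within X)"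
      if "0 \<le> t" "t \<le> h" for t
    proof -
      have f: "(f has_derivative f' (x + s *\<^sub>R u + t *\<^sub>R v)) (at (x + s *\<^sub>R u + t *\<^sub>R v))"
        using d \<open>0 \<le> s\<close> \<open>s \<le> h\<close> that by auto
      have "((\<lambda>s. x + s *\<^sub>R u + t *\<^sub>R v) has_derivative (\<lambda>k. k *\<^sub>R u)) (at s within X)"
        by (auto intro!: derivative_eq_intros)
      from has_derivative_compose[OF this f] show ?thesis
        using linear_scale[OF has_derivative_linear[OF f]] by simp
    qed
    show ?thesis unfolding p_def using has_derivative_diff[OF 1[of h] 1[of 0]] h
      by (simp add: algebra_simps)
  qed
  then obtain s where s: "0 < s" "s < h"
    "p h - p 0 = h * (f' (x + s *\<^sub>R u + h *\<^sub>R v) u - f' (x + s *\<^sub>R u) u)"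
    using mvt_simple[OF h, of p "\<lambda>s k. k * (f' (x + s *\<^sub>R u + h *\<^sub>R v) u - f' (x + s *\<^sub>R u) u)"] by auto
  have "((\<lambda>t. f' (x + s *\<^sub>R u + t *\<^sub>R v) u) has_derivative (\<lambda>k. k * f'' (x + s *\<^sub>R u + t *\<^sub>R v) v)) (at t within X)"
    if "0 \<le> t" "t \<le> h" for t X
  proof -
    have f: "((\<lambda>y. f' y u) has_derivative f'' (x + s *\<^sub>R u + t *\<^sub>R v)) (at (x + s *\<^sub>R u + t *\<^sub>R v))"
      using d s that by auto
    have "((\<lambda>t. x + s *\<^sub>R u + t *\<^sub>R v) has_derivative (\<lambda>k. k *\<^sub>R v)) (at t within X)"
      by (auto intro!: derivative_eq_intros)
    from has_derivative_compose[OF this f] show ?thesis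
      using linear_scale[OF has_derivative_linear[OF f]] by simp
  qed
  then obtain t where t: "0 < t" "t < h"
    "f' (x + s *\<^sub>R u + h *\<^sub>R v) u - f' (x + s *\<^sub>R u + 0 *\<^sub>R v) u = h * f'' (x + s *\<^sub>R u + t *\<^sub>R v) v"
    using mvt_simple[OF h, of "\<lambda>t. f' (x + s *\<^sub>R u + t *\<^sub>R v) u" "\<lambda>t k. k * f'' (x + s *\<^sub>R u + t *\<^sub>R v) v"]
    by auto
  show ?thesis
    using s t h by (intro exI[of _ s] exI[of _ t]) (simp add: p_def algebra_simps)
qed

lemma frechet_derivative_inner_left:
  "f differentiable (at x) \<Longrightarrow> frechet_derivative (\<lambda>x. f x \<bullet> b) (at x) = (\<lambda>v. frechet_derivative f (at x) v \<bullet> b)"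
  by (rule frechet_derivative_at[symmetric], rule has_derivative_inner_left)
     (simp add: frechet_derivative_works[symmetric])

lemma second_derivative_symmetric_real:
  fixes f :: "'a::euclidean_space \<Rightarrow> real"
  assumes "open S" "Ck_on 2 S f" "x \<in> S"
  shows "frechet_derivative (\<lambda>z. frechet_derivative f (at z) v) (at x) u
       = frechet_derivative (\<lambda>z. frechet_derivative f (at z) u) (at x) v"
proof -
  let ?D = "\<lambda>v u z. frechet_derivative (\<lambda>z. frechet_derivative f (at z) v) (at z) u"
  have C: "Ck_on (Suc (Suc 0)) S f" using assms(2) by (simp add: numeral_2_eq_2)
  have D: "(f has_derivative frechet_derivative f (at z)) (at z)"
    "((\<lambda>z. frechet_derivative f (at z) w) has_derivative (\<lambda>u. ?D w u z)) (at z)" if "z \<in> S" for z w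
    using C that by (auto simp: frechet_derivative_works)
  have c: "continuous (at x) (?D w w')" for w w'
  proof -
    have "continuous_on S (?D w w')" using C by simp
    then show ?thesis using assms by (simp add: continuous_on_eq_continuous_at)
  qed
  show ?thesis
  proof (rule ccontr)
    assume ne: "?D v u x \<noteq> ?D u v x"
    \<comment> \<open>Half the gap: two values, each strictly within \<open>e\<close> of one of the
      mixed derivatives, cannot be equal.\<close>
    define e where "e = \<bar>?D v u x - ?D u v x\<bar> / 2"
    have e: "0 < e" using ne by (simp add: e_def)
    obtain d1 where d1: "d1 > 0" "\<And>z. dist z x < d1 \<Longrightarrow> dist (?D v u z) (?D v u x) < e"
      using c[of v u] e unfolding continuous_at_eps_delta by metis
    obtain d2 where d2: "d2 > 0" "\<And>z. dist z x < d2 \<Longrightarrow> dist (?D u v z) (?D u v x) < e"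
      using c[of u v] e unfolding continuous_at_eps_delta by metis
    obtain d3 where d3: "d3 > 0" "\<And>z. dist z x < d3 \<Longrightarrow> z \<in> S"
      using assms unfolding open_dist by metis
    define d where "d = min d1 (min d2 d3)"
    have d: "d > 0" using d1 d2 d3 by (simp add: d_def)
    \<comment> \<open>Keeps the parallelogram spanned by h u and h v within d/2 of \<open>x\<close>;
      the summand 1 excludes a zero denominator.\<close>
    define h where "h = d / (2 * (norm u + norm v + 1))"
    have np: "norm u + norm v + 1 > 0" by (smt (verit) norm_ge_zero)
    have h: "h > 0" using d np by (simp add: h_def)
    have near: "dist (x + s *\<^sub>R u + t *\<^sub>R v) x < d" if "0 \<le> s" "s \<le> h" "0 \<le> t" "t \<le> h" for s t u' v'
    proof -
      have "dist (x + s *\<^sub>R u + t *\<^sub>R v) x = norm (s *\<^sub>R u + t *\<^sub>R v)" by (simp add: dist_norm)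
      also have "\<dots> \<le> s * norm u + t * norm v" using that by (metis abs_of_nonneg norm_scaleR norm_triangle_ineq)
      also have "\<dots> \<le> h * norm u + h * norm v" using that by (intro add_mono mult_right_mono) auto
      also have "\<dots> \<le> h * (norm u + norm v + 1)" using h by (simp add: algebra_simps)
      also have "\<dots> = d / 2" using np unfolding h_def by (simp add: field_simps)
      finally show ?thesis using d by simp
    qed
    have "\<exists>s t. 0 \<le> s \<and> s \<le> h \<and> 0 \<le> t \<and> t \<le> h \<and>
      f (x + h *\<^sub>R u + h *\<^sub>R v) - f (x + h *\<^sub>R u) - f (x + h *\<^sub>R v) + f x
      = h * h * ?D u v (x + s *\<^sub>R u + t *\<^sub>R v)"
      using near d3 by (intro second_difference_mvt[OF h, where f' = "\<lambda>z. frechet_derivative f (at z)"] conjI D)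
        (auto simp: d_def)
    then obtain s t where st: "0 \<le> s" "s \<le> h" "0 \<le> t" "t \<le> h"
      "f (x + h *\<^sub>R u + h *\<^sub>R v) - f (x + h *\<^sub>R u) - f (x + h *\<^sub>R v) + f x
      = h * h * ?D u v (x + s *\<^sub>R u + t *\<^sub>R v)" by blast
    have near': "dist (x + s *\<^sub>R v + t *\<^sub>R u) x < d" if "0 \<le> s" "s \<le> h" "0 \<le> t" "t \<le> h" for s t
      using near[of t s] that by (simp add: algebra_simps)
    have "\<exists>s t. 0 \<le> s \<and> s \<le> h \<and> 0 \<le> t \<and> t \<le> h \<and>
      f (x + h *\<^sub>R v + h *\<^sub>R u) - f (x + h *\<^sub>R v) - f (x + h *\<^sub>R u) + f x
      = h * h * ?D v u (x + s *\<^sub>R v + t *\<^sub>R u)"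
      using near' d3 by (intro second_difference_mvt[OF h, where f' = "\<lambda>z. frechet_derivative f (at z)"] conjI D)
        (auto simp: d_def)
    then obtain s' t' where st': "0 \<le> s'" "s' \<le> h" "0 \<le> t'" "t' \<le> h"
      "f (x + h *\<^sub>R v + h *\<^sub>R u) - f (x + h *\<^sub>R v) - f (x + h *\<^sub>R u) + f x
      = h * h * ?D v u (x + s' *\<^sub>R v + t' *\<^sub>R u)" by blast
    have "h * h * ?D u v (x + s *\<^sub>R u + t *\<^sub>R v) = h * h * ?D v u (x + s' *\<^sub>R v + t' *\<^sub>R u)"
      using st(5) st'(5) by (simp add: algebra_simps)
    then have "?D u v (x + s *\<^sub>R u + t *\<^sub>R v) = ?D v u (x + s' *\<^sub>R v + t' *\<^sub>R u)" using h by simp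
    moreover have "dist (?D u v (x + s *\<^sub>R u + t *\<^sub>R v)) (?D u v x) < e"
      using d2 near st by (simp add: d_def)
    moreover have "dist (?D v u (x + s' *\<^sub>R v + t' *\<^sub>R u)) (?D v u x) < e"
      using d1 near' st' by (simp add: d_def)
    ultimately show False unfolding e_def dist_real_def by (simp add: abs_if split: if_splits)
  qed
qed

lemma second_derivative_symmetric:
  fixes f :: "'a::euclidean_space \<Rightarrow> 'b::euclidean_space"
  assumes "open S" "Ck_on 2 S f" "x \<in> S"
  shows "frechet_derivative (\<lambda>z. frechet_derivative f (at z) v) (at x) u
       = frechet_derivative (\<lambda>z. frechet_derivative f (at z) u) (at x) v"
proof (rule euclidean_eqI)
  fix b :: 'b
  have C: "Ck_on (Suc (Suc 0)) S f" using assms(2) by (simp add: numeral_2_eq_2)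
  have 1: "frechet_derivative (\<lambda>x. f x \<bullet> b) (at z) w = frechet_derivative f (at z) w \<bullet> b" if "z \<in> S" for z w
    using C that by (simp add: frechet_derivative_inner_left)
  have 2: "frechet_derivative (\<lambda>z. frechet_derivative (\<lambda>x. f x \<bullet> b) (at z) w) (at x) w'
     = frechet_derivative (\<lambda>z. frechet_derivative f (at z) w) (at x) w' \<bullet> b" for w w'
  proof -
    have "((\<lambda>z. frechet_derivative f (at z) w \<bullet> b) has_derivative
       (\<lambda>w'. frechet_derivative (\<lambda>z. frechet_derivative f (at z) w) (at x) w' \<bullet> b)) (at x)"
      using C assms(3) by (intro has_derivative_inner_left) (auto simp: frechet_derivative_works)
    then have "((\<lambda>z. frechet_derivative (\<lambda>x. f x \<bullet> b) (at z) w) has_derivative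
       (\<lambda>w'. frechet_derivative (\<lambda>z. frechet_derivative f (at z) w) (at x) w' \<bullet> b)) (at x)"
      by (rule has_derivative_transform_within_open[OF _ assms(1,3)]) (simp add: 1)
    then show ?thesis by (metis frechet_derivative_at)
  qed
  have "Ck_on 2 S (\<lambda>x. f x \<bullet> b)"
    by (intro Ck_on_inner assms Ck_on_const)
  from second_derivative_symmetric_real[OF assms(1) this assms(3), of v u]
  show "frechet_derivative (\<lambda>z. frechet_derivative f (at z) v) (at x) u \<bullet> b
     = frechet_derivative (\<lambda>z. frechet_derivative f (at z) u) (at x) v \<bullet> b"
    unfolding 2 .
qed

section \<open>Ordinary differential equations\<close>

lemma vector_derivative_bound:
  fixes g :: "real \<Rightarrow> 'b::real_normed_vector"
  assumes "\<And>t. t \<in> {a..b} \<Longrightarrow> (g has_vector_derivative g' t) (at t within {a..b})"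
    and "\<And>t. t \<in> {a..b} \<Longrightarrow> norm (g' t) \<le> B" "s \<in> {a..b}" "t \<in> {a..b}"
  shows "norm (g t - g s) \<le> B * \<bar>t - s\<bar>"
proof -
  have "onorm (\<lambda>h. h *\<^sub>R g' t) \<le> B" if "t \<in> {a..b}" for t
  proof (rule onorm_le)
    show "norm (h *\<^sub>R g' t) \<le> B * norm h" for h
      using mult_left_mono[OF assms(2)[OF that] abs_ge_zero[of h]] by (simp add: mult.commute)
  qed
  then show ?thesis
    using differentiable_bound[of "{a..b}" g "\<lambda>t h. h *\<^sub>R g' t" B t s] assms
    by (auto simp: has_vector_derivative_def)
qed

text \<open>The expression is the integral of \<open>G\<close> from 0 to \<open>r\<close>. Rescaled
  to the fixed interval [0,1] it makes sense for both signs of \<open>r\<close>, and its continuity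
  in parameters follows from the rule for a fixed domain of integration.\<close>

lemma scaled_integral_has_vector_derivative:
  fixes G :: "real \<Rightarrow> 'b::banach"
  assumes G: "continuous_on {- d..d} G" and r: "r \<in> {- d..d}"
  shows "((\<lambda>r. r *\<^sub>R integral {0..1} (\<lambda>\<sigma>. G (r * \<sigma>))) has_vector_derivative G r) (at r within {- d..d})"
proof -
  define H where "H r = integral {- d..r} G" for r
  have H: "(H has_vector_derivative G r) (at r within {- d..d})" if "r \<in> {- d..d}" for r
    unfolding H_def using integral_has_vector_derivative[OF G that] .
  have eq: "r *\<^sub>R integral {0..1} (\<lambda>\<sigma>. G (r * \<sigma>)) = H r - H 0" if r: "r \<in> {- d..d}" for r
  proof -
    have im: "r * \<sigma> \<in> {- d..d}" if "\<sigma> \<in> {0..1}" for \<sigma>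
    proof -
      have "\<bar>r * \<sigma>\<bar> \<le> d * 1"
        unfolding abs_mult using that r by (intro mult_mono) auto
      then show ?thesis by auto
    qed
    have "((\<lambda>\<sigma>. H (r * \<sigma>)) has_vector_derivative r *\<^sub>R G (r * \<sigma>)) (at \<sigma> within {0..1})" if "\<sigma> \<in> {0..1}" for \<sigma>
    proof -
      have 1: "((\<lambda>\<sigma>. r * \<sigma>) has_vector_derivative r) (at \<sigma> within {0..1})"
        by (auto intro!: derivative_eq_intros)
      have 2: "(H has_vector_derivative G (r * \<sigma>)) (at (r * \<sigma>) within (\<lambda>\<sigma>. r * \<sigma>) ` {0..1})"
        by (rule has_vector_derivative_within_subset[OF H[OF im[OF that]]]) (use im in blast)
      show ?thesis using vector_diff_chain_within[OF 1 2] by (simp add: o_def)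
    qed
    then have "((\<lambda>\<sigma>. r *\<^sub>R G (r * \<sigma>)) has_integral (H (r * 1) - H (r * 0))) {0..1}"
      by (intro fundamental_theorem_of_calculus) auto
    from integral_unique[OF this] show ?thesis by (simp only: integral_cmul mult_1_right mult_zero_right)
  qed
  have "((\<lambda>r. H r - H 0) has_vector_derivative G r) (at r within {- d..d})"
    using has_vector_derivative_diff[OF H[OF r] has_vector_derivative_const] by simp
  then show ?thesis
    by (rule has_vector_derivative_transform[OF r, rotated]) (rule eq)
qed

text \<open>Picard's contraction, run on functions of the parameter and the time together, so that
  continuous dependence on \<open>x\<close> comes with existence. The product d L is the contraction
  constant.\<close>

lemma param_ode_exists:
  fixes f :: "('x::euclidean_space \<times> real) \<Rightarrow> 'y::euclidean_space \<Rightarrow> 'y"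
  assumes S: "compact S" "convex S" "S \<noteq> {}" and d: "0 < d" "0 \<le> L" "d * L \<le> 1/2"
    and cont: "continuous_on ((S \<times> {- d..d}) \<times> UNIV) (\<lambda>(p, y). f p y)"
    and lip: "\<And>p y y'. p \<in> S \<times> {- d..d} \<Longrightarrow> norm (f p y - f p y') \<le> L * norm (y - y')"
  obtains y where "continuous_on (S \<times> {- d..d}) y" "\<And>x. x \<in> S \<Longrightarrow> y (x, 0) = 0"
    "\<And>x r. x \<in> S \<Longrightarrow> r \<in> {- d..d} \<Longrightarrow>
       ((\<lambda>r. y (x, r)) has_vector_derivative f (x, r) (y (x, r))) (at r within {- d..d})"
proof -
  define K where "K = S \<times> {- d..d}"
  have K: "compact K" "convex K" "K \<noteq> {}" "closed K"
    using S d by (auto simp: K_def intro!: compact_Times convex_Times compact_imp_closed)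
  \<comment> \<open>Bounded continuous functions live on the whole type, whereas \<open>Q\<close> is
    controlled only on \<open>K\<close>. Precomposition with the nearest-point projection extends
    \<open>Q w\<close> to all points without changing it on \<open>K\<close>.\<close>
  define c where "c = closest_point K"
  have cK: "c p \<in> K" for p unfolding c_def using closest_point_in_set[OF K(4,3)] .
  have c_id: "c p = p" if "p \<in> K" for p unfolding c_def using closest_point_self[OF that] .
  have c_cont: "continuous_on UNIV c"
    unfolding c_def using continuous_on_closest_point[OF K(2,4,3)] .
  define Q where "Q w p = snd p *\<^sub>R integral {0..1} (\<lambda>\<sigma>. f (fst p, snd p * \<sigma>) (w (fst p, snd p * \<sigma>)))"
    for w :: "'x \<times> real \<Rightarrow> 'y" and p
  have in_K: "(fst p, snd p * \<sigma>) \<in> K" if "p \<in> K" "\<sigma> \<in> {0..1}" for p \<sigma>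
  proof -
    have "\<bar>snd p * \<sigma>\<bar> \<le> d * 1"
      unfolding abs_mult using that by (intro mult_mono) (auto simp: K_def)
    then show ?thesis using that by (auto simp: K_def)
  qed
  have integrand: "continuous_on (K \<times> {0..1}) (\<lambda>(p, \<sigma>). f (fst p, snd p * \<sigma>) (w (fst p, snd p * \<sigma>)))"
    if "continuous_on UNIV w" for w :: "'x \<times> real \<Rightarrow> 'y"
  proof -
    have "continuous_on (K \<times> {0..1}) (\<lambda>q. ((fst (fst q), snd (fst q) * snd q), w (fst (fst q), snd (fst q) * snd q)))"
      by (intro continuous_intros continuous_on_compose2[OF that]) auto
    from continuous_on_compose2[OF cont this] show ?thesis
      using in_K unfolding case_prod_beta K_def by (force simp: case_prod_beta)
  qed
  have Qcont: "continuous_on K (Q w)" if "continuous_on UNIV w" for w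
    unfolding Q_def using integral_continuous_on_param[of K 0 "1::real"] integrand[OF that]
    by (intro continuous_intros) auto
  have QB: "(\<lambda>p. Q w (c p)) \<in> bcontfun" if "continuous_on UNIV w" for w
  proof -
    have "continuous_on UNIV (\<lambda>p. Q w (c p))"
      by (rule continuous_on_compose2[OF Qcont[OF that] c_cont]) (use cK in auto)
    moreover have "range (\<lambda>p. Q w (c p)) \<subseteq> Q w ` K" using cK by auto
    ultimately show ?thesis
      unfolding bcontfun_def using bounded_subset compact_imp_bounded
        compact_continuous_image[OF Qcont[OF that] K(1)] by blast
  qed
  define T where "T w = Bcontfun (\<lambda>p. Q (apply_bcontfun w) (c p))" for w
  have T: "apply_bcontfun (T w) p = Q (apply_bcontfun w) (c p)" for w p
    unfolding T_def using Bcontfun_inverse[OF QB[of "apply_bcontfun w"]] by simp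
  have "dist (T w) (T w') \<le> 1/2 * dist w w'" for w w'
  proof (rule dist_bound)
    fix p
    define q where "q = c p"
    have q: "q \<in> K" using cK q_def by simp
    define a where "a w \<sigma> = f (fst q, snd q * \<sigma>) (apply_bcontfun w (fst q, snd q * \<sigma>))" for w \<sigma>
    have ac: "continuous_on {0..1} (a w)" for w
    proof -
      have "continuous_on {0..1} (\<lambda>\<sigma>. (q, \<sigma>))" by (intro continuous_intros)
      from continuous_on_compose2[OF integrand[of "apply_bcontfun w"] this] q
      show ?thesis by (auto simp: a_def)
    qed
    have ab: "norm (a w \<sigma> - a w' \<sigma>) \<le> L * dist w w'" if "\<sigma> \<in> {0..1}" for \<sigma>
    proof -
      have "norm (a w \<sigma> - a w' \<sigma>) \<le> L * norm (apply_bcontfun w (fst q, snd q * \<sigma>) - apply_bcontfun w' (fst q, snd q * \<sigma>))"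
        unfolding a_def using lip in_K[OF q that] by (auto simp: K_def)
      also have "\<dots> \<le> L * dist w w'"
        using dist_bounded[of w _ w'] d by (intro mult_left_mono) (auto simp: dist_norm)
      finally show ?thesis .
    qed
    have "dist (T w p) (T w' p) = norm (snd q *\<^sub>R (integral {0..1} (a w) - integral {0..1} (a w')))"
      by (simp add: T Q_def q_def[symmetric] a_def[abs_def] dist_norm scaleR_diff_right)
    also have "\<dots> = \<bar>snd q\<bar> * norm (integral {0..1} (\<lambda>\<sigma>. a w \<sigma> - a w' \<sigma>))"
      using integral_diff[of "a w" "{0..1}" "a w'"] integrable_continuous_real[OF ac] by simp
    also have "\<dots> \<le> d * (L * dist w w' * (1 - 0))"
      using q d ab ac by (intro mult_mono integral_bound continuous_on_diff) (auto simp: K_def)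
    also have "\<dots> \<le> 1/2 * dist w w'"
      using mult_right_mono[OF d(3), of "dist w w'"] by (simp add: mult.assoc)
    finally show "dist (T w p) (T w' p) \<le> 1/2 * dist w w'" .
  qed
  then obtain w where w: "T w = w"
    using banach_fix_type[of "1/2" T] by auto
  have wK: "apply_bcontfun w p = Q (apply_bcontfun w) p" if "p \<in> K" for p
    using T[of w p] w c_id[OF that] by simp
  show thesis
  proof (rule that[of "apply_bcontfun w"])
    show "apply_bcontfun w (x, 0) = 0" if "x \<in> S" for x
      using wK[of "(x, 0)"] that d by (auto simp: Q_def K_def)
    fix x r assume x: "x \<in> S" and r: "r \<in> {- d..d}"
    have "continuous_on {- d..d} (\<lambda>r. ((x, r), apply_bcontfun w (x, r)))"
      by (intro continuous_intros continuous_on_compose2[OF continuous_on_apply_bcontfun[of UNIV]]) auto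
    from continuous_on_compose2[OF cont this]
    have "continuous_on {- d..d} (\<lambda>r. f (x, r) (apply_bcontfun w (x, r)))" using x by auto
    from scaled_integral_has_vector_derivative[OF this r]
    show "((\<lambda>r. apply_bcontfun w (x, r)) has_vector_derivative f (x, r) (apply_bcontfun w (x, r))) (at r within {- d..d})"
      by (rule has_vector_derivative_transform[OF r, rotated])
        (use wK x in \<open>auto simp: Q_def K_def\<close>)
  qed auto
qed

section \<open>Estimates for C^1 functions that are uniform on compact sets\<close>

lemma Ck_on_derivative_uniformly_continuous:
  fixes f :: "'a::euclidean_space \<Rightarrow> 'b::euclidean_space"
  assumes "open \<Omega>" "Ck_on 1 \<Omega> f" "compact K" "K \<subseteq> \<Omega>" "0 < e"
  obtains \<eta> where "0 < \<eta>" "\<And>a b v. a \<in> K \<Longrightarrow> b \<in> K \<Longrightarrow> dist b a < \<eta> \<Longrightarrow>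
     norm (frechet_derivative f (at b) v - frechet_derivative f (at a) v) \<le> e * norm v"
proof -
  let ?D = "\<lambda>x v. frechet_derivative f (at x) v"
  \<comment> \<open>Every basis direction receives an equal share of the error.\<close>
  define e' where "e' = e / DIM('a)"
  have e': "e' > 0" using assms(5) by (simp add: e'_def)
  have C: "Ck_on (Suc 0) \<Omega> f" using assms(2) by simp
  have "\<exists>\<eta>>0. \<forall>a\<in>K. \<forall>b\<in>K. dist b a < \<eta> \<longrightarrow> dist (?D b i) (?D a i) < e'" for i
  proof -
    have "continuous_on K (\<lambda>x. ?D x i)" using C assms(4) by (auto intro: continuous_on_subset)
    from compact_uniformly_continuous[OF this assms(3)] e' show ?thesis
      unfolding uniformly_continuous_on_def by blast
  qed
  then obtain \<eta> where \<eta>: "\<And>i. \<eta> i > 0"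
    "\<And>i a b. a \<in> K \<Longrightarrow> b \<in> K \<Longrightarrow> dist b a < \<eta> i \<Longrightarrow> dist (?D b i) (?D a i) < e'" by metis
  show thesis
  proof (rule that[of "Min (\<eta> ` Basis)"])
    show "0 < Min (\<eta> ` Basis)" using \<eta>(1) by (subst Min_gr_iff) auto
    fix a b v assume ab: "a \<in> K" "b \<in> K" "dist b a < Min (\<eta> ` Basis)"
    have lin: "linear (?D x)" if "x \<in> K" for x
      using has_derivative_linear[OF Ck_on_has_derivative[OF C]] that assms(4) by blast
    have "norm (?D b v - ?D a v) = norm (\<Sum>i\<in>Basis. (v \<bullet> i) *\<^sub>R (?D b i - ?D a i))"
      using linear_basis_expand[OF lin[OF ab(1)], of v] linear_basis_expand[OF lin[OF ab(2)], of v]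
      by (simp add: sum_subtractf scaleR_diff_right)
    also have "\<dots> \<le> (\<Sum>i\<in>(Basis :: 'a set). norm v * e')"
    proof (rule sum_norm_le)
      fix i :: 'a assume i: "i \<in> Basis"
      have "dist (?D b i) (?D a i) < e'" using \<eta>(2)[OF ab(1,2), of i] ab(3) i by simp
      then show "norm ((v \<bullet> i) *\<^sub>R (?D b i - ?D a i)) \<le> norm v * e'"
        using Basis_le_norm[OF i, of v] e' by (auto simp: dist_norm intro!: mult_mono)
    qed
    also have "\<dots> = e * norm v" by (simp add: e'_def)
    finally show "norm (?D b v - ?D a v) \<le> e * norm v" .
  qed
qed

text \<open>The estimate is uniform in \<open>a\<close>, while \<open>b\<close> may leave
  \<open>K\<close>. Hence \<open>K\<close> is first thickened to a compact union of balls inside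
  \<open>\<Omega>\<close>, on which the derivative is uniformly continuous.\<close>

lemma Ck_on_uniformly_differentiable:
  fixes f :: "'a::euclidean_space \<Rightarrow> 'b::euclidean_space"
  assumes "open \<Omega>" "Ck_on 1 \<Omega> f" "compact K" "K \<subseteq> \<Omega>" "0 < e"
  obtains \<eta> where "0 < \<eta>" "\<And>a b. a \<in> K \<Longrightarrow> norm (b - a) < \<eta> \<Longrightarrow>
     norm (f b - f a - frechet_derivative f (at a) (b - a)) \<le> e * norm (b - a)"
proof -
  obtain r where r: "r > 0" "(\<Union>x\<in>K. cball x r) \<subseteq> \<Omega>"
    using compact_subset_open_imp_cball_epsilon_subset[OF assms(3,1,4)] .
  obtain \<eta> where \<eta>: "\<eta> > 0" "\<And>a b v. a \<in> (\<Union>x\<in>K. cball x r) \<Longrightarrow> b \<in> (\<Union>x\<in>K. cball x r) \<Longrightarrow> dist b a < \<eta> \<Longrightarrow>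
     norm (frechet_derivative f (at b) v - frechet_derivative f (at a) v) \<le> e * norm v"
    using Ck_on_derivative_uniformly_continuous[OF assms(1,2) compact_minkowski_sum_cball[OF assms(3), of r] r(2) assms(5)] by blast
  show thesis
  proof (rule that[of "min r \<eta>"])
    show "0 < min r \<eta>" using r \<eta> by simp
    fix a b assume a: "a \<in> K" and b: "norm (b - a) < min r \<eta>"
    let ?S = "ball a (min r \<eta>)"
    have S: "x \<in> (\<Union>x\<in>K. cball x r)" if "x \<in> ?S" for x using that a by (auto intro!: bexI[of _ a])
    have C: "Ck_on (Suc 0) \<Omega> f" using assms(2) by simp
    have "norm (f b - f a - frechet_derivative f (at a) (b - a)) \<le> norm (b - a) * e"
    proof (rule differentiable_bound_linearization[where S = ?S and f' = "\<lambda>x. frechet_derivative f (at x)"])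
      show "a + t *\<^sub>R (b - a) \<in> ?S" if "t \<in> {0..1}" for t
      proof -
        have "norm (t *\<^sub>R (b - a)) \<le> 1 * norm (b - a)" 
          unfolding norm_scaleR using that by (intro mult_right_mono) auto
        then show ?thesis using b by (simp add: dist_norm)
      qed
      show "(f has_derivative frechet_derivative f (at x)) (at x within ?S)" if "x \<in> ?S" for x
        using Ck_on_has_derivative[OF C] S[OF that] r(2) by (blast intro: has_derivative_at_withinI)
      show "onorm (frechet_derivative f (at x) - frechet_derivative f (at a)) \<le> e" if "x \<in> ?S" for x
        by (rule onorm_le) (use \<eta>(2)[of a x] S[OF that] S[of a] that r \<eta> in \<open>auto simp: dist_commute\<close>)
      show "a \<in> ?S" using r \<eta> by simp
    qed
    then show "norm (f b - f a - frechet_derivative f (at a) (b - a)) \<le> e * norm (b - a)"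
      by (simp add: mult.commute)
  qed
qed

lemma Ck_on_derivative_bounded:
  fixes f :: "'a::euclidean_space \<Rightarrow> 'b::euclidean_space"
  assumes "Ck_on 1 \<Omega> f" "compact K" "K \<subseteq> \<Omega>"
  obtains L where "0 \<le> L" "\<And>a v. a \<in> K \<Longrightarrow> norm (frechet_derivative f (at a) v) \<le> L * norm v"
proof -
  let ?D = "\<lambda>x v. frechet_derivative f (at x) v"
  have C: "Ck_on (Suc 0) \<Omega> f" using assms(1) by simp
  have "\<exists>B\<ge>0. \<forall>a\<in>K. norm (?D a i) \<le> B" for i
  proof -
    have "continuous_on K (\<lambda>x. ?D x i)" using C assms(3) by (auto intro: continuous_on_subset)
    from compact_imp_bounded[OF compact_continuous_image[OF this assms(2)]]
    obtain B where "\<And>a. a \<in> K \<Longrightarrow> norm (?D a i) \<le> B" unfolding bounded_iff by auto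
    then show ?thesis by (intro exI[of _ "max B 0"]) (auto intro: le_max_iff_disj[THEN iffD2])
  qed
  then obtain B where B: "\<And>i. B i \<ge> 0" "\<And>i a. a \<in> K \<Longrightarrow> norm (?D a i) \<le> B i" by metis
  show thesis
  proof (rule that[of "\<Sum>i\<in>Basis. B i"])
    show "0 \<le> (\<Sum>i\<in>Basis. B i)" using B(1) by (simp add: sum_nonneg)
    fix a v assume a: "a \<in> K"
    have lin: "linear (?D a)"
      using has_derivative_linear[OF Ck_on_has_derivative[OF C]] a assms(3) by blast
    have "norm (?D a v) = norm (\<Sum>i\<in>Basis. (v \<bullet> i) *\<^sub>R ?D a i)"
      using linear_basis_expand[OF lin, of v] by simp
    also have "\<dots> \<le> (\<Sum>i\<in>Basis. B i * norm v)"
    proof (rule sum_norm_le)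
      fix i :: 'a assume i: "i \<in> Basis"
      have "\<bar>v \<bullet> i\<bar> * norm (?D a i) \<le> norm v * B i"
        using Basis_le_norm[OF i, of v] B a by (intro mult_mono) auto
      then show "norm ((v \<bullet> i) *\<^sub>R ?D a i) \<le> B i * norm v" by (simp add: mult.commute)
    qed
    finally show "norm (?D a v) \<le> (\<Sum>i\<in>Basis. B i) * norm v" by (simp add: sum_distrib_right)
  qed
qed


text \<open>Reads the derivative in the second variable off a joint derivative. It serves to bound
  the variational equation without computing its derivative in the other variables.\<close>

lemma has_derivative_affine_partial:
  assumes f: "(f has_derivative f') (at (p, z))"
    and g: "((\<lambda>w. f (p, w)) has_derivative g') (at z)"
  shows "f' (0, w) = g' w"
proof -
  have "((\<lambda>w. (p, w)) has_derivative (\<lambda>w. (0, w))) (at z)"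
    by (auto intro!: derivative_eq_intros)
  from has_derivative_compose[OF this f] g show ?thesis
    using has_derivative_unique by metis
qed

text \<open>The interval is kept short, \<open>d * L \<le> 1/2\<close>, so that the linear equation for the
  error term can be absorbed instead of invoking Gronwall's inequality. The constant \<open>L\<close> bounds only
  the derivative in the unknown, and is therefore the same for the variational equation, which makes
  the induction in \<open>param_ode_Ck\<close> possible.\<close>

lemma param_ode_has_derivative:
  fixes f :: "('x::euclidean_space \<times> real) \<times> 'y::euclidean_space \<Rightarrow> 'y" and y :: "'x \<times> real \<Rightarrow> 'y"
    and z :: "'x \<Rightarrow> 'x \<times> real \<Rightarrow> 'y"
  assumes \<Omega>: "open \<Omega>" "Ck_on 1 \<Omega> f"
    and d: "0 < d" "0 \<le> L" "d * L \<le> 1/2"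
    and y: "continuous_on (cball x1 \<rho> \<times> {- d..d}) y"
      "\<And>x r. x \<in> cball x1 \<rho> \<Longrightarrow> r \<in> {- d..d} \<Longrightarrow> ((x, r), y (x, r)) \<in> \<Omega>"
      "\<And>x r. x \<in> cball x1 \<rho> \<Longrightarrow> r \<in> {- d..d} \<Longrightarrow>
         ((\<lambda>r. y (x, r)) has_vector_derivative f ((x, r), y (x, r))) (at r within {- d..d})"
      "\<And>x. x \<in> cball x1 \<rho> \<Longrightarrow> y (x, 0) = 0"
    and L: "\<And>x r w. x \<in> cball x1 \<rho> \<Longrightarrow> r \<in> {- d..d} \<Longrightarrow>
         norm (frechet_derivative f (at ((x, r), y (x, r))) (0, w)) \<le> L * norm w"
    and z: "\<And>e. e \<in> Basis \<Longrightarrow> continuous_on (cball x1 \<rho> \<times> {- d..d}) (z e)"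
      "\<And>e x. e \<in> Basis \<Longrightarrow> x \<in> cball x1 \<rho> \<Longrightarrow> z e (x, 0) = 0"
      "\<And>e x r. e \<in> Basis \<Longrightarrow> x \<in> cball x1 \<rho> \<Longrightarrow> r \<in> {- d..d} \<Longrightarrow>
         ((\<lambda>r. z e (x, r)) has_vector_derivative
            frechet_derivative f (at ((x, r), y (x, r))) ((e, 0), z e (x, r))) (at r within {- d..d})"
    and x: "x \<in> ball x1 \<rho>" and r: "r \<in> {- d..d}"
  shows "((\<lambda>x. y (x, r)) has_derivative (\<lambda>h. \<Sum>e\<in>Basis. (h \<bullet> e) *\<^sub>R z e (x, r))) (at x)"
proof -
  \<comment> \<open>The candidate for the derivative: the variational equation is linear, so its
    solutions for the basis directions combine to the solution for the direction
    \<open>h\<close>.\<close>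
  define Z where "Z \<tau> h = (\<Sum>e\<in>Basis. (h \<bullet> e) *\<^sub>R z e (x, \<tau>))" for \<tau> h
  let ?D = "\<lambda>\<tau>. frechet_derivative f (at ((x, \<tau>), y (x, \<tau>)))"
  have xc: "x \<in> cball x1 \<rho>" using x by auto
  have C: "Ck_on (Suc 0) \<Omega> f" using \<Omega>(2) by simp
  have lin: "linear (?D \<tau>)" if "\<tau> \<in> {- d..d}" for \<tau>
    by (rule has_derivative_linear[OF Ck_on_has_derivative[OF C y(2)[OF xc that]]])
  have linZ: "bounded_linear (Z \<tau>)" for \<tau>
    unfolding Z_def by (intro bounded_linear_sum bounded_linear_compose[OF bounded_linear_scaleR_left] bounded_linear_inner_left)
  have Z0: "Z 0 h = 0" for h unfolding Z_def using z(2) xc by simp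
  have Zd: "((\<lambda>\<tau>. Z \<tau> h) has_vector_derivative ?D \<tau> ((h, 0), Z \<tau> h)) (at \<tau> within {- d..d})"
    if \<tau>: "\<tau> \<in> {- d..d}" for \<tau> h
  proof -
    have "((h, 0), Z \<tau> h) = (\<Sum>e\<in>Basis. (h \<bullet> e) *\<^sub>R ((e, 0::real), z e (x, \<tau>)))"
      by (simp add: Z_def prod_eq_iff fst_sum snd_sum euclidean_representation)
    then have "?D \<tau> ((h, 0), Z \<tau> h) = ?D \<tau> (\<Sum>e\<in>Basis. (h \<bullet> e) *\<^sub>R ((e, 0), z e (x, \<tau>)))"
      by (rule arg_cong)
    also have "\<dots> = (\<Sum>e\<in>Basis. (h \<bullet> e) *\<^sub>R ?D \<tau> ((e, 0), z e (x, \<tau>)))"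
      using lin[OF \<tau>] by (simp add: linear_sum linear_scale del: scaleR_Pair)
    finally show ?thesis unfolding Z_def
      by (auto intro!: has_vector_derivative_sum bounded_linear.has_vector_derivative[OF bounded_linear_scaleR_right] z(3) xc \<tau>)
  qed
  obtain C where C: "C \<ge> 0" "\<And>\<tau> h. \<tau> \<in> {- d..d} \<Longrightarrow> norm (Z \<tau> h) \<le> C * norm h"
  proof -
    have "\<exists>B\<ge>0. \<forall>\<tau>\<in>{- d..d}. norm (z e (x, \<tau>)) \<le> B" if "e \<in> Basis" for e
    proof -
      have "continuous_on {- d..d} (\<lambda>\<tau>. z e (x, \<tau>))"
        using xc by (intro continuous_on_compose2[OF z(1)[OF that]] continuous_intros) auto
      from compact_imp_bounded[OF compact_continuous_image[OF this]]
      obtain B where "\<And>\<tau>. \<tau> \<in> {- d..d} \<Longrightarrow> norm (z e (x, \<tau>)) \<le> B" unfolding bounded_iff by blast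
      then show ?thesis by (intro exI[of _ "max B 0"]) (auto intro: le_max_iff_disj[THEN iffD2])
    qed
    then obtain B where B: "\<And>e. e \<in> Basis \<Longrightarrow> B e \<ge> 0"
      "\<And>e \<tau>. e \<in> Basis \<Longrightarrow> \<tau> \<in> {- d..d} \<Longrightarrow> norm (z e (x, \<tau>)) \<le> B e" by metis
    show thesis
    proof (rule that[of "\<Sum>e\<in>Basis. B e"])
      show "0 \<le> (\<Sum>e\<in>Basis. B e)" using B(1) by (simp add: sum_nonneg)
      fix \<tau> h assume \<tau>: "\<tau> \<in> {- d..d}"
      have "norm (Z \<tau> h) \<le> (\<Sum>e\<in>Basis. B e * norm h)" unfolding Z_def
      proof (rule sum_norm_le)
        fix e :: 'x assume e: "e \<in> Basis"
        have "\<bar>h \<bullet> e\<bar> * norm (z e (x, \<tau>)) \<le> norm h * B e"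
          using Basis_le_norm[OF e, of h] B[OF e] \<tau> by (intro mult_mono) auto
        then show "norm ((h \<bullet> e) *\<^sub>R z e (x, \<tau>)) \<le> B e * norm h" by (simp add: mult.commute)
      qed
      then show "norm (Z \<tau> h) \<le> (\<Sum>e\<in>Basis. B e) * norm h" by (simp add: sum_distrib_right)
    qed
  qed
  define K where "K = (\<lambda>\<tau>. ((x, \<tau>), y (x, \<tau>))) ` {- d..d}"
  have K: "compact K" unfolding K_def
    using xc by (intro compact_continuous_image continuous_intros continuous_on_compose2[OF y(1)]) auto
  have K\<Omega>: "K \<subseteq> \<Omega>" unfolding K_def using y(2) xc by auto
  have yu: "uniformly_continuous_on (cball x1 \<rho> \<times> {- d..d}) y"
    by (intro compact_uniformly_continuous[OF y(1)] compact_Times) auto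
  have main: "\<exists>\<delta>>0. \<forall>h. norm h < \<delta> \<longrightarrow> norm (y (x + h, r) - y (x, r) - Z r h) \<le> e * norm h" if e: "e > 0" for e
  proof -
    \<comment> \<open>The first entry gives d \<epsilon> \<le> 1/4, which together with d L \<le>
      1/2 leaves a quarter of the error on the left side; the second turns the remaining term 4 d
      \<epsilon> (1 + C) |h| into at most e |h|.\<close>
    define \<epsilon> where "\<epsilon> = min (1 / (4 * d)) (e / (4 * d * (1 + C)))"
    have \<epsilon>: "\<epsilon> > 0" "d * \<epsilon> \<le> 1/4" "4 * d * \<epsilon> * (1 + C) \<le> e"
    proof -
      show "\<epsilon> > 0" using d e C by (auto simp: \<epsilon>_def)
      have "d * \<epsilon> \<le> d * (1 / (4 * d))" using d by (intro mult_left_mono) (auto simp: \<epsilon>_def)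
      then show "d * \<epsilon> \<le> 1/4" using d by simp
      have "4 * d * (1 + C) * \<epsilon> \<le> 4 * d * (1 + C) * (e / (4 * d * (1 + C)))"
        using d C by (intro mult_left_mono) (auto simp: \<epsilon>_def)
      also have "\<dots> = e" using d C by (auto simp: field_simps add_nonneg_eq_0_iff)
      finally show "4 * d * \<epsilon> * (1 + C) \<le> e" by (simp add: mult.commute mult.left_commute)
    qed
    obtain \<eta> where \<eta>: "\<eta> > 0" "\<And>a b. a \<in> K \<Longrightarrow> norm (b - a) < \<eta> \<Longrightarrow>
      norm (f b - f a - frechet_derivative f (at a) (b - a)) \<le> \<epsilon> * norm (b - a)"
      using Ck_on_uniformly_differentiable[OF \<Omega> K K\<Omega> \<epsilon>(1)] by blast
    obtain \<delta>1 where \<delta>1: "\<delta>1 > 0" "\<And>p q. p \<in> cball x1 \<rho> \<times> {- d..d} \<Longrightarrow> q \<in> cball x1 \<rho> \<times> {- d..d} \<Longrightarrow>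
        dist q p < \<delta>1 \<Longrightarrow> dist (y q) (y p) < \<eta> / 2"
      using yu \<eta>(1) unfolding uniformly_continuous_on_def by (metis half_gt_zero)
    obtain \<delta>2 where \<delta>2: "\<delta>2 > 0" "ball x \<delta>2 \<subseteq> ball x1 \<rho>"
      using x openE[OF open_ball] by blast
    \<comment> \<open>One half of \<open>\<eta>\<close> is for the change of the parameter, the
      other, ensured by \<open>\<delta>1\<close>, for the change of the solution;
      \<open>\<delta>2\<close> keeps the new parameter in the ball.\<close>
    define \<delta> where "\<delta> = min (min \<delta>1 \<delta>2) (\<eta> / 2)"
    have "\<delta> > 0" using \<delta>1 \<delta>2 \<eta> by (simp add: \<delta>_def)
    moreover have "norm (y (x + h, r) - y (x, r) - Z r h) \<le> e * norm h" if h: "norm h < \<delta>" for h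
    proof -
      have xh: "x + h \<in> cball x1 \<rho>"
        using \<delta>2(2) h by (auto simp: \<delta>_def subset_iff dist_norm intro: less_imp_le)
      \<comment> \<open>The error of the linearization as a function of time. It vanishes at time 0,
        and its derivative is bounded by L + \<epsilon> times its own maximum \<open>M\<close> plus
        a term of order \<epsilon> |h|.\<close>
      define g where "g \<tau> = y (x + h, \<tau>) - y (x, \<tau>) - Z \<tau> h" for \<tau>
      define g' where "g' \<tau> = f ((x + h, \<tau>), y (x + h, \<tau>)) - f ((x, \<tau>), y (x, \<tau>)) - ?D \<tau> ((h, 0), Z \<tau> h)" for \<tau>
      have gd: "(g has_vector_derivative g' \<tau>) (at \<tau> within {- d..d})" if "\<tau> \<in> {- d..d}" for \<tau>
        unfolding g_def g'_def using that
        by (intro has_vector_derivative_diff y(3) Zd xh xc)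
      have "continuous_on {- d..d} (\<lambda>\<tau>. norm (g \<tau>))"
        using gd by (intro continuous_on_norm)
          (meson continuous_on_eq_continuous_within has_vector_derivative_continuous)
      then obtain \<tau>0 where \<tau>0: "\<tau>0 \<in> {- d..d}" "\<And>\<tau>. \<tau> \<in> {- d..d} \<Longrightarrow> norm (g \<tau>) \<le> norm (g \<tau>0)"
        using continuous_attains_sup[of "{- d..d}" "\<lambda>\<tau>. norm (g \<tau>)"] d by auto
      define M where "M = norm (g \<tau>0)"
      have "norm (g' \<tau>) \<le> L * M + \<epsilon> * ((1 + C) * norm h + M)" if \<tau>: "\<tau> \<in> {- d..d}" for \<tau>
      proof -
        let ?a = "((x, \<tau>), y (x, \<tau>))" and ?b = "((x + h, \<tau>), y (x + h, \<tau>))"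
        have gM: "norm (g \<tau>) \<le> M" using \<tau>0(2)[OF \<tau>] by (simp add: M_def)
        have ba: "?b - ?a = ((h, 0), g \<tau> + Z \<tau> h)" by (simp add: g_def)
        have yy: "g \<tau> + Z \<tau> h = y (x + h, \<tau>) - y (x, \<tau>)" by (simp add: g_def)
        have "dist (y (x + h, \<tau>)) (y (x, \<tau>)) < \<eta> / 2"
          using h by (intro \<delta>1(2)) (use xc xh \<tau> in \<open>auto simp: dist_Pair_Pair dist_norm \<delta>_def\<close>)
        then have "norm (?b - ?a) < \<eta>"
          using norm_Pair_le[of "(h, 0::real)" "g \<tau> + Z \<tau> h"] h unfolding ba yy
          by (auto simp: dist_norm \<delta>_def norm_Pair)
        from \<eta>(2)[OF _ this] \<tau> have R: "norm (f ?b - f ?a - ?D \<tau> (?b - ?a)) \<le> \<epsilon> * norm (?b - ?a)"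
          unfolding K_def by blast
        have "norm (?b - ?a) \<le> norm h + norm (g \<tau> + Z \<tau> h)"
          using norm_Pair_le[of "(h, 0::real)" "g \<tau> + Z \<tau> h"] unfolding ba by (simp add: norm_Pair)
        also have "\<dots> \<le> norm h + (M + C * norm h)"
          using gM C(2)[OF \<tau>, of h] norm_triangle_ineq[of "g \<tau>" "Z \<tau> h"] by linarith
        finally have "\<epsilon> * norm (?b - ?a) \<le> \<epsilon> * ((1 + C) * norm h + M)"
          using \<epsilon>(1) by (intro mult_left_mono) (auto simp: algebra_simps)
        moreover have "?D \<tau> (?b - ?a) = ?D \<tau> ((h, 0), Z \<tau> h) + ?D \<tau> (0, g \<tau>)"
          unfolding ba using linear_add[OF lin[OF \<tau>], of "((h, 0), Z \<tau> h)" "(0, g \<tau>)"]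
          by (simp add: add.commute zero_prod_def)
        moreover have "norm (?D \<tau> (0, g \<tau>)) \<le> L * M"
          using L[OF xc \<tau>, of "g \<tau>"] mult_left_mono[OF gM d(2)] by linarith
        ultimately show ?thesis
          using R norm_triangle_ineq[of "f ?b - f ?a - ?D \<tau> (?b - ?a)" "?D \<tau> (0, g \<tau>)"]
          unfolding g'_def by (simp add: algebra_simps)
      qed
      from vector_derivative_bound[OF gd this _ \<tau>0(1), of 0] d
      have "norm (g \<tau>0 - g 0) \<le> (L * M + \<epsilon> * ((1 + C) * norm h + M)) * \<bar>\<tau>0\<bar>" by auto
      moreover have "g 0 = 0" using y(4) xh xc Z0 by (simp add: g_def)
      moreover have "(L * M + \<epsilon> * ((1 + C) * norm h + M)) * \<bar>\<tau>0\<bar> \<le> (L * M + \<epsilon> * ((1 + C) * norm h + M)) * d"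
        using \<tau>0(1) d \<epsilon> C(1) by (intro mult_left_mono add_nonneg_nonneg mult_nonneg_nonneg) (auto simp: M_def)
      ultimately have "M \<le> (d * L) * M + (d * \<epsilon>) * M + d * \<epsilon> * (1 + C) * norm h"
        unfolding M_def by (simp add: algebra_simps)
      also have "\<dots> \<le> 1/2 * M + 1/4 * M + d * \<epsilon> * (1 + C) * norm h"
        using d \<epsilon> by (intro add_mono mult_right_mono order_refl) (auto simp: M_def)
      finally have "M \<le> (4 * d * \<epsilon> * (1 + C)) * norm h" by simp
      also have "\<dots> \<le> e * norm h" using \<epsilon>(3) by (intro mult_right_mono) auto
      finally show ?thesis using \<tau>0(2)[OF r] by (simp add: M_def g_def)
    qed
    ultimately show ?thesis by blast
  qed
  have "((\<lambda>x. y (x, r)) has_derivative Z r) (at x)"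
    unfolding has_derivative_within_alt
  proof (intro conjI linZ allI impI)
    fix e :: real assume "e > 0"
    from main[OF this] obtain \<delta> where "\<delta> > 0"
      "\<And>h. norm h < \<delta> \<Longrightarrow> norm (y (x + h, r) - y (x, r) - Z r h) \<le> e * norm h" by blast
    then show "\<exists>\<delta>>0. \<forall>x'\<in>UNIV. norm (x' - x) < \<delta> \<longrightarrow> norm (y (x', r) - y (x, r) - Z r (x' - x)) \<le> e * norm (x' - x)"
      by (metis add.commute diff_add_cancel)
  qed
  then show ?thesis unfolding Z_def .
qed


text \<open>Each induction step gains one order: the derivatives in the parameter solve the
  variational equation, whose right side is of class C^n if \<open>f\<close> is of class C^(n+1),
  and the derivative in time is \<open>f\<close> along the solution.\<close>

lemma param_ode_Ck:
  fixes f :: "('x::euclidean_space \<times> real) \<times> 'y::euclidean_space \<Rightarrow> 'y" and y :: "'x \<times> real \<Rightarrow> 'y"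
  assumes V: "open V" and \<Omega>: "open \<Omega>" "Ck_on n \<Omega> f"
    and d: "0 < d" "0 \<le> L" "d * L \<le> 1/2"
    and y: "continuous_on (V \<times> {- d<..<d}) y"
      "\<And>x r. x \<in> V \<Longrightarrow> r \<in> {- d<..<d} \<Longrightarrow> ((x, r), y (x, r)) \<in> \<Omega>"
      "\<And>x r. x \<in> V \<Longrightarrow> r \<in> {- d<..<d} \<Longrightarrow>
         ((\<lambda>r. y (x, r)) has_vector_derivative f ((x, r), y (x, r))) (at r)"
      "\<And>x. x \<in> V \<Longrightarrow> y (x, 0) = 0"
    and L: "\<And>x r w. x \<in> V \<Longrightarrow> r \<in> {- d<..<d} \<Longrightarrow> 1 \<le> n \<Longrightarrow>
         norm (frechet_derivative f (at ((x, r), y (x, r))) (0, w)) \<le> L * norm w"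
  shows "Ck_on n (V \<times> {- d<..<d}) y"
  using V \<Omega> d y L
proof (induction n arbitrary: V d \<Omega> f y)
  case 0
  then show ?case by simp
next
  case (Suc n)
  note V = Suc.prems(1) and \<Omega> = Suc.prems(2,3) and d = Suc.prems(4-6) and y = Suc.prems(7-10)
  have L: "norm (frechet_derivative f (at ((x, r), y (x, r))) (0, w)) \<le> L * norm w"
    if "x \<in> V" "r \<in> {- d<..<d}" for x r w
    using Suc.prems(11)[OF that] by simp
  let ?D = "\<lambda>p. frechet_derivative f (at (p, y p))"
  have C1: "Ck_on 1 \<Omega> f" using Ck_on_mono[OF \<Omega>(2), of 1] by simp
  have Cn: "Ck_on n (V \<times> {- d<..<d}) y"
    by (rule Suc.IH[OF V \<Omega>(1) Ck_on_SucD[OF \<Omega>(2)] d y L])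
  show ?case
  proof (rule Ck_on_local)
    fix p assume "p \<in> V \<times> {- d<..<d}"
    then obtain x1 r1 where p: "p = (x1, r1)" "x1 \<in> V" "r1 \<in> {- d<..<d}" by auto
    obtain \<rho> where \<rho>: "\<rho> > 0" "cball x1 \<rho> \<subseteq> V"
      using V p(2) open_contains_cball by blast
    \<comment> \<open>Halfway between |r1| and \<open>d\<close>: the closed interval of radius
      \<open>d1\<close> has \<open>r1\<close> in its interior and stays inside the open one, as the
      existence and derivative lemmas work on compact intervals.\<close>
    define d1 where "d1 = (d + \<bar>r1\<bar>) / 2"
    have "\<bar>r1\<bar> < d" using p(3) by auto
    then have "\<bar>r1\<bar> < d1" "0 < d1" and d1: "d1 < d" using d by (simp_all add: d1_def)
    then have d1: "0 < d1" "d1 < d" "r1 \<in> {- d1<..<d1}" by (auto simp: abs_less_iff)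
    have d1L: "d1 * L \<le> 1/2"
      using mult_right_mono[of d1 d L] d1(2) d by linarith
    let ?S = "cball x1 \<rho>" and ?U = "ball x1 \<rho> \<times> {- d1<..<d1}"
    have sub: "?S \<times> {- d1..d1} \<subseteq> V \<times> {- d<..<d}" "?U \<subseteq> ?S \<times> {- d1..d1}"
      using \<rho>(2) d1 by auto
    have oU: "open ?U" by (intro open_Times open_ball open_greaterThanLessThan)
    have yc: "continuous_on (?S \<times> {- d1..d1}) y" using continuous_on_subset[OF y(1) sub(1)] .
    have in\<Omega>: "(p, y p) \<in> \<Omega>" if "p \<in> V \<times> {- d<..<d}" for p
      using that y(2) by auto
    have lin: "linear (?D p)" if "p \<in> V \<times> {- d<..<d}" for p
      using has_derivative_linear[OF Ck_on_has_derivative[OF \<Omega>(2) in\<Omega>[OF that]]] .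
    have diff: "?D p (a, w) - ?D p (a, w') = ?D p (0, w - w')" if "p \<in> V \<times> {- d<..<d}" for p a w w'
      using linear_diff[OF lin[OF that], of "(a, w)" "(a, w')"] by (simp add: zero_prod_def)
    have Dcont: "continuous_on ((?S \<times> {- d1..d1}) \<times> UNIV) (\<lambda>(p, w). ?D p ((e, 0), w))" for e
    proof -
      have "continuous_on ((?S \<times> {- d1..d1}) \<times> UNIV)
         (\<lambda>q. \<Sum>b\<in>Basis. (((e, 0), snd q) \<bullet> b) *\<^sub>R frechet_derivative f (at (fst q, y (fst q))) b)"
      proof (intro continuous_on_sum continuous_on_scaleR continuous_intros)
        fix b :: "('x \<times> real) \<times> 'y"
        have "continuous_on \<Omega> (\<lambda>x. frechet_derivative f (at x) b)"
          using C1 unfolding One_nat_def Ck_on.simps by blast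
        then show "continuous_on ((?S \<times> {- d1..d1}) \<times> UNIV) (\<lambda>q. frechet_derivative f (at (fst q, y (fst q))) b)"
          by (rule continuous_on_compose2)
            (use in\<Omega> sub in \<open>auto intro!: continuous_intros continuous_on_compose2[OF yc]\<close>)
      qed
      then show ?thesis
        by (rule continuous_on_cong[THEN iffD1, OF refl, rotated])
          (use \<rho>(2) d1(2) in \<open>auto simp: subset_iff intro!: linear_basis_expand[OF lin, symmetric]\<close>)
    qed
    have "\<exists>z. continuous_on (?S \<times> {- d1..d1}) z \<and> (\<forall>x\<in>?S. z (x, 0) = 0) \<and>
        (\<forall>x\<in>?S. \<forall>r\<in>{- d1..d1}. ((\<lambda>r. z (x, r)) has_vector_derivative ?D (x, r) ((e, 0), z (x, r))) (at r within {- d1..d1}))"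
      for e
    proof -
      \<comment> \<open>The variational equation is linear in its unknown, so the bound on the
        derivative is already a global Lipschitz constant and no cut-off is involved.\<close>
      have lip: "norm (?D p ((e, 0), w) - ?D p ((e, 0), w')) \<le> L * norm (w - w')"
        if "p \<in> ?S \<times> {- d1..d1}" for p w w'
      proof -
        have "p \<in> V \<times> {- d<..<d}" using that sub(1) by blast
        from diff[OF this] show ?thesis using L[of "fst p" "snd p"] \<open>p \<in> V \<times> {- d<..<d}\<close> by auto
      qed
      have ne: "?S \<noteq> {}" using \<rho>(1) by simp
      show ?thesis
        by (rule param_ode_exists[OF compact_cball convex_cball ne d1(1) d(2) d1L Dcont lip]) blast+
    qed
    then obtain z where z: "\<And>e. continuous_on (?S \<times> {- d1..d1}) (z e)"
       "\<And>e x. x \<in> ?S \<Longrightarrow> z e (x, 0) = 0"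
       "\<And>e x r. x \<in> ?S \<Longrightarrow> r \<in> {- d1..d1} \<Longrightarrow>
         ((\<lambda>r. z e (x, r)) has_vector_derivative ?D (x, r) ((e, 0), z e (x, r))) (at r within {- d1..d1})"
      by metis
    have yd: "((\<lambda>r. y (x, r)) has_vector_derivative f ((x, r), y (x, r))) (at r)"
      if "x \<in> ?S" "r \<in> {- d1..d1}" for x r
      using y(3) sub(1) that by blast
    have px: "((\<lambda>x. y (x, r)) has_derivative (\<lambda>h. \<Sum>e\<in>Basis. (h \<bullet> e) *\<^sub>R z e (x, r))) (at x)"
      if x: "x \<in> ball x1 \<rho>" and r: "r \<in> {- d1..d1}" for x r
    proof (rule param_ode_has_derivative[OF \<Omega>(1) C1 d1(1) d(2) d1L yc _ _ _ _ z(1,2,3) x r])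
      show "((x, r), y (x, r)) \<in> \<Omega>" "norm (?D (x, r) (0, w)) \<le> L * norm w"
        "((\<lambda>r. y (x, r)) has_vector_derivative f ((x, r), y (x, r))) (at r within {- d1..d1})"
        if "x \<in> ?S" "r \<in> {- d1..d1}" for x r w
        using that sub(1) in\<Omega> L yd by (blast intro: has_vector_derivative_at_within)+
      show "y (x, 0) = 0" if "x \<in> ?S" for x using y(4) that \<rho>(2) by blast
    qed auto
    have in\<Omega>U: "((x, r), y (x, r)) \<in> \<Omega>" if "dist x1 x < \<rho>" "- d1 < r" "r < d1" for x r
      using that \<rho>(2) d1(2) by (intro in\<Omega>) (auto simp: subset_iff)
    have fy: "continuous_on ?U (\<lambda>p. f (p, y p))"
      by (rule continuous_on_compose2[OF Ck_on_imp_continuous_on[OF C1]])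
        (use in\<Omega>U sub in \<open>auto intro!: continuous_intros continuous_on_subset[OF yc]\<close>)
    have deriv: "(y has_derivative (\<lambda>(h, k). (\<Sum>e\<in>Basis. (h \<bullet> e) *\<^sub>R z e p) + k *\<^sub>R f (p, y p))) (at p)"
      if "p \<in> ?U" for p
    proof -
      obtain x r where p: "p = (x, r)" "x \<in> ball x1 \<rho>" "r \<in> {- d1<..<d1}" using \<open>p \<in> ?U\<close> by auto
      \<comment> \<open>Joint differentiability follows once one partial derivative is continuous as
        an operator-valued function. This role falls to the time derivative, hence
        \<open>blinfun_scaleR_left\<close>.\<close>
      have "((\<lambda>(x, r). y (x, r)) has_derivative
          (\<lambda>(h, k). (\<Sum>e\<in>Basis. (h \<bullet> e) *\<^sub>R z e (x, r)) + blinfun_scaleR_left (f ((x, r), y (x, r))) k))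
          (at (x, r) within ?U)"
      proof (rule has_derivative_partialsI)
        show "((\<lambda>x. y (x, r)) has_derivative (\<lambda>h. \<Sum>e\<in>Basis. (h \<bullet> e) *\<^sub>R z e (x, r))) (at x within ball x1 \<rho>)"
          by (rule has_derivative_at_withinI[OF px]) (use p in auto)
        show "((\<lambda>r. y (x, r)) has_derivative blinfun_apply (blinfun_scaleR_left (f ((x, r), y (x, r))))) (at r within {- d1<..<d1})"
          if "x \<in> ball x1 \<rho>" "r \<in> {- d1<..<d1}" for x r
          using yd[of x r] that
          by (auto simp: has_vector_derivative_def intro!: has_derivative_at_withinI)
        have "continuous_on ?U (\<lambda>p. blinfun_scaleR_left (f (p, y p)))"
          by (intro bounded_linear.continuous_on[OF bounded_linear_blinfun_scaleR_left] fy)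
        then show "continuous (at (x, r) within ?U) (\<lambda>(x, r). blinfun_scaleR_left (f ((x, r), y (x, r))))"
          using p(2,3) unfolding continuous_on_eq_continuous_within by (simp add: case_prod_unfold)
      qed (use p in auto)
      then show ?thesis
        using at_within_open[OF _ oU, of "(x, r)"] p by (simp add: case_prod_beta)
    qed
    \<comment> \<open>The induction hypothesis is applied to the variational equation, with
      \<open>y\<close>, already of class C^n by \<open>Cn\<close>, absorbed into its coefficients.
      The values of \<open>z e\<close> are unconstrained, whence the factor
      \<open>UNIV\<close>.\<close>
    have zC: "Ck_on n ?U (z e)" for e
    proof (rule Suc.IH[where \<Omega> = "?U \<times> UNIV" and f = "\<lambda>q. ?D (fst q) ((e, 0), snd q)"])
      show "open (ball x1 \<rho>)" "open (?U \<times> (UNIV :: 'y set))" using oU by (auto intro: open_Times)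
      have U2: "open (?U \<times> (UNIV :: 'y set))" using oU by (auto intro: open_Times)
      have yn: "Ck_on n (?U \<times> (UNIV :: 'y set)) (\<lambda>q. y (fst q))"
        by (rule Ck_on_compose[OF U2 oU Ck_on_fst[OF U2 Ck_on_ident[OF U2]] Ck_on_subset[OF Cn order.trans[OF sub(2,1)]]]) auto
      show Cf: "Ck_on n (?U \<times> UNIV) (\<lambda>q. ?D (fst q) ((e, 0), snd q))"
        by (rule Ck_on_deriv_apply[OF U2 \<Omega>(1,2)])
          (use in\<Omega>U sub in \<open>auto intro!: Ck_on_Pair Ck_on_fst Ck_on_snd Ck_on_ident Ck_on_const yn U2\<close>)
      show "0 < d1" "0 \<le> L" "d1 * L \<le> 1/2" using d1 d d1L by auto
      show "continuous_on ?U (z e)" using continuous_on_subset[OF z(1) sub(2)] .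
      show "((x, r), z e (x, r)) \<in> ?U \<times> UNIV" if "x \<in> ball x1 \<rho>" "r \<in> {- d1<..<d1}" for x r
        using that by auto
      show "((\<lambda>r. z e (x, r)) has_vector_derivative ?D (fst ((x, r), z e (x, r))) ((e, 0), snd ((x, r), z e (x, r)))) (at r)"
        if "x \<in> ball x1 \<rho>" "r \<in> {- d1<..<d1}" for x r
      proof -
        have "(at r within {- d1..d1}) = at r"
          using that(2) by (intro at_within_interior) (auto simp: interior_atLeastAtMost_real)
        then show ?thesis using z(3)[of x r e] that by simp
      qed
      show "z e (x, 0) = 0" if "x \<in> ball x1 \<rho>" for x using z(2) that by auto
      \<comment> \<open>Differentiating the variational equation in its unknown gives back the
        derivative of \<open>f\<close> in its unknown, so the constant \<open>L\<close> is
        inherited.\<close>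
      show "norm (frechet_derivative (\<lambda>q. ?D (fst q) ((e, 0), snd q)) (at ((x, r), z e (x, r))) (0, w)) \<le> L * norm w"
        if xr: "x \<in> ball x1 \<rho>" "r \<in> {- d1<..<d1}" and "1 \<le> n" for x r w
      proof -
        have p: "(x, r) \<in> ?U" "(x, r) \<in> V \<times> {- d<..<d}"
          using xr \<rho>(2) d1(2) by (auto simp: subset_iff)
        obtain m where "n = Suc m" using \<open>1 \<le> n\<close> by (cases n) auto
        with Cf have "((\<lambda>q. ?D (fst q) ((e, 0), snd q)) has_derivative
            frechet_derivative (\<lambda>q. ?D (fst q) ((e, 0), snd q)) (at ((x, r), z e (x, r)))) (at ((x, r), z e (x, r)))"
          using p(1) by (intro Ck_on_has_derivative[of m "?U \<times> UNIV"]) auto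
        moreover have "((\<lambda>w. ?D (fst ((x, r), w)) ((e, 0), snd ((x, r), w))) has_derivative (\<lambda>w. ?D (x, r) (0, w))) (at (z e (x, r)))"
        proof -
          have "((\<lambda>w. ((e, 0::real), w)) has_derivative (\<lambda>w. (0, w))) (at (z e (x, r)))"
            by (auto intro!: derivative_eq_intros)
          from bounded_linear.has_derivative[OF has_derivative_bounded_linear[OF
                 Ck_on_has_derivative[OF \<Omega>(2) in\<Omega>[OF p(2)]]] this]
          show ?thesis by simp
        qed
        ultimately have "frechet_derivative (\<lambda>q. ?D (fst q) ((e, 0), snd q)) (at ((x, r), z e (x, r))) (0, w) = ?D (x, r) (0, w)"
          by (rule has_derivative_affine_partial)
        then show ?thesis using L p(2) by auto
      qed
    qed
    have "Ck_on (Suc n) ?U y"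
    proof (rule Ck_on_SucI[OF oU deriv])
      fix v :: "'x \<times> real"
      have "Ck_on n ?U (\<lambda>p. f (p, y p))"
        by (rule Ck_on_compose[OF oU \<Omega>(1) _ Ck_on_SucD[OF \<Omega>(2)]])
          (use in\<Omega>U sub in \<open>auto intro!: Ck_on_Pair Ck_on_ident oU Ck_on_subset[OF Cn order.trans[OF sub(2,1)]]\<close>)
      then show "Ck_on n ?U (\<lambda>p. (\<lambda>(h, k). (\<Sum>e\<in>Basis. (h \<bullet> e) *\<^sub>R z e p) + k *\<^sub>R f (p, y p)) v)"
        by (cases v) (auto intro!: Ck_on_add Ck_on_sum Ck_on_scaleR Ck_on_const oU zC)
    qed
    then show "\<exists>U. open U \<and> p \<in> U \<and> Ck_on (Suc n) U y"
      using oU p \<rho> d1 by (intro exI[of _ ?U]) auto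
  qed
qed

text \<open>The equation is solved for the displacement \<Theta> - x, which starts at 0 for every x
  as \<open>param_ode_exists\<close> requires. Projecting its argument to a ball makes the field
  globally Lipschitz, and on a short interval no solution leaves the ball.\<close>

theorem local_flow_exists:
  fixes Y :: "'a::euclidean_space \<Rightarrow> 'a"
  assumes \<Omega>: "open \<Omega>" "\<And>n. Ck_on n \<Omega> Y" "x0 \<in> \<Omega>"
  obtains V d \<Theta> where "open V" "x0 \<in> V" "0 < d" "\<And>n. Ck_on n (V \<times> {- d<..<d}) \<Theta>"
    "\<And>x r. x \<in> V \<Longrightarrow> r \<in> {- d<..<d} \<Longrightarrow> \<Theta> (x, r) \<in> \<Omega>"
    "\<And>x r. x \<in> V \<Longrightarrow> r \<in> {- d<..<d} \<Longrightarrow> ((\<lambda>r. \<Theta> (x, r)) has_vector_derivative Y (\<Theta> (x, r))) (at r)"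
    "\<And>x. x \<in> V \<Longrightarrow> \<Theta> (x, 0) = x"
proof -
  obtain R' where R': "R' > 0" "cball x0 R' \<subseteq> \<Omega>" using \<Omega>(1,3) open_contains_cball by blast
  \<comment> \<open>Start points lie within \<open>R\<close> of \<open>x0\<close> and move by at
    most d B \<le> R, so the solutions remain in the ball of radius 2 R.\<close>
  define R where "R = R' / 2"
  let ?C = "cball x0 (2 * R)"
  have R: "R > 0" "?C \<subseteq> \<Omega>" using R' by (auto simp: R_def)
  have Yc: "continuous_on ?C Y"
    using continuous_on_subset[OF Ck_on_imp_continuous_on[OF \<Omega>(2)] R(2)] .
  obtain B where B: "B > 0" "\<And>x. x \<in> ?C \<Longrightarrow> norm (Y x) \<le> B"
    using compact_imp_bounded[OF compact_continuous_image[OF Yc compact_cball]]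
    unfolding bounded_pos by auto
  obtain L where L: "0 \<le> L" "\<And>a v. a \<in> ?C \<Longrightarrow> norm (frechet_derivative Y (at a) v) \<le> L * norm v"
    using Ck_on_derivative_bounded[OF \<Omega>(2) compact_cball R(2)] by blast
  have lip: "norm (Y a - Y b) \<le> L * norm (a - b)" if "a \<in> ?C" "b \<in> ?C" for a b
  proof (rule differentiable_bound[OF convex_cball _ _ that])
    show "(Y has_derivative frechet_derivative Y (at x)) (at x within ?C)" if "x \<in> ?C" for x
      using Ck_on_has_derivative[OF \<Omega>(2)[of "Suc 0"], of x] R(2) that by (blast intro: has_derivative_at_withinI)
    show "onorm (frechet_derivative Y (at x)) \<le> L" if "x \<in> ?C" for x
      using L(2)[OF that] by (intro onorm_le) auto
  qed
  \<comment> \<open>The first entry limits the distance travelled, the second ensures d L \<le> 1/2;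
    writing L + 1 avoids a division by zero.\<close>
  define d where "d = min (R / B) (1 / (2 * (L + 1)))"
  have d: "0 < d" "d * L \<le> 1/2" "d * B \<le> R"
  proof -
    show "0 < d" using R B L by (simp add: d_def)
    have "d * L \<le> 1 / (2 * (L + 1)) * L" using L by (intro mult_right_mono) (auto simp: d_def)
    also have "\<dots> \<le> 1/2" using L by (simp add: field_simps)
    finally show "d * L \<le> 1/2" .
    have "d * B \<le> R / B * B" using B by (intro mult_right_mono) (auto simp: d_def)
    then show "d * B \<le> R" using B by simp
  qed
  define c where "c = closest_point ?C"
  have C: "closed ?C" "?C \<noteq> {}" "convex ?C" using R by auto
  have c: "c x \<in> ?C" "x \<in> ?C \<Longrightarrow> c x = x" for x
    unfolding c_def using closest_point_in_set[OF C(1,2)] closest_point_self by blast+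
  let ?f = "\<lambda>(p :: 'a \<times> real) w. Y (c (fst p + w))"
  have fc: "continuous_on ((cball x0 R \<times> {- d..d}) \<times> UNIV) (\<lambda>(p, w). ?f p w)"
  proof -
    have "continuous_on UNIV c" unfolding c_def by (rule continuous_on_closest_point[OF C(3,1,2)])
    then have "continuous_on ((cball x0 R \<times> {- d..d}) \<times> UNIV) (\<lambda>q. c (fst (fst q) + snd q))"
      by (rule continuous_on_compose2) (auto intro!: continuous_intros)
    then have "continuous_on ((cball x0 R \<times> {- d..d}) \<times> UNIV) (\<lambda>q. Y (c (fst (fst q) + snd q)))"
      by (rule continuous_on_compose2[OF Yc]) (use c(1) in blast)
    then show ?thesis by (simp add: case_prod_beta)
  qed
  have fl: "norm (?f p w - ?f p w') \<le> L * norm (w - w')" for p w w'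
  proof -
    have "norm (?f p w - ?f p w') \<le> L * dist (c (fst p + w)) (c (fst p + w'))"
      unfolding dist_norm by (intro lip c(1))
    also have "\<dots> \<le> L * dist (fst p + w) (fst p + w')"
      unfolding c_def by (intro mult_left_mono closest_point_lipschitz C L)
    finally show ?thesis by (simp add: dist_norm)
  qed
  have ne: "cball x0 R \<noteq> {}" using R by simp
  obtain w where w: "continuous_on (cball x0 R \<times> {- d..d}) w" "\<And>x. x \<in> cball x0 R \<Longrightarrow> w (x, 0) = 0"
    "\<And>x r. x \<in> cball x0 R \<Longrightarrow> r \<in> {- d..d} \<Longrightarrow>
       ((\<lambda>r. w (x, r)) has_vector_derivative Y (c (x + w (x, r)))) (at r within {- d..d})"
    using param_ode_exists[OF compact_cball convex_cball ne d(1) L(1) d(2) fc fl] by auto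
  have wC: "x + w (x, r) \<in> ?C" if "x \<in> cball x0 R" "r \<in> {- d..d}" for x r
  proof -
    have "norm (w (x, r) - w (x, 0)) \<le> B * \<bar>r - 0\<bar>"
      by (rule vector_derivative_bound[of "- d" d _ "\<lambda>r. Y (c (x + w (x, r)))"]) (use w(3) B c that d in auto)
    also have "\<dots> \<le> B * d" using that B by (intro mult_left_mono) auto
    finally have "norm (w (x, r)) \<le> R" using w(2)[OF that(1)] d(3) by (simp add: mult.commute)
    then show ?thesis
      using that(1) norm_triangle_ineq4[of "x0 - x" "w (x, r)"] by (simp add: dist_norm diff_diff_eq)
  qed
  let ?V = "ball x0 R"
  have Vd: "open (?V \<times> {- d<..<d})" by (intro open_Times open_ball open_greaterThanLessThan)
  have o': "open ((\<lambda>q :: ('a \<times> real) \<times> 'a. fst (fst q) + snd q) -` \<Omega>)"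
    by (intro open_vimage \<Omega>(1) continuous_intros)
  have bl: "bounded_linear (\<lambda>q :: ('a \<times> real) \<times> 'a. fst (fst q) + snd q)"
    by (intro bounded_linear_add bounded_linear_fst bounded_linear_snd bounded_linear_fst_comp)
  have wd: "((\<lambda>r. w (x, r)) has_vector_derivative Y (x + w (x, r))) (at r)"
    if "x \<in> ?V" "r \<in> {- d<..<d}" for x r
  proof -
    have "(at r within {- d..d}) = at r"
      using that(2) by (intro at_within_interior) (auto simp: interior_atLeastAtMost_real)
    then show ?thesis using w(3)[of x r] that c(2)[OF wC[of x r]] by auto
  qed
  \<comment> \<open>The nearest-point projection is not smooth, so regularity is derived from the
    unprojected equation, which the solution satisfies because it never leaves the ball.\<close>
  have Cw: "Ck_on n (?V \<times> {- d<..<d}) w" for n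
  proof (rule param_ode_Ck[OF open_ball o' _ d(1) L(1) d(2)])
    show "Ck_on n ((\<lambda>q :: ('a \<times> real) \<times> 'a. fst (fst q) + snd q) -` \<Omega>) (\<lambda>q. Y (fst (fst q) + snd q))" for n
      by (rule Ck_on_compose[OF o' \<Omega>(1) Ck_on_linear[OF bl o'] \<Omega>(2)]) auto
    show "continuous_on (?V \<times> {- d<..<d}) w" by (rule continuous_on_subset[OF w(1)]) auto
    show "((x, r), w (x, r)) \<in> (\<lambda>q. fst (fst q) + snd q) -` \<Omega>" if "x \<in> ?V" "r \<in> {- d<..<d}" for x r
      using wC[of x r] that R(2) by auto
    show "((\<lambda>r. w (x, r)) has_vector_derivative Y (fst (fst ((x, r), w (x, r))) + snd ((x, r), w (x, r)))) (at r)"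
      if "x \<in> ?V" "r \<in> {- d<..<d}" for x r using wd[OF that] by simp
    show "w (x, 0) = 0" if "x \<in> ?V" for x using w(2) that by auto
    show "norm (frechet_derivative (\<lambda>q. Y (fst (fst q) + snd q)) (at ((x, r), w (x, r))) (0, v)) \<le> L * norm v"
      if "x \<in> ?V" "r \<in> {- d<..<d}" for x r v
    proof -
      have a: "x + w (x, r) \<in> ?C" using wC[of x r] that by auto
      have 1: "((\<lambda>q :: ('a \<times> real) \<times> 'a. fst (fst q) + snd q) has_derivative (\<lambda>q. fst (fst q) + snd q)) (at ((x, r), w (x, r)))"
        by (rule bounded_linear_imp_has_derivative[OF bl])
      have 2: "(Y has_derivative frechet_derivative Y (at (x + w (x, r))))
          (at (fst (fst ((x, r), w (x, r))) + snd ((x, r), w (x, r))))"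
        using Ck_on_has_derivative[OF \<Omega>(2)[of "Suc 0"], of "x + w (x, r)"] a R(2) by auto
      have "((\<lambda>q. Y (fst (fst q) + snd q)) has_derivative (\<lambda>v. frechet_derivative Y (at (x + w (x, r))) (fst (fst v) + snd v)))
          (at ((x, r), w (x, r)))"
        using has_derivative_compose[OF 1 2] .
      from frechet_derivative_at[OF this, symmetric] L(2)[OF a] show ?thesis by simp
    qed
  qed
  show thesis
  proof (rule that[of ?V d "\<lambda>p. fst p + w p"])
    show "Ck_on n (?V \<times> {- d<..<d}) (\<lambda>p. fst p + w p)" for n
      by (intro Ck_on_add Ck_on_fst Ck_on_ident Vd Cw)
    show "fst (x, r) + w (x, r) \<in> \<Omega>" if "x \<in> ?V" "r \<in> {- d<..<d}" for x r
      using wC[of x r] that R(2) by auto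
    show "((\<lambda>r. fst (x, r) + w (x, r)) has_vector_derivative Y (fst (x, r) + w (x, r))) (at r)"
      if "x \<in> ?V" "r \<in> {- d<..<d}" for x r
      using has_vector_derivative_add[OF has_vector_derivative_const wd[OF that], of x] by simp
    show "fst (x, 0) + w (x, 0) = x" if "x \<in> ?V" for x using w(2)[of x] that by auto
  qed (use R d in auto)
qed

section \<open>Smooth maps on arbitrary sets\<close>

lemma smooth_onE:
  assumes "smooth_on S f" "x \<in> S"
  obtains U h where "open U" "x \<in> U" "\<forall>n. Ck_on n U h" "\<forall>y\<in>S \<inter> U. h y = f y"
proof -
  have "\<exists>U h. open U \<and> x \<in> U \<and> (\<forall>n. Ck_on n U h) \<and> (\<forall>y\<in>S \<inter> U. h y = f y)"
    using assms unfolding smooth_on_def by (rule bspec)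
  then show thesis using that by (elim exE conjE)
qed

lemma smooth_onI_open:
  assumes "open S" "\<And>n. Ck_on n S f"
  shows "smooth_on S f"
  unfolding smooth_on_def using assms by blast

lemma smooth_on_imp_Ck_on:
  assumes "open S" "smooth_on S f"
  shows "Ck_on n S f"
proof (rule Ck_on_local)
  fix x assume x: "x \<in> S"
  obtain U h where U: "open U" "x \<in> U" "\<forall>n. Ck_on n U h" "\<forall>y\<in>S \<inter> U. h y = f y"
    by (rule smooth_onE[OF assms(2) x])
  note U = U(1,2) U(3,4)[rule_format]
  have "Ck_on n (S \<inter> U) f"
    by (rule Ck_on_cong[OF open_Int[OF assms(1) U(1)] Ck_on_subset[OF U(3)]]) (use U(4) in auto)
  then show "\<exists>U. open U \<and> x \<in> U \<and> Ck_on n U f"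
    using x U(1,2) assms(1) by (intro exI[of _ "S \<inter> U"]) auto
qed

lemma smooth_on_local:
  assumes "\<And>x. x \<in> S \<Longrightarrow> \<exists>U. open U \<and> x \<in> U \<and> smooth_on (S \<inter> U) f"
  shows "smooth_on S f"
  unfolding smooth_on_def
proof
  fix x assume x: "x \<in> S"
  then obtain U where U: "open U" "x \<in> U" "smooth_on (S \<inter> U) f" using assms by blast
  have xU: "x \<in> S \<inter> U" using x U(2) by blast
  obtain V h where V: "open V" "x \<in> V" "\<forall>n. Ck_on n V h" "\<forall>y\<in>S \<inter> U \<inter> V. h y = f y"
    by (rule smooth_onE[OF U(3) xU])
  note V = V(1,2) V(3,4)[rule_format]
  have "Ck_on n (U \<inter> V) h" for n by (rule Ck_on_subset[OF V(3)]) auto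
  then show "\<exists>U h. open U \<and> x \<in> U \<and> (\<forall>n. Ck_on n U h) \<and> (\<forall>y\<in>S \<inter> U. h y = f y)"
    using U V by (intro exI[of _ "U \<inter> V"] exI[of _ h]) auto
qed

lemma smooth_on_transfer:
  assumes "smooth_on S f" "T \<subseteq> S" "\<And>x. x \<in> T \<Longrightarrow> f x = g x"
  shows "smooth_on T g"
  unfolding smooth_on_def
proof
  fix x assume "x \<in> T"
  then have x: "x \<in> S" using assms(2) by blast
  obtain U h where U: "open U" "x \<in> U" "\<forall>n. Ck_on n U h" "\<forall>y\<in>S \<inter> U. h y = f y"
    by (rule smooth_onE[OF assms(1) x])
  note U = U(1,2) U(3,4)[rule_format]
  have "\<forall>y\<in>T \<inter> U. h y = g y" using U(4) assms(2,3) by (simp add: subset_iff)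
  then show "\<exists>U h. open U \<and> x \<in> U \<and> (\<forall>n. Ck_on n U h) \<and> (\<forall>y\<in>T \<inter> U. h y = g y)"
    using U(1-3) by (intro exI[of _ U] exI[of _ h]) simp
qed

lemma smooth_on_subset: "smooth_on S f \<Longrightarrow> T \<subseteq> S \<Longrightarrow> smooth_on T f"
  by (erule smooth_on_transfer) simp_all

lemma smooth_on_cong: "smooth_on S f \<Longrightarrow> (\<And>x. x \<in> S \<Longrightarrow> f x = g x) \<Longrightarrow> smooth_on S g"
  by (erule smooth_on_transfer) simp_all

lemma smooth_on_compose:
  fixes f :: "'a::euclidean_space \<Rightarrow> 'b::euclidean_space" and g :: "'b \<Rightarrow> 'c::real_normed_vector"
  assumes "smooth_on S f" "smooth_on T g" "\<And>x. x \<in> S \<Longrightarrow> f x \<in> T"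
  shows "smooth_on S (\<lambda>x. g (f x))"
  unfolding smooth_on_def
proof
  fix x assume x: "x \<in> S"
  obtain U h where U: "open U" "x \<in> U" "\<forall>n. Ck_on n U h" "\<forall>y\<in>S \<inter> U. h y = f y"
    by (rule smooth_onE[OF assms(1) x])
  note U = U(1,2) U(3,4)[rule_format]
  obtain V k where V: "open V" "f x \<in> V" "\<forall>n. Ck_on n V k" "\<forall>y\<in>T \<inter> V. k y = g y"
    by (rule smooth_onE[OF assms(2) assms(3)[OF x]])
  note V = V(1,2) V(3,4)[rule_format]
  have o: "open (U \<inter> h -` V)"
    using continuous_open_preimage[OF Ck_on_imp_continuous_on[OF U(3)] U(1) V(1)] .
  have hx: "h x = f x" using U(2,4) x by auto
  have "Ck_on n (U \<inter> h -` V) (\<lambda>y. k (h y))" for n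
    by (rule Ck_on_compose[OF o V(1) Ck_on_subset[OF U(3)] V(3)]) auto
  moreover have "k (h y) = g (f y)" if "y \<in> S \<inter> (U \<inter> h -` V)" for y
    using that U(4)[of y] V(4)[of "f y"] assms(3)[of y] by auto
  ultimately show "\<exists>U h. open U \<and> x \<in> U \<and> (\<forall>n. Ck_on n U h) \<and> (\<forall>y\<in>S \<inter> U. h y = g (f y))"
    using o U(2) V(2) hx by (intro exI[of _ "U \<inter> h -` V"] exI[of _ "\<lambda>y. k (h y)"]) auto
qed

lemma smooth_on_imp_continuous_on: "smooth_on S f \<Longrightarrow> continuous_on S f"
  unfolding continuous_on_eq_continuous_within
proof
  fix x assume S: "smooth_on S f" and x: "x \<in> S"
  obtain U h where U: "open U" "x \<in> U" "\<forall>n. Ck_on n U h" "\<forall>y\<in>S \<inter> U. h y = f y"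
    by (rule smooth_onE[OF S x])
  note U = U(1,2) U(3,4)[rule_format]
  have "continuous (at x) h"
    using Ck_on_imp_continuous_on[OF U(3)[of 0]] U(1,2) by (simp add: continuous_on_eq_continuous_at)
  then have "continuous (at x within S) h" by (rule continuous_at_imp_continuous_at_within)
  moreover obtain d where "d > 0" "ball x d \<subseteq> U" using U(1,2) openE by blast
  ultimately show "continuous (at x within S) f"
    using U(4) x by (intro continuous_transform_within[of x S h d f]) (auto simp: dist_commute subset_iff)
qed

lemma smooth_on_const: "smooth_on S (\<lambda>x. c)"
  by (rule smooth_on_subset[OF smooth_onI_open[of UNIV]]) (auto intro: Ck_on_const)

lemma smooth_on_linear:
  fixes L :: "'a::euclidean_space \<Rightarrow> 'b::real_normed_vector"
  shows "bounded_linear L \<Longrightarrow> smooth_on S L"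
  by (rule smooth_on_subset[OF smooth_onI_open[of UNIV]]) (auto intro: Ck_on_linear)

lemma smooth_on_ident: "smooth_on S (\<lambda>x. x)"
  and smooth_on_fst: "smooth_on S1 (fst :: 'a::euclidean_space \<times> 'b::euclidean_space \<Rightarrow> _)"
  and smooth_on_snd: "smooth_on S2 (snd :: 'a::euclidean_space \<times> 'b::euclidean_space \<Rightarrow> _)"
  by (auto intro!: smooth_on_linear bounded_linear_intros)

lemma smooth_on_bilinear:
  assumes b: "bounded_bilinear b" and "smooth_on S f" "smooth_on S g"
  shows "smooth_on S (\<lambda>x. b (f x) (g x))"
  unfolding smooth_on_def
proof
  fix x assume x: "x \<in> S"
  obtain U h where U: "open U" "x \<in> U" "\<forall>n. Ck_on n U h" "\<forall>y\<in>S \<inter> U. h y = f y"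
    by (rule smooth_onE[OF assms(2) x])
  note U = U(1,2) U(3,4)[rule_format]
  obtain V k where V: "open V" "x \<in> V" "\<forall>n. Ck_on n V k" "\<forall>y\<in>S \<inter> V. k y = g y"
    by (rule smooth_onE[OF assms(3) x])
  note V = V(1,2) V(3,4)[rule_format]
  have "Ck_on n (U \<inter> V) (\<lambda>y. b (h y) (k y))" for n
    by (intro Ck_on_bilinear[OF b] open_Int U(1) V(1) Ck_on_subset[OF U(3)] Ck_on_subset[OF V(3)]) auto
  then show "\<exists>U ha. open U \<and> x \<in> U \<and> (\<forall>n. Ck_on n U ha) \<and> (\<forall>y\<in>S \<inter> U. ha y = b (f y) (g y))"
    using U V by (intro exI[of _ "U \<inter> V"] exI[of _ "\<lambda>y. b (h y) (k y)"]) auto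
qed

lemmas smooth_on_scaleR = smooth_on_bilinear[OF bounded_bilinear_scaleR]
  and smooth_on_inner = smooth_on_bilinear[OF bounded_bilinear_inner]

lemma smooth_on_Pair:
  assumes "smooth_on S f" "smooth_on S g"
  shows "smooth_on S (\<lambda>x. (f x, g x))"
  unfolding smooth_on_def
proof
  fix x assume x: "x \<in> S"
  obtain U h where U: "open U" "x \<in> U" "\<forall>n. Ck_on n U h" "\<forall>y\<in>S \<inter> U. h y = f y"
    by (rule smooth_onE[OF assms(1) x])
  note U = U(1,2) U(3,4)[rule_format]
  obtain V k where V: "open V" "x \<in> V" "\<forall>n. Ck_on n V k" "\<forall>y\<in>S \<inter> V. k y = g y"
    by (rule smooth_onE[OF assms(2) x])
  note V = V(1,2) V(3,4)[rule_format]
  have "Ck_on n (U \<inter> V) (\<lambda>y. (h y, k y))" for n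
    by (intro Ck_on_Pair open_Int U(1) V(1) Ck_on_subset[OF U(3)] Ck_on_subset[OF V(3)]) auto
  then show "\<exists>U ha. open U \<and> x \<in> U \<and> (\<forall>n. Ck_on n U ha) \<and> (\<forall>y\<in>S \<inter> U. ha y = (f y, g y))"
    using U V by (intro exI[of _ "U \<inter> V"] exI[of _ "\<lambda>y. (h y, k y)"]) auto
qed

lemma smooth_on_add:
  fixes f g :: "'a::euclidean_space \<Rightarrow> 'b::euclidean_space"
  assumes "smooth_on S f" "smooth_on S g"
  shows "smooth_on S (\<lambda>x. f x + g x)"
proof -
  have "bounded_linear (\<lambda>p :: 'b \<times> 'b. fst p + snd p)"
    by (intro bounded_linear_add bounded_linear_fst bounded_linear_snd)
  from smooth_on_compose[OF smooth_on_Pair[OF assms] smooth_on_linear[OF this, of UNIV]]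
  show ?thesis by simp
qed

lemma smooth_on_sum:
  fixes f :: "'i \<Rightarrow> 'a::euclidean_space \<Rightarrow> 'b::euclidean_space"
  shows "(\<And>i. i \<in> X \<Longrightarrow> smooth_on S (f i)) \<Longrightarrow> smooth_on S (\<lambda>x. \<Sum>i\<in>X. f i x)"
  by (induction X rule: infinite_finite_induct) (auto intro: smooth_on_const smooth_on_add)

lemma smooth_on_has_derivative_within:
  assumes "smooth_on S f" "x \<in> S"
  obtains f' where "(f has_derivative f') (at x within S)"
proof -
  obtain U h where U: "open U" "x \<in> U" "\<forall>n. Ck_on n U h" "\<forall>y\<in>S \<inter> U. h y = f y"
    by (rule smooth_onE[OF assms])
  note U = U(1,2) U(3,4)[rule_format]
  have "(h has_derivative frechet_derivative h (at x)) (at x within S)"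
    using Ck_on_has_derivative[OF U(3)[of "Suc 0"] U(2)] by (rule has_derivative_at_withinI)
  moreover obtain d where "d > 0" "ball x d \<subseteq> U" using U(1,2) openE by blast
  ultimately have "(f has_derivative frechet_derivative h (at x)) (at x within S)"
    using U(4) assms(2) by (intro has_derivative_transform_within[of h _ x S d f]) (auto simp: dist_commute subset_iff)
  then show ?thesis using that by blast
qed

text \<open>The slices in \<open>z\<close> are open, so the derivative in \<open>z\<close> is
  determined by \<open>f\<close> even at a time where \<open>D\<close> has a boundary. Every local
  extension computes it, and thereby shows that it is smooth.\<close>

lemma smooth_on_partial_derivative:
  fixes f :: "'a::euclidean_space \<times> 'b::euclidean_space \<Rightarrow> 'c::real_normed_vector"
  assumes f: "smooth_on D f" and op: "\<And>t. open {z. (z, t) \<in> D}"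
  shows "smooth_on D (\<lambda>(z, t). frechet_derivative (\<lambda>z. f (z, t)) (at z) v)"
    and "\<And>z t. (z, t) \<in> D \<Longrightarrow> (\<lambda>z. f (z, t)) differentiable (at z)"
proof -
  have main: "\<exists>U h. open U \<and> x \<in> U \<and> (\<forall>n. Ck_on n U h) \<and>
       (\<forall>(z, t)\<in>D \<inter> U. ((\<lambda>z. f (z, t)) has_derivative (\<lambda>v. frechet_derivative h (at (z, t)) (v, 0))) (at z))"
    if x: "x \<in> D" for x
  proof -
    obtain U h where U: "open U" "x \<in> U" "\<forall>n. Ck_on n U h" "\<forall>y\<in>D \<inter> U. h y = f y"
      by (rule smooth_onE[OF f x])
    note U = U(1,2) U(3,4)[rule_format]
    have "((\<lambda>z. f (z, t)) has_derivative (\<lambda>v. frechet_derivative h (at (z, t)) (v, 0))) (at z)"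
      if zt: "(z, t) \<in> D \<inter> U" for z t
    proof -
      have o: "open ({z. (z, t) \<in> D} \<inter> (\<lambda>z. (z, t)) -` U)"
        by (intro open_Int op open_vimage U(1) continuous_intros)
      have 1: "((\<lambda>z. (z, t)) has_derivative (\<lambda>v. (v, 0))) (at z)" by (auto intro!: derivative_eq_intros)
      have "((\<lambda>z. h (z, t)) has_derivative (\<lambda>v. frechet_derivative h (at (z, t)) (v, 0))) (at z)"
        using has_derivative_compose[OF 1, of h] Ck_on_has_derivative[OF U(3)[of "Suc 0"], of "(z, t)"] zt by blast
      then show ?thesis
        by (rule has_derivative_transform_within_open[OF _ o]) (use zt U(4) in auto)
    qed
    then show ?thesis using U by blast
  qed
  show "smooth_on D (\<lambda>(z, t). frechet_derivative (\<lambda>z. f (z, t)) (at z) v)"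
    unfolding smooth_on_def
  proof
    fix x assume "x \<in> D"
    from main[OF this] obtain U h where U: "open U" "x \<in> U" "\<And>n. Ck_on n U h"
       "\<And>z t. (z, t) \<in> D \<inter> U \<Longrightarrow> ((\<lambda>z. f (z, t)) has_derivative (\<lambda>v. frechet_derivative h (at (z, t)) (v, 0))) (at z)"
      by blast
    have "Ck_on n U (\<lambda>y. frechet_derivative h (at y) (v, 0))" for n
      by (rule Ck_on_SucD_deriv[OF U(3)])
    moreover have "frechet_derivative h (at y) (v, 0) = (case y of (z, t) \<Rightarrow> frechet_derivative (\<lambda>z. f (z, t)) (at z) v)"
      if "y \<in> D \<inter> U" for y
      using frechet_derivative_at[OF U(4)[of "fst y" "snd y"]] that by (auto simp: case_prod_beta dest: fun_cong)
    ultimately show "\<exists>U ha. open U \<and> x \<in> U \<and> (\<forall>n. Ck_on n U ha) \<and>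
        (\<forall>y\<in>D \<inter> U. ha y = (case y of (z, t) \<Rightarrow> frechet_derivative (\<lambda>z. f (z, t)) (at z) v))"
      using U(1,2) by blast
  qed
  show "(\<lambda>z. f (z, t)) differentiable (at z)" if "(z, t) \<in> D" for z t
  proof -
    from main[OF that] obtain U h where "(z, t) \<in> U"
      "\<And>z t. (z, t) \<in> D \<inter> U \<Longrightarrow> ((\<lambda>z. f (z, t)) has_derivative (\<lambda>v. frechet_derivative h (at (z, t)) (v, 0))) (at z)"
      by blast
    then show ?thesis using that differentiableI by blast
  qed
qed

section \<open>Smooth maps between manifolds\<close>

lemma smooth_atlasD:
  assumes "smooth_atlas A" "\<xi> \<in> A"
  shows "open (dom_chart \<xi>)" "open (coord \<xi> ` dom_chart \<xi>)"
    "continuous_on (dom_chart \<xi>) (coord \<xi>)" "continuous_on (coord \<xi> ` dom_chart \<xi>) (coord_inv \<xi>)"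
    "\<And>p. p \<in> dom_chart \<xi> \<Longrightarrow> coord_inv \<xi> (coord \<xi> p) = p"
    "\<And>z. z \<in> coord \<xi> ` dom_chart \<xi> \<Longrightarrow> coord \<xi> (coord_inv \<xi> z) = z"
    "\<And>z. z \<in> coord \<xi> ` dom_chart \<xi> \<Longrightarrow> coord_inv \<xi> z \<in> dom_chart \<xi>"
  using assms unfolding smooth_atlas_def homeomorphism_def
  by (auto simp: f_inv_into_f inv_into_into)

lemma smooth_atlas_transition:
  "smooth_atlas A \<Longrightarrow> \<xi> \<in> A \<Longrightarrow> \<eta> \<in> A \<Longrightarrow>
    smooth_on (coord \<xi> ` (dom_chart \<xi> \<inter> dom_chart \<eta>)) (\<lambda>z. coord \<eta> (coord_inv \<xi> z))"
  unfolding smooth_atlas_def comp_def by blast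

lemma chart_at:
  assumes "smooth_atlas A"
  shows "chart_at A p \<in> A" "p \<in> dom_chart (chart_at A p)"
proof -
  have "\<exists>\<xi>. \<xi> \<in> A \<and> p \<in> dom_chart \<xi>" using assms unfolding smooth_atlas_def by blast
  from someI_ex[OF this] show "chart_at A p \<in> A" "p \<in> dom_chart (chart_at A p)"
    unfolding chart_at_def by auto
qed

lemma open_coord_image:
  assumes "smooth_atlas A" "\<xi> \<in> A" "open U" "U \<subseteq> dom_chart \<xi>"
  shows "open (coord \<xi> ` U)"
proof -
  have "coord \<xi> ` U = coord \<xi> ` dom_chart \<xi> \<inter> coord_inv \<xi> -` U"
    using smooth_atlasD(5,7)[OF assms(1,2)] smooth_atlasD(6)[OF assms(1,2)] assms(4)
    by (auto simp: image_iff)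
  then show ?thesis
    using continuous_open_preimage[OF smooth_atlasD(4,2)[OF assms(1,2)] assms(3)] by simp
qed

section \<open>Coordinate representations of one-parameter families of maps\<close>

definition family_domain :: "('a, 'e) chart \<Rightarrow> ('b, 'f) chart \<Rightarrow> real set \<Rightarrow> ('a \<Rightarrow> real \<Rightarrow> 'b) \<Rightarrow> ('e \<times> real) set" where
  "family_domain \<xi> \<kappa> I F = {(z, t). z \<in> coord \<xi> ` dom_chart \<xi> \<and> t \<in> I \<and> F (coord_inv \<xi> z) t \<in> dom_chart \<kappa>}"

definition family_rep :: "('a, 'e) chart \<Rightarrow> ('b, 'f) chart \<Rightarrow> ('a \<Rightarrow> real \<Rightarrow> 'b) \<Rightarrow> 'e \<times> real \<Rightarrow> 'f" where
  "family_rep \<xi> \<kappa> F = (\<lambda>(z, t). coord \<kappa> (F (coord_inv \<xi> z) t))"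

lemma family_domain_eq:
  assumes "smooth_atlas A" "\<xi> \<in> A"
  shows "{(coord \<xi> p, t) | p t. p \<in> dom_chart \<xi> \<and> t \<in> I \<and> F p t \<in> dom_chart \<kappa>} = family_domain \<xi> \<kappa> I F"
  using smooth_atlasD(5,6,7)[OF assms] unfolding family_domain_def by auto

lemma smooth_family_iff:
  assumes "smooth_atlas A"
  shows "smooth_family A B I F \<longleftrightarrow> continuous_on (UNIV \<times> I) (\<lambda>(p, t). F p t) \<and>
    (\<forall>\<xi>\<in>A. \<forall>\<kappa>\<in>B. smooth_on (family_domain \<xi> \<kappa> I F) (family_rep \<xi> \<kappa> F))"
  unfolding smooth_family_def family_rep_def
  by (intro conj_cong ball_cong refl) (simp only: family_domain_eq[OF assms])

lemma smooth_familyD: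
  assumes "smooth_atlas A" "smooth_family A B I F"
  shows "continuous_on (UNIV \<times> I) (\<lambda>(p, t). F p t)"
    "\<xi> \<in> A \<Longrightarrow> \<kappa> \<in> B \<Longrightarrow> smooth_on (family_domain \<xi> \<kappa> I F) (family_rep \<xi> \<kappa> F)"
  using assms(2) unfolding smooth_family_iff[OF assms(1)] by blast+

text \<open>One pair of charts around each point suffices, since all other representations arise
  from it by composition with changes of coordinates; continuity is read off the same local
  representation.\<close>

lemma smooth_familyI_local:
  assumes A: "smooth_atlas A" and B: "smooth_atlas B"
    and loc: "\<And>p0 t0. t0 \<in> I \<Longrightarrow> \<exists>\<xi>\<in>A. \<exists>\<kappa>\<in>B. \<exists>U J. open U \<and> open J \<and> p0 \<in> U \<and> t0 \<in> J \<and> U \<subseteq> dom_chart \<xi> \<and>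
      (\<forall>p\<in>U. \<forall>t\<in>I \<inter> J. F p t \<in> dom_chart \<kappa>) \<and> smooth_on (coord \<xi> ` U \<times> (I \<inter> J)) (family_rep \<xi> \<kappa> F)"
  shows "smooth_family A B I F"
  unfolding smooth_family_iff[OF A]
proof (intro conjI ballI)
  show "continuous_on (UNIV \<times> I) (\<lambda>(p, t). F p t)"
    unfolding continuous_on_eq_continuous_within
  proof
    fix x :: "'a \<times> real" assume "x \<in> UNIV \<times> I"
    then obtain p0 t0 where x: "x = (p0, t0)" "t0 \<in> I" by auto
    from loc[OF x(2), of p0] obtain \<xi> \<kappa> U J where l: "\<xi> \<in> A" "\<kappa> \<in> B" "open U" "open J" "p0 \<in> U" "t0 \<in> J"
      "U \<subseteq> dom_chart \<xi>" "\<And>p t. p \<in> U \<Longrightarrow> t \<in> I \<inter> J \<Longrightarrow> F p t \<in> dom_chart \<kappa>"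
      "smooth_on (coord \<xi> ` U \<times> (I \<inter> J)) (family_rep \<xi> \<kappa> F)" by metis
    have "continuous_on (U \<times> (I \<inter> J)) (\<lambda>q. (coord \<xi> (fst q), snd q))"
      using l(7) by (auto intro!: continuous_intros continuous_on_compose2[OF smooth_atlasD(3)[OF A l(1)]])
    then have "continuous_on (U \<times> (I \<inter> J)) (\<lambda>q. family_rep \<xi> \<kappa> F (coord \<xi> (fst q), snd q))"
      by (rule continuous_on_compose2[OF smooth_on_imp_continuous_on[OF l(9)]]) auto
    then have "continuous_on (U \<times> (I \<inter> J)) (\<lambda>q. coord \<kappa> (F (fst q) (snd q)))"
      by (rule continuous_on_cong[THEN iffD1, OF refl, rotated])
        (use smooth_atlasD(5)[OF A l(1)] l(7) in \<open>auto simp: family_rep_def subset_iff\<close>)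
    then have "continuous_on (U \<times> (I \<inter> J)) (\<lambda>q. coord_inv \<kappa> (coord \<kappa> (F (fst q) (snd q))))"
      by (rule continuous_on_compose2[OF smooth_atlasD(4)[OF B l(2)]]) (use l(8) in auto)
    then have "continuous_on (U \<times> (I \<inter> J)) (\<lambda>(p, t). F p t)"
      by (rule continuous_on_cong[THEN iffD1, OF refl, rotated])
        (use smooth_atlasD(5)[OF B l(2)] l(8) in auto)
    then have "continuous (at x within U \<times> (I \<inter> J)) (\<lambda>(p, t). F p t)"
      using l(5,6) x by (auto simp: continuous_on_eq_continuous_within)
    moreover have "at x within U \<times> (I \<inter> J) = at x within UNIV \<times> I"
      by (rule at_within_nhd[of x "U \<times> J"]) (use l x in \<open>auto intro: open_Times\<close>)
    ultimately show "continuous (at x within UNIV \<times> I) (\<lambda>(p, t). F p t)" by simp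
  qed
next
  fix \<xi>' \<kappa>' assume c': "\<xi>' \<in> A" "\<kappa>' \<in> B"
  note X' = smooth_atlasD[OF A c'(1)] and K' = smooth_atlasD[OF B c'(2)]
  show "smooth_on (family_domain \<xi>' \<kappa>' I F) (family_rep \<xi>' \<kappa>' F)"
  proof (rule smooth_on_local)
    fix x assume "x \<in> family_domain \<xi>' \<kappa>' I F"
    then obtain p0 t0 where x: "x = (coord \<xi>' p0, t0)" "p0 \<in> dom_chart \<xi>'" "t0 \<in> I" "F p0 t0 \<in> dom_chart \<kappa>'"
      using X'(5) by (auto simp: family_domain_def)
    from loc[OF x(3), of p0] obtain \<xi> \<kappa> U J where l: "\<xi> \<in> A" "\<kappa> \<in> B" "open U" "open J" "p0 \<in> U" "t0 \<in> J"
      "U \<subseteq> dom_chart \<xi>" "\<And>p t. p \<in> U \<Longrightarrow> t \<in> I \<inter> J \<Longrightarrow> F p t \<in> dom_chart \<kappa>"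
      "smooth_on (coord \<xi> ` U \<times> (I \<inter> J)) (family_rep \<xi> \<kappa> F)" by metis
    note X = smooth_atlasD[OF A l(1)] and K = smooth_atlasD[OF B l(2)]
    let ?O = "coord \<xi>' ` (dom_chart \<xi>' \<inter> U) \<times> J"
    let ?S = "family_domain \<xi>' \<kappa>' I F \<inter> ?O"
    have o: "open ?O"
      using open_coord_image[OF A c'(1), of "dom_chart \<xi>' \<inter> U"] X'(1) l(3,4) by (auto intro: open_Times)
    have S: "\<exists>p\<in>dom_chart \<xi>' \<inter> U. fst q = coord \<xi>' p \<and> coord_inv \<xi>' (fst q) = p \<and> p \<in> dom_chart \<xi> \<and> snd q \<in> I \<inter> J \<and>
        F p (snd q) \<in> dom_chart \<kappa> \<inter> dom_chart \<kappa>'" if "q \<in> ?S" for q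
    proof -
      have "fst q \<in> coord \<xi>' ` (dom_chart \<xi>' \<inter> U)" "snd q \<in> J" using that by auto
      then obtain p where p: "p \<in> dom_chart \<xi>'" "p \<in> U" "fst q = coord \<xi>' p" "snd q \<in> J" by blast
      have q: "snd q \<in> I" "F (coord_inv \<xi>' (fst q)) (snd q) \<in> dom_chart \<kappa>'"
        using that by (auto simp: family_domain_def)
      show ?thesis
        using p q X'(5)[OF p(1)] l(7) l(8)[of p "snd q"] by (intro bexI[of _ p]) auto
    qed
    have "smooth_on ?S (\<lambda>q. coord \<xi> (coord_inv \<xi>' (fst q)))"
      by (rule smooth_on_compose[OF smooth_on_fst smooth_atlas_transition[OF A c'(1) l(1)]])
        (use S in blast)
    then have "smooth_on ?S (\<lambda>q. (coord \<xi> (coord_inv \<xi>' (fst q)), snd q))"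
      by (intro smooth_on_Pair smooth_on_snd)
    then have "smooth_on ?S (\<lambda>q. family_rep \<xi> \<kappa> F (coord \<xi> (coord_inv \<xi>' (fst q)), snd q))"
      by (rule smooth_on_compose[OF _ l(9)]) (use S in fastforce)
    then have "smooth_on ?S (\<lambda>q. coord \<kappa> (F (coord_inv \<xi>' (fst q)) (snd q)))"
      by (rule smooth_on_cong) (use S X(5) in \<open>fastforce simp: family_rep_def\<close>)
    then have "smooth_on ?S (\<lambda>q. coord \<kappa>' (coord_inv \<kappa> (coord \<kappa> (F (coord_inv \<xi>' (fst q)) (snd q)))))"
      by (rule smooth_on_compose[OF _ smooth_atlas_transition[OF B l(2) c'(2)]]) (use S in fastforce)
    then have "smooth_on ?S (family_rep \<xi>' \<kappa>' F)"
      by (rule smooth_on_cong) (use S K(5) in \<open>fastforce simp: family_rep_def case_prod_beta\<close>)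
    then show "\<exists>U. open U \<and> x \<in> U \<and> smooth_on (family_domain \<xi>' \<kappa>' I F \<inter> U) (family_rep \<xi>' \<kappa>' F)"
      using o x l(5,6) by (intro exI[of _ ?O]) auto
  qed
qed

text \<open>Produces neighbourhoods of the product form that \<open>smooth_familyI_local\<close>
  asks for; continuity keeps their image inside one chart.\<close>

lemma smooth_family_locally_rep:
  assumes A: "smooth_atlas A" and B: "smooth_atlas B" and F: "smooth_family A B I F"
    and "\<xi> \<in> A" "\<kappa> \<in> B" "p0 \<in> dom_chart \<xi>" "t0 \<in> I" "F p0 t0 \<in> dom_chart \<kappa>"
  obtains U J where "open U" "open J" "p0 \<in> U" "t0 \<in> J" "U \<subseteq> dom_chart \<xi>"
    "\<And>p t. p \<in> U \<Longrightarrow> t \<in> I \<inter> J \<Longrightarrow> F p t \<in> dom_chart \<kappa>" "smooth_on (coord \<xi> ` U \<times> (I \<inter> J)) (family_rep \<xi> \<kappa> F)"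
proof -
  note F = smooth_familyD[OF A F]
  have "openin (top_of_set (UNIV \<times> I)) (UNIV \<times> I \<inter> (\<lambda>(p, t). F p t) -` dom_chart \<kappa>)"
    by (rule continuous_openin_preimage_gen[OF F(1) smooth_atlasD(1)[OF B assms(5)]])
  then obtain T where T: "open T" "UNIV \<times> I \<inter> (\<lambda>(p, t). F p t) -` dom_chart \<kappa> = (UNIV \<times> I) \<inter> T"
    unfolding openin_open by blast
  then have "(p0, t0) \<in> T" using assms by auto
  then obtain U J where U: "open U" "open J" "p0 \<in> U" "t0 \<in> J" "U \<times> J \<subseteq> T"
    using open_prod_elim[OF T(1)] by (metis mem_Sigma_iff)
  show thesis
  proof (rule that[of "U \<inter> dom_chart \<xi>" J])
    show in\<kappa>: "F p t \<in> dom_chart \<kappa>" if "p \<in> U \<inter> dom_chart \<xi>" "t \<in> I \<inter> J" for p t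
    proof -
      have "(p, t) \<in> (UNIV \<times> I) \<inter> T" using that U(5) by auto
      then have "(p, t) \<in> UNIV \<times> I \<inter> (\<lambda>(p, t). F p t) -` dom_chart \<kappa>" using T(2) by simp
      then show ?thesis by simp
    qed
    show "smooth_on (coord \<xi> ` (U \<inter> dom_chart \<xi>) \<times> (I \<inter> J)) (family_rep \<xi> \<kappa> F)"
      by (rule smooth_on_subset[OF F(2)[OF assms(4,5)]])
        (use in\<kappa> smooth_atlasD(5)[OF A assms(4)] in \<open>auto simp: family_domain_def\<close>)
  qed (use U smooth_atlasD(1)[OF A assms(4)] assms in auto)
qed

text \<open>The change of time makes this cover both compositions in the proof:
  \<open>F (\<psi> p t) t\<close> with the identity, and \<open>\<Phi> (F p t) (\<tau> t)\<close>
  with the integral of the coefficient \<phi>.\<close>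

lemma smooth_family_compose:
  assumes A: "smooth_atlas A" and B: "smooth_atlas B" and C: "smooth_atlas C"
    and F: "smooth_family A B I F" and G: "smooth_family B C J G" and \<tau>: "smooth_on I \<tau>" "\<And>t. t \<in> I \<Longrightarrow> \<tau> t \<in> J"
  shows "smooth_family A C I (\<lambda>p t. G (F p t) (\<tau> t))"
proof (rule smooth_familyI_local[OF A C])
  fix p0 t0 assume t0: "t0 \<in> I"
  define \<xi> \<eta> \<kappa> where "\<xi> = chart_at A p0" and "\<eta> = chart_at B (F p0 t0)" and "\<kappa> = chart_at C (G (F p0 t0) (\<tau> t0))"
  have c: "\<xi> \<in> A" "p0 \<in> dom_chart \<xi>" "\<eta> \<in> B" "F p0 t0 \<in> dom_chart \<eta>" "\<kappa> \<in> C" "G (F p0 t0) (\<tau> t0) \<in> dom_chart \<kappa>"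
    using chart_at[OF A] chart_at[OF B] chart_at[OF C] by (auto simp: \<xi>_def \<eta>_def \<kappa>_def)
  obtain U1 J1 where 1: "open U1" "open J1" "p0 \<in> U1" "t0 \<in> J1" "U1 \<subseteq> dom_chart \<xi>"
    "\<And>p t. p \<in> U1 \<Longrightarrow> t \<in> I \<inter> J1 \<Longrightarrow> F p t \<in> dom_chart \<eta>" "smooth_on (coord \<xi> ` U1 \<times> (I \<inter> J1)) (family_rep \<xi> \<eta> F)"
    using smooth_family_locally_rep[OF A B F c(1,3,2) t0 c(4)] by metis
  obtain U2 J2 where 2: "open U2" "open J2" "F p0 t0 \<in> U2" "\<tau> t0 \<in> J2" "U2 \<subseteq> dom_chart \<eta>"
    "\<And>p t. p \<in> U2 \<Longrightarrow> t \<in> J \<inter> J2 \<Longrightarrow> G p t \<in> dom_chart \<kappa>" "smooth_on (coord \<eta> ` U2 \<times> (J \<inter> J2)) (family_rep \<eta> \<kappa> G)"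
    using smooth_family_locally_rep[OF B C G c(3,5,4) \<tau>(2)[OF t0] c(6)] by metis
  have cF: "continuous_on (UNIV \<times> I) (\<lambda>(p, t). (F p t, \<tau> t))"
    using smooth_familyD(1)[OF A F]
    by (auto simp: case_prod_beta intro!: continuous_on_Pair continuous_on_compose2[OF smooth_on_imp_continuous_on[OF \<tau>(1)]] continuous_intros)
  have "openin (top_of_set (UNIV \<times> I)) (UNIV \<times> I \<inter> (\<lambda>(p, t). (F p t, \<tau> t)) -` (U2 \<times> J2))"
    by (rule continuous_openin_preimage_gen[OF cF open_Times[OF 2(1,2)]])
  then obtain T where T: "open T" "UNIV \<times> I \<inter> (\<lambda>(p, t). (F p t, \<tau> t)) -` (U2 \<times> J2) = (UNIV \<times> I) \<inter> T"
    unfolding openin_open by blast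
  then have "(p0, t0) \<in> T" using 2 t0 by auto
  then obtain U3 J3 where 3: "open U3" "open J3" "p0 \<in> U3" "t0 \<in> J3" "U3 \<times> J3 \<subseteq> T"
    using open_prod_elim[OF T(1)] by (metis mem_Sigma_iff)
  have in2: "F p t \<in> U2" "\<tau> t \<in> J2" if "p \<in> U3" "t \<in> I \<inter> J3" for p t
  proof -
    have "(p, t) \<in> (UNIV \<times> I) \<inter> T" using that 3(5) by auto
    then have "(p, t) \<in> UNIV \<times> I \<inter> (\<lambda>(p, t). (F p t, \<tau> t)) -` (U2 \<times> J2)" using T(2) by simp
    then show "F p t \<in> U2" "\<tau> t \<in> J2" by auto
  qed
  let ?U = "U1 \<inter> U3" and ?J = "J1 \<inter> J3"
  let ?S = "coord \<xi> ` ?U \<times> (I \<inter> ?J)"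
  have "smooth_on ?S (family_rep \<xi> \<eta> F)" by (rule smooth_on_subset[OF 1(7)]) auto
  moreover have "smooth_on ?S (\<lambda>q. \<tau> (snd q))" by (rule smooth_on_compose[OF smooth_on_snd \<tau>(1)]) auto
  ultimately have "smooth_on ?S (\<lambda>q. (family_rep \<xi> \<eta> F q, \<tau> (snd q)))" by (rule smooth_on_Pair)
  then have "smooth_on ?S (\<lambda>q. family_rep \<eta> \<kappa> G (family_rep \<xi> \<eta> F q, \<tau> (snd q)))"
    by (rule smooth_on_compose[OF _ 2(7)])
      (use in2 \<tau>(2) smooth_atlasD(5)[OF A c(1)] 1(5) in \<open>auto simp: family_rep_def subset_iff\<close>)
  then have "smooth_on ?S (family_rep \<xi> \<kappa> (\<lambda>p t. G (F p t) (\<tau> t)))"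
    by (rule smooth_on_cong)
      (use 1(5,6) smooth_atlasD(5)[OF A c(1)] smooth_atlasD(5)[OF B c(3)] in \<open>auto simp: family_rep_def subset_iff\<close>)
  then show "\<exists>\<xi>\<in>A. \<exists>\<kappa>\<in>C. \<exists>U J. open U \<and> open J \<and> p0 \<in> U \<and> t0 \<in> J \<and> U \<subseteq> dom_chart \<xi> \<and>
      (\<forall>p\<in>U. \<forall>t\<in>I \<inter> J. G (F p t) (\<tau> t) \<in> dom_chart \<kappa>) \<and>
      smooth_on (coord \<xi> ` U \<times> (I \<inter> J)) (family_rep \<xi> \<kappa> (\<lambda>p t. G (F p t) (\<tau> t)))"
    using c 1 3 2 in2 \<tau>(2) by (intro bexI[of _ \<xi>] bexI[of _ \<kappa>] exI[of _ ?U] exI[of _ ?J]) auto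
qed

text \<open>A map is a family over the single time 0, which transfers the composition rule from
  families to maps.\<close>

lemma smooth_map_iff_family:
  assumes A: "smooth_atlas A"
  shows "smooth_map A B f \<longleftrightarrow> smooth_family A B {0} (\<lambda>p t. f p)"
proof -
  have c: "continuous_on UNIV f \<longleftrightarrow> continuous_on (UNIV \<times> {0::real}) (\<lambda>(p, t). f p)"
  proof
    assume "continuous_on UNIV f"
    then show "continuous_on (UNIV \<times> {0::real}) (\<lambda>(p, t). f p)"
      unfolding case_prod_beta by (rule continuous_on_compose2) (auto intro: continuous_intros)
  next
    assume c: "continuous_on (UNIV \<times> {0::real}) (\<lambda>(p, t). f p)"
    have "continuous_on UNIV (\<lambda>p. (p, 0::real))" by (intro continuous_intros)
    from continuous_on_compose2[OF c this] show "continuous_on UNIV f" by auto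
  qed
  have m: "smooth_on (coord \<xi> ` (dom_chart \<xi> \<inter> f -` dom_chart \<kappa>)) (coord \<kappa> \<circ> f \<circ> coord_inv \<xi>) \<longleftrightarrow>
      smooth_on (family_domain \<xi> \<kappa> {0} (\<lambda>p t. f p)) (family_rep \<xi> \<kappa> (\<lambda>p t. f p))" (is "?L \<longleftrightarrow> ?R") if "\<xi> \<in> A" for \<xi> \<kappa>
  proof -
    let ?S = "coord \<xi> ` (dom_chart \<xi> \<inter> f -` dom_chart \<kappa>)"
    have S: "family_domain \<xi> \<kappa> {0} (\<lambda>p t. f p) = ?S \<times> {0}"
      using smooth_atlasD(5,6,7)[OF A that] by (auto simp: family_domain_def)
    show ?thesis
    proof
      assume ?L
      from smooth_on_compose[OF smooth_on_fst this, of "?S \<times> {0}"] show ?R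
        unfolding S by (rule smooth_on_transfer) (auto simp: family_rep_def)
    next
      assume R: ?R
      have "smooth_on ?S (\<lambda>z. (z, 0::real))" by (intro smooth_on_Pair smooth_on_ident smooth_on_const)
      from smooth_on_compose[OF this R] show ?L
        unfolding S by (rule smooth_on_transfer) (auto simp: family_rep_def)
    qed
  qed
  show ?thesis unfolding smooth_map_def smooth_family_iff[OF A]
    by (intro conj_cong c ball_cong refl m)
qed

lemma smooth_family_imp_smooth_map:
  assumes A: "smooth_atlas A" and "smooth_family A B I F" "t \<in> I"
  shows "smooth_map A B (\<lambda>p. F p t)"
proof -
  note F = smooth_familyD[OF A assms(2)]
  have "continuous_on UNIV (\<lambda>p. (p, t))" by (intro continuous_intros)
  from continuous_on_compose2[OF F(1) this] assms(3) have "continuous_on UNIV (\<lambda>p. F p t)" by auto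
  moreover have "smooth_on (coord \<xi> ` (dom_chart \<xi> \<inter> (\<lambda>p. F p t) -` dom_chart \<kappa>)) (coord \<kappa> \<circ> (\<lambda>p. F p t) \<circ> coord_inv \<xi>)"
    if "\<xi> \<in> A" "\<kappa> \<in> B" for \<xi> \<kappa>
  proof -
    let ?S = "coord \<xi> ` (dom_chart \<xi> \<inter> (\<lambda>p. F p t) -` dom_chart \<kappa>)"
    have "smooth_on ?S (\<lambda>z. (z, t))" by (intro smooth_on_Pair smooth_on_ident smooth_on_const)
    then have "smooth_on ?S (\<lambda>z. family_rep \<xi> \<kappa> F (z, t))"
      by (rule smooth_on_compose[OF _ F(2)[OF that]])
        (use smooth_atlasD(5)[OF A that(1)] assms(3) in \<open>auto simp: family_domain_def\<close>)
    then show ?thesis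
      by (rule smooth_on_cong) (simp add: family_rep_def)
  qed
  ultimately show ?thesis unfolding smooth_map_def by blast
qed

lemma smooth_map_compose:
  assumes "smooth_atlas A" "smooth_atlas B" "smooth_atlas C" "smooth_map A B f" "smooth_map B C h"
  shows "smooth_map A C (\<lambda>p. h (f p))"
  using smooth_family_compose[OF assms(1,2,3), of "{0}" "\<lambda>p t. f p" "{0}" "\<lambda>p t. h p" "\<lambda>t. t"] assms
  by (simp add: smooth_map_iff_family smooth_on_ident)

lemma smooth_family_ident:
  assumes A: "smooth_atlas A"
  shows "smooth_family A A I (\<lambda>p t. p)"
proof (rule smooth_familyI_local[OF A A])
  fix p0 t0
  define \<xi> where "\<xi> = chart_at A p0"
  have c: "\<xi> \<in> A" "p0 \<in> dom_chart \<xi>" using chart_at[OF A] by (auto simp: \<xi>_def)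
  note X = smooth_atlasD[OF A c(1)]
  have "smooth_on (coord \<xi> ` dom_chart \<xi> \<times> (I \<inter> UNIV)) (family_rep \<xi> \<xi> (\<lambda>p t. p))"
    by (rule smooth_on_cong[OF smooth_on_fst]) (use X in \<open>auto simp: family_rep_def\<close>)
  then show "\<exists>\<xi>\<in>A. \<exists>\<kappa>\<in>A. \<exists>U J. open U \<and> open J \<and> p0 \<in> U \<and> t0 \<in> J \<and> U \<subseteq> dom_chart \<xi> \<and>
      (\<forall>p\<in>U. \<forall>t\<in>I \<inter> J. p \<in> dom_chart \<kappa>) \<and> smooth_on (coord \<xi> ` U \<times> (I \<inter> J)) (family_rep \<xi> \<kappa> (\<lambda>p t. p))"
    using c X by (intro bexI[of _ \<xi>] exI[of _ "dom_chart \<xi>"] exI[of _ UNIV]) auto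
qed

lemma diffeomorphism_ident: "smooth_atlas A \<Longrightarrow> diffeomorphism A A (\<lambda>p. p)"
  using smooth_family_imp_smooth_map[OF _ smooth_family_ident[of A UNIV]]
  by (auto simp: diffeomorphism_def bij_def inj_def inv_def)

lemma diffeomorphism_compose:
  assumes A: "smooth_atlas A" and f: "diffeomorphism A A f" and h: "diffeomorphism A A h"
  shows "diffeomorphism A A (\<lambda>p. h (f p))"
proof -
  have b: "bij f" "bij h" using f h by (auto simp: diffeomorphism_def)
  have "inv (\<lambda>p. h (f p)) = (\<lambda>p. inv f (inv h p))"
    using o_inv_distrib[OF b(2,1)] by (simp add: comp_def)
  then show ?thesis
    using f h bij_comp[OF b] smooth_map_compose[OF A A A]
    by (auto simp: diffeomorphism_def comp_def)
qed

subsection \<open>Differentials\<close>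

lemma smooth_map_rep:
  assumes A: "smooth_atlas A" and B: "smooth_atlas B" and F: "smooth_map A B F" and "\<xi> \<in> A" "\<kappa> \<in> B"
  shows "open (coord \<xi> ` (dom_chart \<xi> \<inter> F -` dom_chart \<kappa>))"
    "Ck_on n (coord \<xi> ` (dom_chart \<xi> \<inter> F -` dom_chart \<kappa>)) (coord \<kappa> \<circ> F \<circ> coord_inv \<xi>)"
proof -
  have "open (F -` dom_chart \<kappa>)"
    using F smooth_atlasD(1)[OF B assms(5)] by (auto simp: smooth_map_def intro: open_vimage)
  then show o: "open (coord \<xi> ` (dom_chart \<xi> \<inter> F -` dom_chart \<kappa>))"
    using smooth_atlasD(1)[OF A assms(4)] by (intro open_coord_image[OF A assms(4)]) auto
  show "Ck_on n (coord \<xi> ` (dom_chart \<xi> \<inter> F -` dom_chart \<kappa>)) (coord \<kappa> \<circ> F \<circ> coord_inv \<xi>)"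
    using F assms(4,5) by (intro smooth_on_imp_Ck_on[OF o]) (auto simp: smooth_map_def)
qed

lemma differential_has_derivative:
  assumes A: "smooth_atlas A" and B: "smooth_atlas B" and F: "smooth_map A B F"
    and "\<xi> \<in> A" "\<kappa> \<in> B" "p \<in> dom_chart \<xi>" "F p \<in> dom_chart \<kappa>"
  shows "((coord \<kappa> \<circ> F \<circ> coord_inv \<xi>) has_derivative differential \<xi> \<kappa> F p) (at (coord \<xi> p))"
  unfolding differential_def
  by (rule Ck_on_has_derivative[OF smooth_map_rep(2)[OF A B F assms(4,5), of "Suc 0"]]) (use assms in auto)

lemma differential_linear:
  assumes "smooth_atlas A" "smooth_atlas B" "smooth_map A B F"
    "\<xi> \<in> A" "\<kappa> \<in> B" "p \<in> dom_chart \<xi>" "F p \<in> dom_chart \<kappa>"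
  shows "linear (differential \<xi> \<kappa> F p)"
  using has_derivative_linear[OF differential_has_derivative[OF assms]] .

lemma differential_compose:
  assumes A: "smooth_atlas A" and B: "smooth_atlas B" and C: "smooth_atlas C"
    and F: "smooth_map A B F" and G: "smooth_map B C G"
    and c: "\<xi> \<in> A" "\<eta> \<in> B" "\<kappa> \<in> C" "p \<in> dom_chart \<xi>" "F p \<in> dom_chart \<eta>" "G (F p) \<in> dom_chart \<kappa>"
  shows "differential \<xi> \<kappa> (\<lambda>p. G (F p)) p v = differential \<eta> \<kappa> G (F p) (differential \<xi> \<eta> F p v)"
proof -
  note X = smooth_atlasD[OF A c(1)] and E = smooth_atlasD[OF B c(2)]
  let ?S = "coord \<xi> ` (dom_chart \<xi> \<inter> F -` dom_chart \<eta>)"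
  have 1: "((coord \<eta> \<circ> F \<circ> coord_inv \<xi>) has_derivative differential \<xi> \<eta> F p) (at (coord \<xi> p))"
    by (rule differential_has_derivative[OF A B F c(1,2,4,5)])
  have "((coord \<kappa> \<circ> G \<circ> coord_inv \<eta>) has_derivative differential \<eta> \<kappa> G (F p)) (at ((coord \<eta> \<circ> F \<circ> coord_inv \<xi>) (coord \<xi> p)))"
    using differential_has_derivative[OF B C G c(2,3,5,6)] X(5)[OF c(4)] by simp
  from has_derivative_compose[OF 1 this]
  have "((\<lambda>z. (coord \<kappa> \<circ> G \<circ> coord_inv \<eta>) ((coord \<eta> \<circ> F \<circ> coord_inv \<xi>) z)) has_derivative
      (\<lambda>v. differential \<eta> \<kappa> G (F p) (differential \<xi> \<eta> F p v))) (at (coord \<xi> p))" .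
  then have "((coord \<kappa> \<circ> (\<lambda>p. G (F p)) \<circ> coord_inv \<xi>) has_derivative
      (\<lambda>v. differential \<eta> \<kappa> G (F p) (differential \<xi> \<eta> F p v))) (at (coord \<xi> p))"
    by (rule has_derivative_transform_within_open[OF _ smooth_map_rep(1)[OF A B F c(1,2)]])
      (use c X(5) E(5) in auto)
  then show ?thesis
    unfolding differential_def[of \<xi> \<kappa>] by (metis frechet_derivative_at)
qed

lemma smooth_map_id: "smooth_atlas A \<Longrightarrow> smooth_map A A id"
  using diffeomorphism_ident[of A] by (simp add: diffeomorphism_def id_def)

lemma differential_id_same:
  assumes A: "smooth_atlas A" and "\<xi> \<in> A" "p \<in> dom_chart \<xi>"
  shows "differential \<xi> \<xi> id p v = v"
proof -
  note X = smooth_atlasD[OF A assms(2)]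
  have "((coord \<xi> \<circ> id \<circ> coord_inv \<xi>) has_derivative (\<lambda>v. v)) (at (coord \<xi> p))"
    by (rule has_derivative_transform_within_open[OF has_derivative_ident X(2)]) (use X(6) assms in auto)
  then show ?thesis unfolding differential_def by (metis frechet_derivative_at)
qed

lemma differential_change_target:
  assumes A: "smooth_atlas A" and B: "smooth_atlas B" and F: "smooth_map A B F"
    and c: "\<xi> \<in> A" "\<eta> \<in> B" "\<kappa> \<in> B" "p \<in> dom_chart \<xi>" "F p \<in> dom_chart \<eta>" "F p \<in> dom_chart \<kappa>"
  shows "differential \<xi> \<kappa> F p v = differential \<eta> \<kappa> id (F p) (differential \<xi> \<eta> F p v)"
  using differential_compose[OF A B B F smooth_map_id[OF B] c(1,2,3,4,5)] c(6) by simp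

lemma differential_change_source:
  assumes A: "smooth_atlas A" and B: "smooth_atlas B" and F: "smooth_map A B F"
    and c: "\<xi> \<in> A" "\<xi>' \<in> A" "\<kappa> \<in> B" "p \<in> dom_chart \<xi>" "p \<in> dom_chart \<xi>'" "F p \<in> dom_chart \<kappa>"
  shows "differential \<xi> \<kappa> F p v = differential \<xi>' \<kappa> F p (differential \<xi> \<xi>' id p v)"
  using differential_compose[OF A A B smooth_map_id[OF A] F c(1,2,3)] c(4-) by simp

text \<open>The chain rule with the inverse map gives injectivity; source and target share the model
  space, so surjectivity follows.\<close>

lemma differential_diffeomorphism_bij:
  assumes A: "smooth_atlas A" and \<Phi>: "diffeomorphism A A \<Phi>"
    and c: "\<xi> \<in> A" "\<eta> \<in> A" "p \<in> dom_chart \<xi>" "\<Phi> p \<in> dom_chart \<eta>"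
  shows "bij (differential \<xi> \<eta> \<Phi> p)"
proof -
  have s: "smooth_map A A \<Phi>" "smooth_map A A (inv \<Phi>)" and b: "bij \<Phi>"
    using \<Phi> by (auto simp: diffeomorphism_def)
  have i: "inv \<Phi> (\<Phi> q) = q" "\<Phi> (inv \<Phi> q) = q" for q
    using b by (simp_all add: bij_is_inj bij_is_surj surj_f_inv_f)
  have "differential \<eta> \<xi> (inv \<Phi>) (\<Phi> p) (differential \<xi> \<eta> \<Phi> p v) = v" for v
    using differential_compose[OF A A A s c(1,2,1,3,4), of v] differential_id_same[OF A c(1,3)] i(1) c(3)
    by (simp add: id_def)
  then have "inj (differential \<xi> \<eta> \<Phi> p)" by (metis injI)
  then show ?thesis
    using linear_injective_imp_surjective[OF differential_linear[OF A A s(1) c]] by (simp add: bij_def)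
qed

section \<open>Velocities\<close>

lemma eventually_in_open_within:
  assumes "continuous (at t within S) \<gamma>" "open U" "\<gamma> t \<in> U"
  shows "\<exists>d>0. \<forall>s\<in>S. dist s t < d \<longrightarrow> \<gamma> s \<in> U"
proof -
  have "\<forall>\<^sub>F s in at t within S. \<gamma> s \<in> U"
    using topological_tendstoD[OF assms(1)[unfolded continuous_within] assms(2,3)] .
  then show ?thesis
    using assms(3) unfolding eventually_at by (metis dist_eq_0_iff)
qed

text \<open>At an endpoint of \<open>J\<close> the domain is not open, and uniqueness of a
  derivative within it is not automatic. The linear map is identified on spatial vectors by the open
  slice, and on the time direction by the given one-sided velocity, for which
  \<open>at \<sigma> within J\<close> must be nontrivial.\<close>

lemma family_rep_derivative:
  assumes A: "smooth_atlas A" and B: "smooth_atlas B" and G: "smooth_family A B J G"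
    and c: "\<xi> \<in> A" "\<kappa> \<in> B" "p \<in> dom_chart \<xi>" "\<sigma> \<in> J" "G p \<sigma> \<in> dom_chart \<kappa>"
    and nb: "at \<sigma> within J \<noteq> bot"
    and w: "((\<lambda>s. coord \<kappa> (G p s)) has_vector_derivative w) (at \<sigma> within J)"
  shows "(family_rep \<xi> \<kappa> G has_derivative (\<lambda>(v, r). differential \<xi> \<kappa> (\<lambda>p. G p \<sigma>) p v + r *\<^sub>R w))
     (at (coord \<xi> p, \<sigma>) within family_domain \<xi> \<kappa> J G)"
proof -
  let ?D = "family_domain \<xi> \<kappa> J G" and ?f = "family_rep \<xi> \<kappa> G" and ?z = "coord \<xi> p"
  note X = smooth_atlasD[OF A c(1)]
  have inD: "(?z, \<sigma>) \<in> ?D" using c X(5) by (auto simp: family_domain_def)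
  obtain f' where f': "(?f has_derivative f') (at (?z, \<sigma>) within ?D)"
    using smooth_on_has_derivative_within[OF smooth_familyD(2)[OF A G c(1,2)] inD] .
  have lin: "linear f'" using has_derivative_linear[OF f'] .
  have sm: "smooth_map A B (\<lambda>p. G p \<sigma>)" by (rule smooth_family_imp_smooth_map[OF A G c(4)])
  have 1: "f' (v, 0) = differential \<xi> \<kappa> (\<lambda>p. G p \<sigma>) p v" for v
  proof -
    let ?S = "coord \<xi> ` (dom_chart \<xi> \<inter> (\<lambda>p. G p \<sigma>) -` dom_chart \<kappa>)"
    have o: "open ?S" by (rule smooth_map_rep(1)[OF A B sm c(1,2)])
    have zS: "?z \<in> ?S" using c by auto
    have sub: "(\<lambda>z. (z, \<sigma>)) ` ?S \<subseteq> ?D" using c X(5) by (auto simp: family_domain_def)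
    have "((\<lambda>z. (z, \<sigma>)) has_derivative (\<lambda>v. (v, 0))) (at ?z within ?S)" by (auto intro!: derivative_eq_intros)
    from diff_chain_within[OF this has_derivative_subset[OF f' sub]]
    have "((\<lambda>z. ?f (z, \<sigma>)) has_derivative (\<lambda>v. f' (v, 0))) (at ?z)"
      using at_within_open[OF zS o] by (simp add: o_def)
    then have "((coord \<kappa> \<circ> (\<lambda>p. G p \<sigma>) \<circ> coord_inv \<xi>) has_derivative (\<lambda>v. f' (v, 0))) (at ?z)"
      by (simp add: family_rep_def comp_def)
    from has_derivative_unique[OF this differential_has_derivative[OF A B sm c(1,2,3,5)]]
    show ?thesis by metis
  qed
  have 2: "f' (0, 1) = w"
  proof -
    have cont: "continuous (at \<sigma> within J) (G p)"
    proof -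
      have "continuous_on J (\<lambda>s. (p, s))" by (intro continuous_intros)
      from continuous_on_compose2[OF smooth_familyD(1)[OF A G] this]
      show ?thesis using c(4) by (auto simp: continuous_on_eq_continuous_within)
    qed
    obtain d where d: "d > 0" "\<And>s. s \<in> J \<Longrightarrow> dist s \<sigma> < d \<Longrightarrow> G p s \<in> dom_chart \<kappa>"
      using eventually_in_open_within[OF cont smooth_atlasD(1)[OF B c(2)] c(5)] by blast
    let ?J = "J \<inter> ball \<sigma> d"
    have sub: "(\<lambda>s. (?z, s)) ` ?J \<subseteq> ?D"
      using c X(5) d by (auto simp: family_domain_def dist_commute)
    have "((\<lambda>s. (?z, s)) has_vector_derivative (0, 1)) (at \<sigma> within ?J)"
      unfolding has_vector_derivative_def by (auto intro!: derivative_eq_intros simp: zero_prod_def)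
    then have "((\<lambda>s. (?z, s)) has_derivative (\<lambda>h. h *\<^sub>R (0, 1))) (at \<sigma> within ?J)"
      unfolding has_vector_derivative_def .
    from diff_chain_within[OF this has_derivative_subset[OF f' sub]]
    have "((\<lambda>s. ?f (?z, s)) has_vector_derivative f' (0, 1)) (at \<sigma> within ?J)"
      using linear_scale[OF lin] by (simp add: o_def has_vector_derivative_def del: scaleR_Pair)
    then have "((\<lambda>s. coord \<kappa> (G p s)) has_vector_derivative f' (0, 1)) (at \<sigma> within ?J)"
      using X(5)[OF c(3)] by (simp add: family_rep_def)
    moreover have "at \<sigma> within ?J = at \<sigma> within J"
      by (rule at_within_nhd[of \<sigma> "ball \<sigma> d"]) (use d in auto)
    ultimately show ?thesis
      using vector_derivative_unique_within[OF nb _ w] by simp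
  qed
  have "f' = (\<lambda>(v, r). differential \<xi> \<kappa> (\<lambda>p. G p \<sigma>) p v + r *\<^sub>R w)"
  proof
    fix x
    have "f' x = f' ((fst x, 0) + snd x *\<^sub>R (0, 1))" by simp
    then show "f' x = (case x of (v, r) \<Rightarrow> differential \<xi> \<kappa> (\<lambda>p. G p \<sigma>) p v + r *\<^sub>R w)"
      using 1 2 by (simp add: linear_add[OF lin] linear_scale[OF lin] case_prod_beta del: scaleR_Pair)
  qed
  with f' show ?thesis by simp
qed

text \<open>The chain rule for a moving point and a moving parameter at once. Times are restricted
  near \<open>t\<close> until both the curve and its image stay inside the chosen charts.\<close>

lemma velocity_family:
  assumes A: "smooth_atlas A" and B: "smooth_atlas B" and G: "smooth_family A B J G"
    and c: "\<xi> \<in> A" "\<kappa> \<in> B" "\<gamma> t \<in> dom_chart \<xi>" "G (\<gamma> t) (\<tau> t) \<in> dom_chart \<kappa>" "t \<in> S"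
    and \<gamma>: "continuous (at t within S) \<gamma>" "((\<lambda>s. coord \<xi> (\<gamma> s)) has_vector_derivative v) (at t within S)"
    and \<tau>: "(\<tau> has_vector_derivative r) (at t within S)" "\<And>s. s \<in> S \<Longrightarrow> \<tau> s \<in> J"
    and nb: "at (\<tau> t) within J \<noteq> bot"
    and w: "((\<lambda>s. coord \<kappa> (G (\<gamma> t) s)) has_vector_derivative w) (at (\<tau> t) within J)"
  shows "((\<lambda>s. coord \<kappa> (G (\<gamma> s) (\<tau> s))) has_vector_derivative
     (differential \<xi> \<kappa> (\<lambda>p. G p (\<tau> t)) (\<gamma> t) v + r *\<^sub>R w)) (at t within S)"
proof -
  note X = smooth_atlasD[OF A c(1)]
  let ?D = "family_domain \<xi> \<kappa> J G" and ?f = "family_rep \<xi> \<kappa> G"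
  have f': "(?f has_derivative (\<lambda>(v, r). differential \<xi> \<kappa> (\<lambda>p. G p (\<tau> t)) (\<gamma> t) v + r *\<^sub>R w))
     (at (coord \<xi> (\<gamma> t), \<tau> t) within ?D)"
    by (rule family_rep_derivative[OF A B G c(1,2,3) \<tau>(2)[OF c(5)] c(4) nb w])
  have lin: "linear (\<lambda>(v, r). differential \<xi> \<kappa> (\<lambda>p. G p (\<tau> t)) (\<gamma> t) v + r *\<^sub>R w)"
    using has_derivative_linear[OF f'] .
  have c\<tau>: "continuous (at t within S) \<tau>" using has_vector_derivative_continuous[OF \<tau>(1)] .
  have cG: "continuous (at t within S) (\<lambda>s. G (\<gamma> s) (\<tau> s))"
  proof -
    have "continuous (at (\<gamma> t, \<tau> t) within UNIV \<times> J) (\<lambda>(p, t). G p t)"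
      using smooth_familyD(1)[OF A G] \<tau>(2)[OF c(5)] by (auto simp: continuous_on_eq_continuous_within)
    then have "continuous (at (\<gamma> t, \<tau> t) within (\<lambda>s. (\<gamma> s, \<tau> s)) ` S) (\<lambda>(p, t). G p t)"
      by (rule continuous_within_subset) (use \<tau>(2) in auto)
    from continuous_within_compose2[OF continuous_Pair[OF \<gamma>(1) c\<tau>] this] show ?thesis by simp
  qed
  obtain d1 where d1: "d1 > 0" "\<And>s. s \<in> S \<Longrightarrow> dist s t < d1 \<Longrightarrow> \<gamma> s \<in> dom_chart \<xi>"
    using eventually_in_open_within[OF \<gamma>(1) X(1) c(3)] by blast
  obtain d2 where d2: "d2 > 0" "\<And>s. s \<in> S \<Longrightarrow> dist s t < d2 \<Longrightarrow> G (\<gamma> s) (\<tau> s) \<in> dom_chart \<kappa>"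
    using eventually_in_open_within[OF cG smooth_atlasD(1)[OF B c(2)] c(4)] by blast
  define d where "d = min d1 d2"
  have d: "d > 0" using d1 d2 by (simp add: d_def)
  let ?S = "S \<inter> ball t d"
  have eq: "at t within ?S = at t within S"
    by (rule at_within_nhd[of t "ball t d"]) (use d in auto)
  have der: "((\<lambda>s. (coord \<xi> (\<gamma> s), \<tau> s)) has_derivative (\<lambda>h. (h *\<^sub>R v, h *\<^sub>R r))) (at t within ?S)"
    using \<gamma>(2) \<tau>(1) unfolding eq has_vector_derivative_def by (rule has_derivative_Pair)
  have im: "(\<lambda>s. (coord \<xi> (\<gamma> s), \<tau> s)) ` ?S \<subseteq> ?D"
    using d1 d2 \<tau>(2) X(5) by (auto simp: family_domain_def d_def dist_commute)
  have "((\<lambda>s. ?f (coord \<xi> (\<gamma> s), \<tau> s)) has_derivative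
      (\<lambda>h. differential \<xi> \<kappa> (\<lambda>p. G p (\<tau> t)) (\<gamma> t) (h *\<^sub>R v) + (h *\<^sub>R r) *\<^sub>R w)) (at t within ?S)"
    using diff_chain_within[OF der has_derivative_subset[OF f' im]] by (simp add: o_def)
  then have "((\<lambda>s. ?f (coord \<xi> (\<gamma> s), \<tau> s)) has_vector_derivative
     (differential \<xi> \<kappa> (\<lambda>p. G p (\<tau> t)) (\<gamma> t) v + r *\<^sub>R w)) (at t within ?S)"
    using linear_scale[OF lin, of _ "(v, r)"] unfolding has_vector_derivative_def by simp
  then show ?thesis
    unfolding eq
    by (rule has_vector_derivative_transform_within[OF _ d c(5)])
       (use d1 X(5) in \<open>auto simp: family_rep_def d_def\<close>)
qed

lemma smooth_family_const_time:
  assumes A: "smooth_atlas A" and B: "smooth_atlas B" and "smooth_map A B \<Phi>"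
  shows "smooth_family A B I (\<lambda>p t. \<Phi> p)"
  using smooth_family_compose[OF A A B smooth_family_ident[OF A], of "{0}" "\<lambda>p t. \<Phi> p" I "\<lambda>t. 0"] assms
  by (simp add: smooth_map_iff_family smooth_on_const)

lemma velocity_map:
  assumes A: "smooth_atlas A" and B: "smooth_atlas B" and "smooth_map A B \<Phi>"
    and c: "\<xi> \<in> A" "\<kappa> \<in> B" "\<gamma> t \<in> dom_chart \<xi>" "\<Phi> (\<gamma> t) \<in> dom_chart \<kappa>" "t \<in> S"
    and \<gamma>: "continuous (at t within S) \<gamma>" "((\<lambda>s. coord \<xi> (\<gamma> s)) has_vector_derivative v) (at t within S)"
  shows "((\<lambda>s. coord \<kappa> (\<Phi> (\<gamma> s))) has_vector_derivative differential \<xi> \<kappa> \<Phi> (\<gamma> t) v) (at t within S)"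
  using velocity_family[OF A B smooth_family_const_time[OF assms(1-3)] c(1-5) \<gamma>, of "\<lambda>t. 0" 0 UNIV 0]
  by (simp add: has_vector_derivative_const trivial_limit_at)

lemma has_velocityI_chart:
  assumes A: "smooth_atlas A" and c: "\<xi> \<in> A" "\<gamma> t \<in> dom_chart \<xi>" "t \<in> S"
    and \<gamma>: "continuous (at t within S) \<gamma>" "((\<lambda>s. coord \<xi> (\<gamma> s)) has_vector_derivative V \<xi>) (at t within S)"
    and V: "\<And>\<xi>'. \<xi>' \<in> A \<Longrightarrow> \<gamma> t \<in> dom_chart \<xi>' \<Longrightarrow> V \<xi>' = differential \<xi> \<xi>' id (\<gamma> t) (V \<xi>)"
  shows "has_velocity A S \<gamma> t V"
  unfolding has_velocity_def
  using velocity_map[OF A A smooth_map_id[OF A] c(1) _ c(2) _ c(3) \<gamma>] V by auto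

section \<open>Flows of time-dependent vector fields on compact manifolds\<close>

definition time_dependent_field ::
    "('a, 'e::euclidean_space) chart set \<Rightarrow> real set \<Rightarrow> (('a, 'e) chart \<Rightarrow> 'a \<Rightarrow> real \<Rightarrow> 'e) \<Rightarrow> bool" where
  "time_dependent_field A I X \<longleftrightarrow>
     (\<forall>\<xi>\<in>A. smooth_on (coord \<xi> ` dom_chart \<xi> \<times> I) (\<lambda>(z, t). X \<xi> (coord_inv \<xi> z) t)) \<and>
     (\<forall>\<xi>\<in>A. \<forall>\<eta>\<in>A. \<forall>p\<in>dom_chart \<xi> \<inter> dom_chart \<eta>. \<forall>t\<in>I. X \<eta> p t = differential \<xi> \<eta> id p (X \<xi> p t))"

lemma time_dependent_fieldD:
  "time_dependent_field A I X \<Longrightarrow> \<xi> \<in> A \<Longrightarrow> \<eta> \<in> A \<Longrightarrow> p \<in> dom_chart \<xi> \<Longrightarrow> p \<in> dom_chart \<eta> \<Longrightarrow> t \<in> I \<Longrightarrow>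
    X \<eta> p t = differential \<xi> \<eta> id p (X \<xi> p t)"
  unfolding time_dependent_field_def by blast

text \<open>Continuity is stated separately: a coordinate map has arbitrary values outside its
  chart, so differentiability of the coordinates alone does not keep a curve near its point.\<close>

definition integral_curve ::
    "('a::topological_space, 'e::euclidean_space) chart set \<Rightarrow> (('a, 'e) chart \<Rightarrow> 'a \<Rightarrow> real \<Rightarrow> 'e) \<Rightarrow> real set \<Rightarrow> (real \<Rightarrow> 'a) \<Rightarrow> bool" where
  "integral_curve A X S \<gamma> \<longleftrightarrow> continuous_on S \<gamma> \<and> (\<forall>t\<in>S. has_velocity A S \<gamma> t (\<lambda>\<xi>. X \<xi> (\<gamma> t) t))"

lemma integral_curve_subset: "integral_curve A X S \<gamma> \<Longrightarrow> T \<subseteq> S \<Longrightarrow> integral_curve A X T \<gamma>"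
  unfolding integral_curve_def has_velocity_def
  by (auto intro: continuous_on_subset has_vector_derivative_within_subset)

section \<open>Uniqueness of integral curves\<close>

lemma Ck_on_locally_lipschitz:
  fixes f :: "'a::euclidean_space \<Rightarrow> 'b::euclidean_space"
  assumes "open \<Omega>" "Ck_on 1 \<Omega> f" "x \<in> \<Omega>"
  obtains r L where "0 < r" "0 \<le> L" "cball x r \<subseteq> \<Omega>"
    "\<And>a b. a \<in> cball x r \<Longrightarrow> b \<in> cball x r \<Longrightarrow> norm (f a - f b) \<le> L * norm (a - b)"
proof -
  obtain r where r: "r > 0" "cball x r \<subseteq> \<Omega>" using assms(1,3) open_contains_cball by blast
  obtain L where L: "0 \<le> L" "\<And>a v. a \<in> cball x r \<Longrightarrow> norm (frechet_derivative f (at a) v) \<le> L * norm v"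
    using Ck_on_derivative_bounded[OF assms(2) compact_cball r(2)] by blast
  have "norm (f a - f b) \<le> L * norm (a - b)" if "a \<in> cball x r" "b \<in> cball x r" for a b
  proof (rule differentiable_bound[OF convex_cball _ _ that])
    show "(f has_derivative frechet_derivative f (at y)) (at y within cball x r)" if "y \<in> cball x r" for y
    proof (rule has_derivative_at_withinI, rule Ck_on_has_derivative[of 0 \<Omega>])
      show "Ck_on (Suc 0) \<Omega> f" using assms(2) by (simp only: One_nat_def)
      show "y \<in> \<Omega>" using r(2) that by blast
    qed
    show "onorm (frechet_derivative f (at y)) \<le> L" if "y \<in> cball x r" for y
      using L(2)[OF that] by (intro onorm_le) auto
  qed
  then show ?thesis using that r L by blast
qed

text \<open>The maximum of |c1 - c2| is at most L (b - a) \<le> 1/2 times itself, so it is zero; on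
  a short interval this absorption stands in for Gronwall's inequality.\<close>

lemma ode_unique_short:
  fixes c1 c2 :: "real \<Rightarrow> 'b::real_normed_vector"
  assumes "t1 \<in> {a..b}" "c1 t1 = c2 t1" "0 \<le> L" "(b - a) * L \<le> 1/2"
    and c1: "\<And>t. t \<in> {a..b} \<Longrightarrow> (c1 has_vector_derivative v1 t) (at t within {a..b})"
    and c2: "\<And>t. t \<in> {a..b} \<Longrightarrow> (c2 has_vector_derivative v2 t) (at t within {a..b})"
    and L: "\<And>t. t \<in> {a..b} \<Longrightarrow> norm (v1 t - v2 t) \<le> L * norm (c1 t - c2 t)"
    and t: "t \<in> {a..b}"
  shows "c1 t = c2 t"
proof -
  define g where "g t = c1 t - c2 t" for t
  have g: "(g has_vector_derivative (v1 t - v2 t)) (at t within {a..b})" if "t \<in> {a..b}" for t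
    unfolding g_def using c1[OF that] c2[OF that] by (rule has_vector_derivative_diff)
  have "continuous_on {a..b} (\<lambda>\<tau>. norm (g \<tau>))"
    using g by (intro continuous_on_norm)
      (meson continuous_on_eq_continuous_within has_vector_derivative_continuous)
  then obtain \<tau> where \<tau>: "\<tau> \<in> {a..b}" "\<And>s. s \<in> {a..b} \<Longrightarrow> norm (g s) \<le> norm (g \<tau>)"
    using continuous_attains_sup[of "{a..b}" "\<lambda>\<tau>. norm (g \<tau>)"] t by auto
  have "norm (v1 s - v2 s) \<le> L * norm (g \<tau>)" if "s \<in> {a..b}" for s
    using L[OF that] \<tau>(2)[OF that] mult_left_mono[OF \<tau>(2)[OF that] assms(3)] by (simp add: g_def)
  from vector_derivative_bound[OF g this assms(1) \<tau>(1)]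
  have "norm (g \<tau>) \<le> L * norm (g \<tau>) * \<bar>\<tau> - t1\<bar>" using assms(2) by (simp add: g_def)
  also have "\<dots> \<le> L * norm (g \<tau>) * (b - a)"
    using \<tau>(1) assms(1,3) by (intro mult_left_mono) auto
  also have "\<dots> \<le> 1/2 * norm (g \<tau>)"
    using mult_right_mono[OF assms(4), of "norm (g \<tau>)"] by (simp add: algebra_simps)
  finally have "norm (g \<tau>) = 0" using norm_ge_zero[of "g \<tau>"] by linarith
  then show ?thesis using \<tau>(2)[OF t] by (simp add: g_def)
qed

text \<open>The field is smooth relative to the time set only, so the Lipschitz constant comes from
  a local extension \<open>h\<close>. It agrees with the field along both curves while they stay in
  the chart and the time stays in \<open>S\<close>.\<close>

lemma integral_curve_unique_locally:
  assumes A: "smooth_atlas A" and X: "time_dependent_field A I X"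
    and S: "is_interval S" "S \<subseteq> I" and g: "integral_curve A X S \<gamma>1" "integral_curve A X S \<gamma>2"
    and t1: "t1 \<in> S" "\<gamma>1 t1 = \<gamma>2 t1"
  shows "\<exists>\<eta>>0. \<forall>t\<in>S. dist t t1 < \<eta> \<longrightarrow> \<gamma>1 t = \<gamma>2 t"
proof -
  define \<xi> where "\<xi> = chart_at A (\<gamma>1 t1)"
  have \<xi>: "\<xi> \<in> A" "\<gamma>1 t1 \<in> dom_chart \<xi>" "\<gamma>2 t1 \<in> dom_chart \<xi>" using chart_at[OF A] t1(2) by (auto simp: \<xi>_def)
  note C = smooth_atlasD[OF A \<xi>(1)]
  have Xs: "smooth_on (coord \<xi> ` dom_chart \<xi> \<times> I) (\<lambda>(z, t). X \<xi> (coord_inv \<xi> z) t)"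
    using X \<xi>(1) by (auto simp: time_dependent_field_def)
  have x: "(coord \<xi> (\<gamma>1 t1), t1) \<in> coord \<xi> ` dom_chart \<xi> \<times> I" using \<xi> S t1 by auto
  obtain U h where U: "open U" "(coord \<xi> (\<gamma>1 t1), t1) \<in> U" "\<forall>n. Ck_on n U h"
      "\<forall>y\<in>(coord \<xi> ` dom_chart \<xi> \<times> I) \<inter> U. h y = (case y of (z, t) \<Rightarrow> X \<xi> (coord_inv \<xi> z) t)"
    by (rule smooth_onE[OF Xs x])
  obtain r L where r: "0 < r" "0 \<le> L" "cball (coord \<xi> (\<gamma>1 t1), t1) r \<subseteq> U"
    "\<And>a b. a \<in> cball (coord \<xi> (\<gamma>1 t1), t1) r \<Longrightarrow> b \<in> cball (coord \<xi> (\<gamma>1 t1), t1) r \<Longrightarrow> norm (h a - h b) \<le> L * norm (a - b)"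
    using Ck_on_locally_lipschitz[OF U(1) U(3)[rule_format] U(2)] by blast
  have near: "\<exists>d>0. \<forall>t\<in>S. dist t t1 < d \<longrightarrow> \<gamma> t \<in> dom_chart \<xi> \<and> (coord \<xi> (\<gamma> t), t) \<in> ball (coord \<xi> (\<gamma>1 t1), t1) r"
    if gi: "integral_curve A X S \<gamma>" and ge: "\<gamma> t1 = \<gamma>1 t1" for \<gamma>
  proof -
    have c: "continuous (at t1 within S) \<gamma>"
      using gi t1(1) by (auto simp: integral_curve_def continuous_on_eq_continuous_within)
    obtain d1 where d1: "d1 > 0" "\<And>t. t \<in> S \<Longrightarrow> dist t t1 < d1 \<Longrightarrow> \<gamma> t \<in> dom_chart \<xi>"
      using eventually_in_open_within[OF c C(1)] \<xi>(2) ge by metis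
    have "((\<lambda>s. coord \<xi> (\<gamma> s)) has_vector_derivative X \<xi> (\<gamma> t1) t1) (at t1 within S)"
      using gi ge t1(1) \<xi>(1,2) by (auto simp: integral_curve_def has_velocity_def)
    then have "continuous (at t1 within S) (\<lambda>s. (coord \<xi> (\<gamma> s), s))"
      by (intro continuous_Pair continuous_ident) (rule has_vector_derivative_continuous)
    from eventually_in_open_within[OF this open_ball, of "(coord \<xi> (\<gamma>1 t1), t1)" r] ge r(1)
    obtain d2 where d2: "d2 > 0" "\<And>t. t \<in> S \<Longrightarrow> dist t t1 < d2 \<Longrightarrow> (coord \<xi> (\<gamma> t), t) \<in> ball (coord \<xi> (\<gamma>1 t1), t1) r"
      by auto
    show ?thesis using d1 d2 by (intro exI[of _ "min d1 d2"]) auto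
  qed
  obtain d1 where d1: "d1 > 0" "\<And>t. t \<in> S \<Longrightarrow> dist t t1 < d1 \<Longrightarrow> \<gamma>1 t \<in> dom_chart \<xi> \<and> (coord \<xi> (\<gamma>1 t), t) \<in> ball (coord \<xi> (\<gamma>1 t1), t1) r"
    using near[OF g(1) refl] by blast
  obtain d2 where d2: "d2 > 0" "\<And>t. t \<in> S \<Longrightarrow> dist t t1 < d2 \<Longrightarrow> \<gamma>2 t \<in> dom_chart \<xi> \<and> (coord \<xi> (\<gamma>2 t), t) \<in> ball (coord \<xi> (\<gamma>1 t1), t1) r"
    using near[OF g(2) t1(2)[symmetric]] by blast
  define \<eta> where "\<eta> = min (min d1 d2) (1 / (2 * (L + 1)))"
  have \<eta>: "\<eta> > 0" "\<eta> * L \<le> 1/2"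
  proof -
    show "\<eta> > 0" using d1 d2 r(2) by (simp add: \<eta>_def)
    have "\<eta> * L \<le> 1 / (2 * (L + 1)) * L" using r(2) by (intro mult_right_mono) (auto simp: \<eta>_def)
    also have "\<dots> \<le> 1/2" using r(2) by (simp add: field_simps)
    finally show "\<eta> * L \<le> 1/2" .
  qed
  have "\<gamma>1 t = \<gamma>2 t" if t: "t \<in> S" "dist t t1 < \<eta>" for t
  proof -
    define a b where "a = min t t1" and "b = max t t1"
    have ab: "{a..b} \<subseteq> S" "t \<in> {a..b}" "t1 \<in> {a..b}" "b - a < \<eta>"
    proof -
      have "a \<in> S" "b \<in> S" using t(1) t1(1) by (auto simp: a_def b_def min_def max_def)
      then show "{a..b} \<subseteq> S" using mem_is_interval_1_I[OF S(1)] by (meson atLeastAtMost_iff subsetI)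
      show "t \<in> {a..b}" "t1 \<in> {a..b}" by (auto simp: a_def b_def)
      show "b - a < \<eta>" using t(2) by (auto simp: a_def b_def dist_real_def min_def max_def)
    qed
    have s: "s \<in> S" "dist s t1 < d1" "dist s t1 < d2" if "s \<in> {a..b}" for s
      using that ab t by (auto simp: a_def b_def dist_real_def \<eta>_def min_def max_def split: if_splits)
    have v: "((\<lambda>s. coord \<xi> (\<gamma> s)) has_vector_derivative h (coord \<xi> (\<gamma> s), s)) (at s within {a..b})"
      if "integral_curve A X S \<gamma>" "s \<in> {a..b}" "\<gamma> s \<in> dom_chart \<xi>" "(coord \<xi> (\<gamma> s), s) \<in> ball (coord \<xi> (\<gamma>1 t1), t1) r" for \<gamma> s
    proof -
      have "((\<lambda>s. coord \<xi> (\<gamma> s)) has_vector_derivative X \<xi> (\<gamma> s) s) (at s within S)"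
        using that s(1) \<xi>(1) by (auto simp: integral_curve_def has_velocity_def)
      moreover have "h (coord \<xi> (\<gamma> s), s) = X \<xi> (\<gamma> s) s"
        using U(4)[rule_format, of "(coord \<xi> (\<gamma> s), s)"] that C(5) r(3) s(1)[OF that(2)] S(2)
        by (auto simp: subset_iff dist_commute intro: less_imp_le)
      ultimately show ?thesis using ab(1) by (auto intro: has_vector_derivative_within_subset)
    qed
    have "coord \<xi> (\<gamma>1 t) = coord \<xi> (\<gamma>2 t)"
    proof (rule ode_unique_short[OF ab(3) _ r(2) _ _ _ _ ab(2)])
      show "(b - a) * L \<le> 1/2" using mult_right_mono[of "b - a" \<eta> L] ab(4) r(2) \<eta>(2) by linarith
      show "((\<lambda>s. coord \<xi> (\<gamma>1 s)) has_vector_derivative h (coord \<xi> (\<gamma>1 s), s)) (at s within {a..b})"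
        "((\<lambda>s. coord \<xi> (\<gamma>2 s)) has_vector_derivative h (coord \<xi> (\<gamma>2 s), s)) (at s within {a..b})" if "s \<in> {a..b}" for s
        using v[OF g(1) that] v[OF g(2) that] d1(2)[OF s(1,2)[OF that]] d2(2)[OF s(1,3)[OF that]] by auto
      show "norm (h (coord \<xi> (\<gamma>1 s), s) - h (coord \<xi> (\<gamma>2 s), s)) \<le> L * norm (coord \<xi> (\<gamma>1 s) - coord \<xi> (\<gamma>2 s))"
        if "s \<in> {a..b}" for s
        using r(4)[of "(coord \<xi> (\<gamma>1 s), s)" "(coord \<xi> (\<gamma>2 s), s)"] d1(2)[OF s(1,2)[OF that]] d2(2)[OF s(1,3)[OF that]]
        by (simp add: norm_Pair less_imp_le)
    qed (use t1 in simp)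
    then show ?thesis using C(5) d1(2) d2(2) s ab(2) by metis
  qed
  then show ?thesis using \<eta>(1) by blast
qed

text \<open>The coincidence set is open by local uniqueness and closed because the manifold is
  Hausdorff; intervals are connected.\<close>

lemma integral_curve_unique:
  fixes A :: "('a::{t2_space,second_countable_topology}, 'e::euclidean_space) chart set"
  assumes A: "smooth_atlas A" and X: "time_dependent_field A I X"
    and S: "is_interval S" "S \<subseteq> I" and g: "integral_curve A X S \<gamma>1" "integral_curve A X S \<gamma>2"
    and t1: "t1 \<in> S" "\<gamma>1 t1 = \<gamma>2 t1" and t: "t \<in> S"
  shows "\<gamma>1 t = \<gamma>2 t"
proof -
  let ?E = "{t \<in> S. \<gamma>1 t = \<gamma>2 t}"
  have c: "continuous_on S \<gamma>1" "continuous_on S \<gamma>2" using g by (auto simp: integral_curve_def)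
  have "closedin (top_of_set S) ?E"
  proof -
    have "continuous_on S (\<lambda>t. (\<gamma>1 t, \<gamma>2 t))" using c by (intro continuous_on_Pair)
    then have "closedin (top_of_set S) (S \<inter> (\<lambda>t. (\<gamma>1 t, \<gamma>2 t)) -` {y. \<exists>x. y = (x, x)})"
      by (rule continuous_closedin_preimage) (rule closed_diagonal)
    moreover have "S \<inter> (\<lambda>t. (\<gamma>1 t, \<gamma>2 t)) -` {y. \<exists>x. y = (x, x)} = ?E" by auto
    ultimately show ?thesis by simp
  qed
  moreover have "openin (top_of_set S) ?E"
    unfolding openin_euclidean_subtopology_iff
    using integral_curve_unique_locally[OF A X S g] by fastforce
  moreover have "connected S" using S(1) is_interval_connected_1 by blast
  ultimately have "?E = {} \<or> ?E = S" using connected_clopen by blast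
  then show ?thesis using t1 t by auto
qed


text \<open>Time becomes a coordinate: the autonomous flow of (h, 1) is started at (p, s) and read
  off after time t - s. Since \<open>h\<close> is a local extension of the field, the evolution
  exists for all times near \<open>t0\<close>, while it is an integral curve of the field only at
  times of \<open>I\<close>.\<close>

lemma local_evolution_exists:
  assumes A: "smooth_atlas A" and X: "time_dependent_field A I X" and t0: "t0 \<in> I"
  shows "\<exists>\<xi> P \<delta> \<theta>. \<xi> \<in> A \<and> open P \<and> p0 \<in> P \<and> P \<subseteq> dom_chart \<xi> \<and> 0 < \<delta> \<and>
    (\<forall>p\<in>P. \<forall>s\<in>ball t0 \<delta>. \<forall>t\<in>ball t0 \<delta>. \<theta> p s t \<in> dom_chart \<xi>) \<and>
    (\<forall>p\<in>P. \<forall>s\<in>ball t0 \<delta>. \<theta> p s s = p) \<and>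
    (\<forall>p\<in>P. \<forall>s\<in>ball t0 \<delta>. integral_curve A X (I \<inter> ball t0 \<delta>) (\<theta> p s)) \<and>
    (\<forall>s\<in>ball t0 \<delta>. smooth_on (coord \<xi> ` P \<times> ball t0 \<delta>) (family_rep \<xi> \<xi> (\<lambda>p. \<theta> p s)))"
proof -
  define \<xi> where "\<xi> = chart_at A p0"
  have \<xi>: "\<xi> \<in> A" "p0 \<in> dom_chart \<xi>" using chart_at[OF A] by (auto simp: \<xi>_def)
  note C = smooth_atlasD[OF A \<xi>(1)]
  define z0 where "z0 = coord \<xi> p0"
  have Xs: "smooth_on (coord \<xi> ` dom_chart \<xi> \<times> I) (\<lambda>(z, t). X \<xi> (coord_inv \<xi> z) t)"
    using X \<xi>(1) by (auto simp: time_dependent_field_def)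
  have x: "(z0, t0) \<in> coord \<xi> ` dom_chart \<xi> \<times> I" using \<xi> t0 by (auto simp: z0_def)
  obtain U h where U: "open U" "(z0, t0) \<in> U" "\<forall>n. Ck_on n U h"
      "\<forall>y\<in>(coord \<xi> ` dom_chart \<xi> \<times> I) \<inter> U. h y = (case y of (z, t) \<Rightarrow> X \<xi> (coord_inv \<xi> z) t)"
    by (rule smooth_onE[OF Xs x])
  define \<Omega> where "\<Omega> = U \<inter> (coord \<xi> ` dom_chart \<xi> \<times> UNIV)"
  have \<Omega>: "open \<Omega>" "(z0, t0) \<in> \<Omega>"
    using U(1,2) C(2) x by (auto simp: \<Omega>_def intro!: open_Int open_Times)
  have Y: "Ck_on n \<Omega> (\<lambda>x. (h x, 1::real))" for n
    by (intro Ck_on_Pair \<Omega>(1) Ck_on_const Ck_on_subset[OF U(3)[rule_format]]) (auto simp: \<Omega>_def)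
  obtain V d \<Theta> where V: "open V" "(z0, t0) \<in> V" "0 < d" "\<And>n. Ck_on n (V \<times> {- d<..<d}) \<Theta>"
    "\<And>x r. x \<in> V \<Longrightarrow> r \<in> {- d<..<d} \<Longrightarrow> \<Theta> (x, r) \<in> \<Omega>"
    "\<And>x r. x \<in> V \<Longrightarrow> r \<in> {- d<..<d} \<Longrightarrow> ((\<lambda>r. \<Theta> (x, r)) has_vector_derivative (h (\<Theta> (x, r)), 1)) (at r)"
    "\<And>x. x \<in> V \<Longrightarrow> \<Theta> (x, 0) = x"
    using local_flow_exists[OF \<Omega>(1) Y \<Omega>(2)] by metis
  \<comment> \<open>The last component of the extended field is 1, so the second component of the
    flow is a clock.\<close>
  have snd\<Theta>: "snd (\<Theta> (x, r)) = snd x + r" if "x \<in> V" "r \<in> {- d<..<d}" for x r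
  proof -
    have der: "((\<lambda>r. snd (\<Theta> (x, r)) - r) has_vector_derivative 0) (at r)" if "r \<in> {- d<..<d}" for r
      using has_vector_derivative_diff[OF bounded_linear.has_vector_derivative[OF bounded_linear_snd V(6)[OF \<open>x \<in> V\<close> that]]
          has_vector_derivative_id] by simp
    have "norm ((snd (\<Theta> (x, r)) - r) - (snd (\<Theta> (x, 0)) - 0)) \<le> 0 * \<bar>r - 0\<bar>"
    proof (rule vector_derivative_bound[of "- \<bar>r\<bar>" "\<bar>r\<bar>" _ "\<lambda>_. 0"])
      show "((\<lambda>r. snd (\<Theta> (x, r)) - r) has_vector_derivative 0) (at t within {- \<bar>r\<bar>..\<bar>r\<bar>})"
        if "t \<in> {- \<bar>r\<bar>..\<bar>r\<bar>}" for t
      proof (rule has_vector_derivative_at_within, rule der)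
        show "t \<in> {- d<..<d}" using that \<open>r \<in> {- d<..<d}\<close> by (auto simp: abs_if split: if_splits)
      qed
    qed auto
    then show ?thesis using V(7)[OF that(1)] by simp
  qed
  obtain Vz e where Ve: "open Vz" "open e" "z0 \<in> Vz" "t0 \<in> e" "Vz \<times> e \<subseteq> V"
    using open_prod_elim[OF V(1,2)] by (metis mem_Sigma_iff)
  obtain r where r: "r > 0" "ball t0 r \<subseteq> e" using Ve(2,4) openE by blast
  \<comment> \<open>Two times in a ball of radius d/2 differ by less than \<open>d\<close>, the
    lifetime of \<open>\<Theta>\<close>.\<close>
  define \<delta> where "\<delta> = min r (d / 2)"
  have \<delta>: "\<delta> > 0" "ball t0 \<delta> \<subseteq> e" "\<And>s t. s \<in> ball t0 \<delta> \<Longrightarrow> t \<in> ball t0 \<delta> \<Longrightarrow> t - s \<in> {- d<..<d}"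
  proof -
    show "\<delta> > 0" using r V(3) by (simp add: \<delta>_def)
    show "ball t0 \<delta> \<subseteq> e" using r by (auto simp: \<delta>_def subset_iff)
    fix s t assume "s \<in> ball t0 \<delta>" "t \<in> ball t0 \<delta>"
    then have "\<bar>t0 - s\<bar> < d / 2" "\<bar>t0 - t\<bar> < d / 2" by (auto simp: \<delta>_def dist_real_def)
    then show "t - s \<in> {- d<..<d}" by (simp add: abs_if split: if_splits)
  qed
  define P where "P = dom_chart \<xi> \<inter> coord \<xi> -` Vz"
  have P: "open P" "p0 \<in> P" "P \<subseteq> dom_chart \<xi>"
    using continuous_open_preimage[OF C(3,1) Ve(1)] \<xi> Ve(3) by (auto simp: P_def z0_def)
  have inV: "(coord \<xi> p, s) \<in> V" if "p \<in> P" "s \<in> ball t0 \<delta>" for p s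
    using that Ve(5) \<delta>(2) by (auto simp: P_def)
  define \<theta> where "\<theta> p s t = coord_inv \<xi> (fst (\<Theta> ((coord \<xi> p, s), t - s)))" for p s t
  have in\<Omega>: "\<Theta> ((coord \<xi> p, s), t - s) \<in> \<Omega>" if "p \<in> P" "s \<in> ball t0 \<delta>" "t \<in> ball t0 \<delta>" for p s t
    using V(5)[OF inV \<delta>(3)] that by blast
  have fst_in: "fst (\<Theta> ((coord \<xi> p, s), t - s)) \<in> coord \<xi> ` dom_chart \<xi>"
    if "p \<in> P" "s \<in> ball t0 \<delta>" "t \<in> ball t0 \<delta>" for p s t
    using in\<Omega>[OF that] by (auto simp: \<Omega>_def)
  have \<theta>c: "coord \<xi> (\<theta> p s t) = fst (\<Theta> ((coord \<xi> p, s), t - s))"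
    if "p \<in> P" "s \<in> ball t0 \<delta>" "t \<in> ball t0 \<delta>" for p s t
    unfolding \<theta>_def using C(6)[OF fst_in[OF that]] .
  have \<theta>d: "\<theta> p s t \<in> dom_chart \<xi>" if "p \<in> P" "s \<in> ball t0 \<delta>" "t \<in> ball t0 \<delta>" for p s t
    unfolding \<theta>_def using C(7)[OF fst_in[OF that]] .
  have \<theta>v: "((\<lambda>t. coord \<xi> (\<theta> p s t)) has_vector_derivative X \<xi> (\<theta> p s t) t) (at t)"
    if p: "p \<in> P" and s: "s \<in> ball t0 \<delta>" and t: "t \<in> I \<inter> ball t0 \<delta>" for p s t
  proof -
    let ?x = "(coord \<xi> p, s)"
    have t': "t \<in> ball t0 \<delta>" using t by simp
    have d1: "((\<lambda>t. t - s) has_vector_derivative 1) (at t)" by (auto intro!: derivative_eq_intros)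
    have d2: "((\<lambda>r. fst (\<Theta> (?x, r))) has_vector_derivative h (\<Theta> (?x, t - s))) (at (t - s))"
      using bounded_linear.has_vector_derivative[OF bounded_linear_fst V(6)[OF inV[OF p s] \<delta>(3)[OF s t']]] by simp
    have "((\<lambda>t. fst (\<Theta> (?x, t - s))) has_vector_derivative h (\<Theta> (?x, t - s))) (at t)"
      using vector_diff_chain_at[OF d1 d2] by (simp add: o_def)
    then have "((\<lambda>t. coord \<xi> (\<theta> p s t)) has_vector_derivative h (\<Theta> (?x, t - s))) (at t)"
      by (rule has_vector_derivative_transform_within_open[OF _ open_ball t'])
        (use \<theta>c[OF p s] in simp)
    moreover have "h (\<Theta> (?x, t - s)) = X \<xi> (\<theta> p s t) t"
    proof -
      have "\<Theta> (?x, t - s) = (fst (\<Theta> (?x, t - s)), t)"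
        using snd\<Theta>[OF inV[OF p s] \<delta>(3)[OF s t']] by (simp add: prod_eq_iff)
      moreover have "\<Theta> (?x, t - s) \<in> (coord \<xi> ` dom_chart \<xi> \<times> I) \<inter> U"
        using in\<Omega>[OF p s t'] t snd\<Theta>[OF inV[OF p s] \<delta>(3)[OF s t']] by (auto simp: \<Omega>_def mem_Times_iff)
      ultimately show ?thesis using U(4)[rule_format, of "\<Theta> (?x, t - s)"] unfolding \<theta>_def by (metis case_prod_conv)
    qed
    ultimately show ?thesis by simp
  qed
  have \<theta>s: "smooth_on (coord \<xi> ` P \<times> ball t0 \<delta>) (family_rep \<xi> \<xi> (\<lambda>p. \<theta> p s))" if s: "s \<in> ball t0 \<delta>" for s
  proof -
    let ?S = "coord \<xi> ` P \<times> ball t0 \<delta>"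
    have "smooth_on (V \<times> {- d<..<d}) \<Theta>"
      using V(4) by (intro smooth_onI_open open_Times V(1) open_greaterThanLessThan)
    moreover have "smooth_on ?S (\<lambda>q. ((fst q, s), snd q - s))"
    proof -
      have "bounded_linear (\<lambda>q :: 'b \<times> real. ((fst q, 0 :: real), snd q))"
        by (intro bounded_linear_Pair bounded_linear_fst bounded_linear_snd bounded_linear_zero)
      from smooth_on_add[OF smooth_on_linear[OF this] smooth_on_const[of _ "((0, s), - s)"]]
      show ?thesis by (rule smooth_on_cong) simp
    qed
    moreover have "((fst q, s), snd q - s) \<in> V \<times> {- d<..<d}" if "q \<in> ?S" for q
      using that inV[OF _ s] \<delta>(3)[OF s] by force
    ultimately have "smooth_on ?S (\<lambda>q. \<Theta> ((fst q, s), snd q - s))"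
      by (intro smooth_on_compose[where f = "\<lambda>q. ((fst q, s), snd q - s)" and g = \<Theta>])
    then have "smooth_on ?S (\<lambda>q. fst (\<Theta> ((fst q, s), snd q - s)))"
      by (rule smooth_on_compose[OF _ smooth_on_fst[of UNIV]]) simp
    then show ?thesis
      by (rule smooth_on_cong) (use \<theta>c[OF _ s] C(5) P(3) in \<open>auto simp: family_rep_def subset_iff\<close>)
  qed
  have \<theta>i: "integral_curve A X (I \<inter> ball t0 \<delta>) (\<theta> p s)" if p: "p \<in> P" and s: "s \<in> ball t0 \<delta>" for p s
  proof -
    have c: "continuous (at t) (\<theta> p s)" if t: "t \<in> I \<inter> ball t0 \<delta>" for t
    proof -
      have t': "t \<in> ball t0 \<delta>" using t by simp
      have "continuous (at (coord \<xi> (\<theta> p s t))) (coord_inv \<xi>)"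
        using C(2,4) \<theta>d[OF p s t'] by (simp add: continuous_on_eq_continuous_at)
      from continuous_at_compose[OF has_vector_derivative_continuous[OF \<theta>v[OF p s t]] this]
      have "continuous (at t) (\<lambda>t. coord_inv \<xi> (coord \<xi> (\<theta> p s t)))" by (simp add: o_def)
      then have c0: "isCont (\<lambda>t. coord_inv \<xi> (coord \<xi> (\<theta> p s t))) t" .
      have "\<forall>\<^sub>F t in nhds t. coord_inv \<xi> (coord \<xi> (\<theta> p s t)) = \<theta> p s t"
        unfolding eventually_nhds using C(5)[OF \<theta>d[OF p s]] t' by (intro exI[of _ "ball t0 \<delta>"]) auto
      from iffD1[OF isCont_cong[OF this] c0] show ?thesis .
    qed
    show ?thesis unfolding integral_curve_def
    proof (intro conjI ballI)
      show "continuous_on (I \<inter> ball t0 \<delta>) (\<theta> p s)" using c by (rule continuous_at_imp_continuous_on[OF ballI])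
      fix t assume t: "t \<in> I \<inter> ball t0 \<delta>"
      show "has_velocity A (I \<inter> ball t0 \<delta>) (\<theta> p s) t (\<lambda>\<xi>. X \<xi> (\<theta> p s t) t)"
      proof (rule has_velocityI_chart[OF A \<xi>(1) _ t])
        show \<theta>t: "\<theta> p s t \<in> dom_chart \<xi>" using \<theta>d[OF p s] t by auto
        show "continuous (at t within I \<inter> ball t0 \<delta>) (\<theta> p s)"
          using c[OF t] by (rule continuous_at_imp_continuous_at_within)
        show "((\<lambda>t. coord \<xi> (\<theta> p s t)) has_vector_derivative X \<xi> (\<theta> p s t) t) (at t within I \<inter> ball t0 \<delta>)"
          using \<theta>v[OF p s t] by (rule has_vector_derivative_at_within)
        show "X \<xi>' (\<theta> p s t) t = differential \<xi> \<xi>' id (\<theta> p s t) (X \<xi> (\<theta> p s t) t)"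
          if "\<xi>' \<in> A" "\<theta> p s t \<in> dom_chart \<xi>'" for \<xi>'
          using time_dependent_fieldD[OF X \<xi>(1) that(1) \<theta>t that(2)] t by blast
      qed
    qed
  qed
  have \<theta>0: "\<theta> p s s = p" if "p \<in> P" "s \<in> ball t0 \<delta>" for p s
    using V(7)[OF inV[OF that]] C(5) P(3) that(1) by (auto simp: \<theta>_def)
  show ?thesis
    by (rule exI[of _ \<xi>], rule exI[of _ P], rule exI[of _ \<delta>], rule exI[of _ \<theta>])
      (intro conjI ballI \<xi>(1) P \<delta>(1) \<theta>d \<theta>0 \<theta>i \<theta>s)
qed

lemma is_interval_Int_ball: "is_interval I \<Longrightarrow> is_interval (I \<inter> ball (t0::real) \<delta>)"
  by (intro is_interval_Int is_interval_ball_real)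

text \<open>Compactness of the manifold leaves finitely many local evolutions, and the smallest of
  their lifetimes is common to all start points.\<close>

lemma evolution_exists:
  fixes A :: "('a::{t2_space,second_countable_topology}, 'e::euclidean_space) chart set"
  assumes A: "smooth_atlas A" and M: "compact (UNIV :: 'a set)" and X: "time_dependent_field A I X"
    and I: "is_interval I" and t0: "t0 \<in> I"
  obtains \<delta> E where "0 < \<delta>" "\<And>p s. s \<in> I \<inter> ball t0 \<delta> \<Longrightarrow> E p s s = p"
    "\<And>p s. s \<in> I \<inter> ball t0 \<delta> \<Longrightarrow> integral_curve A X (I \<inter> ball t0 \<delta>) (E p s)"
    "\<And>s. s \<in> I \<inter> ball t0 \<delta> \<Longrightarrow> smooth_family A A (I \<inter> ball t0 \<delta>) (\<lambda>p. E p s)"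
proof -
  define Q where "Q p0 \<xi> P \<delta> \<theta> \<longleftrightarrow> \<xi> \<in> A \<and> open P \<and> p0 \<in> P \<and> P \<subseteq> dom_chart \<xi> \<and> 0 < \<delta> \<and>
    (\<forall>p\<in>P. \<forall>s\<in>ball t0 \<delta>. \<forall>t\<in>ball t0 \<delta>. \<theta> p s t \<in> dom_chart \<xi>) \<and>
    (\<forall>p\<in>P. \<forall>s\<in>ball t0 \<delta>. \<theta> p s s = p) \<and>
    (\<forall>p\<in>P. \<forall>s\<in>ball t0 \<delta>. integral_curve A X (I \<inter> ball t0 \<delta>) (\<theta> p s)) \<and>
    (\<forall>s\<in>ball t0 \<delta>. smooth_on (coord \<xi> ` P \<times> ball t0 \<delta>) (family_rep \<xi> \<xi> (\<lambda>p. \<theta> p s)))" for p0 \<xi> P \<delta> \<theta>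
  have "\<exists>\<xi> P \<delta> \<theta>. Q p0 \<xi> P \<delta> \<theta>" for p0
    unfolding Q_def by (rule local_evolution_exists[OF A X t0])
  then obtain \<xi> P \<delta>' \<theta> where "\<And>p0. Q p0 (\<xi> p0) (P p0) (\<delta>' p0) (\<theta> p0)"
    by metis
  then have l: "\<And>p0. \<xi> p0 \<in> A" "\<And>p0. open (P p0)" "\<And>p0. p0 \<in> P p0" "\<And>p0. P p0 \<subseteq> dom_chart (\<xi> p0)"
    "\<And>p0. 0 < \<delta>' p0"
    "\<And>p0 p s t. p \<in> P p0 \<Longrightarrow> s \<in> ball t0 (\<delta>' p0) \<Longrightarrow> t \<in> ball t0 (\<delta>' p0) \<Longrightarrow> \<theta> p0 p s t \<in> dom_chart (\<xi> p0)"
    "\<And>p0 p s. p \<in> P p0 \<Longrightarrow> s \<in> ball t0 (\<delta>' p0) \<Longrightarrow> \<theta> p0 p s s = p"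
    "\<And>p0 p s. p \<in> P p0 \<Longrightarrow> s \<in> ball t0 (\<delta>' p0) \<Longrightarrow> integral_curve A X (I \<inter> ball t0 (\<delta>' p0)) (\<theta> p0 p s)"
    "\<And>p0 s. s \<in> ball t0 (\<delta>' p0) \<Longrightarrow> smooth_on (coord (\<xi> p0) ` P p0 \<times> ball t0 (\<delta>' p0)) (family_rep (\<xi> p0) (\<xi> p0) (\<lambda>p. \<theta> p0 p s))"
    unfolding Q_def by blast+
  obtain D where D: "finite D" "(UNIV :: 'a set) \<subseteq> (\<Union>p0\<in>D. P p0)"
    using compactE_image[OF M, of UNIV P] l(2,3) by (metis UNIV_I UN_I subsetI subset_UNIV)
  have Dne: "D \<noteq> {}" using D(2) by auto
  define \<delta> where "\<delta> = Min (\<delta>' ` D)"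
  have \<delta>: "\<delta> > 0" "\<And>p0. p0 \<in> D \<Longrightarrow> ball t0 \<delta> \<subseteq> ball t0 (\<delta>' p0)"
  proof -
    show "\<delta> > 0" using D(1) Dne l(5) by (auto simp: \<delta>_def)
    fix p0 assume "p0 \<in> D"
    then have "\<delta> \<le> \<delta>' p0" using D(1) by (simp add: \<delta>_def)
    then show "ball t0 \<delta> \<subseteq> ball t0 (\<delta>' p0)" by (rule subset_ball)
  qed
  define i where "i p = (SOME p0. p0 \<in> D \<and> p \<in> P p0)" for p
  have i: "i p \<in> D" "p \<in> P (i p)" for p
  proof -
    have "\<exists>p0. p0 \<in> D \<and> p \<in> P p0" using D(2) by blast
    from someI_ex[OF this] show "i p \<in> D" "p \<in> P (i p)" unfolding i_def by auto
  qed
  define E where "E p s t = \<theta> (i p) p s t" for p s t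
  let ?J = "I \<inter> ball t0 \<delta>"
  have cur: "integral_curve A X ?J (\<theta> p0 p s)" if "p0 \<in> D" "p \<in> P p0" "s \<in> ?J" for p0 p s
    by (rule integral_curve_subset[OF l(8)[OF that(2)]]) (use \<delta>(2)[OF that(1)] that(3) in auto)
  \<comment> \<open>\<open>E\<close> uses a patch chosen separately for each point. Uniqueness
    replaces it by one patch that is fixed near a point, so \<open>E\<close> inherits smoothness
    from there.\<close>
  have Eq: "E p s t = \<theta> p0 p s t" if "p0 \<in> D" "p \<in> P p0" "s \<in> ?J" "t \<in> ?J" for p0 p s t
    unfolding E_def
  proof (rule integral_curve_unique[OF A X is_interval_Int_ball[OF I] _ cur cur])
    show "\<theta> (i p) p s s = \<theta> p0 p s s"
      using l(7)[of p "i p" s] l(7)[of p p0 s] i that \<delta>(2) by (metis IntD2 subsetD)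
  qed (use i that in auto)
  show thesis
  proof (rule that[OF \<delta>(1), of E])
    show "E p s s = p" if "s \<in> ?J" for p s
      unfolding E_def using l(7)[of p "i p" s] i \<delta>(2) that by blast
    show "integral_curve A X ?J (E p s)" if "s \<in> ?J" for p s
      using cur[OF i that] unfolding E_def[abs_def] .
    show "smooth_family A A ?J (\<lambda>p. E p s)" if s: "s \<in> ?J" for s
    proof (rule smooth_familyI_local[OF A A])
      fix p t1 assume t1: "t1 \<in> ?J"
      let ?k = "i p"
      have s': "s \<in> ball t0 (\<delta>' ?k)" using s \<delta>(2)[OF i(1)] by blast
      have "smooth_on (coord (\<xi> ?k) ` P ?k \<times> (?J \<inter> UNIV)) (family_rep (\<xi> ?k) (\<xi> ?k) (\<lambda>p. E p s))"
      proof (rule smooth_on_transfer[OF l(9)[OF s']])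
        show "coord (\<xi> ?k) ` P ?k \<times> (?J \<inter> UNIV) \<subseteq> coord (\<xi> ?k) ` P ?k \<times> ball t0 (\<delta>' ?k)"
          using \<delta>(2)[OF i(1)] by blast
        show "family_rep (\<xi> ?k) (\<xi> ?k) (\<lambda>p. \<theta> ?k p s) x = family_rep (\<xi> ?k) (\<xi> ?k) (\<lambda>p. E p s) x"
          if "x \<in> coord (\<xi> ?k) ` P ?k \<times> (?J \<inter> UNIV)" for x
          using that smooth_atlasD(5)[OF A l(1)] l(4) Eq[OF i(1) _ s] by (auto simp: family_rep_def subset_iff)
      qed
      moreover have "E q s t \<in> dom_chart (\<xi> ?k)" if "q \<in> P ?k" "t \<in> ?J" for q t
      proof -
        have "t \<in> ball t0 (\<delta>' ?k)" using \<delta>(2)[OF i(1)] that(2) by blast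
        then show ?thesis using Eq[OF i(1) that(1) s that(2)] l(6)[OF that(1) s'] by simp
      qed
      ultimately show "\<exists>\<xi>\<in>A. \<exists>\<kappa>\<in>A. \<exists>U J. open U \<and> open J \<and> p \<in> U \<and> t1 \<in> J \<and> U \<subseteq> dom_chart \<xi> \<and>
          (\<forall>p\<in>U. \<forall>t\<in>?J \<inter> J. E p s t \<in> dom_chart \<kappa>) \<and> smooth_on (coord \<xi> ` U \<times> (?J \<inter> J)) (family_rep \<xi> \<kappa> (\<lambda>p. E p s))"
        using l(1,2,4) i by (intro bexI[of _ "\<xi> ?k"] exI[of _ "P ?k"] exI[of _ UNIV]) auto
    qed
  qed
qed

section \<open>Concatenation of integral curves\<close>

lemma has_vector_derivative_within_Un:
  "(f has_vector_derivative v) (at t within S) \<Longrightarrow> (f has_vector_derivative v) (at t within T) \<Longrightarrow>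
    (f has_vector_derivative v) (at t within S \<union> T)"
  by (simp add: has_vector_derivative_def has_derivative_within Lim_within_Un)

text \<open>At the junction both one-sided derivatives equal the field at the common point, so the
  glued curve has a velocity there too.\<close>

lemma integral_curve_glue:
  assumes 1: "integral_curve A X {a..b} \<gamma>1" and 2: "integral_curve A X {b..c} \<gamma>2" and eq: "\<gamma>1 b = \<gamma>2 b"
    and ab: "a \<le> b" "b \<le> c"
  shows "integral_curve A X {a..c} (\<lambda>t. if t \<le> b then \<gamma>1 t else \<gamma>2 t)"
proof -
  let ?g = "\<lambda>t. if t \<le> b then \<gamma>1 t else \<gamma>2 t"
  have un: "{a..c} = {a..b} \<union> {b..c}" using ab by auto
  have g1: "?g t = \<gamma>1 t" if "t \<in> {a..b}" for t using that by auto
  have g2: "?g t = \<gamma>2 t" if "t \<in> {b..c}" for t using that eq by auto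
  have i1: "integral_curve A X {a..b} ?g"
    unfolding integral_curve_def has_velocity_def
  proof (intro conjI ballI impI)
    show "continuous_on {a..b} ?g"
      by (rule continuous_on_cong[THEN iffD1, OF refl g1[symmetric]]) (use 1 in \<open>auto simp: integral_curve_def\<close>)
    fix t \<kappa> assume t: "t \<in> {a..b}" and "\<kappa> \<in> A" "?g t \<in> dom_chart \<kappa>"
    then have "((\<lambda>s. coord \<kappa> (\<gamma>1 s)) has_vector_derivative X \<kappa> (\<gamma>1 t) t) (at t within {a..b})"
      using 1 g1[OF t] unfolding integral_curve_def has_velocity_def by auto
    then show "((\<lambda>s. coord \<kappa> (?g s)) has_vector_derivative X \<kappa> (?g t) t) (at t within {a..b})"
      unfolding g1[OF t] by (rule has_vector_derivative_transform[OF t, rotated]) (simp add: g1)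
  qed
  have i2: "integral_curve A X {b..c} ?g"
    unfolding integral_curve_def has_velocity_def
  proof (intro conjI ballI impI)
    show "continuous_on {b..c} ?g"
      by (rule continuous_on_cong[THEN iffD1, OF refl g2[symmetric]]) (use 2 in \<open>auto simp: integral_curve_def\<close>)
    fix t \<kappa> assume t: "t \<in> {b..c}" and "\<kappa> \<in> A" "?g t \<in> dom_chart \<kappa>"
    then have "((\<lambda>s. coord \<kappa> (\<gamma>2 s)) has_vector_derivative X \<kappa> (\<gamma>2 t) t) (at t within {b..c})"
      using 2 g2[OF t] unfolding integral_curve_def has_velocity_def by auto
    then show "((\<lambda>s. coord \<kappa> (?g s)) has_vector_derivative X \<kappa> (?g t) t) (at t within {b..c})"
      unfolding g2[OF t] by (rule has_vector_derivative_transform[OF t, rotated]) (rule arg_cong[OF g2])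
  qed
  show ?thesis
    unfolding integral_curve_def has_velocity_def
  proof (intro conjI ballI impI)
    show "continuous_on {a..c} ?g"
      unfolding un using i1 i2 by (intro continuous_on_closed_Un) (auto simp: integral_curve_def)
    fix t \<kappa> assume t: "t \<in> {a..c}" and \<kappa>: "\<kappa> \<in> A" "?g t \<in> dom_chart \<kappa>"
    have v: "((\<lambda>s. coord \<kappa> (?g s)) has_vector_derivative X \<kappa> (?g t) t) (at t within S)"
      if "integral_curve A X S ?g" "t \<in> S" for S
      using that \<kappa> unfolding integral_curve_def has_velocity_def by blast
    consider "t < b" | "t = b" | "t > b" by linarith
    then show "((\<lambda>s. coord \<kappa> (?g s)) has_vector_derivative X \<kappa> (?g t) t) (at t within {a..c})"
    proof cases
      case 1
      then have "at t within {a..c} = at t within {a..b}"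
        using t ab by (intro at_within_nhd[of t "{..<b}"]) auto
      with v[OF i1] 1 t show ?thesis by simp
    next
      case 2
      with v[OF i1] v[OF i2] ab show ?thesis unfolding un by (intro has_vector_derivative_within_Un) auto
    next
      case 3
      then have "at t within {a..c} = at t within {b..c}"
        using t ab by (intro at_within_nhd[of t "{b<..}"]) auto
      with v[OF i2] 3 t show ?thesis by simp
    qed
  qed
qed

lemma diffeomorphismI:
  assumes "smooth_map A A \<Phi>" "smooth_map A A \<Psi>" "\<And>p. \<Psi> (\<Phi> p) = p" "\<And>p. \<Phi> (\<Psi> p) = p"
  shows "diffeomorphism A A \<Phi>"
proof -
  have "bij \<Phi>" by (rule bij_betw_byWitness[of _ \<Psi>]) (use assms in auto)
  moreover have "inv \<Phi> = \<Psi>" by (rule inv_equality) (use assms in auto)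
  ultimately show ?thesis using assms by (simp add: diffeomorphism_def)
qed

text \<open>The lifetime depends on the time, so longer intervals are reached by bisection: evolving
  from \<open>a\<close> to \<open>b\<close> is a diffeomorphism for all short intervals around each
  time, and this passes to the union of adjoining intervals.\<close>

theorem flow_of_time_dependent_field:
  fixes A :: "('a::{t2_space,second_countable_topology}, 'e::euclidean_space) chart set"
  assumes A: "smooth_atlas A" and M: "compact (UNIV :: 'a set)" and X: "time_dependent_field A I X"
    and I: "is_interval I" "0 \<in> I" "\<And>t. t \<in> I \<Longrightarrow> 0 \<le> t"
  obtains \<psi> where "time_dependent_diffeo A I \<psi>"
    "\<And>p t. t \<in> I \<Longrightarrow> has_velocity A I (\<psi> p) t (\<lambda>\<xi>. X \<xi> (\<psi> p t) t)"
proof -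
  \<comment> \<open>Vacuous unless {a..b} lies in \<open>I\<close>: the bisection principle also
    tests short intervals that reach across an endpoint of \<open>I\<close>.\<close>
  define good where "good a b \<longleftrightarrow> ({a..b} \<subseteq> I \<longrightarrow> (\<exists>\<Phi>. diffeomorphism A A \<Phi> \<and>
      (\<forall>p. \<exists>\<gamma>. integral_curve A X {a..b} \<gamma> \<and> \<gamma> a = p \<and> \<gamma> b = \<Phi> p)))" for a b
  have good: "good 0 \<tau>" if \<tau>: "\<tau> \<in> I" for \<tau>
  proof (induction rule: Bolzano[OF I(3)[OF \<tau>]])
    case (1 a b c)
    show ?case unfolding good_def
    proof
      assume "{a..c} \<subseteq> I"
      then have sub: "{a..b} \<subseteq> I" "{b..c} \<subseteq> I" using 1 by auto
      obtain \<Phi>1 where \<Phi>1: "diffeomorphism A A \<Phi>1"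
         "\<And>p. \<exists>\<gamma>. integral_curve A X {a..b} \<gamma> \<and> \<gamma> a = p \<and> \<gamma> b = \<Phi>1 p"
        using 1(1) sub(1) unfolding good_def by blast
      obtain \<Phi>2 where \<Phi>2: "diffeomorphism A A \<Phi>2"
         "\<And>p. \<exists>\<gamma>. integral_curve A X {b..c} \<gamma> \<and> \<gamma> b = p \<and> \<gamma> c = \<Phi>2 p"
        using 1(2) sub(2) unfolding good_def by blast
      have "\<exists>\<gamma>. integral_curve A X {a..c} \<gamma> \<and> \<gamma> a = p \<and> \<gamma> c = \<Phi>2 (\<Phi>1 p)" for p
      proof -
        obtain \<gamma>1 where g1: "integral_curve A X {a..b} \<gamma>1" "\<gamma>1 a = p" "\<gamma>1 b = \<Phi>1 p" using \<Phi>1(2) by blast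
        obtain \<gamma>2 where g2: "integral_curve A X {b..c} \<gamma>2" "\<gamma>2 b = \<Phi>1 p" "\<gamma>2 c = \<Phi>2 (\<Phi>1 p)" using \<Phi>2(2) by blast
        show ?thesis
          using integral_curve_glue[OF g1(1) g2(1) _ 1(3,4)] g1 g2 1(3,4)
          by (intro exI[of _ "\<lambda>t. if t \<le> b then \<gamma>1 t else \<gamma>2 t"]) (auto simp: antisym)
      qed
      then show "\<exists>\<Phi>. diffeomorphism A A \<Phi> \<and> (\<forall>p. \<exists>\<gamma>. integral_curve A X {a..c} \<gamma> \<and> \<gamma> a = p \<and> \<gamma> c = \<Phi> p)"
        using diffeomorphism_compose[OF A \<Phi>1(1) \<Phi>2(1)] by blast
    qed
  next
    case (2 x)
    then have "x \<in> I" using mem_is_interval_1_I[OF I(1,2) \<tau>] by auto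
    obtain \<delta> E where E: "0 < \<delta>" "\<And>p s. s \<in> I \<inter> ball x \<delta> \<Longrightarrow> E p s s = p"
      "\<And>p s. s \<in> I \<inter> ball x \<delta> \<Longrightarrow> integral_curve A X (I \<inter> ball x \<delta>) (E p s)"
      "\<And>s. s \<in> I \<inter> ball x \<delta> \<Longrightarrow> smooth_family A A (I \<inter> ball x \<delta>) (\<lambda>p. E p s)"
      using evolution_exists[OF A M X I(1) \<open>x \<in> I\<close>] by metis
    have "good a b" if ab: "a \<le> x" "x \<le> b" "b - a < \<delta>" for a b
      unfolding good_def
    proof
      assume sub: "{a..b} \<subseteq> I"
      let ?J = "I \<inter> ball x \<delta>"
      have J: "a \<in> ?J" "b \<in> ?J" "{a..b} \<subseteq> ?J" using sub ab by (auto simp: dist_real_def)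
      \<comment> \<open>Evolving back undoes evolving forth, by uniqueness; this supplies the
        inverse of the diffeomorphism.\<close>
      have uniq: "E (E p s t) t s = p" if "s \<in> ?J" "t \<in> ?J" for p s t
      proof -
        have "E (E p s t) t s = E p s s"
          by (rule integral_curve_unique[OF A X is_interval_Int_ball[OF I(1)] _ E(3)[OF that(2)] E(3)[OF that(1)] that(2) _ that(1)])
            (use E(2)[OF that(2)] in auto)
        then show ?thesis using E(2)[OF that(1)] by simp
      qed
      have "diffeomorphism A A (\<lambda>p. E p a b)"
        by (rule diffeomorphismI[where \<Psi> = "\<lambda>p. E p b a"])
          (use smooth_family_imp_smooth_map[OF A E(4)] J uniq in auto)
      moreover have "integral_curve A X {a..b} (E p a)" for p
        using integral_curve_subset[OF E(3)[OF J(1)] J(3)] .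
      ultimately show "\<exists>\<Phi>. diffeomorphism A A \<Phi> \<and> (\<forall>p. \<exists>\<gamma>. integral_curve A X {a..b} \<gamma> \<and> \<gamma> a = p \<and> \<gamma> b = \<Phi> p)"
        using E(2)[OF J(1)] by blast
    qed
    then show ?case using E(1) by blast
  qed
  have sub: "{0..t} \<subseteq> I" if "t \<in> I" for t using mem_is_interval_1_I[OF I(1,2) that] by auto
  have "\<exists>\<Phi>. diffeomorphism A A \<Phi> \<and> (\<forall>p. \<exists>\<gamma>. integral_curve A X {0..t} \<gamma> \<and> \<gamma> 0 = p \<and> \<gamma> t = \<Phi> p)" if "t \<in> I" for t
    using good[OF that] sub[OF that] unfolding good_def by blast
  then obtain \<Phi> where \<Phi>: "\<And>t. t \<in> I \<Longrightarrow> diffeomorphism A A (\<Phi> t)"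
    "\<And>t p. t \<in> I \<Longrightarrow> \<exists>\<gamma>. integral_curve A X {0..t} \<gamma> \<and> \<gamma> 0 = p \<and> \<gamma> t = \<Phi> t p" by metis
  obtain \<gamma> where \<gamma>: "\<And>t p. t \<in> I \<Longrightarrow> integral_curve A X {0..t} (\<gamma> t p)"
    "\<And>t p. t \<in> I \<Longrightarrow> \<gamma> t p 0 = p" "\<And>t p. t \<in> I \<Longrightarrow> \<gamma> t p t = \<Phi> t p" using \<Phi>(2) by metis
  define \<psi> where "\<psi> p t = \<Phi> t p" for p t
  \<comment> \<open>The curves obtained for different final times are restrictions of one another,
    so the end point maps \<open>\<Phi> t\<close> assemble to a single curve through each
    \<open>p\<close>.\<close>
  have on_curve: "\<gamma> t p s = \<psi> p s" if "t \<in> I" "s \<in> {0..t}" for t p s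
  proof -
    have s: "s \<in> I" using sub[OF that(1)] that(2) by blast
    have "\<gamma> t p s = \<gamma> s p s"
    proof (rule integral_curve_unique[OF A X is_interval_cc sub[OF s] _ \<gamma>(1)[OF s]])
      show "integral_curve A X {0..s} (\<gamma> t p)"
        by (rule integral_curve_subset[OF \<gamma>(1)[OF that(1)]]) (use that in auto)
      show "\<gamma> t p 0 = \<gamma> s p 0" using \<gamma>(2) s that(1) by simp
    qed (use that in auto)
    then show ?thesis using \<gamma>(3)[OF s] by (simp add: \<psi>_def)
  qed
  have \<psi>0: "\<psi> p 0 = p" for p using \<gamma>(2,3)[OF I(2)] by (simp add: \<psi>_def)
  \<comment> \<open>Bisection gives diffeomorphisms for single times but no joint smoothness. Near
    \<open>t0\<close> the flow is a jointly smooth local evolution applied after the fixed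
    diffeomorphism at \<open>t0\<close>, which provides it.\<close>
  have local: "\<exists>\<delta> E. 0 < \<delta> \<and> (\<forall>p. \<forall>t\<in>I \<inter> ball t0 \<delta>. \<psi> p t = E (\<psi> p t0) t) \<and>
      (\<forall>p. integral_curve A X (I \<inter> ball t0 \<delta>) (E p)) \<and> smooth_family A A (I \<inter> ball t0 \<delta>) E" if t0: "t0 \<in> I" for t0
  proof -
    obtain \<delta> E where E: "0 < \<delta>" "\<And>p s. s \<in> I \<inter> ball t0 \<delta> \<Longrightarrow> E p s s = p"
      "\<And>p s. s \<in> I \<inter> ball t0 \<delta> \<Longrightarrow> integral_curve A X (I \<inter> ball t0 \<delta>) (E p s)"
      "\<And>s. s \<in> I \<inter> ball t0 \<delta> \<Longrightarrow> smooth_family A A (I \<inter> ball t0 \<delta>) (\<lambda>p. E p s)"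
      using evolution_exists[OF A M X I(1) t0] by metis
    let ?J = "I \<inter> ball t0 \<delta>"
    have t0J: "t0 \<in> ?J" using t0 E(1) by simp
    have "\<psi> p t = E (\<psi> p t0) t0 t" if t: "t \<in> ?J" for p t
    proof -
      define m M where "m = min t t0" and "M = max t t0"
      have mM: "M \<in> I" "t \<in> {m..M}" "t0 \<in> {m..M}" "0 \<le> m" using t t0 I(3) by (auto simp: m_def M_def min_def max_def)
      have sJ: "{m..M} \<subseteq> ?J"
      proof -
        have "m \<in> ?J" "M \<in> ?J" unfolding m_def M_def min_def max_def using t t0J by presburger+
        then show ?thesis
          using mem_is_interval_1_I[OF is_interval_Int_ball[OF I(1)]] by (meson atLeastAtMost_iff subsetI)
      qed
      have "\<gamma> M p t = E (\<psi> p t0) t0 t"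
      proof (rule integral_curve_unique[OF A X is_interval_cc _ _ integral_curve_subset[OF E(3)[OF t0J] sJ] mM(3) _ mM(2)])
        show "integral_curve A X {m..M} (\<gamma> M p)"
          by (rule integral_curve_subset[OF \<gamma>(1)[OF mM(1)]]) (use mM in auto)
        show "\<gamma> M p t0 = E (\<psi> p t0) t0 t0"
          using on_curve[OF mM(1), of t0] mM E(2)[OF t0J] by auto
      qed (use sJ in auto)
      then show ?thesis using on_curve[OF mM(1), of t] mM by auto
    qed
    then show ?thesis using E(1) E(3,4)[OF t0J] by (intro exI[of _ \<delta>] exI[of _ "\<lambda>p. E p t0"]) auto
  qed
  have diffeo: "diffeomorphism A A (\<lambda>p. \<psi> p t)" if "t \<in> I" for t
    using \<Phi>(1)[OF that] by (simp add: \<psi>_def)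
  have "smooth_family A A I \<psi>"
  proof (rule smooth_familyI_local[OF A A])
    fix p0 t0 assume t0: "t0 \<in> I"
    from local[OF t0] obtain \<delta> E where E: "0 < \<delta>" "\<And>p t. t \<in> I \<inter> ball t0 \<delta> \<Longrightarrow> \<psi> p t = E (\<psi> p t0) t"
       "smooth_family A A (I \<inter> ball t0 \<delta>) E" by blast
    let ?J = "I \<inter> ball t0 \<delta>"
    let ?G = "\<lambda>p t. E (\<psi> p t0) t"
    have "smooth_map A A (\<lambda>p. \<psi> p t0)" using diffeo[OF t0] by (simp add: diffeomorphism_def)
    from smooth_family_compose[OF A A A smooth_family_const_time[OF A A this] E(3) smooth_on_ident]
    have G: "smooth_family A A ?J ?G" by blast
    define \<xi> \<kappa> where "\<xi> = chart_at A p0" and "\<kappa> = chart_at A (?G p0 t0)"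
    have c: "\<xi> \<in> A" "p0 \<in> dom_chart \<xi>" "\<kappa> \<in> A" "?G p0 t0 \<in> dom_chart \<kappa>"
      using chart_at[OF A] by (auto simp: \<xi>_def \<kappa>_def)
    have t0J: "t0 \<in> ?J" using t0 E(1) by simp
    obtain U J where UJ: "open U" "open J" "p0 \<in> U" "t0 \<in> J" "U \<subseteq> dom_chart \<xi>"
      "\<And>p t. p \<in> U \<Longrightarrow> t \<in> ?J \<inter> J \<Longrightarrow> ?G p t \<in> dom_chart \<kappa>" "smooth_on (coord \<xi> ` U \<times> (?J \<inter> J)) (family_rep \<xi> \<kappa> ?G)"
      using smooth_family_locally_rep[OF A A G c(1,3,2) t0J c(4)] by metis
    have "smooth_on (coord \<xi> ` U \<times> (I \<inter> (ball t0 \<delta> \<inter> J))) (family_rep \<xi> \<kappa> \<psi>)"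
      by (rule smooth_on_transfer[OF UJ(7)]) (use E(2) in \<open>auto simp: family_rep_def\<close>)
    then show "\<exists>\<xi>\<in>A. \<exists>\<kappa>\<in>A. \<exists>U J. open U \<and> open J \<and> p0 \<in> U \<and> t0 \<in> J \<and> U \<subseteq> dom_chart \<xi> \<and>
        (\<forall>p\<in>U. \<forall>t\<in>I \<inter> J. \<psi> p t \<in> dom_chart \<kappa>) \<and> smooth_on (coord \<xi> ` U \<times> (I \<inter> J)) (family_rep \<xi> \<kappa> \<psi>)"
      using c UJ E(1,2) by (intro bexI[of _ \<xi>] bexI[of _ \<kappa>] exI[of _ U] exI[of _ "ball t0 \<delta> \<inter> J"]) auto
  qed
  moreover have "has_velocity A I (\<psi> p) t0 (\<lambda>\<xi>. X \<xi> (\<psi> p t0) t0)" if t0: "t0 \<in> I" for p t0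
  proof -
    from local[OF t0] obtain \<delta> E where E: "0 < \<delta>" "\<And>t. t \<in> I \<inter> ball t0 \<delta> \<Longrightarrow> \<psi> p t = E (\<psi> p t0) t"
       "integral_curve A X (I \<inter> ball t0 \<delta>) (E (\<psi> p t0))" by blast
    have t0J: "t0 \<in> I \<inter> ball t0 \<delta>" using t0 E(1) by simp
    have eq: "at t0 within I \<inter> ball t0 \<delta> = at t0 within I"
      by (rule at_within_nhd[of t0 "ball t0 \<delta>"]) (use E(1) in auto)
    show ?thesis unfolding has_velocity_def
    proof (intro ballI impI)
      fix \<kappa> assume \<kappa>: "\<kappa> \<in> A" "\<psi> p t0 \<in> dom_chart \<kappa>"
      have "((\<lambda>s. coord \<kappa> (E (\<psi> p t0) s)) has_vector_derivative X \<kappa> (\<psi> p t0) t0) (at t0 within I \<inter> ball t0 \<delta>)"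
      proof -
        have "has_velocity A (I \<inter> ball t0 \<delta>) (E (\<psi> p t0)) t0 (\<lambda>\<xi>. X \<xi> (E (\<psi> p t0) t0) t0)"
          using E(3) t0J unfolding integral_curve_def by blast
        then show ?thesis
          using \<kappa> unfolding has_velocity_def E(2)[OF t0J, symmetric] by blast
      qed
      then have "((\<lambda>s. coord \<kappa> (\<psi> p s)) has_vector_derivative X \<kappa> (\<psi> p t0) t0) (at t0 within I \<inter> ball t0 \<delta>)"
        by (rule has_vector_derivative_transform[OF t0J, rotated]) (simp add: E(2))
      then show "((\<lambda>s. coord \<kappa> (\<psi> p s)) has_vector_derivative X \<kappa> (\<psi> p t0) t0) (at t0 within I)"
        unfolding eq .
    qed
  qed
  ultimately show thesis
    using that[of \<psi>] diffeo \<psi>0 by (auto simp: time_dependent_diffeo_def)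
qed

section \<open>Linear algebra of inner products\<close>

definition inner_form :: "('e::euclidean_space \<Rightarrow> 'e \<Rightarrow> real) \<Rightarrow> bool" where
  "inner_form b \<longleftrightarrow> bilinear b \<and> (\<forall>u v. b u v = b v u) \<and> (\<forall>u. u \<noteq> 0 \<longrightarrow> 0 < b u u)"

lemma inner_formD:
  assumes "inner_form b"
  shows "bilinear b" "b u v = b v u" "u \<noteq> 0 \<Longrightarrow> 0 < b u u" "linear (b u)" "linear (\<lambda>u. b u v)"
  using assms unfolding inner_form_def bilinear_def by blast+

lemma inner_form_ext:
  assumes b: "inner_form b" and eq: "\<And>z. b w z = b w' z"
  shows "w = w'"
proof (rule ccontr)
  assume "w \<noteq> w'"
  then have "0 < b (w - w') (w - w')" using inner_formD(3)[OF b] by simp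
  moreover have "b (w - w') (w - w') = 0"
    using eq linear_diff[OF inner_formD(5)[OF b], of w w' "w - w'"] by simp
  ultimately show False by simp
qed

lemma dual_vector_unique:
  assumes b: "inner_form b" and w: "\<And>z. b w z = l z"
  shows "dual_vector b l = w"
  unfolding dual_vector_def
proof (rule the_equality)
  show "w' = w" if "\<forall>z. b w' z = l z" for w'
    by (rule inner_form_ext[OF b]) (simp add: that w)
qed (simp add: w)

text \<open>Recording the values on the basis is an injective map because the form is definite,
  hence a surjective one in finite dimension.\<close>

lemma dual_vector:
  assumes b: "inner_form b" and l: "linear l"
  shows "b (dual_vector b l) z = l z"
proof -
  define f where "f w = (\<Sum>i\<in>Basis. b w i *\<^sub>R i)" for w
  have "linear f" unfolding f_def
    by (intro linear_compose_sum ballI) (use linear_compose[OF inner_formD(5)[OF b] linear_scaleR_left] in \<open>auto simp: o_def\<close>)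
  have fi: "f w \<bullet> i = b w i" if "i \<in> Basis" for w i
    unfolding f_def using that by (simp add: inner_sum_left_Basis)
  have full: "b w z = (\<Sum>i\<in>Basis. (z \<bullet> i) * b w i)" for w z
    using linear_basis_expand[OF inner_formD(4)[OF b, of w], of z] by simp
  have "inj f"
    unfolding linear_injective_0[OF \<open>linear f\<close>]
  proof (intro allI impI)
    fix w assume "f w = 0"
    then have "b w i = 0" if "i \<in> Basis" for i using fi[OF that, of w] by simp
    then have "b w w = 0" using full[of w w] by simp
    then show "w = 0" using inner_formD(3)[OF b] by fastforce
  qed
  then have "surj f" using linear_injective_imp_surjective[OF \<open>linear f\<close>] by simp
  then obtain w where w: "f w = (\<Sum>i\<in>Basis. l i *\<^sub>R i)" by (metis surjD)
  have "b w i = l i" if "i \<in> Basis" for i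
    using fi[OF that, of w] that by (simp add: w inner_sum_left_Basis)
  then have "b w z = l z" for z
    using full[of w z] linear_basis_expand[OF l, of z] by simp
  then show ?thesis using dual_vector_unique[OF b, of w l] by simp
qed

lemma inner_form_pullback:
  assumes b: "inner_form b" and L: "linear L" "inj L"
  shows "inner_form (\<lambda>u v. b (L u) (L v))"
  unfolding inner_form_def bilinear_def
proof (intro conjI allI impI)
  show "linear (\<lambda>v. b (L u) (L v))" for u
    using linear_compose[OF L(1) inner_formD(4)[OF b]] by (simp add: o_def)
  show "linear (\<lambda>u. b (L u) (L v))" for v
    using linear_compose[OF L(1) inner_formD(5)[OF b]] by (simp add: o_def)
  show "b (L u) (L v) = b (L v) (L u)" for u v by (rule inner_formD(2)[OF b])
  show "0 < b (L u) (L u)" if "u \<noteq> 0" for u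
    using inner_formD(3)[OF b] that L linear_injective_0[OF L(1)] by blast
qed

section \<open>Splitting a vector along the range of a linear map and its complement\<close>

lemma orth_part_unique:
  assumes b: "inner_form b" and S: "subspace S" and w: "v - w \<in> S" "\<And>s. s \<in> S \<Longrightarrow> b w s = 0"
  shows "orth_part b S v = w"
  unfolding orth_part_def
proof (rule the_equality)
  fix w' assume w': "v - w' \<in> S \<and> (\<forall>s\<in>S. b w' s = 0)"
  have "w - w' \<in> S" using subspace_diff[OF S, of "v - w'" "v - w"] w w' by simp
  then have "b (w - w') (w - w') = 0"
    using linear_diff[OF inner_formD(5)[OF b], of w w' "w - w'"] w w' by simp
  then have "w - w' = 0" using inner_formD(3)[OF b, of "w - w'"] by force
  then show "w' = w" by simp
qed (use w in auto)

text \<open>The preimage under \<open>L\<close> of the orthogonal projection of \<open>v\<close> to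
  the range of \<open>L\<close>. Being a dual vector for the Gram form, it inherits smooth
  dependence on parameters from \<open>smooth_on_dual_vector\<close>.\<close>

definition tangential_part :: "('f \<Rightarrow> 'f \<Rightarrow> real) \<Rightarrow> ('e \<Rightarrow> 'f) \<Rightarrow> 'f \<Rightarrow> 'e" where
  "tangential_part b L v = dual_vector (\<lambda>u u'. b (L u) (L u')) (\<lambda>u. b v (L u))"

lemma tangential_part:
  fixes L :: "'e::euclidean_space \<Rightarrow> 'f::euclidean_space"
  assumes b: "inner_form b" and L: "linear L" "inj L"
  shows "b (L (tangential_part b L v)) (L u) = b v (L u)"
proof -
  have "linear (\<lambda>u. b v (L u))"
    using linear_compose[OF L(1) inner_formD(4)[OF b]] by (simp add: o_def)
  from dual_vector[OF inner_form_pullback[OF b L] this] show ?thesis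
    unfolding tangential_part_def by simp
qed

lemma subspace_range: "linear L \<Longrightarrow> subspace (range L)"
  by (rule linear_subspace_image) simp_all

lemma orth_part_range:
  fixes L :: "'e::euclidean_space \<Rightarrow> 'f::euclidean_space"
  assumes b: "inner_form b" and L: "linear L" "inj L"
  shows "orth_part b (range L) v = v - L (tangential_part b L v)"
proof (rule orth_part_unique[OF b subspace_range[OF L(1)]])
  show "b (v - L (tangential_part b L v)) s = 0" if s: "s \<in> range L" for s
  proof -
    obtain u where "s = L u" using s by blast
    then show ?thesis
      using linear_diff[OF inner_formD(5)[OF b], of v _ s] tangential_part[OF b L, of v u] by simp
  qed
qed simp

lemma orth_part:
  fixes L :: "'e::euclidean_space \<Rightarrow> 'f::euclidean_space"
  assumes b: "inner_form b" and L: "linear L" "inj L"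
  shows "v - orth_part b (range L) v \<in> range L" "s \<in> range L \<Longrightarrow> b (orth_part b (range L) v) s = 0"
proof -
  show "v - orth_part b (range L) v \<in> range L" unfolding orth_part_range[OF assms] by simp
  assume "s \<in> range L"
  then obtain u where "s = L u" by blast
  then show "b (orth_part b (range L) v) s = 0"
    unfolding orth_part_range[OF assms]
    using linear_diff[OF inner_formD(5)[OF b], of v _ s] tangential_part[OF assms, of v u] by simp
qed

lemma linear_orth_part:
  fixes L :: "'e::euclidean_space \<Rightarrow> 'f::euclidean_space"
  assumes b: "inner_form b" and L: "linear L" "inj L"
  shows "linear (orth_part b (range L))"
proof (rule linearI)
  note S = subspace_range[OF L(1)] and o = orth_part[OF assms]
  show "orth_part b (range L) (v + w) = orth_part b (range L) v + orth_part b (range L) w" for v w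
  proof (rule orth_part_unique[OF b S])
    show "v + w - (orth_part b (range L) v + orth_part b (range L) w) \<in> range L"
      using subspace_add[OF S o(1)[of v] o(1)[of w]] by (simp add: algebra_simps)
  qed (simp add: linear_add[OF inner_formD(5)[OF b]] o(2))
  show "orth_part b (range L) (c *\<^sub>R v) = c *\<^sub>R orth_part b (range L) v" for c v
  proof (rule orth_part_unique[OF b S])
    show "c *\<^sub>R v - c *\<^sub>R orth_part b (range L) v \<in> range L"
      using subspace_scale[OF S o(1)[of v], of c] by (simp add: algebra_simps)
  qed (simp add: linear_scale[OF inner_formD(5)[OF b]] o(2))
qed

lemma orth_part_eq_0:
  fixes L :: "'e::euclidean_space \<Rightarrow> 'f::euclidean_space"
  assumes "inner_form b" "linear L" "v \<in> range L"
  shows "orth_part b (range L) v = 0"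
  by (rule orth_part_unique[OF assms(1) subspace_range[OF assms(2)]])
     (use assms in \<open>auto simp: linear_0[OF inner_formD(5)]\<close>)

text \<open>A map that multiplies inner products by a constant preserves orthogonality, so it
  commutes with the normal projection.\<close>

lemma orth_part_conformal:
  fixes L :: "'e::euclidean_space \<Rightarrow> 'f::euclidean_space" and D :: "'f \<Rightarrow> 'f"
  assumes a: "inner_form a" and b: "inner_form b" and L: "linear L" "inj L" and D: "linear D"
    and conf: "\<And>u v. b (D u) (D v) = c * a u v"
  shows "orth_part b (range (\<lambda>u. D (L u))) (D v) = D (orth_part a (range L) v)"
proof (rule orth_part_unique[OF b])
  show "subspace (range (\<lambda>u. D (L u)))"
    using subspace_range[OF linear_compose[OF L(1) D]] by (simp add: o_def)
  obtain u where "v - orth_part a (range L) v = L u" using orth_part(1)[OF a L, of v] by blast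
  then show "D v - D (orth_part a (range L) v) \<in> range (\<lambda>u. D (L u))"
    using linear_diff[OF D, of v] by (metis rangeI)
  show "b (D (orth_part a (range L) v)) s = 0" if "s \<in> range (\<lambda>u. D (L u))" for s
    using that conf orth_part(2)[OF a L] by auto
qed

text \<open>The dual vectors for \<open>b\<close> are combinations of the images of those for the
  pulled-back form, with the coefficients of \<open>\<theta>\<close>; exchanging the sums moves
  these coefficients to the other argument of \<open>S\<close>.\<close>

lemma trace_wrt_change_basis:
  fixes S :: "'e::euclidean_space \<Rightarrow> 'e \<Rightarrow> 'f::euclidean_space" and \<theta> :: "'e \<Rightarrow> 'e"
  assumes b: "inner_form b" and S: "bilinear S" and \<theta>: "linear \<theta>" "bij \<theta>"
  shows "trace_wrt (\<lambda>u v. b (\<theta> u) (\<theta> v)) (\<lambda>u v. S (\<theta> u) (\<theta> v)) = trace_wrt b S"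
proof -
  let ?b = "\<lambda>u v. b (\<theta> u) (\<theta> v)"
  define d where "d i = dual_vector ?b (\<lambda>z. z \<bullet> i)" for i
  have b': "inner_form ?b" using inner_form_pullback[OF b \<theta>(1)] \<theta>(2) by (simp add: bij_is_inj)
  have lin: "linear (\<lambda>z::'e. z \<bullet> i)" for i by (rule bounded_linear.linear[OF bounded_linear_inner_left])
  have d: "b (\<theta> (d i)) (\<theta> z) = z \<bullet> i" for i z
    unfolding d_def using dual_vector[OF b' lin] by simp
  have S1: "linear (\<lambda>u. S u v)" and S2: "linear (S u)" for u v
    using S by (auto simp: bilinear_def)
  have dual: "dual_vector b (\<lambda>z. z \<bullet> j) = (\<Sum>i\<in>Basis. (\<theta> i \<bullet> j) *\<^sub>R \<theta> (d i))" for j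
  proof (rule dual_vector_unique[OF b])
    fix y
    obtain z where y: "y = \<theta> z" using \<theta>(2) by (metis bij_pointE)
    have "b (\<Sum>i\<in>Basis. (\<theta> i \<bullet> j) *\<^sub>R \<theta> (d i)) y = (\<Sum>i\<in>Basis. (\<theta> i \<bullet> j) * (z \<bullet> i))"
      using linear_sum[OF inner_formD(5)[OF b], of "\<lambda>i. (\<theta> i \<bullet> j) *\<^sub>R \<theta> (d i)" Basis y]
      by (simp add: linear_scale[OF inner_formD(5)[OF b]] d y)
    also have "\<dots> = y \<bullet> j"
      unfolding y linear_basis_expand[OF \<theta>(1), of z] by (simp add: inner_sum_left mult.commute)
    finally show "b (\<Sum>i\<in>Basis. (\<theta> i \<bullet> j) *\<^sub>R \<theta> (d i)) y = y \<bullet> j" .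
  qed
  have "trace_wrt ?b (\<lambda>u v. S (\<theta> u) (\<theta> v)) = (\<Sum>i\<in>Basis. S (\<theta> i) (\<theta> (d i)))"
    by (simp add: trace_wrt_def d_def)
  also have "\<dots> = (\<Sum>i\<in>Basis. \<Sum>j\<in>Basis. (\<theta> i \<bullet> j) *\<^sub>R S j (\<theta> (d i)))"
    by (intro sum.cong refl) (rule linear_basis_expand[OF S1])
  also have "\<dots> = (\<Sum>j\<in>Basis. \<Sum>i\<in>Basis. (\<theta> i \<bullet> j) *\<^sub>R S j (\<theta> (d i)))"
    by (rule sum.swap)
  also have "\<dots> = (\<Sum>j\<in>Basis. S j (dual_vector b (\<lambda>z. z \<bullet> j)))"
    unfolding dual by (intro sum.cong refl) (simp add: linear_sum[OF S2] linear_scale[OF S2])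
  finally show ?thesis by (simp add: trace_wrt_def)
qed

text \<open>Dual vectors for c b are those for \<open>b\<close> divided by \<open>c\<close>, which
  cancels the factor in front. Each basis vector \<open>i\<close> contributes b(i, d i) = 1 times
  \<open>w\<close>; this is the origin of the dimension m in the flow equation.\<close>

lemma trace_wrt_conformal:
  fixes S :: "'e::euclidean_space \<Rightarrow> 'e \<Rightarrow> 'f::euclidean_space"
  assumes b: "inner_form b" and c: "0 < c" and S: "bilinear S" and D: "linear (D :: 'f \<Rightarrow> 'h::real_vector)"
  shows "c *\<^sub>R trace_wrt (\<lambda>u v. c * b u v) (\<lambda>u v. D (S u v - b u v *\<^sub>R w))
     = D (trace_wrt b S - real DIM('e) *\<^sub>R w)"
proof -
  have lin: "linear (\<lambda>z::'e. z \<bullet> i)" for i by (rule bounded_linear.linear[OF bounded_linear_inner_left])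
  define d where "d i = dual_vector b (\<lambda>z. z \<bullet> i)" for i
  have d: "b (d i) z = z \<bullet> i" for i z unfolding d_def by (rule dual_vector[OF b lin])
  have "inner_form (\<lambda>u v. c * b u v)"
    using inner_form_pullback[OF b linear_scale_self, of "sqrt c"] c
    by (auto simp: linear_scale[OF inner_formD(4)[OF b]] linear_scale[OF inner_formD(5)[OF b]] mult.assoc[symmetric] inj_def)
  then have dc: "dual_vector (\<lambda>u v. c * b u v) (\<lambda>z. z \<bullet> i) = (1 / c) *\<^sub>R d i" for i
    by (rule dual_vector_unique) (use c in \<open>simp add: linear_scale[OF inner_formD(5)[OF b]] d\<close>)
  have S2: "linear (S u)" for u using S by (auto simp: bilinear_def)
  have "c *\<^sub>R D (S i ((1 / c) *\<^sub>R d i) - b i ((1 / c) *\<^sub>R d i) *\<^sub>R w) = D (S i (d i) - w)" if "i \<in> Basis" for i :: 'e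
  proof -
    have "b i (d i) = 1" using d[of i i] inner_formD(2)[OF b, of i "d i"] that by simp
    then have "S i ((1 / c) *\<^sub>R d i) - b i ((1 / c) *\<^sub>R d i) *\<^sub>R w = (1 / c) *\<^sub>R (S i (d i) - w)"
      by (simp add: linear_scale[OF S2] linear_scale[OF inner_formD(4)[OF b]] scaleR_diff_right)
    then show ?thesis using c by (simp add: linear_scale[OF D])
  qed
  then have "c *\<^sub>R trace_wrt (\<lambda>u v. c * b u v) (\<lambda>u v. D (S u v - b u v *\<^sub>R w)) = (\<Sum>i\<in>Basis. D (S i (d i) - w))"
    unfolding trace_wrt_def dc scaleR_sum_right by (intro sum.cong) auto
  also have "\<dots> = D (\<Sum>i\<in>Basis. S i (d i) - w)" by (simp add: linear_sum[OF D])
  finally show ?thesis by (simp add: trace_wrt_def d_def sum_subtractf sum_constant_scaleR)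
qed

section \<open>Connections in coordinates\<close>

text \<open>The derivative of \<open>L y u\<close> is known for fixed \<open>u\<close> only. The
  expansion over the basis turns this into a product rule for a moving argument and shows that the
  derivative is linear in \<open>u\<close>.\<close>

lemma linear_family_derivative:
  fixes L :: "'a::real_normed_vector \<Rightarrow> 'b::euclidean_space \<Rightarrow> 'c::real_normed_vector"
  assumes Y: "open Y" "y0 \<in> Y" and L: "\<And>y. y \<in> Y \<Longrightarrow> linear (L y)"
    and d: "\<And>u. ((\<lambda>y. L y u) has_derivative (\<lambda>x. L' x u)) (at y0)"
  shows "linear (L' x)" and "(p has_derivative p') (at y0) \<Longrightarrow>
    ((\<lambda>y. L y (p y)) has_derivative (\<lambda>x. L' x (p y0) + L y0 (p' x))) (at y0)"
proof -
  have exp: "L' x v = (\<Sum>i\<in>Basis. (v \<bullet> i) *\<^sub>R L' x i)" for x v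
  proof -
    have "((\<lambda>y. \<Sum>i\<in>Basis. (v \<bullet> i) *\<^sub>R L y i) has_derivative (\<lambda>x. \<Sum>i\<in>Basis. (v \<bullet> i) *\<^sub>R L' x i)) (at y0)"
      by (intro has_derivative_sum has_derivative_scaleR_right d)
    then have "((\<lambda>y. L y v) has_derivative (\<lambda>x. \<Sum>i\<in>Basis. (v \<bullet> i) *\<^sub>R L' x i)) (at y0)"
      by (rule has_derivative_transform_within_open[OF _ Y]) (rule linear_basis_expand[OF L, symmetric])
    from has_derivative_unique[OF d this] show ?thesis by metis
  qed
  have "linear (\<lambda>v. \<Sum>i\<in>Basis. (v \<bullet> i) *\<^sub>R L' x i)"
    by (intro bounded_linear.linear bounded_linear_sum bounded_linear_compose[OF bounded_linear_scaleR_left]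
        bounded_linear_inner_left)
  then show "linear (L' x)"
    by (rule back_subst[of linear]) (rule ext, rule exp[symmetric])
  assume p: "(p has_derivative p') (at y0)"
  have "((\<lambda>y. \<Sum>i\<in>Basis. (p y \<bullet> i) *\<^sub>R L y i) has_derivative
      (\<lambda>x. \<Sum>i\<in>Basis. (p y0 \<bullet> i) *\<^sub>R L' x i + (p' x \<bullet> i) *\<^sub>R L y0 i)) (at y0)"
    by (intro has_derivative_sum has_derivative_scaleR has_derivative_inner_left p d)
  then have "((\<lambda>y. L y (p y)) has_derivative
      (\<lambda>x. \<Sum>i\<in>Basis. (p y0 \<bullet> i) *\<^sub>R L' x i + (p' x \<bullet> i) *\<^sub>R L y0 i)) (at y0)"
    by (rule has_derivative_transform_within_open[OF _ Y]) (rule linear_basis_expand[OF L, symmetric])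
  moreover have "(\<Sum>i\<in>Basis. (p y0 \<bullet> i) *\<^sub>R L' x i + (p' x \<bullet> i) *\<^sub>R L y0 i) = L' x (p y0) + L y0 (p' x)" for x
    using exp[of x "p y0"] linear_basis_expand[OF L[OF Y(2)], of "p' x"] by (simp add: sum.distrib)
  ultimately show "((\<lambda>y. L y (p y)) has_derivative (\<lambda>x. L' x (p y0) + L y0 (p' x))) (at y0)" by simp
qed

lemma bilinear_family_derivative:
  fixes B :: "'a::real_normed_vector \<Rightarrow> 'b::euclidean_space \<Rightarrow> 'c::euclidean_space \<Rightarrow> real"
  assumes Y: "open Y" "y0 \<in> Y" and B: "\<And>y. y \<in> Y \<Longrightarrow> bilinear (B y)"
    and d: "\<And>u v. ((\<lambda>y. B y u v) has_derivative (\<lambda>x. B' x u v)) (at y0)"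
    and p: "(p has_derivative p') (at y0)" and q: "(q has_derivative q') (at y0)"
  shows "((\<lambda>y. B y (p y) (q y)) has_derivative
      (\<lambda>x. B' x (p y0) (q y0) + B y0 (p' x) (q y0) + B y0 (p y0) (q' x))) (at y0)"
proof -
  have 1: "((\<lambda>y. B y u (q y)) has_derivative (\<lambda>x. B' x u (q y0) + B y0 u (q' x))) (at y0)" for u
    by (rule linear_family_derivative(2)[OF Y _ d q]) (use B in \<open>auto simp: bilinear_def\<close>)
  have "((\<lambda>y. (\<lambda>u. B y u (q y)) (p y)) has_derivative
      (\<lambda>x. (B' x (p y0) (q y0) + B y0 (p y0) (q' x)) + B y0 (p' x) (q y0))) (at y0)"
    by (rule linear_family_derivative(2)[OF Y _ 1 p]) (use B in \<open>auto simp: bilinear_def\<close>)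
  then show ?thesis by (simp add: algebra_simps)
qed

abbreviation D1 :: "('a::real_normed_vector \<Rightarrow> 'b::real_normed_vector) \<Rightarrow> 'a \<Rightarrow> 'a \<Rightarrow> 'b" where
  "D1 f z \<equiv> frechet_derivative f (at z)"

text \<open>Argument order: differentiated first in the direction \<open>v\<close>, then in the
  direction \<open>u\<close>.\<close>

abbreviation D2 :: "('a::real_normed_vector \<Rightarrow> 'b::real_normed_vector) \<Rightarrow> 'a \<Rightarrow> 'a \<Rightarrow> 'a \<Rightarrow> 'b" where
  "D2 f z u v \<equiv> D1 (\<lambda>z. D1 f z v) z u"

lemma C2_derivatives:
  assumes "Ck_on 2 S f" "z \<in> S"
  shows "(f has_derivative D1 f z) (at z)" "((\<lambda>z. D1 f z v) has_derivative (\<lambda>u. D2 f z u v)) (at z)"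
proof -
  have C: "Ck_on (Suc (Suc 0)) S f" using assms(1) by (simp only: numeral_2_eq_2)
  show "(f has_derivative D1 f z) (at z)" by (rule Ck_on_has_derivative[OF C assms(2)])
  show "((\<lambda>z. D1 f z v) has_derivative (\<lambda>u. D2 f z u v)) (at z)"
    by (rule Ck_on_has_derivative[OF Ck_on_SucD_deriv[OF C] assms(2)])
qed

lemma bilinear_D2:
  fixes f :: "'a::euclidean_space \<Rightarrow> 'b::euclidean_space"
  assumes "open S" "Ck_on 2 S f" "z \<in> S"
  shows "bilinear (D2 f z)"
  unfolding bilinear_def
proof (intro conjI allI)
  show "linear (\<lambda>v. D2 f z u v)" for u
    by (rule linear_family_derivative(1)[OF assms(1,3) _ C2_derivatives(2)[OF assms(2,3)]])
       (rule has_derivative_linear[OF C2_derivatives(1)[OF assms(2)]])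
  show "linear (\<lambda>u. D2 f z u v)" for v
    by (rule has_derivative_linear[OF C2_derivatives(2)[OF assms(2,3)]])
qed

text \<open>Used in two ways: with the reparametrization of M as the inner map, and with the
  conformal map of N as the outer one.\<close>

lemma derivatives_compose:
  fixes f :: "'a::euclidean_space \<Rightarrow> 'b::euclidean_space" and h :: "'b \<Rightarrow> 'c::euclidean_space"
  assumes S: "open S" "z \<in> S" and T: "open T" and f: "Ck_on 2 S f" "f ` S \<subseteq> T" and h: "Ck_on 2 T h"
  shows "D1 (\<lambda>z. h (f z)) z v = D1 h (f z) (D1 f z v)"
    and "D2 (\<lambda>z. h (f z)) z u v = D2 h (f z) (D1 f z u) (D1 f z v) + D1 h (f z) (D2 f z u v)"
proof -
  have fT: "f x \<in> T" if "x \<in> S" for x using f(2) that by blast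
  have 1: "((\<lambda>z. h (f z)) has_derivative (\<lambda>v. D1 h (f x) (D1 f x v))) (at x)" if "x \<in> S" for x
    by (rule has_derivative_compose[OF C2_derivatives(1)[OF f(1) that] C2_derivatives(1)[OF h fT[OF that]]])
  have 2: "D1 (\<lambda>z. h (f z)) x v = D1 h (f x) (D1 f x v)" if "x \<in> S" for x v
    by (rule fun_cong[OF frechet_derivative_at[OF 1[OF that], symmetric]])
  show "D1 (\<lambda>z. h (f z)) z v = D1 h (f z) (D1 f z v)" by (rule 2[OF S(2)])
  have "((\<lambda>x. D1 h (f x) (D1 f x v)) has_derivative
      (\<lambda>u. D2 h (f z) (D1 f z u) (D1 f z v) + D1 h (f z) (D2 f z u v))) (at z)"
  proof (rule linear_family_derivative(2)[OF S, where L = "\<lambda>x. D1 h (f x)" and p = "\<lambda>x. D1 f x v"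
        and L' = "\<lambda>u w. D2 h (f z) (D1 f z u) w" and p' = "\<lambda>u. D2 f z u v"])
    show "linear (D1 h (f x))" if "x \<in> S" for x
      by (rule has_derivative_linear[OF C2_derivatives(1)[OF h fT[OF that]]])
    show "((\<lambda>x. D1 h (f x) w) has_derivative (\<lambda>u. D2 h (f z) (D1 f z u) w)) (at z)" for w
      by (rule has_derivative_compose[OF C2_derivatives(1)[OF f(1) S(2)] C2_derivatives(2)[OF h fT[OF S(2)]]])
    show "((\<lambda>x. D1 f x v) has_derivative (\<lambda>u. D2 f z u v)) (at z)"
      by (rule C2_derivatives(2)[OF f(1) S(2)])
  qed
  then have "((\<lambda>x. D1 (\<lambda>z. h (f z)) x v) has_derivative
      (\<lambda>u. D2 h (f z) (D1 f z u) (D1 f z v) + D1 h (f z) (D2 f z u v))) (at z)"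
    by (rule has_derivative_transform_within_open[OF _ S]) (simp add: 2)
  from fun_cong[OF frechet_derivative_at[OF this, symmetric], of u]
  show "D2 (\<lambda>z. h (f z)) z u v = D2 h (f z) (D1 f z u) (D1 f z v) + D1 h (f z) (D2 f z u v)" .
qed

section \<open>Christoffel symbols of metrics on open subsets of the model space\<close>

definition coord_christoffel :: "('f::euclidean_space \<Rightarrow> 'f \<Rightarrow> 'f \<Rightarrow> real) \<Rightarrow> 'f \<Rightarrow> 'f \<Rightarrow> 'f \<Rightarrow> 'f" where
  "coord_christoffel a y u v = dual_vector (a y)
     (\<lambda>w. (D1 (\<lambda>y. a y v w) y u + D1 (\<lambda>y. a y u w) y v - D1 (\<lambda>y. a y u v) y w) / 2)"

definition coord_metric :: "'f::euclidean_space set \<Rightarrow> ('f \<Rightarrow> 'f \<Rightarrow> 'f \<Rightarrow> real) \<Rightarrow> bool" where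
  "coord_metric Y a \<longleftrightarrow> open Y \<and> (\<forall>y\<in>Y. inner_form (a y)) \<and> (\<forall>u v. Ck_on 1 Y (\<lambda>y. a y u v))"

lemma coord_metricD:
  assumes "coord_metric Y a"
  shows "open Y" "y \<in> Y \<Longrightarrow> inner_form (a y)" "y \<in> Y \<Longrightarrow> bilinear (a y)"
    "y \<in> Y \<Longrightarrow> ((\<lambda>y. a y u v) has_derivative D1 (\<lambda>y. a y u v) y) (at y)"
  using assms Ck_on_has_derivative[of 0 Y "\<lambda>y. a y u v" y] inner_formD(1)
  unfolding coord_metric_def One_nat_def by blast+

lemma coord_metric_deriv_linear:
  assumes a: "coord_metric Y a" "y \<in> Y"
  shows "linear (\<lambda>x. D1 (\<lambda>y. a y u v) y x)" "linear (\<lambda>v. D1 (\<lambda>y. a y u v) y x)" "linear (\<lambda>u. D1 (\<lambda>y. a y u v) y x)"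
proof -
  note d = coord_metricD(4)[OF a]
  show "linear (\<lambda>x. D1 (\<lambda>y. a y u v) y x)" using has_derivative_linear[OF d] .
  show "linear (\<lambda>v. D1 (\<lambda>y. a y u v) y x)"
    by (rule linear_family_derivative(1)[OF coord_metricD(1)[OF a(1)] a(2) _ d])
       (use inner_formD(4) coord_metricD(2)[OF a(1)] in blast)
  show "linear (\<lambda>u. D1 (\<lambda>y. a y u v) y x)"
    by (rule linear_family_derivative(1)[OF coord_metricD(1)[OF a(1)] a(2) _ d])
       (use inner_formD(5) coord_metricD(2)[OF a(1)] in blast)
qed

lemma linear_half: "linear l \<Longrightarrow> linear (\<lambda>w. l w / (2::real))"
  by (auto simp: linear_iff add_divide_distrib)

lemma coord_christoffel:
  assumes a: "coord_metric Y a" "y \<in> Y"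
  shows "a y (coord_christoffel a y u v) w
    = (D1 (\<lambda>y. a y v w) y u + D1 (\<lambda>y. a y u w) y v - D1 (\<lambda>y. a y u v) y w) / 2"
  unfolding coord_christoffel_def
  by (rule dual_vector[OF coord_metricD(2)[OF a]])
     (intro linear_half linear_compose_sub linear_compose_add coord_metric_deriv_linear[OF a])

lemma bilinear_coord_christoffel:
  assumes a: "coord_metric Y a" "y \<in> Y"
  shows "bilinear (coord_christoffel a y)"
proof -
  note b = coord_metricD(2)[OF a] and c = coord_christoffel[OF a]
  note l = coord_metric_deriv_linear[OF a]
  note ad = linear_add[OF l(1)] linear_add[OF l(2)] linear_add[OF l(3)]
  note sc = linear_scale[OF l(1)] linear_scale[OF l(2)] linear_scale[OF l(3)]
  note b5 = linear_add[OF inner_formD(5)[OF b]] linear_scale[OF inner_formD(5)[OF b]]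
  show ?thesis unfolding bilinear_def
    by (intro conjI allI linearI inner_form_ext[OF b])
       (simp_all add: b5 c ad sc field_simps)
qed

text \<open>As in the Koszul formula, the conformality relation is differentiated and three permuted
  copies of the result are combined. Symmetry of the second derivative of \<open>G\<close> cancels
  the unwanted terms, and the derivative of \<open>r\<close> leaves the terms in
  \<open>dl\<close>.\<close>

lemma coord_christoffel_conformal:
  fixes G :: "'f::euclidean_space \<Rightarrow> 'f"
  assumes a: "coord_metric Y a" and b: "coord_metric Z b" and G: "Ck_on 2 Y G" "G ` Y \<subseteq> Z"
    and r: "\<And>y. y \<in> Y \<Longrightarrow> 0 < r y"
    and conf: "\<And>y u v. y \<in> Y \<Longrightarrow> b (G y) (D1 G y u) (D1 G y v) = (r y)\<^sup>2 * a y u v"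
    and y0: "y0 \<in> Y" and surj: "surj (D1 G y0)"
  defines "dl \<equiv> D1 (\<lambda>y. ln (r y)) y0"
  shows "D2 G y0 u v + coord_christoffel b (G y0) (D1 G y0 u) (D1 G y0 v)
    = D1 G y0 (coord_christoffel a y0 u v + dl u *\<^sub>R v + dl v *\<^sub>R u - a y0 u v *\<^sub>R dual_vector (a y0) dl)"
    and "linear dl"
proof -
  have Y: "open Y" using coord_metricD(1)[OF a] .
  have GZ: "G y \<in> Z" if "y \<in> Y" for y using G(2) that by blast
  note A = coord_metricD(2)[OF a y0] and B = coord_metricD(2)[OF b GZ[OF y0]]
  let ?D = "D1 G y0" and ?R = "(r y0)\<^sup>2"
  let ?Db = "\<lambda>x u v. D1 (\<lambda>y. b y u v) (G y0) x" and ?Da = "\<lambda>x u v. D1 (\<lambda>y. a y u v) y0 x"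
  have linD: "linear ?D" by (rule has_derivative_linear[OF C2_derivatives(1)[OF G(1) y0]])
  have dB: "((\<lambda>y. b (G y) (D1 G y u) (D1 G y v)) has_derivative
      (\<lambda>x. ?Db (?D x) (?D u) (?D v) + b (G y0) (D2 G y0 x u) (?D v) + b (G y0) (?D u) (D2 G y0 x v))) (at y0)" for u v
  proof (rule bilinear_family_derivative[OF Y y0])
    show "bilinear (b (G y))" if "y \<in> Y" for y by (rule coord_metricD(3)[OF b GZ[OF that]])
    show "((\<lambda>y. b (G y) u v) has_derivative (\<lambda>x. ?Db (?D x) u v)) (at y0)" for u v
      by (rule has_derivative_compose[OF C2_derivatives(1)[OF G(1) y0] coord_metricD(4)[OF b GZ[OF y0]]])
  qed (rule C2_derivatives(2)[OF G(1) y0])+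
  obtain e :: 'f where e: "e \<in> Basis" using nonempty_Basis by blast
  \<comment> \<open>Equals the square of \<open>r\<close> by conformality. As a quotient of
    differentiable functions it makes ln r differentiable, which must be derived because
    \<open>r\<close> is given only pointwise.\<close>
  define N where "N y = b (G y) (D1 G y e) (D1 G y e) / a y e e" for y
  have ae: "a y e e > 0" if "y \<in> Y" for y
    using inner_formD(3)[OF coord_metricD(2)[OF a that], of e] e by (metis nonzero_Basis)
  have N: "N y = (r y)\<^sup>2" "N y > 0" "ln (r y) = ln (N y) / 2" if "y \<in> Y" for y
  proof -
    show "N y = (r y)\<^sup>2" unfolding N_def using conf[OF that] ae[OF that] by simp
    then show "N y > 0" "ln (r y) = ln (N y) / 2" using r[OF that] by (simp_all add: ln_realpow)
  qed
  have "N differentiable (at y0)"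
    unfolding N_def
    by (intro differentiable_divide differentiableI[OF dB] differentiableI[OF coord_metricD(4)[OF a y0]])
      (use ae[OF y0] in simp)
  then have dN: "(N has_derivative D1 N y0) (at y0)" by (simp add: frechet_derivative_works)
  have "((\<lambda>y. ln (N y) / 2) has_derivative (\<lambda>x. D1 N y0 x * inverse (N y0) / 2)) (at y0)"
    by (rule bounded_linear.has_derivative[OF bounded_linear_divide
          DERIV_compose_FDERIV[OF DERIV_ln[OF N(2)[OF y0]] dN]])
  then have d: "((\<lambda>y. ln (r y)) has_derivative (\<lambda>x. D1 N y0 x * inverse (N y0) / 2)) (at y0)"
    by (rule has_derivative_transform_within_open[OF _ Y y0]) (simp add: N(3))
  have dl_eq: "dl = (\<lambda>x. D1 N y0 x * inverse (N y0) / 2)"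
    unfolding dl_def by (rule frechet_derivative_at[OF d, symmetric])
  have "linear dl" unfolding dl_eq by (rule has_derivative_linear[OF d])
  show "linear dl" by fact
  have dN': "D1 N y0 x = 2 * ?R * dl x" for x using N(1,2)[OF y0] by (simp add: dl_eq)
  have E: "?Db (?D x) (?D u) (?D v) + b (G y0) (D2 G y0 x u) (?D v) + b (G y0) (?D u) (D2 G y0 x v)
     = 2 * ?R * dl x * a y0 u v + ?R * ?Da x u v" for x u v
  proof -
    have "((\<lambda>y. N y * a y u v) has_derivative (\<lambda>x. N y0 * ?Da x u v + D1 N y0 x * a y0 u v)) (at y0)"
      by (rule has_derivative_mult[OF dN coord_metricD(4)[OF a y0]])
    then have "((\<lambda>y. b (G y) (D1 G y u) (D1 G y v)) has_derivative (\<lambda>x. N y0 * ?Da x u v + D1 N y0 x * a y0 u v)) (at y0)"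
      by (rule has_derivative_transform_within_open[OF _ Y y0]) (simp add: N(1) conf)
    from has_derivative_unique[OF dB this, THEN fun_cong, of x] show ?thesis
      using N(1)[OF y0] by (simp add: dN')
  qed
  have sym: "D2 G y0 u v = D2 G y0 v u" for u v by (rule second_derivative_symmetric[OF Y G(1) y0])
  let ?grad = "dual_vector (a y0) dl"
  have grad: "a y0 ?grad x = dl x" for x by (rule dual_vector[OF A \<open>linear dl\<close>])
  show "D2 G y0 u v + coord_christoffel b (G y0) (?D u) (?D v)
    = ?D (coord_christoffel a y0 u v + dl u *\<^sub>R v + dl v *\<^sub>R u - a y0 u v *\<^sub>R ?grad)"
  proof (rule inner_form_ext[OF B])
    fix z
    \<comment> \<open>The conformality relation evaluates inner products with vectors in the image
      of the differential; surjectivity makes these all vectors.\<close>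
    obtain x where z: "z = ?D x" using surj by (metis surjD)
    let ?w = "coord_christoffel a y0 u v + dl u *\<^sub>R v + dl v *\<^sub>R u - a y0 u v *\<^sub>R ?grad"
    have "a y0 ?w x = a y0 (coord_christoffel a y0 u v) x + dl u * a y0 v x + dl v * a y0 u x - a y0 u v * dl x"
      by (simp add: linear_add[OF inner_formD(5)[OF A]] linear_diff[OF inner_formD(5)[OF A]]
          linear_scale[OF inner_formD(5)[OF A]] grad)
    also have "a y0 (coord_christoffel a y0 u v) x = (?Da u v x + ?Da v u x - ?Da x u v) / 2"
      by (rule coord_christoffel[OF a y0])
    finally have "?R * a y0 ?w x = (?R * ?Da u v x + ?R * ?Da v u x - ?R * ?Da x u v) / 2
        + ?R * dl u * a y0 v x + ?R * dl v * a y0 u x - ?R * dl x * a y0 u v"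
      by (simp only:) (simp add: algebra_simps add_divide_distrib diff_divide_distrib)
    moreover have "b (G y0) (coord_christoffel b (G y0) (?D u) (?D v)) (?D x) =
      (?Db (?D u) (?D v) (?D x) + ?Db (?D v) (?D u) (?D x) - ?Db (?D x) (?D u) (?D v)) / 2"
      by (rule coord_christoffel[OF b GZ[OF y0]])
    moreover have "b (G y0) (?D ?w) (?D x) = ?R * a y0 ?w x" by (rule conf[OF y0])
    \<comment> \<open>Koszul's combination: in the first plus the second minus the third copy, the
      second derivatives of \<open>G\<close> reduce to twice the one in the directions
      \<open>u\<close> and \<open>v\<close>.\<close>
    moreover note E[where x = u and u = v and v = x] E[where x = v and u = u and v = x] E[where x = x and u = u and v = v]
    moreover have "b (G y0) (D2 G y0 x u) (?D v) = b (G y0) (?D v) (D2 G y0 u x)"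
      "b (G y0) (D2 G y0 v u) (?D x) = b (G y0) (D2 G y0 u v) (?D x)"
      "b (G y0) (?D u) (D2 G y0 x v) = b (G y0) (?D u) (D2 G y0 v x)"
      using sym[of x u] sym[of v u] sym[of x v] inner_formD(2)[OF B] by simp_all
    moreover have "b (G y0) (D2 G y0 u v + coord_christoffel b (G y0) (?D u) (?D v)) (?D x)
       = b (G y0) (D2 G y0 u v) (?D x) + b (G y0) (coord_christoffel b (G y0) (?D u) (?D v)) (?D x)"
      by (rule linear_add[OF inner_formD(5)[OF B]])
    ultimately show "b (G y0) (D2 G y0 u v + coord_christoffel b (G y0) (?D u) (?D v)) z = b (G y0) (?D ?w) z"
      unfolding z mult.assoc by argo
  qed
qed

section \<open>Mean curvature\<close>

lemma riemannian_metricD: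
  assumes "riemannian_metric B g" "\<kappa> \<in> B"
  shows "q \<in> dom_chart \<kappa> \<Longrightarrow> inner_form (g \<kappa> q)"
    "smooth_on (coord \<kappa> ` dom_chart \<kappa>) (\<lambda>z. g \<kappa> (coord_inv \<kappa> z) u v)"
    "\<eta> \<in> B \<Longrightarrow> q \<in> dom_chart \<kappa> \<Longrightarrow> q \<in> dom_chart \<eta> \<Longrightarrow>
       g \<kappa> q u v = g \<eta> q (differential \<kappa> \<eta> id q u) (differential \<kappa> \<eta> id q v)"
  using assms unfolding riemannian_metric_def inner_form_def by blast+

lemma coord_metric_subset: "coord_metric Y a \<Longrightarrow> open Y' \<Longrightarrow> Y' \<subseteq> Y \<Longrightarrow> coord_metric Y' a"
  unfolding coord_metric_def using Ck_on_subset by blast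

lemma coord_metric_chart:
  assumes B: "smooth_atlas B" and g: "riemannian_metric B g" and \<kappa>: "\<kappa> \<in> B"
  shows "coord_metric (coord \<kappa> ` dom_chart \<kappa>) (\<lambda>z. g \<kappa> (coord_inv \<kappa> z))"
  unfolding coord_metric_def
proof (intro conjI ballI allI)
  note K = smooth_atlasD[OF B \<kappa>]
  show "open (coord \<kappa> ` dom_chart \<kappa>)" by (rule K(2))
  show "inner_form (g \<kappa> (coord_inv \<kappa> z))" if "z \<in> coord \<kappa> ` dom_chart \<kappa>" for z
    by (rule riemannian_metricD(1)[OF g \<kappa> K(7)[OF that]])
  show "Ck_on 1 (coord \<kappa> ` dom_chart \<kappa>) (\<lambda>z. g \<kappa> (coord_inv \<kappa> z) u v)" for u v
    by (rule smooth_on_imp_Ck_on[OF K(2) riemannian_metricD(2)[OF g \<kappa>]])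
qed

lemma christoffel_eq_coord:
  assumes B: "smooth_atlas B" and \<kappa>: "\<kappa> \<in> B" "q \<in> dom_chart \<kappa>"
  shows "christoffel g \<kappa> q u v = coord_christoffel (\<lambda>z. g \<kappa> (coord_inv \<kappa> z)) (coord \<kappa> q) u v"
  unfolding christoffel_def coord_christoffel_def metric_deriv_def smooth_atlasD(5)[OF B \<kappa>] ..

text \<open>Frees the pullback from the chart picked by \<open>chart_at\<close>, so that it can be
  computed in the chart where the rest of an argument takes place.\<close>

lemma pullback_metric_eq:
  assumes A: "smooth_atlas A" and B: "smooth_atlas B" and g: "riemannian_metric B g" and F: "smooth_map A B F"
    and c: "\<xi> \<in> A" "\<kappa> \<in> B" "p \<in> dom_chart \<xi>" "F p \<in> dom_chart \<kappa>"
  shows "pullback_metric B g F \<xi> p u v = g \<kappa> (F p) (differential \<xi> \<kappa> F p u) (differential \<xi> \<kappa> F p v)"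
proof -
  define \<eta> where "\<eta> = chart_at B (F p)"
  have \<eta>: "\<eta> \<in> B" "F p \<in> dom_chart \<eta>" using chart_at[OF B] by (auto simp: \<eta>_def)
  show ?thesis
    unfolding pullback_metric_def Let_def \<eta>_def[symmetric]
      riemannian_metricD(3)[OF g \<eta>(1) c(2) \<eta>(2) c(4)]
      differential_change_target[OF A B F c(1) \<eta>(1) c(2,3) \<eta>(2) c(4)] ..
qed

lemma derivatives_cong:
  fixes f h :: "'a::euclidean_space \<Rightarrow> 'b::euclidean_space"
  assumes S: "open S" "z \<in> S" and f: "Ck_on 2 S f" and eq: "\<And>x. x \<in> S \<Longrightarrow> f x = h x"
  shows "D1 h z = D1 f z" "D2 h z u v = D2 f z u v"
proof -
  have 1: "D1 h x = D1 f x" if "x \<in> S" for x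
    by (rule frechet_derivative_at[symmetric], rule has_derivative_transform_within_open[OF C2_derivatives(1)[OF f that] S(1) that])
      (rule eq)
  show "D1 h z = D1 f z" by (rule 1[OF S(2)])
  have "((\<lambda>x. D1 h x v) has_derivative (\<lambda>u. D2 f z u v)) (at z)"
    by (rule has_derivative_transform_within_open[OF C2_derivatives(2)[OF f S(2)] S]) (simp add: 1)
  from fun_cong[OF frechet_derivative_at[OF this, symmetric], of u] show "D2 h z u v = D2 f z u v" .
qed

lemma cov_deriv_eq_coord:
  assumes A: "smooth_atlas A" and B: "smooth_atlas B"
    and c: "\<xi> \<in> A" "\<kappa> \<in> B" "p \<in> dom_chart \<xi>" "F p \<in> dom_chart \<kappa>"
  defines "f \<equiv> coord \<kappa> \<circ> F \<circ> coord_inv \<xi>" and "z \<equiv> coord \<xi> p"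
  shows "cov_deriv g \<xi> \<kappa> F p u v
    = D2 f z u v + coord_christoffel (\<lambda>z. g \<kappa> (coord_inv \<kappa> z)) (f z) (D1 f z u) (D1 f z v)"
  unfolding cov_deriv_def christoffel_eq_coord[OF B c(2,4)] differential_def f_def z_def
  using smooth_atlasD(5)[OF A c(1,3)] by simp

section \<open>Bilinearity of the second fundamental form\<close>

lemma bilinear_compose_linear:
  assumes h: "bilinear h" and L: "linear L"
  shows "bilinear (\<lambda>u v. L (h u v))"
  unfolding bilinear_def
proof (intro conjI allI)
  have 1: "linear (h u)" and 2: "linear (\<lambda>u. h u v)" for u v using h unfolding bilinear_def by simp_all
  show "linear (\<lambda>v. L (h u v))" for u using linear_compose[OF 1 L] by (simp add: o_def)
  show "linear (\<lambda>u. L (h u v))" for v using linear_compose[OF 2 L] by (simp add: o_def)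
qed

lemma bilinear_compose_args:
  assumes h: "bilinear h" and L: "linear L"
  shows "bilinear (\<lambda>u v. h (L u) (L v))"
  unfolding bilinear_def
proof (intro conjI allI)
  have 1: "linear (h u)" and 2: "linear (\<lambda>u. h u v)" for u v using h unfolding bilinear_def by simp_all
  show "linear (\<lambda>v. h (L u) (L v))" for u using linear_compose[OF L 1] by (simp add: o_def)
  show "linear (\<lambda>u. h (L u) (L v))" for v using linear_compose[OF L 2] by (simp add: o_def)
qed

lemma bilinear_add:
  assumes h: "bilinear h" and k: "bilinear k"
  shows "bilinear (\<lambda>u v. h u v + k u v)"
  unfolding bilinear_def
proof (intro conjI allI)
  show "linear (\<lambda>v. h u v + k u v)" for u
    by (rule linear_compose_add) (use h k in \<open>simp_all add: bilinear_def\<close>)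
  show "linear (\<lambda>u. h u v + k u v)" for v
    by (rule linear_compose_add) (use h k in \<open>simp_all add: bilinear_def\<close>)
qed

lemma bilinear_second_fundamental_form:
  assumes A: "smooth_atlas A" and B: "smooth_atlas B" and g: "riemannian_metric B g" and F: "immersion A B F"
    and c: "\<xi> \<in> A" "\<kappa> \<in> B" "p \<in> dom_chart \<xi>" "F p \<in> dom_chart \<kappa>"
  shows "bilinear (second_fundamental_form g \<xi> \<kappa> F p)"
proof -
  have F': "smooth_map A B F" "inj (differential \<xi> \<kappa> F p)" using F c by (auto simp: immersion_def)
  note X = smooth_atlasD[OF A c(1)] and K = smooth_atlasD[OF B c(2)]
  let ?f = "coord \<kappa> \<circ> F \<circ> coord_inv \<xi>" and ?z = "coord \<xi> p"
  have L: "linear (differential \<xi> \<kappa> F p)" by (rule differential_linear[OF A B F'(1) c])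
  have b: "inner_form (g \<kappa> (F p))" by (rule riemannian_metricD(1)[OF g c(2,4)])
  have z: "?z \<in> coord \<xi> ` (dom_chart \<xi> \<inter> F -` dom_chart \<kappa>)" using c by auto
  have fz: "?f ?z \<in> coord \<kappa> ` dom_chart \<kappa>" using c X(5) by simp
  have "bilinear (D2 ?f ?z)" by (rule bilinear_D2[OF smooth_map_rep[OF A B F'(1) c(1,2)] z])
  moreover have "bilinear (\<lambda>u v. coord_christoffel (\<lambda>z. g \<kappa> (coord_inv \<kappa> z)) (?f ?z) (D1 ?f ?z u) (D1 ?f ?z v))"
    using bilinear_compose_args[OF bilinear_coord_christoffel[OF coord_metric_chart[OF B g c(2)] fz] L]
    by (simp add: differential_def)
  ultimately have "bilinear (cov_deriv g \<xi> \<kappa> F p)"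
    unfolding cov_deriv_eq_coord[where F = F, OF A B c, abs_def] by (rule bilinear_add)
  then show ?thesis
    unfolding second_fundamental_form_def[abs_def]
    by (rule bilinear_compose_linear) (rule linear_orth_part[OF b L F'(2)])
qed

lemma diffeomorphism_smooth: "diffeomorphism A B \<Phi> \<Longrightarrow> smooth_map A B \<Phi>"
  by (simp add: diffeomorphism_def)

section \<open>Immersions composed with diffeomorphisms\<close>

lemma immersion_diffeomorphism_right:
  assumes A: "smooth_atlas A" and B: "smooth_atlas B" and F: "immersion A B F" and \<psi>: "diffeomorphism A A \<psi>"
  shows "immersion A B (\<lambda>p. F (\<psi> p))"
  unfolding immersion_def
proof (intro conjI ballI impI)
  have F': "smooth_map A B F" using F by (simp add: immersion_def)
  show "smooth_map A B (\<lambda>p. F (\<psi> p))"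
    by (rule smooth_map_compose[OF A A B diffeomorphism_smooth[OF \<psi>] F'])
  fix \<xi> \<kappa> p assume c: "\<xi> \<in> A" "\<kappa> \<in> B" "p \<in> dom_chart \<xi>" "F (\<psi> p) \<in> dom_chart \<kappa>"
  define \<xi>' where "\<xi>' = chart_at A (\<psi> p)"
  have \<xi>': "\<xi>' \<in> A" "\<psi> p \<in> dom_chart \<xi>'" using chart_at[OF A] by (auto simp: \<xi>'_def)
  have "inj (differential \<xi>' \<kappa> F (\<psi> p))" using F \<xi>' c by (auto simp: immersion_def)
  moreover have "inj (differential \<xi> \<xi>' \<psi> p)"
    using differential_diffeomorphism_bij[OF A \<psi> c(1) \<xi>'(1) c(3) \<xi>'(2)] by (rule bij_is_inj)
  ultimately show "inj (differential \<xi> \<kappa> (\<lambda>p. F (\<psi> p)) p)"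
    using differential_compose[OF A A B diffeomorphism_smooth[OF \<psi>] F' c(1) \<xi>'(1) c(2,3) \<xi>'(2) c(4)]
    by (auto simp: inj_def)
qed

lemma immersion_diffeomorphism_left:
  assumes A: "smooth_atlas A" and B: "smooth_atlas B" and F: "immersion A B F" and \<Phi>: "diffeomorphism B B \<Phi>"
  shows "immersion A B (\<lambda>p. \<Phi> (F p))"
  unfolding immersion_def
proof (intro conjI ballI impI)
  have F': "smooth_map A B F" using F by (simp add: immersion_def)
  show "smooth_map A B (\<lambda>p. \<Phi> (F p))"
    by (rule smooth_map_compose[OF A B B F' diffeomorphism_smooth[OF \<Phi>]])
  fix \<xi> \<kappa> p assume c: "\<xi> \<in> A" "\<kappa> \<in> B" "p \<in> dom_chart \<xi>" "\<Phi> (F p) \<in> dom_chart \<kappa>"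
  define \<eta> where "\<eta> = chart_at B (F p)"
  have \<eta>: "\<eta> \<in> B" "F p \<in> dom_chart \<eta>" using chart_at[OF B] by (auto simp: \<eta>_def)
  have "inj (differential \<xi> \<eta> F p)" using F \<eta> c by (auto simp: immersion_def)
  moreover have "inj (differential \<eta> \<kappa> \<Phi> (F p))"
    using differential_diffeomorphism_bij[OF B \<Phi> \<eta>(1) c(2) \<eta>(2) c(4)] by (rule bij_is_inj)
  ultimately show "inj (differential \<xi> \<kappa> (\<lambda>p. \<Phi> (F p)) p)"
    using differential_compose[OF A B B F' diffeomorphism_smooth[OF \<Phi>] c(1) \<eta>(1) c(2,3) \<eta>(2) c(4)]
    by (auto simp: inj_def)
qed

text \<open>By the second-order chain rule the covariant derivative picks up dF applied to the
  second derivative of \<open>\<psi>\<close> in coordinates. This is tangential, so the normal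
  projection removes it, the second fundamental form transforms as a tensor, and its trace does not
  depend on the basis.\<close>

lemma mean_curvature_reparametrization:
  assumes A: "smooth_atlas A" and B: "smooth_atlas B" and g: "riemannian_metric B g" and F: "immersion A B F"
    and \<psi>: "diffeomorphism A A \<psi>" and \<kappa>: "\<kappa> \<in> B" "F (\<psi> p) \<in> dom_chart \<kappa>"
  shows "mean_curvature A B g (\<lambda>p. F (\<psi> p)) p \<kappa> = mean_curvature A B g F (\<psi> p) \<kappa>"
proof -
  define \<xi> \<xi>' where "\<xi> = chart_at A p" and "\<xi>' = chart_at A (\<psi> p)"
  have c: "\<xi> \<in> A" "p \<in> dom_chart \<xi>" "\<xi>' \<in> A" "\<psi> p \<in> dom_chart \<xi>'"
    using chart_at[OF A] by (auto simp: \<xi>_def \<xi>'_def)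
  note X = smooth_atlasD[OF A c(1)] and X' = smooth_atlasD[OF A c(3)]
  have F': "smooth_map A B F" "inj (differential \<xi>' \<kappa> F (\<psi> p))" using F c \<kappa> by (auto simp: immersion_def)
  note \<psi>' = diffeomorphism_smooth[OF \<psi>]
  have F\<psi>: "smooth_map A B (\<lambda>p. F (\<psi> p))" by (rule smooth_map_compose[OF A A B \<psi>' F'(1)])
  let ?f = "coord \<kappa> \<circ> F \<circ> coord_inv \<xi>'" and ?\<theta> = "coord \<xi>' \<circ> \<psi> \<circ> coord_inv \<xi>"
    and ?h = "coord \<kappa> \<circ> (\<lambda>p. F (\<psi> p)) \<circ> coord_inv \<xi>"
  let ?z = "coord \<xi> p" and ?b = "g \<kappa> (F (\<psi> p))"
  let ?S = "coord \<xi> ` (dom_chart \<xi> \<inter> (\<psi> -` dom_chart \<xi>' \<inter> (\<lambda>p. F (\<psi> p)) -` dom_chart \<kappa>))"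
  let ?T = "coord \<xi>' ` (dom_chart \<xi>' \<inter> F -` dom_chart \<kappa>)"
  have T: "open ?T" "\<And>n. Ck_on n ?T ?f" by (rule smooth_map_rep[OF A B F'(1) c(3) \<kappa>(1)])+
  have S: "open ?S"
  proof (rule open_coord_image[OF A c(1)])
    show "open (dom_chart \<xi> \<inter> (\<psi> -` dom_chart \<xi>' \<inter> (\<lambda>p. F (\<psi> p)) -` dom_chart \<kappa>))"
      using \<psi>' F\<psi> X(1) X'(1) smooth_atlasD(1)[OF B \<kappa>(1)] unfolding smooth_map_def
      by (intro open_Int open_vimage) auto
  qed auto
  have z: "?z \<in> ?S" using c \<kappa> by auto
  have \<theta>: "Ck_on n ?S ?\<theta>" for n by (rule Ck_on_subset[OF smooth_map_rep(2)[OF A A \<psi>' c(1,3)]]) auto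
  have \<theta>T: "?\<theta> ` ?S \<subseteq> ?T" using X(5) by auto
  have eq: "?f (?\<theta> x) = ?h x" if "x \<in> ?S" for x using that X(5) X'(5) by auto
  have comp: "Ck_on n ?S (\<lambda>x. ?f (?\<theta> x))" for n by (rule Ck_on_compose[OF S T(1) \<theta> T(2) \<theta>T])
  note ch = derivatives_compose[OF S z T(1) \<theta> \<theta>T T(2)]
  have cong: "D1 ?h ?z = D1 (\<lambda>x. ?f (?\<theta> x)) ?z" "D2 ?h ?z u v = D2 (\<lambda>x. ?f (?\<theta> x)) ?z u v" for u v
    by (rule derivatives_cong[OF S z comp], rule eq, assumption)+
  have \<theta>z: "?\<theta> ?z = coord \<xi>' (\<psi> p)" using X(5) c by simp
  let ?L = "differential \<xi>' \<kappa> F (\<psi> p)" and ?M = "differential \<xi> \<xi>' \<psi> p"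
  have L: "linear ?L" by (rule differential_linear[OF A B F'(1) c(3) \<kappa>(1) c(4) \<kappa>(2)])
  have M: "linear ?M" "bij ?M"
    by (rule differential_linear[OF A A \<psi>' c(1,3,2,4)]) (rule differential_diffeomorphism_bij[OF A \<psi> c(1,3,2,4)])
  have d: "differential \<xi> \<kappa> (\<lambda>p. F (\<psi> p)) p v = ?L (?M v)" for v
    by (rule differential_compose[OF A A B \<psi>' F'(1) c(1,3) \<kappa>(1) c(2,4) \<kappa>(2)])
  have range: "range (differential \<xi> \<kappa> (\<lambda>p. F (\<psi> p)) p) = range ?L"
    using M(2) by (auto simp: d) (metis bij_pointE rangeI)
  have b: "inner_form ?b" by (rule riemannian_metricD(1)[OF g \<kappa>])
  have cov: "cov_deriv g \<xi> \<kappa> (\<lambda>p. F (\<psi> p)) p u v = cov_deriv g \<xi>' \<kappa> F (\<psi> p) (?M u) (?M v) + ?L (D2 ?\<theta> ?z u v)" for u v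
  proof -
    have LM: "D1 ?f (coord \<xi>' (\<psi> p)) = ?L" "D1 ?\<theta> ?z = ?M" by (simp_all add: differential_def)
    have "cov_deriv g \<xi> \<kappa> (\<lambda>p. F (\<psi> p)) p u v
       = D2 ?h ?z u v + coord_christoffel (\<lambda>z. g \<kappa> (coord_inv \<kappa> z)) (?h ?z) (D1 ?h ?z u) (D1 ?h ?z v)"
      by (rule cov_deriv_eq_coord[where F = "\<lambda>p. F (\<psi> p)", OF A B c(1) \<kappa>(1) c(2) \<kappa>(2)])
    also have "\<dots> = cov_deriv g \<xi>' \<kappa> F (\<psi> p) (?M u) (?M v) + ?L (D2 ?\<theta> ?z u v)"
      unfolding cov_deriv_eq_coord[where F = F, OF A B c(3) \<kappa>(1) c(4) \<kappa>(2)]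
      unfolding cong ch eq[OF z, symmetric] \<theta>z LM by (simp add: add.assoc add.commute)
    finally show ?thesis .
  qed
  have sff: "second_fundamental_form g \<xi> \<kappa> (\<lambda>p. F (\<psi> p)) p u v = second_fundamental_form g \<xi>' \<kappa> F (\<psi> p) (?M u) (?M v)" for u v
    unfolding second_fundamental_form_def range cov
    using linear_add[OF linear_orth_part[OF b L F'(2)]] orth_part_eq_0[OF b L] by simp
  have pb: "pullback_metric B g (\<lambda>p. F (\<psi> p)) \<xi> p = (\<lambda>u v. pullback_metric B g F \<xi>' (\<psi> p) (?M u) (?M v))"
    by (intro ext) (simp add: pullback_metric_eq[OF A B g F\<psi> c(1) \<kappa>(1) c(2) \<kappa>(2)]
        pullback_metric_eq[OF A B g F'(1) c(3) \<kappa>(1) c(4) \<kappa>(2)] d)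
  have ip: "inner_form (pullback_metric B g F \<xi>' (\<psi> p))"
    using inner_form_pullback[OF b L F'(2)] unfolding pullback_metric_eq[OF A B g F'(1) c(3) \<kappa>(1) c(4) \<kappa>(2), abs_def] .
  show ?thesis
    unfolding mean_curvature_def Let_def \<xi>_def[symmetric] \<xi>'_def[symmetric] sff[abs_def] pb
    by (rule trace_wrt_change_basis[OF ip bilinear_second_fundamental_form[OF A B g F c(3) \<kappa>(1) c(4) \<kappa>(2)] M])
qed

text \<open>The conformal change of the connection adds dl(u) v + dl(v) u - g(u,v) grad. For tangent
  vectors the first two terms are tangential and disappear in the normal projection; the trace of
  the last is -m times the normal part of the gradient, and the factor \<sigma>^2 offsets the
  rescaled metric in the trace.\<close>

lemma mean_curvature_conformal:
  fixes A :: "('a::{t2_space,second_countable_topology}, 'e::euclidean_space) chart set"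
  assumes A: "smooth_atlas A" and B: "smooth_atlas B" and g: "riemannian_metric B g" and F: "immersion A B F"
    and \<Phi>: "diffeomorphism B B \<Phi>" and \<sigma>: "conformal_factor B g \<Phi> \<sigma>"
    and \<kappa>: "\<kappa> \<in> B" "\<Phi> (F p) \<in> dom_chart \<kappa>"
  shows "(\<sigma> (F p))\<^sup>2 *\<^sub>R mean_curvature A B g (\<lambda>p. \<Phi> (F p)) p \<kappa>
      + real DIM('e) *\<^sub>R pushforward B \<Phi> (F p) (normal_part A g F p (gradient g (\<lambda>q. ln (\<sigma> q)) (F p))) \<kappa>
    = pushforward B \<Phi> (F p) (mean_curvature A B g F p) \<kappa>"
proof -
  define \<xi> \<eta> where "\<xi> = chart_at A p" and "\<eta> = chart_at B (F p)"
  have c: "\<xi> \<in> A" "p \<in> dom_chart \<xi>" "\<eta> \<in> B" "F p \<in> dom_chart \<eta>"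
    using chart_at[OF A] chart_at[OF B] by (auto simp: \<xi>_def \<eta>_def)
  note X = smooth_atlasD[OF A c(1)] and E = smooth_atlasD[OF B c(3)] and K = smooth_atlasD[OF B \<kappa>(1)]
  have F': "smooth_map A B F" "inj (differential \<xi> \<eta> F p)" using F c by (auto simp: immersion_def)
  note \<Phi>' = diffeomorphism_smooth[OF \<Phi>]
  have \<Phi>F: "smooth_map A B (\<lambda>p. \<Phi> (F p))" by (rule smooth_map_compose[OF A B B F'(1) \<Phi>'])
  let ?f = "coord \<eta> \<circ> F \<circ> coord_inv \<xi>" and ?G = "coord \<kappa> \<circ> \<Phi> \<circ> coord_inv \<eta>"
    and ?h = "coord \<kappa> \<circ> (\<lambda>p. \<Phi> (F p)) \<circ> coord_inv \<xi>"
  let ?z = "coord \<xi> p" and ?y = "coord \<eta> (F p)"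
  let ?a = "\<lambda>y. g \<eta> (coord_inv \<eta> y)" and ?b = "\<lambda>y. g \<kappa> (coord_inv \<kappa> y)"
  let ?S = "coord \<xi> ` (dom_chart \<xi> \<inter> (F -` dom_chart \<eta> \<inter> (\<lambda>p. \<Phi> (F p)) -` dom_chart \<kappa>))"
  let ?Y = "coord \<eta> ` (dom_chart \<eta> \<inter> \<Phi> -` dom_chart \<kappa>)" and ?Z = "coord \<kappa> ` dom_chart \<kappa>"
  have Y: "open ?Y" "\<And>n. Ck_on n ?Y ?G" by (rule smooth_map_rep[OF B B \<Phi>' c(3) \<kappa>(1)])+
  have S: "open ?S"
  proof (rule open_coord_image[OF A c(1)])
    show "open (dom_chart \<xi> \<inter> (F -` dom_chart \<eta> \<inter> (\<lambda>p. \<Phi> (F p)) -` dom_chart \<kappa>))"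
      using F'(1) \<Phi>F X(1) E(1) K(1) unfolding smooth_map_def by (intro open_Int open_vimage) auto
  qed auto
  have z: "?z \<in> ?S" using c \<kappa> by auto
  have y: "?y \<in> ?Y" using c \<kappa> by auto
  have f: "Ck_on n ?S ?f" for n by (rule Ck_on_subset[OF smooth_map_rep(2)[OF A B F'(1) c(1,3)]]) auto
  have fY: "?f ` ?S \<subseteq> ?Y" using X(5) by auto
  have GZ: "?G ` ?Y \<subseteq> ?Z" using E(5) by auto
  have eq: "?G (?f x) = ?h x" if "x \<in> ?S" for x using that X(5) E(5) by auto
  have comp: "Ck_on n ?S (\<lambda>x. ?G (?f x))" for n by (rule Ck_on_compose[OF S Y(1) f Y(2) fY])
  note ch = derivatives_compose[OF S z Y(1) f fY Y(2)]
  have cong: "D1 ?h ?z = D1 (\<lambda>x. ?G (?f x)) ?z" "D2 ?h ?z u v = D2 (\<lambda>x. ?G (?f x)) ?z u v" for u v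
    by (rule derivatives_cong[OF S z comp], rule eq, assumption)+
  have fz: "?f ?z = ?y" using X(5) c by simp
  let ?L = "differential \<xi> \<eta> F p" and ?M = "differential \<eta> \<kappa> \<Phi> (F p)"
  have L: "linear ?L" by (rule differential_linear[OF A B F'(1) c(1,3,2,4)])
  have M: "linear ?M" "bij ?M"
    by (rule differential_linear[OF B B \<Phi>' c(3) \<kappa>(1) c(4) \<kappa>(2)]) (rule differential_diffeomorphism_bij[OF B \<Phi> c(3) \<kappa>(1) c(4) \<kappa>(2)])
  have d: "differential \<xi> \<kappa> (\<lambda>p. \<Phi> (F p)) p = (\<lambda>v. ?M (?L v))"
    by (intro ext differential_compose[OF A B B F'(1) \<Phi>' c(1,3) \<kappa>(1) c(2,4) \<kappa>(2)])
  have ip: "inner_form (g \<eta> (F p))" "inner_form (g \<kappa> (\<Phi> (F p)))"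
    using riemannian_metricD(1)[OF g] c \<kappa> by auto
  have \<sigma>pos: "0 < \<sigma> q" for q using \<sigma> by (simp add: conformal_factor_def)
  have conf: "g \<kappa> (\<Phi> q) (differential \<eta> \<kappa> \<Phi> q u) (differential \<eta> \<kappa> \<Phi> q v) = (\<sigma> q)\<^sup>2 * g \<eta> q u v"
    if "q \<in> dom_chart \<eta>" "\<Phi> q \<in> dom_chart \<kappa>" for q u v
    using \<sigma> c(3) that unfolding conformal_factor_def pullback_metric_eq[OF B B g \<Phi>' c(3) \<kappa>(1) that, symmetric] by blast
  let ?dl = "D1 (\<lambda>y. ln (\<sigma> (coord_inv \<eta> y))) ?y"
  let ?grad = "dual_vector (?a ?y) ?dl"
  have ay: "?a ?y = g \<eta> (F p)" using E(5)[OF c(4)] by simp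
  have "coord_metric ?Y ?a"
    by (rule coord_metric_subset[OF coord_metric_chart[OF B g c(3)] Y(1)]) auto
  then have chr: "D2 ?G ?y u v + coord_christoffel ?b (?G ?y) (D1 ?G ?y u) (D1 ?G ?y v)
      = D1 ?G ?y (coord_christoffel ?a ?y u v + ?dl u *\<^sub>R v + ?dl v *\<^sub>R u - ?a ?y u v *\<^sub>R ?grad)" for u v
  proof (rule coord_christoffel_conformal(1)[OF _ coord_metric_chart[OF B g \<kappa>(1)] Y(2) GZ _ _ y])
    show "0 < \<sigma> (coord_inv \<eta> y)" for y by (rule \<sigma>pos)
    show "?b (?G y) (D1 ?G y u) (D1 ?G y v) = (\<sigma> (coord_inv \<eta> y))\<^sup>2 * ?a y u v" if yY: "y \<in> ?Y" for y u v
    proof -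
      obtain q where q: "y = coord \<eta> q" "q \<in> dom_chart \<eta>" "\<Phi> q \<in> dom_chart \<kappa>" using yY by blast
      show ?thesis using conf[OF q(2,3), of u v] E(5)[OF q(2)] K(5)[OF q(3)] by (simp add: q(1) differential_def)
    qed
    show "surj (D1 ?G ?y)" using M(2) by (simp add: differential_def bij_is_surj)
  qed
  let ?t = "\<lambda>u v. ?dl (?L u) *\<^sub>R ?L v + ?dl (?L v) *\<^sub>R ?L u"
  have cov: "cov_deriv g \<xi> \<kappa> (\<lambda>p. \<Phi> (F p)) p u v
     = ?M (cov_deriv g \<xi> \<eta> F p u v + ?t u v - g \<eta> (F p) (?L u) (?L v) *\<^sub>R ?grad)" for u v
  proof -
    have LM: "D1 ?f ?z = ?L" "D1 ?G ?y = ?M" by (simp_all add: differential_def)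
    have "cov_deriv g \<xi> \<kappa> (\<lambda>p. \<Phi> (F p)) p u v
       = D2 ?h ?z u v + coord_christoffel ?b (?h ?z) (D1 ?h ?z u) (D1 ?h ?z v)"
      by (rule cov_deriv_eq_coord[where F = "\<lambda>p. \<Phi> (F p)", OF A B c(1) \<kappa>(1) c(2) \<kappa>(2)])
    also have "\<dots> = (D2 ?G ?y (?L u) (?L v) + coord_christoffel ?b (?G ?y) (?M (?L u)) (?M (?L v))) + ?M (D2 ?f ?z u v)"
      unfolding cong ch eq[OF z, symmetric] fz LM by (simp add: add.assoc add.commute)
    also have "\<dots> = ?M (coord_christoffel ?a ?y (?L u) (?L v) + ?t u v - g \<eta> (F p) (?L u) (?L v) *\<^sub>R ?grad) + ?M (D2 ?f ?z u v)"
      using chr[where u = "?L u" and v = "?L v"] unfolding LM ay by (simp add: add.assoc)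
    also have "\<dots> = ?M (D2 ?f ?z u v + coord_christoffel ?a ?y (?L u) (?L v) + ?t u v - g \<eta> (F p) (?L u) (?L v) *\<^sub>R ?grad)"
      unfolding linear_add[OF M(1), symmetric] by (rule arg_cong[of _ _ ?M]) (simp add: algebra_simps)
    finally show ?thesis
      unfolding cov_deriv_eq_coord[where F = F, OF A B c(1,3,2,4)] fz LM .
  qed
  let ?n = "orth_part (g \<eta> (F p)) (range ?L)"
  have lin_n: "linear ?n" by (rule linear_orth_part[OF ip(1) L F'(2)])
  have sff: "second_fundamental_form g \<xi> \<kappa> (\<lambda>p. \<Phi> (F p)) p u v
     = ?M (second_fundamental_form g \<xi> \<eta> F p u v - pullback_metric B g F \<xi> p u v *\<^sub>R ?n ?grad)" for u v
  proof -
    have "?t u v \<in> range ?L"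
      using subspace_range[OF L] by (intro subspace_add subspace_scale) auto
    then have "?n (?t u v) = 0" by (rule orth_part_eq_0[OF ip(1) L])
    moreover have "orth_part (g \<kappa> (\<Phi> (F p))) (range (\<lambda>u. ?M (?L u))) (?M w) = ?M (?n w)" for w
      by (rule orth_part_conformal[OF ip L F'(2) M(1) conf[OF c(4) \<kappa>(2)]])
    ultimately show ?thesis
      unfolding second_fundamental_form_def cov d pullback_metric_eq[OF A B g F'(1) c(1,3,2,4)]
      by (simp add: linear_diff[OF lin_n] linear_add[OF lin_n] linear_scale[OF lin_n])
  qed
  have pb: "pullback_metric B g (\<lambda>p. \<Phi> (F p)) \<xi> p = (\<lambda>u v. (\<sigma> (F p))\<^sup>2 * pullback_metric B g F \<xi> p u v)"
    by (intro ext) (simp add: pullback_metric_eq[OF A B g \<Phi>F c(1) \<kappa>(1) c(2) \<kappa>(2)]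
        pullback_metric_eq[OF A B g F'(1) c(1,3,2,4)] d conf[OF c(4) \<kappa>(2)])
  have ipb: "inner_form (pullback_metric B g F \<xi> p)"
    using inner_form_pullback[OF ip(1) L F'(2)] unfolding pullback_metric_eq[OF A B g F'(1) c(1,3,2,4), abs_def] .
  have "(\<sigma> (F p))\<^sup>2 *\<^sub>R mean_curvature A B g (\<lambda>p. \<Phi> (F p)) p \<kappa>
     = ?M (mean_curvature A B g F p \<eta> - real DIM('e) *\<^sub>R ?n ?grad)"
    unfolding mean_curvature_def Let_def \<xi>_def[symmetric] sff[abs_def] pb
    by (rule trace_wrt_conformal[OF ipb _ bilinear_second_fundamental_form[OF A B g F c(1,3,2,4)] M(1)])
      (use \<sigma>pos[of "F p"] in simp)
  moreover have "gradient g (\<lambda>q. ln (\<sigma> q)) (F p) \<eta> = ?grad"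
    by (simp add: gradient_def o_def ay)
  ultimately show ?thesis
    unfolding pushforward_def Let_def \<eta>_def[symmetric] normal_part_def \<xi>_def[symmetric]
    by (simp add: linear_diff[OF M(1)] linear_scale[OF M(1)])
qed

section \<open>Flows of conformal vector fields\<close>

lemma open_family_domain:
  assumes A: "smooth_atlas A" and B: "smooth_atlas B" and F: "smooth_family A B J F" and J: "open J"
    and c: "\<xi> \<in> A" "\<kappa> \<in> B"
  shows "open (family_domain \<xi> \<kappa> J F)"
proof -
  note X = smooth_atlasD[OF A c(1)]
  let ?S = "coord \<xi> ` dom_chart \<xi> \<times> J"
  have "continuous_on ?S (\<lambda>q. (coord_inv \<xi> (fst q), snd q))"
    by (intro continuous_on_Pair continuous_on_compose2[OF X(4)] continuous_intros) auto
  then have "continuous_on ?S (\<lambda>q. (\<lambda>(p, t). F p t) (coord_inv \<xi> (fst q), snd q))"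
    by (rule continuous_on_compose2[OF smooth_familyD(1)[OF A F]]) auto
  then have "continuous_on ?S (\<lambda>q. F (coord_inv \<xi> (fst q)) (snd q))" by simp
  from continuous_open_preimage[OF this open_Times[OF X(2) J] smooth_atlasD(1)[OF B c(2)]]
  have "open (?S \<inter> (\<lambda>q. F (coord_inv \<xi> (fst q)) (snd q)) -` dom_chart \<kappa>)" .
  moreover have "?S \<inter> (\<lambda>q. F (coord_inv \<xi> (fst q)) (snd q)) -` dom_chart \<kappa> = family_domain \<xi> \<kappa> J F"
    by (auto simp: family_domain_def)
  ultimately show ?thesis by simp
qed

lemma smooth_vector_fieldD:
  assumes "smooth_vector_field B W"
  shows "\<kappa> \<in> B \<Longrightarrow> smooth_on (coord \<kappa> ` dom_chart \<kappa>) (W \<kappa> \<circ> coord_inv \<kappa>)"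
    "\<kappa> \<in> B \<Longrightarrow> \<eta> \<in> B \<Longrightarrow> q \<in> dom_chart \<kappa> \<Longrightarrow> q \<in> dom_chart \<eta> \<Longrightarrow> W \<eta> q = differential \<kappa> \<eta> id q (W \<kappa> q)"
  using assms unfolding smooth_vector_field_def by blast+

text \<open>Vectors \<open>c s\<close> along a curve \<open>\<gamma>\<close> that are carried along by the flow of \<open>-W\<close>.\<close>

definition lie_transported ::
    "('b::topological_space, 'f::euclidean_space) chart set \<Rightarrow> real set \<Rightarrow> (('b, 'f) chart \<Rightarrow> 'b \<Rightarrow> 'f) \<Rightarrow>
     (real \<Rightarrow> 'b) \<Rightarrow> (real \<Rightarrow> ('b, 'f) chart \<Rightarrow> 'f) \<Rightarrow> bool" where
  "lie_transported B J W \<gamma> c \<longleftrightarrow> (\<forall>s\<in>J. \<forall>\<kappa>\<in>B. \<gamma> s \<in> dom_chart \<kappa> \<longrightarrow>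
     (\<forall>\<eta>\<in>B. \<gamma> s \<in> dom_chart \<eta> \<longrightarrow> c s \<eta> = differential \<kappa> \<eta> id (\<gamma> s) (c s \<kappa>)) \<and>
     ((\<lambda>s. c s \<kappa>) has_vector_derivative - D1 (W \<kappa> \<circ> coord_inv \<kappa>) (coord \<kappa> (\<gamma> s)) (c s \<kappa>)) (at s))"

lemma lie_transportedD:
  assumes "lie_transported B J W \<gamma> c" "s \<in> J" "\<kappa> \<in> B" "\<gamma> s \<in> dom_chart \<kappa>"
  shows "\<eta> \<in> B \<Longrightarrow> \<gamma> s \<in> dom_chart \<eta> \<Longrightarrow> c s \<eta> = differential \<kappa> \<eta> id (\<gamma> s) (c s \<kappa>)"
    "((\<lambda>s. c s \<kappa>) has_vector_derivative - D1 (W \<kappa> \<circ> coord_inv \<kappa>) (coord \<kappa> (\<gamma> s)) (c s \<kappa>)) (at s)"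
  using assms unfolding lie_transported_def by blast+

lemma vector_field_derivative:
  assumes B: "smooth_atlas B" and W: "smooth_vector_field B W" and \<kappa>: "\<kappa> \<in> B" "q \<in> dom_chart \<kappa>"
  shows "((W \<kappa> \<circ> coord_inv \<kappa>) has_derivative D1 (W \<kappa> \<circ> coord_inv \<kappa>) (coord \<kappa> q)) (at (coord \<kappa> q))"
  by (rule Ck_on_has_derivative[OF smooth_on_imp_Ck_on[OF smooth_atlasD(2)[OF B \<kappa>(1)] smooth_vector_fieldD(1)[OF W \<kappa>(1)], of "Suc 0"]])
     (use \<kappa> in blast)

lemma lie_transported_diff:
  assumes B: "smooth_atlas B" and W: "smooth_vector_field B W"
    and c: "lie_transported B J W \<gamma> c" and d: "lie_transported B J W \<gamma> d"
  shows "lie_transported B J W \<gamma> (\<lambda>s \<kappa>. c s \<kappa> - d s \<kappa>)"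
  unfolding lie_transported_def
proof (intro ballI impI conjI)
  fix s \<kappa> assume s: "s \<in> J" "\<kappa> \<in> B" "\<gamma> s \<in> dom_chart \<kappa>"
  show "c s \<eta> - d s \<eta> = differential \<kappa> \<eta> id (\<gamma> s) (c s \<kappa> - d s \<kappa>)" if "\<eta> \<in> B" "\<gamma> s \<in> dom_chart \<eta>" for \<eta>
    using lie_transportedD(1)[OF c s that] lie_transportedD(1)[OF d s that]
      linear_diff[OF differential_linear[OF B B smooth_map_id[OF B] s(2) that(1) s(3)]] that(2) by simp
  show "((\<lambda>s. c s \<kappa> - d s \<kappa>) has_vector_derivative - D1 (W \<kappa> \<circ> coord_inv \<kappa>) (coord \<kappa> (\<gamma> s)) (c s \<kappa> - d s \<kappa>)) (at s)"
    using has_vector_derivative_diff[OF lie_transportedD(2)[OF c s] lie_transportedD(2)[OF d s]]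
      linear_diff[OF has_derivative_linear[OF vector_field_derivative[OF B W s(2,3)]]] by simp
qed

definition square_length :: "('b, 'f::euclidean_space) chart set \<Rightarrow> ('b, 'f) metric \<Rightarrow> 'b \<Rightarrow> (('b, 'f) chart \<Rightarrow> 'f) \<Rightarrow> real" where
  "square_length B g q v = g (chart_at B q) q (v (chart_at B q)) (v (chart_at B q))"

text \<open>In coordinates, the derivative of \<open>g(c, c)\<close> is \<open>- (L\<^sub>W g)(c, c)\<close>.\<close>

lemma lie_transported_square_length:
  assumes B: "smooth_atlas B" and g: "riemannian_metric B g" and W: "smooth_vector_field B W"
    and \<mu>: "\<And>\<kappa> q u v. \<kappa> \<in> B \<Longrightarrow> q \<in> dom_chart \<kappa> \<Longrightarrow> lie_metric W g \<kappa> q u v = \<mu> q * g \<kappa> q u v"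
    and J: "open J" "s \<in> J" and \<gamma>: "continuous_on J \<gamma>" "\<And>s. s \<in> J \<Longrightarrow> has_velocity B J \<gamma> s (\<lambda>\<kappa>. - W \<kappa> (\<gamma> s))"
    and c: "lie_transported B J W \<gamma> c"
  shows "((\<lambda>s. square_length B g (\<gamma> s) (c s)) has_field_derivative
      - \<mu> (\<gamma> s) * square_length B g (\<gamma> s) (c s)) (at s)"
proof -
  define \<kappa> where "\<kappa> = chart_at B (\<gamma> s)"
  have \<kappa>: "\<kappa> \<in> B" "\<gamma> s \<in> dom_chart \<kappa>" using chart_at[OF B] by (auto simp: \<kappa>_def)
  note K = smooth_atlasD[OF B \<kappa>(1)]
  let ?b = "\<lambda>z. g \<kappa> (coord_inv \<kappa> z)" and ?z = "\<lambda>s. coord \<kappa> (\<gamma> s)"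
  define V where "V = J \<inter> \<gamma> -` dom_chart \<kappa>"
  have V: "open V" "s \<in> V" using continuous_open_preimage[OF \<gamma>(1) J(1) K(1)] J(2) \<kappa> by (auto simp: V_def)
  have bm: "coord_metric (coord \<kappa> ` dom_chart \<kappa>) ?b" by (rule coord_metric_chart[OF B g \<kappa>(1)])
  have zs: "?z s \<in> coord \<kappa> ` dom_chart \<kappa>" using \<kappa> by blast
  \<comment> \<open>\<open>square_length\<close> may switch charts as \<open>r\<close> varies. The
    transformation law moves it to the chart fixed at time \<open>s\<close>, where it can be
    differentiated.\<close>
  have sq: "square_length B g (\<gamma> r) (c r) = ?b (?z r) (c r \<kappa>) (c r \<kappa>)" if "r \<in> V" for r
  proof -
    define \<eta> where "\<eta> = chart_at B (\<gamma> r)"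
    have \<eta>: "\<eta> \<in> B" "\<gamma> r \<in> dom_chart \<eta>" using chart_at[OF B] by (auto simp: \<eta>_def)
    have r: "r \<in> J" "\<gamma> r \<in> dom_chart \<kappa>" using that by (auto simp: V_def)
    show ?thesis
      unfolding square_length_def \<eta>_def[symmetric] K(5)[OF r(2)]
        riemannian_metricD(3)[OF g \<eta>(1) \<kappa>(1) \<eta>(2) r(2)] lie_transportedD(1)[OF c r(1) \<eta> \<kappa>(1) r(2)] ..
  qed
  let ?DW = "D1 (W \<kappa> \<circ> coord_inv \<kappa>) (?z s)"
  have dz: "(?z has_derivative (\<lambda>h. h *\<^sub>R - W \<kappa> (\<gamma> s))) (at s)"
    using \<gamma>(2)[OF J(2)] \<kappa> at_within_open[OF J(2,1)]
    by (auto simp: has_velocity_def has_vector_derivative_def)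
  have dc: "((\<lambda>s. c s \<kappa>) has_derivative (\<lambda>h. h *\<^sub>R - ?DW (c s \<kappa>))) (at s)"
    using lie_transportedD(2)[OF c J(2) \<kappa>] by (simp add: has_vector_derivative_def)
  note b = coord_metricD(2)[OF bm zs] and bd = coord_metricD(4)[OF bm zs]
  have "((\<lambda>r. ?b (?z r) (c r \<kappa>) (c r \<kappa>)) has_derivative
      (\<lambda>h. D1 (\<lambda>z. ?b z (c s \<kappa>) (c s \<kappa>)) (?z s) (h *\<^sub>R - W \<kappa> (\<gamma> s))
         + ?b (?z s) (h *\<^sub>R - ?DW (c s \<kappa>)) (c s \<kappa>) + ?b (?z s) (c s \<kappa>) (h *\<^sub>R - ?DW (c s \<kappa>)))) (at s)"
  proof (rule bilinear_family_derivative[OF V _ _ dc dc, where B = "\<lambda>r. ?b (?z r)"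
        and B' = "\<lambda>h u v. D1 (\<lambda>z. ?b z u v) (?z s) (h *\<^sub>R - W \<kappa> (\<gamma> s))"])
    show "bilinear (?b (?z r))" if "r \<in> V" for r
      using coord_metricD(3)[OF bm] that by (auto simp: V_def)
    show "((\<lambda>r. ?b (?z r) u v) has_derivative (\<lambda>h. D1 (\<lambda>z. ?b z u v) (?z s) (h *\<^sub>R - W \<kappa> (\<gamma> s)))) (at s)" for u v
      by (rule has_derivative_compose[OF dz bd])
  qed
  moreover have "D1 (\<lambda>z. ?b z (c s \<kappa>) (c s \<kappa>)) (?z s) (h *\<^sub>R - W \<kappa> (\<gamma> s))
         + ?b (?z s) (h *\<^sub>R - ?DW (c s \<kappa>)) (c s \<kappa>) + ?b (?z s) (c s \<kappa>) (h *\<^sub>R - ?DW (c s \<kappa>))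
      = h * (- \<mu> (\<gamma> s) * ?b (?z s) (c s \<kappa>) (c s \<kappa>))" for h
  proof -
    have "lie_metric W g \<kappa> (\<gamma> s) (c s \<kappa>) (c s \<kappa>) = \<mu> (\<gamma> s) * ?b (?z s) (c s \<kappa>) (c s \<kappa>)"
      using \<mu>[OF \<kappa>] K(5)[OF \<kappa>(2)] by simp
    then have "D1 (\<lambda>z. ?b z (c s \<kappa>) (c s \<kappa>)) (?z s) (W \<kappa> (\<gamma> s)) + ?b (?z s) (?DW (c s \<kappa>)) (c s \<kappa>) + ?b (?z s) (c s \<kappa>) (?DW (c s \<kappa>))
       = \<mu> (\<gamma> s) * ?b (?z s) (c s \<kappa>) (c s \<kappa>)"
      by (simp add: lie_metric_def metric_deriv_def Let_def K(5)[OF \<kappa>(2)])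
    then have "h * (D1 (\<lambda>z. ?b z (c s \<kappa>) (c s \<kappa>)) (?z s) (W \<kappa> (\<gamma> s)) + ?b (?z s) (?DW (c s \<kappa>)) (c s \<kappa>) + ?b (?z s) (c s \<kappa>) (?DW (c s \<kappa>)))
       = h * (\<mu> (\<gamma> s) * ?b (?z s) (c s \<kappa>) (c s \<kappa>))" by simp
    then show ?thesis
      using linear_scale[OF has_derivative_linear[OF bd]] linear_neg[OF has_derivative_linear[OF bd]]
        linear_scale[OF inner_formD(4)[OF b]] linear_neg[OF inner_formD(4)[OF b]]
        linear_scale[OF inner_formD(5)[OF b]] linear_neg[OF inner_formD(5)[OF b]]
      by (simp add: distrib_left)
  qed
  ultimately have "((\<lambda>r. ?b (?z r) (c r \<kappa>) (c r \<kappa>)) has_derivative (\<lambda>h. h * (- \<mu> (\<gamma> s) * ?b (?z s) (c s \<kappa>) (c s \<kappa>)))) (at s)"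
    by simp
  then have "((\<lambda>s. square_length B g (\<gamma> s) (c s)) has_derivative (\<lambda>h. h * (- \<mu> (\<gamma> s) * ?b (?z s) (c s \<kappa>) (c s \<kappa>)))) (at s)"
    by (rule has_derivative_transform_within_open[OF _ V]) (simp add: sq)
  then show ?thesis
    unfolding sq[OF V(2)] has_field_derivative_def by (rule back_subst[where P = "\<lambda>f'. (_ has_derivative f') _"]) (simp add: fun_eq_iff)
qed

text \<open>The quotient rule cancels the coefficient \<open>m\<close>, of which only pointwise
  values are known, so no integrating factor has to be formed.\<close>

lemma same_linear_ode_ratio:
  fixes h1 h2 :: "real \<Rightarrow> real"
  assumes J: "convex J" "s \<in> J" "r \<in> J"
    and h1: "\<And>s. s \<in> J \<Longrightarrow> (h1 has_field_derivative m s * h1 s) (at s)"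
    and h2: "\<And>s. s \<in> J \<Longrightarrow> (h2 has_field_derivative m s * h2 s) (at s)" and pos: "\<And>s. s \<in> J \<Longrightarrow> h2 s > 0"
  shows "h1 s / h2 s = h1 r / h2 r"
proof -
  have "((\<lambda>s. h1 s / h2 s) has_field_derivative 0) (at s within J)" if "s \<in> J" for s
  proof -
    have "m s * h1 s * h2 s - h1 s * (m s * h2 s) = 0" by simp
    then show ?thesis
      using DERIV_divide[OF h1[OF that] h2[OF that]] pos[OF that]
      by (metis div_0 has_field_derivative_at_within less_irrefl)
  qed
  from has_field_derivative_zero_constant[OF J(1) this]
  obtain c where "\<forall>s\<in>J. h1 s / h2 s = c" by blast
  then show ?thesis using J(2,3) by simp
qed

lemma one_parameter_familyD:
  assumes "one_parameter_family B J X \<Phi>"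
  shows "smooth_family B B J \<Phi>" "s \<in> J \<Longrightarrow> diffeomorphism B B (\<lambda>q. \<Phi> q s)" "\<Phi> q 0 = q"
    "s \<in> J \<Longrightarrow> has_velocity B J (\<Phi> q) s (\<lambda>\<kappa>. X \<kappa> (\<Phi> q s))"
    "s \<in> J \<Longrightarrow> smooth_map B B (\<lambda>q. \<Phi> q s)"
  using assms unfolding one_parameter_family_def diffeomorphism_def by blast+

section \<open>Conformality of the flow and invariance of the field under it\<close>

context
  fixes B :: "('b::{t2_space,second_countable_topology}, 'f::euclidean_space) chart set"
    and g W J \<Phi> \<mu>
  assumes B: "smooth_atlas B" and g: "riemannian_metric B g" and W: "smooth_vector_field B W"
    and \<mu>: "\<And>\<kappa> q u v. \<kappa> \<in> B \<Longrightarrow> q \<in> dom_chart \<kappa> \<Longrightarrow> lie_metric W g \<kappa> q u v = \<mu> q * g \<kappa> q u v"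
    and J: "open J" "convex J" "0 \<in> J" and \<Phi>: "one_parameter_family B J (\<lambda>\<kappa> q. - W \<kappa> q) \<Phi>"
begin

lemmas flow_facts = one_parameter_familyD[OF \<Phi>]

lemma flow_curve_continuous: "continuous_on J (\<Phi> q)"
proof -
  have "continuous_on J (\<lambda>s. (q, s))" by (intro continuous_intros)
  from continuous_on_compose2[OF smooth_familyD(1)[OF B flow_facts(1)] this] show ?thesis by auto
qed

lemma flow_velocity:
  assumes "s \<in> J" "\<kappa> \<in> B" "\<Phi> q s \<in> dom_chart \<kappa>"
  shows "((\<lambda>s. coord \<kappa> (\<Phi> q s)) has_vector_derivative - W \<kappa> (\<Phi> q s)) (at s)"
  using flow_facts(4)[OF assms(1), of q] assms(2,3) at_within_open[OF assms(1) J(1)]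
  by (simp add: has_velocity_def)

text \<open>In coordinates the flow R(z, s) satisfies dR/ds = -w(R). Differentiating in the
  direction \<open>u\<close> and exchanging the order of the derivatives gives the linear equation
  along the curve.\<close>

lemma lie_transported_differential:
  assumes \<eta>: "\<eta> \<in> B" "q \<in> dom_chart \<eta>"
  shows "lie_transported B J W (\<Phi> q) (\<lambda>s \<kappa>. differential \<eta> \<kappa> (\<lambda>q. \<Phi> q s) q u)"
  unfolding lie_transported_def
proof (intro ballI impI conjI)
  fix s \<kappa> assume s: "s \<in> J" "\<kappa> \<in> B" "\<Phi> q s \<in> dom_chart \<kappa>"
  show "differential \<eta> \<zeta> (\<lambda>q. \<Phi> q s) q u = differential \<kappa> \<zeta> id (\<Phi> q s) (differential \<eta> \<kappa> (\<lambda>q. \<Phi> q s) q u)"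
    if "\<zeta> \<in> B" "\<Phi> q s \<in> dom_chart \<zeta>" for \<zeta>
    by (rule differential_change_target[OF B B flow_facts(5)[OF s(1)] \<eta>(1) s(2) that(1) \<eta>(2) s(3) that(2)])
  note E = smooth_atlasD[OF B \<eta>(1)] and K = smooth_atlasD[OF B s(2)]
  let ?D = "family_domain \<eta> \<kappa> J \<Phi>" and ?R = "family_rep \<eta> \<kappa> \<Phi>" and ?w = "W \<kappa> \<circ> coord_inv \<kappa>"
  let ?z = "coord \<eta> q"
  have D: "open ?D" by (rule open_family_domain[OF B B flow_facts(1) J(1) \<eta>(1) s(2)])
  have R: "Ck_on n ?D ?R" for n
    by (rule smooth_on_imp_Ck_on[OF D smooth_familyD(2)[OF B flow_facts(1) \<eta>(1) s(2)]])
  have dR: "(?R has_derivative (\<lambda>(v, r). differential \<eta> \<kappa> (\<lambda>q. \<Phi> q t) (coord_inv \<eta> z) v + r *\<^sub>R - ?w (?R (z, t)))) (at (z, t))"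
    if "(z, t) \<in> ?D" for z t
  proof -
    let ?p = "coord_inv \<eta> z"
    have p: "z \<in> coord \<eta> ` dom_chart \<eta>" "t \<in> J" "\<Phi> ?p t \<in> dom_chart \<kappa>" using that by (auto simp: family_domain_def)
    have J': "at t within J \<noteq> bot" using at_within_open[OF p(2) J(1)] by simp
    have "((\<lambda>s. coord \<kappa> (\<Phi> ?p s)) has_vector_derivative - W \<kappa> (\<Phi> ?p t)) (at t within J)"
      using flow_velocity[OF p(2) s(2) p(3)] by (rule has_vector_derivative_at_within)
    from family_rep_derivative[OF B B flow_facts(1) \<eta>(1) s(2) E(7)[OF p(1)] p(2,3) J' this]
    show ?thesis using at_within_open[OF that D] K(5)[OF p(3)] by (simp add: E(6)[OF p(1)] family_rep_def)
  qed
  have zs: "(?z, s) \<in> ?D" using \<eta> s E(5) by (auto simp: family_domain_def)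
  have Rz: "?R (?z, s) = coord \<kappa> (\<Phi> q s)" using E(5)[OF \<eta>(2)] by (simp add: family_rep_def)
  have d1: "D1 ?R (z, t) (v, r) = differential \<eta> \<kappa> (\<lambda>q. \<Phi> q t) (coord_inv \<eta> z) v + r *\<^sub>R - ?w (?R (z, t))" if "(z, t) \<in> ?D" for z t v r
    using fun_cong[OF frechet_derivative_at[OF dR[OF that], symmetric], of "(v, r)"] by simp
  have w0: "linear (\<lambda>v. differential \<eta> \<kappa> (\<lambda>q. \<Phi> q t) (coord_inv \<eta> z) v)" if "(z, t) \<in> ?D" for z t
    using that E(7) by (intro differential_linear[OF B B flow_facts(5) \<eta>(1) s(2)]) (auto simp: family_domain_def)
  \<comment> \<open>The flow equation as an identity on the open domain of \<open>?R\<close>, hence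
    one that may be differentiated in the space variable.\<close>
  have d01: "D1 ?R x (0, 1) = - ?w (?R x)" if "x \<in> ?D" for x
    using d1[of "fst x" "snd x" 0 1] linear_0[OF w0[of "fst x" "snd x"]] that by simp
  have du0: "D1 ?R (?z, t) (u, 0) = differential \<eta> \<kappa> (\<lambda>q. \<Phi> q t) q u" if "(?z, t) \<in> ?D" for t
    using d1[OF that, of u 0] E(5)[OF \<eta>(2)] by simp
  have "((\<lambda>t. D1 ?R (?z, t) (u, 0)) has_vector_derivative D2 ?R (?z, s) (0, 1) (u, 0)) (at s)"
  proof -
    have h: "((\<lambda>t. (?z, t)) has_vector_derivative (0, 1)) (at s)"
      unfolding has_vector_derivative_def by (auto intro!: derivative_eq_intros simp: zero_prod_def)
    have d: "((\<lambda>x. D1 ?R x (u, 0)) has_derivative (\<lambda>x. D2 ?R (?z, s) x (u, 0))) (at (?z, s))"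
      by (rule C2_derivatives(2)[OF R zs])
    show ?thesis
      using has_derivative_compose[OF h[unfolded has_vector_derivative_def] d] linear_scale[OF has_derivative_linear[OF d]]
      by (simp add: has_vector_derivative_def del: scaleR_Pair)
  qed
  moreover have "D2 ?R (?z, s) (0, 1) (u, 0) = D2 ?R (?z, s) (u, 0) (0, 1)"
    by (rule second_derivative_symmetric[OF D R zs])
  moreover have "D2 ?R (?z, s) (u, 0) (0, 1) = - D1 ?w (coord \<kappa> (\<Phi> q s)) (differential \<eta> \<kappa> (\<lambda>q. \<Phi> q s) q u)"
  proof -
    have w: "(?w has_derivative D1 ?w (coord \<kappa> (\<Phi> q s))) (at (?R (?z, s)))"
      unfolding Rz by (rule vector_field_derivative[OF B W s(2,3)])
    have "((\<lambda>x. - ?w (?R x)) has_derivative (\<lambda>x. - D1 ?w (coord \<kappa> (\<Phi> q s)) (D1 ?R (?z, s) x))) (at (?z, s))"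
      by (rule has_derivative_minus[OF has_derivative_compose[OF C2_derivatives(1)[OF R zs] w]])
    then have "((\<lambda>x. D1 ?R x (0, 1)) has_derivative (\<lambda>x. - D1 ?w (coord \<kappa> (\<Phi> q s)) (D1 ?R (?z, s) x))) (at (?z, s))"
      by (rule has_derivative_transform_within_open[OF _ D zs]) (simp only: d01)
    from fun_cong[OF frechet_derivative_at[OF this, symmetric], of "(u, 0)"] show ?thesis
      unfolding du0[OF zs] .
  qed
  ultimately have "((\<lambda>t. D1 ?R (?z, t) (u, 0)) has_vector_derivative
      - D1 ?w (coord \<kappa> (\<Phi> q s)) (differential \<eta> \<kappa> (\<lambda>q. \<Phi> q s) q u)) (at s)" by simp
  moreover have "open ((\<lambda>t. (?z, t)) -` ?D)" by (intro open_vimage D continuous_intros)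
  ultimately show "((\<lambda>s. differential \<eta> \<kappa> (\<lambda>q. \<Phi> q s) q u) has_vector_derivative
      - D1 ?w (coord \<kappa> (\<Phi> q s)) (differential \<eta> \<kappa> (\<lambda>q. \<Phi> q s) q u)) (at s)"
    by (rule has_vector_derivative_transform_within_open) (use zs du0 in auto)
qed

text \<open>The chain rule along the curve: its velocity is -W, so the derivative of W in its own
  direction appears with the required sign.\<close>

lemma lie_transported_field: "lie_transported B J W (\<Phi> q) (\<lambda>s \<kappa>. W \<kappa> (\<Phi> q s))"
  unfolding lie_transported_def
proof (intro ballI impI conjI)
  fix s \<kappa> assume s: "s \<in> J" "\<kappa> \<in> B" "\<Phi> q s \<in> dom_chart \<kappa>"
  note K = smooth_atlasD[OF B s(2)]
  show "W \<eta> (\<Phi> q s) = differential \<kappa> \<eta> id (\<Phi> q s) (W \<kappa> (\<Phi> q s))" if "\<eta> \<in> B" "\<Phi> q s \<in> dom_chart \<eta>" for \<eta>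
    by (rule smooth_vector_fieldD(2)[OF W s(2) that(1) s(3) that(2)])
  note w = vector_field_derivative[OF B W s(2,3)]
  have "((\<lambda>t. (W \<kappa> \<circ> coord_inv \<kappa>) (coord \<kappa> (\<Phi> q t))) has_vector_derivative
      D1 (W \<kappa> \<circ> coord_inv \<kappa>) (coord \<kappa> (\<Phi> q s)) (- W \<kappa> (\<Phi> q s))) (at s)"
    using has_derivative_compose[OF flow_velocity[OF s, unfolded has_vector_derivative_def] w]
      linear_scale[OF has_derivative_linear[OF w]]
    by (simp add: has_vector_derivative_def del: scaleR_minus_right)
  then have "((\<lambda>t. (W \<kappa> \<circ> coord_inv \<kappa>) (coord \<kappa> (\<Phi> q t))) has_vector_derivative
      - D1 (W \<kappa> \<circ> coord_inv \<kappa>) (coord \<kappa> (\<Phi> q s)) (W \<kappa> (\<Phi> q s))) (at s)"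
    using linear_neg[OF has_derivative_linear[OF w]] by simp
  moreover have "open (J \<inter> \<Phi> q -` dom_chart \<kappa>)"
    by (rule continuous_open_preimage[OF flow_curve_continuous J(1) K(1)])
  ultimately show "((\<lambda>s. W \<kappa> (\<Phi> q s)) has_vector_derivative
      - D1 (W \<kappa> \<circ> coord_inv \<kappa>) (coord \<kappa> (\<Phi> q s)) (W \<kappa> (\<Phi> q s))) (at s)"
    by (rule has_vector_derivative_transform_within_open) (use s K(5) in auto)
qed

text \<open>The reference vector \<open>d\<close> is the image of a nonzero \<open>u\<close> under
  injective differentials, so its squared length never vanishes and can be the denominator for every
  transported \<open>c\<close>, even for one that is zero.\<close>

lemma square_length_ratio:
  assumes c: "lie_transported B J W (\<Phi> q) c" and \<eta>: "\<eta> \<in> B" "q \<in> dom_chart \<eta>" "u \<noteq> 0" and s: "s \<in> J"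
  defines "d \<equiv> \<lambda>s \<kappa>. differential \<eta> \<kappa> (\<lambda>q. \<Phi> q s) q u"
  shows "square_length B g (\<Phi> q s) (c s) / square_length B g (\<Phi> q s) (d s)
       = square_length B g q (c 0) / square_length B g q (d 0)"
    and "0 < square_length B g (\<Phi> q s) (d s)"
proof -
  have pos: "0 < square_length B g (\<Phi> q s) (d s)" if "s \<in> J" for s
  proof -
    define \<kappa> where "\<kappa> = chart_at B (\<Phi> q s)"
    have \<kappa>: "\<kappa> \<in> B" "\<Phi> q s \<in> dom_chart \<kappa>" using chart_at[OF B] by (auto simp: \<kappa>_def)
    have "inj (differential \<eta> \<kappa> (\<lambda>q. \<Phi> q s) q)"
      by (rule bij_is_inj[OF differential_diffeomorphism_bij[OF B flow_facts(2)[OF that] \<eta>(1) \<kappa>(1) \<eta>(2) \<kappa>(2)]])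
    then have "d s \<kappa> \<noteq> 0"
      using linear_injective_0[OF differential_linear[OF B B flow_facts(5)[OF that] \<eta>(1) \<kappa>(1) \<eta>(2) \<kappa>(2)]] \<eta>(3)
      unfolding d_def by blast
    then show ?thesis
      unfolding square_length_def \<kappa>_def[symmetric] by (rule inner_formD(3)[OF riemannian_metricD(1)[OF g \<kappa>]])
  qed
  show "0 < square_length B g (\<Phi> q s) (d s)" by (rule pos[OF s])
  have h: "((\<lambda>s. square_length B g (\<Phi> q s) (c s)) has_field_derivative - \<mu> (\<Phi> q s) * square_length B g (\<Phi> q s) (c s)) (at s)"
    if "lie_transported B J W (\<Phi> q) c" "s \<in> J" for c s
    by (rule lie_transported_square_length[OF B g W \<mu> J(1) that(2) flow_curve_continuous flow_facts(4) that(1)])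
  have d: "lie_transported B J W (\<Phi> q) d" unfolding d_def by (rule lie_transported_differential[OF \<eta>(1,2)])
  show "square_length B g (\<Phi> q s) (c s) / square_length B g (\<Phi> q s) (d s)
       = square_length B g q (c 0) / square_length B g q (d 0)"
    using same_linear_ode_ratio[OF J(2) s J(3) h[OF c] h[OF d] pos] flow_facts(3) by simp
qed

text \<open>The difference of both sides is transported and vanishes at time 0, so the constant
  quotient of squared lengths is 0, and definiteness of the metric makes the difference vanish at
  all times.\<close>

lemma flow_preserves_field:
  assumes s: "s \<in> J" and \<eta>: "\<eta> \<in> B" "q \<in> dom_chart \<eta>" and \<kappa>: "\<kappa> \<in> B" "\<Phi> q s \<in> dom_chart \<kappa>"
  shows "differential \<eta> \<kappa> (\<lambda>q. \<Phi> q s) q (W \<eta> q) = W \<kappa> (\<Phi> q s)"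
proof -
  define c where "c s \<kappa> = differential \<eta> \<kappa> (\<lambda>q. \<Phi> q s) q (W \<eta> q) - W \<kappa> (\<Phi> q s)" for s \<kappa>
  have c: "lie_transported B J W (\<Phi> q) c"
    unfolding c_def[abs_def]
    by (rule lie_transported_diff[OF B W lie_transported_differential[OF \<eta>] lie_transported_field])
  obtain e :: 'f where e: "e \<noteq> 0" using nonzero_Basis nonempty_Basis by blast
  define \<zeta> where "\<zeta> = chart_at B (\<Phi> q s)"
  have \<zeta>: "\<zeta> \<in> B" "\<Phi> q s \<in> dom_chart \<zeta>" using chart_at[OF B] by (auto simp: \<zeta>_def)
  define \<zeta>0 where "\<zeta>0 = chart_at B q"
  have \<zeta>0: "\<zeta>0 \<in> B" "q \<in> dom_chart \<zeta>0" using chart_at[OF B] by (auto simp: \<zeta>0_def)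
  have "c 0 \<zeta>0 = 0"
    using smooth_vector_fieldD(2)[OF W \<eta>(1) \<zeta>0(1) \<eta>(2) \<zeta>0(2)] flow_facts(3) by (simp add: c_def id_def)
  then have "square_length B g q (c 0) = 0"
    using linear_0[OF inner_formD(4)[OF riemannian_metricD(1)[OF g \<zeta>0]]] by (simp add: square_length_def \<zeta>0_def[symmetric])
  then have "square_length B g (\<Phi> q s) (c s) = 0"
    using square_length_ratio[OF c \<eta> e s] by simp
  then have "c s \<zeta> = 0"
    using inner_formD(3)[OF riemannian_metricD(1)[OF g \<zeta>], of "c s \<zeta>"] by (force simp: square_length_def \<zeta>_def[symmetric])
  then have "c s \<kappa> = 0"
    using lie_transportedD(1)[OF c s \<zeta> \<kappa>] linear_0[OF differential_linear[OF B B smooth_map_id[OF B] \<zeta>(1) \<kappa>(1) \<zeta>(2)]] \<kappa>(2)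
    by simp
  then show ?thesis by (simp add: c_def)
qed

lemma square_length_differential:
  assumes s: "s \<in> J" and \<eta>: "\<eta> \<in> B" "q \<in> dom_chart \<eta>"
  shows "square_length B g (\<Phi> q s) (\<lambda>\<kappa>. differential \<eta> \<kappa> (\<lambda>q. \<Phi> q s) q u) = pullback_metric B g (\<lambda>q. \<Phi> q s) \<eta> q u u"
  by (simp add: square_length_def pullback_metric_def Let_def)

text \<open>The constant quotients compare every vector with the fixed vector \<open>e\<close>.
  Hence the pulled-back quadratic form is a multiple of the original one, and polarization extends
  this to the bilinear forms.\<close>

lemma flow_conformal:
  obtains \<sigma> where "\<And>s. s \<in> J \<Longrightarrow> conformal_factor B g (\<lambda>q. \<Phi> q s) (\<lambda>q. \<sigma> q s)"
proof -
  obtain e :: 'f where e: "e \<noteq> 0" using nonzero_Basis nonempty_Basis by blast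
  define P where "P s \<eta> q = pullback_metric B g (\<lambda>q. \<Phi> q s) \<eta> q" for s and \<eta> :: "('b, 'f) chart" and q
  \<comment> \<open>The value for one vector in one chart fixes the factor; \<open>ratio\<close>
    makes it valid for all vectors, and the transformation law of the metric for all charts.\<close>
  define \<sigma> where "\<sigma> q s = sqrt (P s (chart_at B q) q e e / g (chart_at B q) q e e)" for q s
  have P0: "P 0 \<eta> q u v = g \<eta> q u v" if "\<eta> \<in> B" "q \<in> dom_chart \<eta>" for \<eta> q u v
    using pullback_metric_eq[OF B B g smooth_map_id[OF B] that(1,1,2)] that(2) differential_id_same[OF B that]
    by (simp add: P_def flow_facts(3) id_def)
  have ratio: "P s \<eta> q u u / P s \<eta> q e e = g \<eta> q u u / g \<eta> q e e" and pos: "0 < P s \<eta> q e e" "0 < g \<eta> q e e"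
    if "s \<in> J" "\<eta> \<in> B" "q \<in> dom_chart \<eta>" for s \<eta> q u
  proof -
    note c = lie_transported_differential[OF that(2,3), of u]
    show "P s \<eta> q u u / P s \<eta> q e e = g \<eta> q u u / g \<eta> q e e"
      using square_length_ratio(1)[OF c that(2,3) e that(1)]
        square_length_differential[OF that(1-3)] square_length_differential[OF J(3) that(2,3)]
        P0[OF that(2,3)] by (simp add: P_def flow_facts(3))
    show "0 < P s \<eta> q e e"
      using square_length_ratio(2)[OF c that(2,3) e that(1)] square_length_differential[OF that(1-3)] by (simp add: P_def)
    show "0 < g \<eta> q e e" by (rule inner_formD(3)[OF riemannian_metricD(1)[OF g that(2,3)] e])
  qed
  have "conformal_factor B g (\<lambda>q. \<Phi> q s) (\<lambda>q. \<sigma> q s)" if s: "s \<in> J" for s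
    unfolding conformal_factor_def
  proof (intro conjI allI ballI)
    show "0 < \<sigma> q s" for q
      using pos[OF s chart_at[OF B]] by (simp add: \<sigma>_def)
    fix \<kappa> q u v assume \<kappa>: "\<kappa> \<in> B" "q \<in> dom_chart \<kappa>"
    define \<eta> where "\<eta> = chart_at B q"
    have \<eta>: "\<eta> \<in> B" "q \<in> dom_chart \<eta>" using chart_at[OF B] by (auto simp: \<eta>_def)
    define \<zeta> where "\<zeta> = chart_at B (\<Phi> q s)"
    have \<zeta>: "\<zeta> \<in> B" "\<Phi> q s \<in> dom_chart \<zeta>" using chart_at[OF B] by (auto simp: \<zeta>_def)
    have sm: "smooth_map B B (\<lambda>q. \<Phi> q s)" by (rule flow_facts(5)[OF s])
    have \<sigma>2: "(\<sigma> q s)\<^sup>2 = P s \<eta> q e e / g \<eta> q e e"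
      using pos[OF s \<eta>] by (simp add: \<sigma>_def \<eta>_def)
    have quad: "P s \<eta> q u u = (\<sigma> q s)\<^sup>2 * g \<eta> q u u" for u
      using ratio[OF s \<eta>, of u] pos[OF s \<eta>] unfolding \<sigma>2 by (simp add: field_simps)
    note peq = pullback_metric_eq[OF B B g sm \<eta>(1) \<zeta>(1) \<eta>(2) \<zeta>(2)]
    have i1: "inner_form (P s \<eta> q)"
      using inner_form_pullback[OF riemannian_metricD(1)[OF g \<zeta>] differential_linear[OF B B sm \<eta>(1) \<zeta>(1) \<eta>(2) \<zeta>(2)]
          bij_is_inj[OF differential_diffeomorphism_bij[OF B flow_facts(2)[OF s] \<eta>(1) \<zeta>(1) \<eta>(2) \<zeta>(2)]]]
      unfolding P_def peq[abs_def] .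
    have i2: "inner_form (g \<eta> q)" by (rule riemannian_metricD(1)[OF g \<eta>])
    have polar: "b (u + v) (u + v) = b u u + b v v + 2 * b u v" if "inner_form b" for b :: "'f \<Rightarrow> 'f \<Rightarrow> real" and u v
      using linear_add[OF inner_formD(4)[OF that]] linear_add[OF inner_formD(5)[OF that]] inner_formD(2)[OF that, of v u] by simp
    have bil: "P s \<eta> q u v = (\<sigma> q s)\<^sup>2 * g \<eta> q u v" for u v
      using quad[of "u + v"] quad[of u] quad[of v] unfolding polar[OF i1] polar[OF i2] by (simp add: distrib_left)
    have "pullback_metric B g (\<lambda>q. \<Phi> q s) \<kappa> q u v = P s \<eta> q (differential \<kappa> \<eta> id q u) (differential \<kappa> \<eta> id q v)"
      unfolding P_def peq pullback_metric_eq[OF B B g sm \<kappa>(1) \<zeta>(1) \<kappa>(2) \<zeta>(2)]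
        differential_change_source[OF B B sm \<kappa>(1) \<eta>(1) \<zeta>(1) \<kappa>(2) \<eta>(2) \<zeta>(2)] ..
    also have "\<dots> = (\<sigma> q s)\<^sup>2 * g \<kappa> q u v"
      unfolding bil riemannian_metricD(3)[OF g \<kappa>(1) \<eta>(1) \<kappa>(2) \<eta>(2), symmetric] ..
    finally show "pullback_metric B g (\<lambda>q. \<Phi> q s) \<kappa> q u v = (\<sigma> q s)\<^sup>2 * g \<kappa> q u v" .
  qed
  then show thesis by (rule that)
qed

end

section \<open>Smooth dependence of integrals and of solutions of linear equations\<close>

text \<open>Near \<open>t0\<close> an extension of the integrand is integrated instead, on a
  two-sided neighbourhood, and shifted to the right value at \<open>t0\<close>; additivity of the
  integral matches the result with the original on \<open>S\<close>.\<close>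

lemma smooth_on_integral:
  fixes \<phi> :: "real \<Rightarrow> real"
  assumes S: "is_interval S" "0 \<in> S" "\<And>t. t \<in> S \<Longrightarrow> 0 \<le> t" and \<phi>: "smooth_on S \<phi>"
  shows "smooth_on S (\<lambda>t. integral {0..t} \<phi>)"
    and "t \<in> S \<Longrightarrow> ((\<lambda>t. integral {0..t} \<phi>) has_vector_derivative \<phi> t) (at t within S)"
proof -
  let ?I = "\<lambda>t. integral {0..t} \<phi>"
  have sub: "{a..b} \<subseteq> S" if "a \<in> S" "b \<in> S" for a b using mem_is_interval_1_I[OF S(1) that] by auto
  have main: "\<exists>U H. open U \<and> t0 \<in> U \<and> (\<forall>n. Ck_on n U H) \<and> (\<forall>t\<in>S \<inter> U. H t = ?I t) \<and>
      (H has_vector_derivative \<phi> t0) (at t0)" if t0: "t0 \<in> S" for t0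
  proof -
    obtain U h where U: "open U" "t0 \<in> U" "\<forall>n. Ck_on n U h" "\<forall>t\<in>S \<inter> U. h t = \<phi> t"
      by (rule smooth_onE[OF \<phi> t0])
    obtain r where r: "r > 0" "cball t0 r \<subseteq> U" using U(1,2) open_contains_cball by blast
    have hc: "continuous_on {t0 - r..t0 + r} h"
      using continuous_on_subset[OF Ck_on_imp_continuous_on[OF U(3)[rule_format]] r(2)]
      by (simp add: cball_eq_atLeastAtMost)
    \<comment> \<open>Both integrals of \<open>h\<close> start at t0 - r; their difference is the
      integral from \<open>t0\<close> to \<open>t\<close> for \<open>t\<close> on either side,
      without orientation conventions.\<close>
    define H where "H t = ?I t0 + (integral {t0 - r..t} h - integral {t0 - r..t0} h)" for t
    have dH: "(H has_vector_derivative h t) (at t)" if t: "t \<in> ball t0 r" for t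
    proof -
      have "t \<in> {t0 - r..t0 + r}" using t by (auto simp: dist_real_def)
      from integral_has_vector_derivative[OF hc this]
      have "(H has_vector_derivative h t) (at t within {t0 - r..t0 + r})"
        unfolding H_def by (auto intro!: derivative_eq_intros)
      moreover have "at t within {t0 - r..t0 + r} = at t"
        using t by (intro at_within_interior) (auto simp: interior_atLeastAtMost_real dist_real_def)
      ultimately show ?thesis by simp
    qed
    have int: "integral {a..b} h = integral {a..b} \<phi>" if "a \<in> S" "b \<in> S" "{a..b} \<subseteq> ball t0 r" for a b
      by (rule integral_cong) (use U(4) sub[OF that(1,2)] that(3) r(2) ball_subset_cball[of t0 r] in blast)
    have ih: "h integrable_on {a..b}" if "{a..b} \<subseteq> {t0 - r..t0 + r}" for a b
      by (rule integrable_continuous_real[OF continuous_on_subset[OF hc that]])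
    have i\<phi>: "\<phi> integrable_on {0..t}" if "t \<in> S" for t
      by (rule integrable_continuous_real[OF continuous_on_subset[OF smooth_on_imp_continuous_on[OF \<phi>] sub[OF S(2) that]]])
    have HI: "H t = ?I t" if "t \<in> S \<inter> ball t0 r" for t
    proof (cases "t0 \<le> t")
      case True
      have t: "t \<in> S" "t \<in> {t0 - r..t0 + r}" "{t0..t} \<subseteq> ball t0 r" using that True by (auto simp: dist_real_def)
      have "integral {0..t0} \<phi> + integral {t0..t} \<phi> = ?I t"
        by (rule Henstock_Kurzweil_Integration.integral_combine[OF S(3)[OF t0] True i\<phi>[OF t(1)]])
      moreover have "integral {t0 - r..t0} h + integral {t0..t} h = integral {t0 - r..t} h"
        by (rule Henstock_Kurzweil_Integration.integral_combine[OF _ True ih]) (use t r in auto)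
      ultimately show ?thesis using int[OF t0 t(1,3)] by (simp add: H_def)
    next
      case False
      have t: "t \<in> S" "t \<in> {t0 - r..t0 + r}" "{t..t0} \<subseteq> ball t0 r" using that False by (auto simp: dist_real_def)
      have "integral {0..t} \<phi> + integral {t..t0} \<phi> = ?I t0"
        by (rule Henstock_Kurzweil_Integration.integral_combine[OF S(3)[OF t(1)] _ i\<phi>[OF t0]]) (use False in simp)
      moreover have "integral {t0 - r..t} h + integral {t..t0} h = integral {t0 - r..t0} h"
        by (rule Henstock_Kurzweil_Integration.integral_combine[OF _ _ ih]) (use t r False in auto)
      ultimately show ?thesis using int[OF t(1) t0 t(3)] by (simp add: H_def)
    qed
    have "Ck_on n (ball t0 r) H" for n
    proof (rule Ck_on_SucD, rule Ck_on_antiderivative[OF open_ball _ dH])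
      show "Ck_on n (ball t0 r) h"
        by (rule Ck_on_subset[OF U(3)[rule_format]]) (use r(2) ball_subset_cball[of t0 r] in blast)
    qed
    moreover have "(H has_vector_derivative \<phi> t0) (at t0)"
      using dH[of t0] r(1) U(2,4) t0 by simp
    ultimately show ?thesis
      using HI r(1) by (intro exI[of _ "ball t0 r"] exI[of _ H]) simp
  qed
  show "smooth_on S ?I"
    unfolding smooth_on_def using main by blast
  assume t: "t \<in> S"
  from main[OF t] obtain U H where U: "open U" "t \<in> U" "\<And>t. t \<in> S \<inter> U \<Longrightarrow> H t = ?I t"
    "(H has_vector_derivative \<phi> t) (at t)" by blast
  obtain d where d: "d > 0" "ball t d \<subseteq> U" using U(1,2) openE by blast
  show "(?I has_vector_derivative \<phi> t) (at t within S)"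
    by (rule has_vector_derivative_transform_within[OF has_vector_derivative_at_within[OF U(4)] d(1) t])
      (use U(3) d(2) in \<open>auto simp: subset_iff dist_commute\<close>)
qed

text \<open>Continuity and differentiability of the solution \<open>w\<close> of \<open>A x (w x) = l x\<close> are obtained by inverting
  the map \<open>(x, w) \<mapsto> (x, A x w)\<close>, using invariance of domain and the inverse function theorem.\<close>

lemma linear_solution_Ck:
  fixes A :: "'d::euclidean_space \<Rightarrow> 'e::euclidean_space \<Rightarrow> 'e"
  assumes \<Omega>: "open \<Omega>" and A: "\<And>x. x \<in> \<Omega> \<Longrightarrow> linear (A x)" "\<And>x. x \<in> \<Omega> \<Longrightarrow> inj (A x)"
    and Ck: "\<And>v. Ck_on n \<Omega> (\<lambda>x. A x v)" and l: "Ck_on n \<Omega> l" and w: "\<And>x. x \<in> \<Omega> \<Longrightarrow> A x (w x) = l x"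
  shows "Ck_on n \<Omega> w"
  using Ck l w
proof (induction n arbitrary: l w)
  case 0
  let ?\<Psi> = "\<lambda>q. (fst q, A (fst q) (snd q))"
  have exp: "A (fst q) (snd q) = (\<Sum>i\<in>Basis. (snd q \<bullet> i) *\<^sub>R A (fst q) i)" if "fst q \<in> \<Omega>" for q
    by (rule linear_basis_expand[OF A(1)[OF that]])
  have "continuous_on (\<Omega> \<times> UNIV) (\<lambda>q. \<Sum>i\<in>Basis. (snd q \<bullet> i) *\<^sub>R A (fst q) i)"
    by (intro continuous_intros continuous_on_compose2[OF 0(1)[unfolded Ck_on.simps(1)]]) auto
  then have "continuous_on (\<Omega> \<times> UNIV) (\<lambda>q. A (fst q) (snd q))"
    by (rule continuous_on_cong[THEN iffD1, OF refl, rotated]) (use exp in auto)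
  then have c: "continuous_on (\<Omega> \<times> UNIV) ?\<Psi>" by (intro continuous_intros)
  have "inj_on ?\<Psi> (\<Omega> \<times> UNIV)"
  proof (rule inj_onI)
    fix p q assume "p \<in> \<Omega> \<times> (UNIV :: 'e set)" "?\<Psi> p = ?\<Psi> q"
    then have "fst p \<in> \<Omega>" "fst p = fst q" "A (fst p) (snd p) = A (fst p) (snd q)" by auto
    then show "p = q" using injD[OF A(2)] by (simp add: prod_eq_iff)
  qed
  then obtain h where h: "homeomorphism (\<Omega> \<times> UNIV) (?\<Psi> ` (\<Omega> \<times> UNIV)) ?\<Psi> h"
    using invariance_of_domain_homeomorphism[OF open_Times[OF \<Omega> open_UNIV] c order_refl] by blast
  have im: "(x, l x) = ?\<Psi> (x, w x)" if "x \<in> \<Omega>" for x using 0(3)[OF that] by simp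
  have "continuous_on \<Omega> (\<lambda>x. (x, l x))" using 0(2) by (auto intro: continuous_intros)
  then have "continuous_on \<Omega> (\<lambda>x. h (x, l x))"
    by (rule continuous_on_compose2[OF homeomorphism_cont2[OF h]]) (use im in blast)
  then have "continuous_on \<Omega> (\<lambda>x. snd (h (x, l x)))" by (rule continuous_on_snd)
  moreover have "snd (h (x, l x)) = w x" if "x \<in> \<Omega>" for x
    using homeomorphism_apply1[OF h, of "(x, w x)"] that by (simp add: 0(3))
  ultimately show ?case by (simp cong: continuous_on_cong)
next
  case (Suc n)
  have wn: "Ck_on n \<Omega> w"
    by (rule Suc.IH[OF Ck_on_SucD[OF Suc.prems(1)] Ck_on_SucD[OF Suc.prems(2)] Suc.prems(3)])
  let ?dA = "\<lambda>x h i. D1 (\<lambda>x. A x i) x h"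
  have dA: "((\<lambda>x. A x i) has_derivative (\<lambda>h. ?dA x h i)) (at x)" if "x \<in> \<Omega>" for x i
    by (rule Ck_on_has_derivative[OF Suc.prems(1) that])
  have dl: "(l has_derivative D1 l x) (at x)" if "x \<in> \<Omega>" for x
    by (rule Ck_on_has_derivative[OF Suc.prems(2) that])
  have bij: "bij (A x)" if "x \<in> \<Omega>" for x
    using linear_injective_imp_surjective[OF A(1)[OF that] A(2)[OF that]] A(2)[OF that] by (simp add: bij_def)
  \<comment> \<open>From implicit differentiation: A w' = l' - A' w. This is again a system with the
    same \<open>A\<close>, and its right side is of class C^n, as the induction requires.\<close>
  define w' where "w' x h = inv (A x) (D1 l x h - ?dA x h (w x))" for x h
  have Aw': "A x (w' x h) = D1 l x h - ?dA x h (w x)" if "x \<in> \<Omega>" for x h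
    unfolding w'_def using bij_is_surj[OF bij[OF that]] by (simp add: surj_f_inv_f)
  let ?\<Psi> = "\<lambda>q. (fst q, A (fst q) (snd q))"
  define G where "G q = (fst q, inv (A (fst q)) (snd q))" for q :: "'d \<times> 'e"
  have oS: "open (\<Omega> \<times> (UNIV :: 'e set))" using \<Omega> by (intro open_Times) auto
  have d\<Psi>: "(?\<Psi> has_derivative (\<lambda>q. (fst q, ?dA x (fst q) v + A x (snd q)))) (at (x, v))" if "x \<in> \<Omega>" for x v
  proof -
    have "((\<lambda>q. A (fst q) (snd q)) has_derivative (\<lambda>q. ?dA x (fst q) (snd (x, v)) + A (fst (x, v)) (snd q))) (at (x, v))"
    proof (rule linear_family_derivative(2)[OF oS, where L = "\<lambda>q. A (fst q)" and L' = "\<lambda>q i. ?dA x (fst q) i"])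
      show "((\<lambda>q. A (fst q) u) has_derivative (\<lambda>q. ?dA x (fst q) u)) (at (x, v))" for u
      proof -
        have "((\<lambda>x. A x u) has_derivative (\<lambda>h. ?dA x h u)) (at (fst (x, v)))" using dA[OF that] by simp
        from has_derivative_compose[OF has_derivative_fst[OF has_derivative_ident] this] show ?thesis by simp
      qed
    qed (use that A(1) in \<open>auto intro!: has_derivative_snd has_derivative_ident\<close>)
    then show ?thesis by (intro has_derivative_Pair has_derivative_fst has_derivative_ident) simp
  qed
  have c\<Psi>: "continuous_on (\<Omega> \<times> UNIV) ?\<Psi>"
    using d\<Psi> by (intro continuous_at_imp_continuous_on) (auto intro: has_derivative_continuous)
  have dw: "(w has_derivative w' x) (at x)" if x: "x \<in> \<Omega>" for x
  proof -
    let ?G' = "\<lambda>q. (fst q, inv (A x) (snd q - ?dA x (fst q) (w x)))"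
    have "(G has_derivative ?G') (at (?\<Psi> (x, w x)))"
    proof (rule has_derivative_inverse_strong[OF oS _ c\<Psi> _ d\<Psi>[OF x]])
      show "(x, w x) \<in> \<Omega> \<times> UNIV" using x by simp
      show "G (?\<Psi> q) = q" if "q \<in> \<Omega> \<times> UNIV" for q
        using that inv_f_f[OF A(2)] by (auto simp: G_def)
      show "(\<lambda>q. (fst q, ?dA x (fst q) (w x) + A x (snd q))) \<circ> ?G' = id"
        using bij_is_surj[OF bij[OF x]] by (auto simp: fun_eq_iff surj_f_inv_f)
    qed
    then have G: "(G has_derivative ?G') (at (x, l x))" using Suc.prems(3)[OF x] by simp
    have "((\<lambda>x. (x, l x)) has_derivative (\<lambda>h. (h, D1 l x h))) (at x)"
      by (intro has_derivative_Pair has_derivative_ident dl x)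
    from has_derivative_snd[OF has_derivative_compose[OF this G]]
    have "((\<lambda>x. snd (G (x, l x))) has_derivative w' x) (at x)" by (simp add: w'_def[abs_def])
    then show ?thesis
      by (rule has_derivative_transform_within_open[OF _ \<Omega> x])
        (use Suc.prems(3) inv_f_f[OF A(2)] in \<open>metis G_def fst_conv snd_conv\<close>)
  qed
  show ?case
  proof (rule Ck_on_SucI[OF \<Omega> dw])
    fix v
    show "Ck_on n \<Omega> (\<lambda>x. w' x v)"
    proof (rule Suc.IH[OF Ck_on_SucD[OF Suc.prems(1)] _ Aw'])
      have "Ck_on n \<Omega> (\<lambda>x. D1 l x v - (\<Sum>i\<in>Basis. (w x \<bullet> i) *\<^sub>R ?dA x v i))"
        by (intro Ck_on_diff Ck_on_sum Ck_on_scaleR Ck_on_inner Ck_on_const \<Omega> wn Ck_on_SucD_deriv Suc.prems(1,2))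
      then show "Ck_on n \<Omega> (\<lambda>x. D1 l x v - ?dA x v (w x))"
      proof (rule Ck_on_cong[OF \<Omega>])
        fix x assume x: "x \<in> \<Omega>"
        have "linear (\<lambda>i. ?dA x v i)" by (rule linear_family_derivative(1)[OF \<Omega> x A(1) dA[OF x]])
        from linear_basis_expand[OF this, of "w x"]
        show "D1 l x v - (\<Sum>i\<in>Basis. (w x \<bullet> i) *\<^sub>R ?dA x v i) = D1 l x v - ?dA x v (w x)" by simp
      qed
    qed
  qed
qed

text \<open>At \<open>x0\<close> the map expands every vector at least by a factor k > 0, and near
  \<open>x0\<close> the deviations on the basis vectors add up to less than \<open>k\<close>; a
  kernel vector at \<open>x\<close> would contradict this.\<close>

lemma injective_nearby:
  fixes A :: "'d::euclidean_space \<Rightarrow> 'e::euclidean_space \<Rightarrow> 'e"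
  assumes U: "open U" "x0 \<in> U" and A: "\<And>x. x \<in> U \<Longrightarrow> linear (A x)" "inj (A x0)"
    and c: "\<And>v. continuous_on U (\<lambda>x. A x v)"
  obtains V where "open V" "x0 \<in> V" "V \<subseteq> U" "\<And>x. x \<in> V \<Longrightarrow> inj (A x)"
proof -
  obtain k where k: "k > 0" "\<And>v. k * norm v \<le> norm (A x0 v)"
    using linear_inj_bounded_below_pos[OF A(1)[OF U(2)] A(2)] by blast
  let ?N = "\<lambda>x. \<Sum>i\<in>Basis. norm (A x i - A x0 i)"
  define V where "V = U \<inter> ?N -` {..<k}"
  have "continuous_on U ?N" by (intro continuous_intros c)
  then have V: "open V" "x0 \<in> V" "V \<subseteq> U"
    unfolding V_def using continuous_open_preimage[OF _ U(1) open_lessThan] U(2) k(1) by auto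
  have "inj (A x)" if x: "x \<in> V" for x
  proof -
    have lin: "linear (A x)" "linear (A x0)" using x V(3) U(2) A(1) by auto
    have "v = 0" if "A x v = 0" for v
    proof (rule ccontr)
      assume "v \<noteq> 0"
      have "A x0 v = - (\<Sum>i\<in>Basis. (v \<bullet> i) *\<^sub>R (A x i - A x0 i))"
        using linear_basis_expand[OF lin(1), of v] linear_basis_expand[OF lin(2), of v] that
        by (simp add: scaleR_diff_right sum_subtractf)
      then have "norm (A x0 v) \<le> (\<Sum>i\<in>Basis. norm v * norm (A x i - A x0 i))"
        by (simp only: norm_minus_cancel) (intro sum_norm_le, simp add: mult_right_mono Basis_le_norm)
      also have "\<dots> = norm v * ?N x" by (simp add: sum_distrib_left)
      also have "\<dots> < norm v * k" using x \<open>v \<noteq> 0\<close> by (auto simp: V_def)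
      finally show False using k(2)[of v] by (simp add: mult.commute)
    qed
    then show ?thesis using linear_injective_0[OF lin(1)] by blast
  qed
  then show ?thesis using that V by blast
qed

text \<open>The dual vector solves a linear system with the Gram matrix. Near a boundary point the
  coefficients are extended smoothly; the extension may be neither symmetric nor definite, but it
  stays injective close to \<open>x0\<close>, and that is what \<open>linear_solution_Ck\<close>
  asks for.\<close>

lemma smooth_on_dual_vector:
  fixes b :: "'d::euclidean_space \<Rightarrow> 'e::euclidean_space \<Rightarrow> 'e \<Rightarrow> real"
  assumes b: "\<And>x. x \<in> S \<Longrightarrow> inner_form (b x)" and l: "\<And>x. x \<in> S \<Longrightarrow> linear (l x)"
    and sb: "\<And>u v. smooth_on S (\<lambda>x. b x u v)" and sl: "\<And>v. smooth_on S (\<lambda>x. l x v)"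
  shows "smooth_on S (\<lambda>x. dual_vector (b x) (l x))"
  unfolding smooth_on_def
proof
  fix x0 assume x0: "x0 \<in> S"
  define a where "a j x = (\<Sum>i\<in>Basis. b x j i *\<^sub>R i)" for j x
  define m where "m x = (\<Sum>i\<in>Basis. l x i *\<^sub>R i)" for x
  have sa: "smooth_on S (a j)" for j unfolding a_def by (intro smooth_on_sum smooth_on_scaleR sb smooth_on_const)
  have sm: "smooth_on S m" unfolding m_def by (intro smooth_on_sum smooth_on_scaleR sl smooth_on_const)
  have "\<exists>U h. open U \<and> x0 \<in> U \<and> (\<forall>n. Ck_on n U h) \<and> (\<forall>y\<in>S \<inter> U. h y = a j y)" for j
    using bspec[OF sa[unfolded smooth_on_def] x0] .
  then obtain U h where U: "\<And>j. open (U j)" "\<And>j. x0 \<in> U j" "\<And>j n. Ck_on n (U j) (h j)"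
      "\<And>j y. y \<in> S \<inter> U j \<Longrightarrow> h j y = a j y" by metis
  obtain U' k where U': "open U'" "x0 \<in> U'" "\<forall>n. Ck_on n U' k" "\<forall>y\<in>S \<inter> U'. k y = m y"
    by (rule smooth_onE[OF sm x0])
  define \<Omega> where "\<Omega> = U' \<inter> (\<Inter>j\<in>Basis. U j)"
  have \<Omega>: "open \<Omega>" "x0 \<in> \<Omega>" using U(1,2) U'(1,2) by (auto simp: \<Omega>_def intro!: open_Int open_INT)
  \<comment> \<open>The system assembled from the extended columns \<open>h j\<close>; it is the
    Gram matrix at the points of \<open>S\<close> only.\<close>
  define A where "A x v = (\<Sum>j\<in>Basis. (v \<bullet> j) *\<^sub>R h j x)" for x v
  have A: "linear (A x)" for x
    unfolding A_def
    by (intro bounded_linear.linear bounded_linear_sum bounded_linear_compose[OF bounded_linear_scaleR_left] bounded_linear_inner_left)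
  have CA: "Ck_on n \<Omega> (\<lambda>x. A x v)" for n v
    unfolding A_def by (intro Ck_on_sum Ck_on_scaleR Ck_on_const \<Omega> Ck_on_subset[OF U(3)]) (auto simp: \<Omega>_def)
  have Ab: "A x v = (\<Sum>i\<in>Basis. b x v i *\<^sub>R i)" if x: "x \<in> S \<inter> \<Omega>" for x v
  proof -
    have bx: "inner_form (b x)" using b x by blast
    have "A x v = (\<Sum>j\<in>Basis. (v \<bullet> j) *\<^sub>R a j x)"
      unfolding A_def using U(4) x by (intro sum.cong refl) (auto simp: \<Omega>_def)
    also have "\<dots> = (\<Sum>j\<in>Basis. \<Sum>i\<in>Basis. ((v \<bullet> j) * b x j i) *\<^sub>R i)"
      by (simp add: a_def scaleR_sum_right)
    also have "\<dots> = (\<Sum>i\<in>Basis. \<Sum>j\<in>Basis. ((v \<bullet> j) * b x j i) *\<^sub>R i)" by (rule sum.swap)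
    also have "\<dots> = (\<Sum>i\<in>Basis. b x v i *\<^sub>R i)"
    proof (rule sum.cong[OF refl])
      fix i :: 'e
      have "b x v i = (\<Sum>j\<in>Basis. (v \<bullet> j) * b x j i)"
        using linear_basis_expand[OF inner_formD(5)[OF bx, of i], of v] by simp
      then show "(\<Sum>j\<in>Basis. ((v \<bullet> j) * b x j i) *\<^sub>R i) = b x v i *\<^sub>R i" by (simp add: scaleR_sum_left)
    qed
    finally show ?thesis .
  qed
  have inj: "inj (A x)" if x: "x \<in> S \<inter> \<Omega>" for x
    unfolding linear_injective_0[OF A]
  proof (intro allI impI)
    fix v assume "A x v = 0"
    have bx: "inner_form (b x)" using b x by blast
    have bi: "b x v i = 0" if "i \<in> Basis" for i
      using arg_cong[OF \<open>A x v = 0\<close>, of "\<lambda>y. y \<bullet> i"] that by (simp add: Ab[OF x] inner_sum_left_Basis)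
    have "b x v v = 0" using linear_basis_expand[OF inner_formD(4)[OF bx, of v], of v] bi by simp
    then show "v = 0" using inner_formD(3)[OF bx, of v] by force
  qed
  obtain V where V: "open V" "x0 \<in> V" "V \<subseteq> \<Omega>" "\<And>x. x \<in> V \<Longrightarrow> inj (A x)"
    using injective_nearby[OF \<Omega> A inj Ck_on_imp_continuous_on[OF CA]] x0 \<Omega>(2) by blast
  define w where "w x = inv (A x) (k x)" for x
  have Aw: "A x (w x) = k x" if "x \<in> V" for x
    unfolding w_def using linear_injective_imp_surjective[OF A V(4)[OF that]] by (simp add: surj_f_inv_f)
  have "Ck_on n V w" for n
  proof (rule linear_solution_Ck[OF V(1) A V(4) _ _ Aw])
    show "Ck_on n V (\<lambda>x. A x v)" for v by (rule Ck_on_subset[OF CA V(3)])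
    show "Ck_on n V k" by (rule Ck_on_subset[OF U'(3)[rule_format]]) (use V(3) in \<open>auto simp: \<Omega>_def\<close>)
  qed
  moreover have "w x = dual_vector (b x) (l x)" if x: "x \<in> S \<inter> V" for x
  proof -
    have x': "x \<in> S \<inter> \<Omega>" "x \<in> S" "x \<in> V" using x V(3) by auto
    have "A x (dual_vector (b x) (l x)) = m x"
      unfolding Ab[OF x'(1)] m_def using dual_vector[OF b[OF x'(2)] l[OF x'(2)]] by simp
    also have "\<dots> = A x (w x)" using Aw[OF x'(3)] U'(4) x' by (auto simp: \<Omega>_def)
    finally show ?thesis using injD[OF V(4)[OF x'(3)]] by metis
  qed
  ultimately show "\<exists>U h. open U \<and> x0 \<in> U \<and> (\<forall>n. Ck_on n U h) \<and> (\<forall>y\<in>S \<inter> U. h y = dual_vector (b y) (l y))"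
    using V(1,2) by blast
qed

section \<open>The tangential component of the force\<close>

lemma tangential_part_transform:
  fixes L :: "'e::euclidean_space \<Rightarrow> 'f::euclidean_space"
  assumes "\<And>u v. b (M u) (M v) = b' u v" "\<And>u. L u = M (L' u)" "v = M v'"
  shows "tangential_part b L v = tangential_part b' L' v'"
  unfolding tangential_part_def assms ..

lemma tangential_part_source:
  fixes L :: "'e::euclidean_space \<Rightarrow> 'f::euclidean_space" and N :: "'e \<Rightarrow> 'e"
  assumes b: "inner_form b" and L: "linear L" "inj L" and N: "linear N" "bij N"
  shows "tangential_part b L v = N (tangential_part b (\<lambda>u. L (N u)) v)"
  unfolding tangential_part_def[of b L]
proof (rule dual_vector_unique[OF inner_form_pullback[OF b L]])
  fix u
  obtain u' where u: "u = N u'" using N(2) by (metis bij_pointE)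
  have LN: "linear (\<lambda>u. L (N u))" "inj (\<lambda>u. L (N u))"
    using linear_compose[OF N(1) L(1)] inj_compose[OF L(2) bij_is_inj[OF N(2)]] by (auto simp: o_def)
  show "b (L (N (tangential_part b (\<lambda>u. L (N u)) v))) (L u) = b v (L u)"
    using tangential_part[OF b LN, of v u'] by (simp add: u)
qed

text \<open>The field F^*(W^T) of the overview: the differential of \<open>F\<close> maps it to the
  tangential component of W along \<open>F\<close>.\<close>

definition tangential_field ::
    "('b::topological_space, 'f::euclidean_space) chart set \<Rightarrow> ('b, 'f) metric \<Rightarrow> (('b, 'f) chart \<Rightarrow> 'b \<Rightarrow> 'f) \<Rightarrow>
     ('a \<Rightarrow> 'b) \<Rightarrow> ('a, 'e::euclidean_space) chart \<Rightarrow> 'a \<Rightarrow> 'e" where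
  "tangential_field B g W F \<xi> p = (let \<kappa> = chart_at B (F p)
     in tangential_part (g \<kappa> (F p)) (differential \<xi> \<kappa> F p) (W \<kappa> (F p)))"

lemma tangential_field_eq:
  assumes A: "smooth_atlas A" and B: "smooth_atlas B" and g: "riemannian_metric B g" and W: "smooth_vector_field B W"
    and F: "smooth_map A B F" and c: "\<xi> \<in> A" "\<kappa> \<in> B" "p \<in> dom_chart \<xi>" "F p \<in> dom_chart \<kappa>"
  shows "tangential_field B g W F \<xi> p = tangential_part (g \<kappa> (F p)) (differential \<xi> \<kappa> F p) (W \<kappa> (F p))"
proof -
  define \<eta> where "\<eta> = chart_at B (F p)"
  have \<eta>: "\<eta> \<in> B" "F p \<in> dom_chart \<eta>" using chart_at[OF B] by (auto simp: \<eta>_def)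
  show ?thesis
    unfolding tangential_field_def Let_def \<eta>_def[symmetric]
  proof (rule tangential_part_transform[where M = "differential \<kappa> \<eta> id (F p)"])
    show "g \<eta> (F p) (differential \<kappa> \<eta> id (F p) u) (differential \<kappa> \<eta> id (F p) v) = g \<kappa> (F p) u v" for u v
      by (rule riemannian_metricD(3)[OF g c(2) \<eta>(1) c(4) \<eta>(2), symmetric])
    show "differential \<xi> \<eta> F p u = differential \<kappa> \<eta> id (F p) (differential \<xi> \<kappa> F p u)" for u
      by (rule differential_change_target[OF A B F c(1,2) \<eta>(1) c(3,4) \<eta>(2)])
    show "W \<eta> (F p) = differential \<kappa> \<eta> id (F p) (W \<kappa> (F p))"
      by (rule smooth_vector_fieldD(2)[OF W c(2) \<eta>(1) c(4) \<eta>(2)])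
  qed
qed

text \<open>In charts the field is a dual vector built from the metric, from \<open>W\<close> and
  from first derivatives of \<open>F\<close> in space, all smooth up to the boundary in time;
  injectivity of the differentials makes the Gram form definite. Changing the chart on the source
  amounts to a change of basis.\<close>

lemma time_dependent_field_tangential:
  assumes A: "smooth_atlas A" and B: "smooth_atlas B" and g: "riemannian_metric B g" and W: "smooth_vector_field B W"
    and F: "smooth_family A B I F" and imm: "\<And>t. t \<in> I \<Longrightarrow> immersion A B (\<lambda>p. F p t)" and \<phi>: "smooth_on I \<phi>"
  shows "time_dependent_field A I (\<lambda>\<xi> p t. \<phi> t *\<^sub>R tangential_field B g W (\<lambda>p. F p t) \<xi> p)"
  unfolding time_dependent_field_def
proof (intro conjI ballI)
  fix \<xi> assume \<xi>: "\<xi> \<in> A"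
  note X = smooth_atlasD[OF A \<xi>]
  show "smooth_on (coord \<xi> ` dom_chart \<xi> \<times> I)
      (\<lambda>(z, t). \<phi> t *\<^sub>R tangential_field B g W (\<lambda>p. F p t) \<xi> (coord_inv \<xi> z))"
  proof (rule smooth_on_local)
    fix x assume "x \<in> coord \<xi> ` dom_chart \<xi> \<times> I"
    then obtain p0 t0 where x: "x = (coord \<xi> p0, t0)" "p0 \<in> dom_chart \<xi>" "t0 \<in> I" by auto
    define \<kappa> where "\<kappa> = chart_at B (F p0 t0)"
    have \<kappa>: "\<kappa> \<in> B" "F p0 t0 \<in> dom_chart \<kappa>" using chart_at[OF B] by (auto simp: \<kappa>_def)
    note K = smooth_atlasD[OF B \<kappa>(1)]
    obtain U J where UJ: "open U" "open J" "p0 \<in> U" "t0 \<in> J" "U \<subseteq> dom_chart \<xi>"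
      "\<And>p t. p \<in> U \<Longrightarrow> t \<in> I \<inter> J \<Longrightarrow> F p t \<in> dom_chart \<kappa>" "smooth_on (coord \<xi> ` U \<times> (I \<inter> J)) (family_rep \<xi> \<kappa> F)"
      using smooth_family_locally_rep[OF A B F \<xi> \<kappa>(1) x(2,3) \<kappa>(2)] by metis
    let ?D = "coord \<xi> ` U \<times> (I \<inter> J)" and ?f = "family_rep \<xi> \<kappa> F"
    have oU: "open (coord \<xi> ` U)" by (rule open_coord_image[OF A \<xi> UJ(1,5)])
    have D: "\<exists>p\<in>U. fst q = coord \<xi> p \<and> coord_inv \<xi> (fst q) = p \<and> p \<in> dom_chart \<xi> \<and> snd q \<in> I \<and> F p (snd q) \<in> dom_chart \<kappa>
        \<and> ?f q = coord \<kappa> (F p (snd q))" if "q \<in> ?D" for q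
      using that X(5) UJ(5,6) by (auto simp: family_rep_def subset_iff)
    let ?L = "\<lambda>q u. D1 (\<lambda>z. ?f (z, snd q)) (fst q) u"
    have Ls: "smooth_on ?D (\<lambda>q. ?L q u)" for u
    proof -
      have op: "open {z. (z, t) \<in> ?D}" for t using oU by (cases "t \<in> I \<inter> J") auto
      show ?thesis using smooth_on_partial_derivative(1)[OF UJ(7) op, of u] by (simp add: case_prod_unfold)
    qed
    have Ld: "?L q = differential \<xi> \<kappa> (\<lambda>p. F p (snd q)) p" if "fst q = coord \<xi> p" for q p
      unfolding differential_def that family_rep_def by (simp add: comp_def)
    let ?b = "\<lambda>z. g \<kappa> (coord_inv \<kappa> z)" and ?w = "\<lambda>z. W \<kappa> (coord_inv \<kappa> z)"
    have fK: "?f q \<in> coord \<kappa> ` dom_chart \<kappa>" if "q \<in> ?D" for q using D[OF that] by auto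
    have bs: "smooth_on ?D (\<lambda>q. ?b (?f q) u v)" for u v
      by (rule smooth_on_compose[OF UJ(7) riemannian_metricD(2)[OF g \<kappa>(1)] fK])
    have ws: "smooth_on ?D (\<lambda>q. ?w (?f q))"
      using smooth_on_compose[OF UJ(7) smooth_vector_fieldD(1)[OF W \<kappa>(1)] fK] by (simp add: o_def)
    have inner: "inner_form (?b (?f q))" if "q \<in> ?D" for q
      by (rule riemannian_metricD(1)[OF g \<kappa>(1) K(7)[OF fK[OF that]]])
    have Llin: "linear (?L q)" "inj (?L q)" if qD: "q \<in> ?D" for q
    proof -
      obtain p where p: "p \<in> U" "fst q = coord \<xi> p" "p \<in> dom_chart \<xi>" "snd q \<in> I" "F p (snd q) \<in> dom_chart \<kappa>"
        using D[OF qD] by blast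
      have im: "immersion A B (\<lambda>p. F p (snd q))" by (rule imm[OF p(4)])
      then have sm: "smooth_map A B (\<lambda>p. F p (snd q))" by (simp add: immersion_def)
      show "linear (?L q)"
        unfolding Ld[OF p(2)] by (rule differential_linear[OF A B sm \<xi> \<kappa>(1) p(3,5)])
      show "inj (?L q)" unfolding Ld[OF p(2)] using im \<xi> \<kappa>(1) p(3,5) by (auto simp: immersion_def)
    qed
    \<comment> \<open>Smoothness of the metric is known for constant arguments; the expansion over
      the basis admits arguments that vary with the point.\<close>
    have bilin: "smooth_on ?D (\<lambda>q. ?b (?f q) (h q) (k q))" if "smooth_on ?D h" "smooth_on ?D k" for h k
    proof -
      have "smooth_on ?D (\<lambda>q. \<Sum>i\<in>Basis. (h q \<bullet> i) *\<^sub>R (\<Sum>j\<in>Basis. (k q \<bullet> j) *\<^sub>R ?b (?f q) i j))"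
        by (intro smooth_on_sum smooth_on_scaleR smooth_on_inner smooth_on_const bs that)
      then show ?thesis
      proof (rule smooth_on_cong)
        fix q assume "q \<in> ?D"
        note i = inner[OF this]
        show "(\<Sum>i\<in>Basis. (h q \<bullet> i) *\<^sub>R (\<Sum>j\<in>Basis. (k q \<bullet> j) *\<^sub>R ?b (?f q) i j)) = ?b (?f q) (h q) (k q)"
          unfolding linear_basis_expand[OF inner_formD(4)[OF i], symmetric] linear_basis_expand[OF inner_formD(5)[OF i], symmetric] ..
      qed
    qed
    have "smooth_on ?D (\<lambda>q. tangential_part (?b (?f q)) (?L q) (?w (?f q)))"
      unfolding tangential_part_def
    proof (rule smooth_on_dual_vector)
      show "inner_form (\<lambda>u u'. ?b (?f q) (?L q u) (?L q u'))" if "q \<in> ?D" for q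
        by (rule inner_form_pullback[OF inner[OF that] Llin[OF that]])
      show "linear (\<lambda>u. ?b (?f q) (?w (?f q)) (?L q u))" if "q \<in> ?D" for q
        using linear_compose[OF Llin(1)[OF that] inner_formD(4)[OF inner[OF that]]] by (simp add: o_def)
    qed (intro bilin Ls ws)+
    moreover have "smooth_on ?D (\<lambda>q. \<phi> (snd q))" by (rule smooth_on_compose[OF smooth_on_snd \<phi>]) auto
    ultimately have "smooth_on ?D (\<lambda>q. \<phi> (snd q) *\<^sub>R tangential_part (?b (?f q)) (?L q) (?w (?f q)))"
      by (intro smooth_on_scaleR)
    then have "smooth_on ?D (\<lambda>(z, t). \<phi> t *\<^sub>R tangential_field B g W (\<lambda>p. F p t) \<xi> (coord_inv \<xi> z))"
    proof (rule smooth_on_cong)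
      fix q assume "q \<in> ?D"
      from D[OF this] obtain p where p: "fst q = coord \<xi> p" "coord_inv \<xi> (fst q) = p" "p \<in> dom_chart \<xi>" "snd q \<in> I"
        "F p (snd q) \<in> dom_chart \<kappa>" "?f q = coord \<kappa> (F p (snd q))" by blast
      have sm: "smooth_map A B (\<lambda>p. F p (snd q))" using imm[OF p(4)] by (simp add: immersion_def)
      show "\<phi> (snd q) *\<^sub>R tangential_part (?b (?f q)) (?L q) (?w (?f q))
          = (case q of (z, t) \<Rightarrow> \<phi> t *\<^sub>R tangential_field B g W (\<lambda>p. F p t) \<xi> (coord_inv \<xi> z))"
        using tangential_field_eq[OF A B g W sm \<xi> \<kappa>(1) p(3,5)] K(5)[OF p(5)]
        by (simp add: case_prod_beta p(2,6) Ld[OF p(1)])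
    qed
    then show "\<exists>U. open U \<and> x \<in> U \<and> smooth_on (coord \<xi> ` dom_chart \<xi> \<times> I \<inter> U)
        (\<lambda>(z, t). \<phi> t *\<^sub>R tangential_field B g W (\<lambda>p. F p t) \<xi> (coord_inv \<xi> z))"
      using oU UJ(2-4) x by (intro exI[of _ "coord \<xi> ` U \<times> J"]) (auto intro!: open_Times elim!: smooth_on_subset)
  qed
next
  fix \<xi> \<eta> p t assume c: "\<xi> \<in> A" "\<eta> \<in> A" "p \<in> dom_chart \<xi> \<inter> dom_chart \<eta>" "t \<in> I"
  then have p: "p \<in> dom_chart \<xi>" "p \<in> dom_chart \<eta>" by auto
  define \<kappa> where "\<kappa> = chart_at B (F p t)"
  have \<kappa>: "\<kappa> \<in> B" "F p t \<in> dom_chart \<kappa>" using chart_at[OF B] by (auto simp: \<kappa>_def)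
  have sm: "smooth_map A B (\<lambda>p. F p t)" and inj: "inj (differential \<eta> \<kappa> (\<lambda>p. F p t) p)"
    using imm[OF c(4)] c(2) p \<kappa> by (auto simp: immersion_def)
  have N: "linear (differential \<xi> \<eta> id p)"
    using p by (intro differential_linear[OF A A smooth_map_id[OF A] c(1,2)]) auto
  have "bij (differential \<xi> \<eta> id p)"
    using differential_diffeomorphism_bij[OF A diffeomorphism_ident[OF A] c(1,2) p] by (simp add: id_def)
  from tangential_part_source[OF riemannian_metricD(1)[OF g \<kappa>] differential_linear[OF A B sm c(2) \<kappa>(1) p(2) \<kappa>(2)] inj N this]
  have "tangential_field B g W (\<lambda>p. F p t) \<eta> p = differential \<xi> \<eta> id p (tangential_field B g W (\<lambda>p. F p t) \<xi> p)"
    unfolding tangential_field_eq[OF A B g W sm c(1) \<kappa>(1) p(1) \<kappa>(2)] tangential_field_eq[OF A B g W sm c(2) \<kappa>(1) p(2) \<kappa>(2)]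
      differential_change_source[OF A B sm c(1,2) \<kappa>(1) p \<kappa>(2), abs_def] .
  then show "\<phi> t *\<^sub>R tangential_field B g W (\<lambda>p. F p t) \<eta> p
      = differential \<xi> \<eta> id p (\<phi> t *\<^sub>R tangential_field B g W (\<lambda>p. F p t) \<xi> p)"
    by (simp add: linear_scale[OF N])
qed

section \<open>Conformal images of mean curvature flows\<close>

lemma family_curve_continuous:
  assumes "smooth_atlas A" "smooth_family A B I F"
  shows "continuous_on I (F p)"
proof -
  have "continuous_on I (\<lambda>s. (p, s))" by (intro continuous_intros)
  from continuous_on_compose2[OF smooth_familyD(1)[OF assms] this] show ?thesis by auto
qed

lemma reparametrized_flow_solution:
  fixes A :: "('a::{t2_space,second_countable_topology}, 'e::euclidean_space) chart set"
    and B :: "('b::{t2_space,second_countable_topology}, 'f::euclidean_space) chart set"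
  assumes A: "smooth_atlas A" and M: "compact (UNIV :: 'a set)" and B: "smooth_atlas B" and g: "riemannian_metric B g"
    and W: "smooth_vector_field B W"
    and I: "is_interval I" "0 \<in> I" "\<And>t. t \<in> I \<Longrightarrow> 0 \<le> t" "\<And>t. t \<in> I \<Longrightarrow> at t within I \<noteq> bot"
    and \<phi>: "smooth_on I \<phi>"
    and F: "flow_solution A B I F (\<lambda>p t \<kappa>. mean_curvature A B g (\<lambda>p. F p t) p \<kappa>
              + \<phi> t *\<^sub>R normal_part A g (\<lambda>p. F p t) p (\<lambda>\<kappa>. W \<kappa> (F p t)) \<kappa>)"
  obtains \<psi> where "time_dependent_diffeo A I \<psi>"
    "flow_solution A B I (\<lambda>p t. F (\<psi> p t) t)
       (\<lambda>p t \<kappa>. mean_curvature A B g (\<lambda>p. F (\<psi> p t) t) p \<kappa> + \<phi> t *\<^sub>R W \<kappa> (F (\<psi> p t) t))"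
proof -
  have Fs: "smooth_family A B I F" and imm: "\<And>t. t \<in> I \<Longrightarrow> immersion A B (\<lambda>p. F p t)"
    and vel: "\<And>t p. t \<in> I \<Longrightarrow> has_velocity B I (F p) t (\<lambda>\<kappa>. mean_curvature A B g (\<lambda>p. F p t) p \<kappa>
              + \<phi> t *\<^sub>R normal_part A g (\<lambda>p. F p t) p (\<lambda>\<kappa>. W \<kappa> (F p t)) \<kappa>)"
    using F by (auto simp: flow_solution_def)
  \<comment> \<open>The sign is positive: the velocity of \<open>F (\<psi> p t) t\<close> is that of
    \<open>F\<close> plus dF applied to \<open>X\<close>, and W is the sum of its normal and
    tangential parts.\<close>
  define X where "X \<xi> p t = \<phi> t *\<^sub>R tangential_field B g W (\<lambda>p. F p t) \<xi> p" for \<xi> :: "('a, 'e) chart" and p t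
  have "time_dependent_field A I X"
    unfolding X_def[abs_def] by (rule time_dependent_field_tangential[OF A B g W Fs imm \<phi>])
  from flow_of_time_dependent_field[OF A M this I(1-3)] obtain \<psi> where
    \<psi>: "time_dependent_diffeo A I \<psi>" "\<And>p t. t \<in> I \<Longrightarrow> has_velocity A I (\<psi> p) t (\<lambda>\<xi>. X \<xi> (\<psi> p t) t)" by metis
  have \<psi>s: "smooth_family A A I \<psi>" and \<psi>d: "\<And>t. t \<in> I \<Longrightarrow> diffeomorphism A A (\<lambda>p. \<psi> p t)"
    using \<psi>(1) by (auto simp: time_dependent_diffeo_def)
  have "flow_solution A B I (\<lambda>p t. F (\<psi> p t) t)
       (\<lambda>p t \<kappa>. mean_curvature A B g (\<lambda>p. F (\<psi> p t) t) p \<kappa> + \<phi> t *\<^sub>R W \<kappa> (F (\<psi> p t) t))"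
    unfolding flow_solution_def
  proof (intro conjI ballI allI)
    show "smooth_family A B I (\<lambda>p t. F (\<psi> p t) t)"
      by (rule smooth_family_compose[OF A A B \<psi>s Fs smooth_on_ident])
    show "immersion A B (\<lambda>p. F (\<psi> p t) t)" if "t \<in> I" for t
      by (rule immersion_diffeomorphism_right[OF A B imm[OF that] \<psi>d[OF that]])
    fix t p assume t: "t \<in> I"
    let ?F = "\<lambda>p. F p t" and ?q = "\<psi> p t"
    show "has_velocity B I (\<lambda>t. F (\<psi> p t) t) t
       (\<lambda>\<kappa>. mean_curvature A B g (\<lambda>p. F (\<psi> p t) t) p \<kappa> + \<phi> t *\<^sub>R W \<kappa> (F (\<psi> p t) t))"
      unfolding has_velocity_def
    proof (intro ballI impI)
      fix \<kappa> assume \<kappa>: "\<kappa> \<in> B" "F ?q t \<in> dom_chart \<kappa>"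
      define \<xi> where "\<xi> = chart_at A ?q"
      have \<xi>: "\<xi> \<in> A" "?q \<in> dom_chart \<xi>" using chart_at[OF A] by (auto simp: \<xi>_def)
      have sm: "smooth_map A B ?F" and inj: "inj (differential \<xi> \<kappa> ?F ?q)"
        using imm[OF t] \<xi> \<kappa> by (auto simp: immersion_def)
      have c: "continuous (at t within I) (\<psi> p)"
        using family_curve_continuous[OF A \<psi>s] t by (simp add: continuous_on_eq_continuous_within)
      have v: "((\<lambda>s. coord \<xi> (\<psi> p s)) has_vector_derivative X \<xi> ?q t) (at t within I)"
        using \<psi>(2)[OF t, of p] \<xi> unfolding has_velocity_def by blast
      let ?V = "mean_curvature A B g ?F ?q \<kappa> + \<phi> t *\<^sub>R normal_part A g ?F ?q (\<lambda>\<kappa>. W \<kappa> (F ?q t)) \<kappa>"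
      have w: "((\<lambda>s. coord \<kappa> (F ?q s)) has_vector_derivative ?V) (at t within I)"
        using vel[OF t, of ?q] \<kappa> unfolding has_velocity_def by blast
      have id: "((\<lambda>s. s) has_vector_derivative 1) (at t within I)" by (rule has_vector_derivative_id)
      let ?L = "differential \<xi> \<kappa> ?F ?q"
      have L: "linear ?L" by (rule differential_linear[OF A B sm \<xi>(1) \<kappa>(1) \<xi>(2) \<kappa>(2)])
      have "((\<lambda>s. coord \<kappa> (F (\<psi> p s) s)) has_vector_derivative (?L (X \<xi> ?q t) + 1 *\<^sub>R ?V)) (at t within I)"
        by (rule velocity_family[OF A B Fs \<xi>(1) \<kappa>(1) \<xi>(2) \<kappa>(2) t c v id _ I(4)[OF t] w])
      moreover have "?L (X \<xi> ?q t) + 1 *\<^sub>R ?V = mean_curvature A B g (\<lambda>p. F (\<psi> p t) t) p \<kappa> + \<phi> t *\<^sub>R W \<kappa> (F ?q t)"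
      proof -
        have "normal_part A g ?F ?q (\<lambda>\<kappa>. W \<kappa> (F ?q t)) \<kappa>
            = W \<kappa> (F ?q t) - ?L (tangential_field B g W ?F \<xi> ?q)"
          unfolding normal_part_def \<xi>_def[symmetric] orth_part_range[OF riemannian_metricD(1)[OF g \<kappa>] L inj]
            tangential_field_eq[OF A B g W sm \<xi>(1) \<kappa>(1) \<xi>(2) \<kappa>(2)] ..
        then show ?thesis
          using mean_curvature_reparametrization[OF A B g imm[OF t] \<psi>d[OF t] \<kappa>]
          by (simp add: X_def linear_scale[OF L] scaleR_diff_right)
      qed
      ultimately show "((\<lambda>s. coord \<kappa> (F (\<psi> p s) s)) has_vector_derivative
          mean_curvature A B g (\<lambda>p. F (\<psi> p t) t) p \<kappa> + \<phi> t *\<^sub>R W \<kappa> (F ?q t)) (at t within I)" by simp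
    qed
  qed
  with \<psi>(1) show thesis by (rule that)
qed

lemma conformal_image_flow_solution:
  fixes A :: "('a::{t2_space,second_countable_topology}, 'e::euclidean_space) chart set"
    and B :: "('b::{t2_space,second_countable_topology}, 'f::euclidean_space) chart set"
  assumes A: "smooth_atlas A" and B: "smooth_atlas B" and g: "riemannian_metric B g" and W: "smooth_vector_field B W"
    and \<mu>: "\<And>\<kappa> q u v. \<kappa> \<in> B \<Longrightarrow> q \<in> dom_chart \<kappa> \<Longrightarrow> lie_metric W g \<kappa> q u v = \<mu> q * g \<kappa> q u v"
    and J: "open J" "convex J" "0 \<in> J" and \<Phi>: "one_parameter_family B J (\<lambda>\<kappa> q. - W \<kappa> q) \<Phi>"
    and \<tau>: "smooth_on I \<tau>" "\<And>t. t \<in> I \<Longrightarrow> \<tau> t \<in> J" "\<And>t. t \<in> I \<Longrightarrow> (\<tau> has_vector_derivative \<phi> t) (at t within I)"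
    and \<rho>: "\<And>t. t \<in> I \<Longrightarrow> conformal_factor B g (\<lambda>q. \<Phi> q (\<tau> t)) (\<lambda>q. \<rho> q t)"
    and F: "flow_solution A B I F (\<lambda>p t \<kappa>. mean_curvature A B g (\<lambda>p. F p t) p \<kappa> + \<phi> t *\<^sub>R W \<kappa> (F p t))"
  shows "flow_solution A B I (\<lambda>p t. \<Phi> (F p t) (\<tau> t)) (external_force_velocity A B g (\<lambda>q t. \<Phi> q (\<tau> t)) \<rho> F)"
proof -
  note ff = one_parameter_familyD[OF \<Phi>]
  have Fs: "smooth_family A B I F" and imm: "\<And>t. t \<in> I \<Longrightarrow> immersion A B (\<lambda>p. F p t)"
    and vel: "\<And>t p. t \<in> I \<Longrightarrow> has_velocity B I (F p) t (\<lambda>\<kappa>. mean_curvature A B g (\<lambda>p. F p t) p \<kappa> + \<phi> t *\<^sub>R W \<kappa> (F p t))"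
    using F by (auto simp: flow_solution_def)
  show ?thesis
    unfolding flow_solution_def
  proof (intro conjI ballI allI)
    show "smooth_family A B I (\<lambda>p t. \<Phi> (F p t) (\<tau> t))"
      by (rule smooth_family_compose[OF A B B Fs ff(1) \<tau>(1,2)])
    show "immersion A B (\<lambda>p. \<Phi> (F p t) (\<tau> t))" if "t \<in> I" for t
      by (rule immersion_diffeomorphism_left[OF A B imm[OF that] ff(2)[OF \<tau>(2)[OF that]]])
    fix t p assume t: "t \<in> I"
    let ?s = "\<tau> t" and ?q = "F p t"
    note s = \<tau>(2)[OF t]
    show "has_velocity B I (\<lambda>t. \<Phi> (F p t) (\<tau> t)) t (external_force_velocity A B g (\<lambda>q t. \<Phi> q (\<tau> t)) \<rho> F p t)"
      unfolding has_velocity_def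
    proof (intro ballI impI)
      fix \<kappa> assume \<kappa>: "\<kappa> \<in> B" "\<Phi> ?q ?s \<in> dom_chart \<kappa>"
      define \<eta> where "\<eta> = chart_at B ?q"
      have \<eta>: "\<eta> \<in> B" "?q \<in> dom_chart \<eta>" using chart_at[OF B] by (auto simp: \<eta>_def)
      let ?H = "mean_curvature A B g (\<lambda>p. F p t) p"
      have c: "continuous (at t within I) (F p)"
        using family_curve_continuous[OF A Fs] t by (simp add: continuous_on_eq_continuous_within)
      have v: "((\<lambda>r. coord \<eta> (F p r)) has_vector_derivative ?H \<eta> + \<phi> t *\<^sub>R W \<eta> ?q) (at t within I)"
        using vel[OF t, of p] \<eta> unfolding has_velocity_def by blast
      have w: "((\<lambda>r. coord \<kappa> (\<Phi> ?q r)) has_vector_derivative - W \<kappa> (\<Phi> ?q ?s)) (at ?s within J)"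
        using ff(4)[OF s, of ?q] \<kappa> unfolding has_velocity_def by blast
      have nb: "at ?s within J \<noteq> bot" using at_within_open[OF s J(1)] by simp
      let ?M = "differential \<eta> \<kappa> (\<lambda>q. \<Phi> q ?s) ?q"
      have M: "linear ?M" by (rule differential_linear[OF B B ff(5)[OF s] \<eta>(1) \<kappa>(1) \<eta>(2) \<kappa>(2)])
      have "((\<lambda>r. coord \<kappa> (\<Phi> (F p r) (\<tau> r))) has_vector_derivative
          (?M (?H \<eta> + \<phi> t *\<^sub>R W \<eta> ?q) + \<phi> t *\<^sub>R - W \<kappa> (\<Phi> ?q ?s))) (at t within I)"
        by (rule velocity_family[OF B B ff(1) \<eta>(1) \<kappa>(1) \<eta>(2) \<kappa>(2) t c v \<tau>(3)[OF t] \<tau>(2) nb w])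
      moreover have "?M (?H \<eta> + \<phi> t *\<^sub>R W \<eta> ?q) + \<phi> t *\<^sub>R - W \<kappa> (\<Phi> ?q ?s)
          = external_force_velocity A B g (\<lambda>q t. \<Phi> q (\<tau> t)) \<rho> F p t \<kappa>"
      proof -
        have "?M (W \<eta> ?q) = W \<kappa> (\<Phi> ?q ?s)"
          by (rule flow_preserves_field[OF B g W \<mu> J \<Phi> s \<eta> \<kappa>])
        then have "?M (?H \<eta> + \<phi> t *\<^sub>R W \<eta> ?q) + \<phi> t *\<^sub>R - W \<kappa> (\<Phi> ?q ?s) = pushforward B (\<lambda>q. \<Phi> q ?s) ?q ?H \<kappa>"
          by (simp add: linear_add[OF M] linear_scale[OF M] pushforward_def Let_def \<eta>_def[symmetric])
        also have "\<dots> = external_force_velocity A B g (\<lambda>q t. \<Phi> q (\<tau> t)) \<rho> F p t \<kappa>"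
          unfolding external_force_velocity_def
          by (rule mean_curvature_conformal[OF A B g imm[OF t] ff(2)[OF s] \<rho>[OF t] \<kappa>, symmetric])
        finally show ?thesis .
      qed
      ultimately show "((\<lambda>r. coord \<kappa> (\<Phi> (F p r) (\<tau> r))) has_vector_derivative
          external_force_velocity A B g (\<lambda>q t. \<Phi> q (\<tau> t)) \<rho> F p t \<kappa>) (at t within I)" by simp
    qed
  qed
qed

theorem theorem3p1:
  fixes A :: "('p::{t2_space,second_countable_topology}, 'e::euclidean_space) chart set"
    and B :: "('q::{t2_space,second_countable_topology}, 'f::euclidean_space) chart set"
    and g :: "('q, 'f) metric"
    and W :: "('q, 'f) chart \<Rightarrow> 'q \<Rightarrow> 'f"
    and flow :: "'q \<Rightarrow> real \<Rightarrow> 'q"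
    and \<epsilon> T T0 :: ereal
    and \<phi> tbar :: "real \<Rightarrow> real"
    and F Fhat :: "'p \<Rightarrow> real \<Rightarrow> 'q"
    and F0 :: "'p \<Rightarrow> 'q"
    and I :: "real set"
  assumes M: "smooth_atlas A" "compact (UNIV :: 'p set)"
    and N: "smooth_atlas B" "riemannian_metric B g"
    and W: "conformal_vector_field B g W"
    and eps: "0 < \<epsilon>"
    and flow: "one_parameter_family B {s. ereal \<bar>s\<bar> < \<epsilon>} (\<lambda>\<kappa> q. - W \<kappa> q) flow"
    and phi: "smooth_on {t. 0 \<le> t \<and> ereal t < T0} \<phi>"
    and T: "0 < T" "T \<le> T0"
    and I_def: "I = {t. 0 \<le> t \<and> ereal t < T}"
    and tbar_def: "\<And>t. tbar t = integral {0..t} \<phi>"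
    and tbar: "\<And>t. t \<in> I \<Longrightarrow> ereal \<bar>tbar t\<bar> < \<epsilon>"
    and F: "flow_solution A B I F
              (\<lambda>p t \<kappa>. mean_curvature A B g (\<lambda>p. F p t) p \<kappa> + \<phi> t *\<^sub>R W \<kappa> (F p t))
            \<or> flow_solution A B I F
              (\<lambda>p t \<kappa>. mean_curvature A B g (\<lambda>p. F p t) p \<kappa>
                 + \<phi> t *\<^sub>R normal_part A g (\<lambda>p. F p t) p (\<lambda>\<kappa>. W \<kappa> (F p t)) \<kappa>)"
    and F0: "\<And>p. F p 0 = F0 p"
    and Fhat_def: "\<And>p t. Fhat p t = flow (F p t) (tbar t)"
  shows "(\<exists>\<rho> :: 'q \<Rightarrow> real \<Rightarrow> real.
            (\<forall>t\<in>I. conformal_factor B g (\<lambda>q. flow q (tbar t)) (\<lambda>q. \<rho> q t)) \<and>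
            (\<exists>\<psi>. time_dependent_diffeo A I \<psi> \<and>
                  flow_solution A B I (\<lambda>p t. Fhat (\<psi> p t) t)
                    (external_force_velocity A B g (\<lambda>q t. flow q (tbar t)) \<rho> (\<lambda>p t. F (\<psi> p t) t)))) \<and>
         (\<forall>p. Fhat p 0 = F0 p) \<and>
         (\<forall>t\<in>I. globally_conformal B g (range (\<lambda>p. F p t)) (range (\<lambda>p. Fhat p t)))"
proof -
  let ?J = "{s. ereal \<bar>s\<bar> < \<epsilon>}"
  have J: "open ?J" "convex ?J" "0 \<in> ?J"
  proof -
    show "open ?J" by (intro open_Collect_less continuous_intros)
    have "is_interval ?J" unfolding is_interval_1
    proof (intro ballI allI impI)
      fix a b x :: real assume ab: "a \<in> ?J" "b \<in> ?J" and x: "a \<le> x \<and> x \<le> b"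
      then have "ereal \<bar>x\<bar> \<le> max (ereal \<bar>a\<bar>) (ereal \<bar>b\<bar>)" by (auto simp: le_max_iff_disj)
      also have "\<dots> < \<epsilon>" using ab by simp
      finally show "x \<in> ?J" by simp
    qed
    then show "convex ?J" by (rule is_interval_convex)
    show "0 \<in> ?J" using eps by (simp add: zero_ereal_def)
  qed
  have I: "is_interval I" "0 \<in> I" "\<And>t. t \<in> I \<Longrightarrow> 0 \<le> t" "\<And>t. t \<in> I \<Longrightarrow> at t within I \<noteq> bot"
  proof -
    show "is_interval I" unfolding is_interval_1 I_def
      by (auto elim: order.strict_trans1[rotated])
    show "0 \<in> I" using T(1) by (simp add: I_def zero_ereal_def)
    show "0 \<le> t" if "t \<in> I" for t using that by (simp add: I_def)
    \<comment> \<open>The upper end of \<open>I\<close> is excluded, so every point is a limit of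
      later ones; this makes one-sided velocities unique.\<close>
    show "at t within I \<noteq> bot" if t: "t \<in> I" for t
    proof -
      have "ereal t < T" "0 \<le> t" using t by (auto simp: I_def)
      obtain b where b: "ereal t < ereal b" "ereal b < T" using ereal_dense2[OF \<open>ereal t < T\<close>] by blast
      have sub: "{t..b} \<subseteq> I"
      proof
        fix x assume "x \<in> {t..b}"
        then show "x \<in> I" using \<open>0 \<le> t\<close> b(2) order.strict_trans1[of "ereal x" "ereal b" T] by (simp add: I_def)
      qed
      have "at t within {t..b} \<noteq> bot" using b(1) by (simp add: trivial_limit_within islimpt_Icc)
      moreover have "at t within {t..b} \<le> at t within I" using sub by (rule at_le)
      ultimately show ?thesis by (metis bot.extremum_unique)
    qed
  qed
  have IS: "I \<subseteq> {t. 0 \<le> t \<and> ereal t < T0}" using T(2) by (auto simp: I_def)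
  have \<phi>: "smooth_on I \<phi>" by (rule smooth_on_subset[OF phi IS])
  have tb: "tbar = (\<lambda>t. integral {0..t} \<phi>)" using tbar_def by auto
  have \<tau>: "smooth_on I tbar" "\<And>t. t \<in> I \<Longrightarrow> (tbar has_vector_derivative \<phi> t) (at t within I)"
    unfolding tb by (rule smooth_on_integral[OF I(1-3) \<phi>], assumption?)+
  have \<tau>J: "tbar t \<in> ?J" if "t \<in> I" for t using tbar[OF that] by simp
  have W': "smooth_vector_field B W" using W by (simp add: conformal_vector_field_def)
  obtain \<mu> where \<mu>: "\<And>\<kappa> q u v. \<kappa> \<in> B \<Longrightarrow> q \<in> dom_chart \<kappa> \<Longrightarrow> lie_metric W g \<kappa> q u v = \<mu> q * g \<kappa> q u v"
    using W unfolding conformal_vector_field_def by blast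
  obtain \<sigma> where \<sigma>: "\<And>s. s \<in> ?J \<Longrightarrow> conformal_factor B g (\<lambda>q. flow q s) (\<lambda>q. \<sigma> q s)"
    using flow_conformal[OF N W' \<mu> J flow] by blast
  define \<rho> where "\<rho> q t = \<sigma> q (tbar t)" for q t
  have \<rho>: "conformal_factor B g (\<lambda>q. flow q (tbar t)) (\<lambda>q. \<rho> q t)" if "t \<in> I" for t
    unfolding \<rho>_def by (rule \<sigma>[OF \<tau>J[OF that]])
  note ff = one_parameter_familyD[OF flow]
  have "\<exists>\<psi>. time_dependent_diffeo A I \<psi> \<and> flow_solution A B I (\<lambda>p t. F (\<psi> p t) t)
      (\<lambda>p t \<kappa>. mean_curvature A B g (\<lambda>p. F (\<psi> p t) t) p \<kappa> + \<phi> t *\<^sub>R W \<kappa> (F (\<psi> p t) t))"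
    using F
  proof
    assume "flow_solution A B I F (\<lambda>p t \<kappa>. mean_curvature A B g (\<lambda>p. F p t) p \<kappa> + \<phi> t *\<^sub>R W \<kappa> (F p t))"
    \<comment> \<open>Here the full field already acts, so the identity serves as the
      reparametrization.\<close>
    moreover have "time_dependent_diffeo A I (\<lambda>p t. p)"
      using smooth_family_ident[OF M(1)] diffeomorphism_ident[OF M(1)] by (simp add: time_dependent_diffeo_def)
    ultimately show ?thesis by (intro exI[of _ "\<lambda>p t. p"]) simp
  next
    assume "flow_solution A B I F (\<lambda>p t \<kappa>. mean_curvature A B g (\<lambda>p. F p t) p \<kappa>
                 + \<phi> t *\<^sub>R normal_part A g (\<lambda>p. F p t) p (\<lambda>\<kappa>. W \<kappa> (F p t)) \<kappa>)"
    from reparametrized_flow_solution[OF M N W' I \<phi> this] show ?thesis by blast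
  qed
  then obtain \<psi> where \<psi>: "time_dependent_diffeo A I \<psi>" "flow_solution A B I (\<lambda>p t. F (\<psi> p t) t)
      (\<lambda>p t \<kappa>. mean_curvature A B g (\<lambda>p. F (\<psi> p t) t) p \<kappa> + \<phi> t *\<^sub>R W \<kappa> (F (\<psi> p t) t))" by blast
  have "flow_solution A B I (\<lambda>p t. Fhat (\<psi> p t) t)
      (external_force_velocity A B g (\<lambda>q t. flow q (tbar t)) \<rho> (\<lambda>p t. F (\<psi> p t) t))"
    unfolding Fhat_def
    by (rule conformal_image_flow_solution[OF M(1) N W' \<mu> J flow \<tau>(1) \<tau>J \<tau>(2) \<rho> \<psi>(2)])
  moreover have "Fhat p 0 = F0 p" for p
    unfolding Fhat_def tbar_def by (simp add: F0 ff(3))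
  \<comment> \<open>The flow map at parameter \<open>tbar t\<close> is itself the ambient conformal
    diffeomorphism, and the images are compared without the reparametrization.\<close>
  moreover have "globally_conformal B g (range (\<lambda>p. F p t)) (range (\<lambda>p. Fhat p t))" if "t \<in> I" for t
    unfolding globally_conformal_def
    using ff(2)[OF \<tau>J[OF that]] \<rho>[OF that] by (intro exI conjI) (auto simp: Fhat_def)
  ultimately show ?thesis
    using \<rho> \<psi>(1) by blast
qed

end
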